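(* Suppose that the family $\{F_\theta\colon\theta\in\Theta\}$ is differentiable in quadratic mean with positive definite Fisher information $I_\theta$ for every $\theta\in\Theta$, and that the sequence of selection functions is uniformly bounded: $\sup\{\Vert p_n\Vert_\infty\colon n\ge 1\}<\infty$. Fix $\theta\in\Theta$ and define $Z_n\equiv Z_n(\theta)=n^{-1/2}I_\theta^{-1}\sum_{i=1}^n\nabla l_\theta(Y_i)$. Assume that $M(x)=E_\theta[\exp\{x^\top\nabla l_\theta(Y_1)\}]<\infty$ for all $x$ in a neighborhood of the origin of $\mathbb{R}^p$, and that there exists a sequence of measurable functions $p_n^*(\cdot;\theta)\colon\mathbb{R}^p\to[0,\infty)$, $n\in\mathbb{N}$, with $\sup\{\Vert p_n^*(\cdot;\theta)\Vert_\infty\colon n\ge1\}<\infty$, satisfying $p_n^*(z;\theta)=E_\theta[p_n(Y^n)\mid Z_n=z]$ for all $z$ in the support of $Z_n$, where $E_\theta$ is expectation under the base model $Y^n\sim F_\theta^n$. Assume further that at least one of the following two conditions is met: (1) the distribution of $\nabla l_\theta(Y_1)$ under $F_\theta$ has an absolutely continuous component; (2) $\sup\{\Vert p_n^*(\cdot;\theta)\Vert_{\mathrm{BL}}\colon n\ge 1\}<\infty$. Define $\varphi_n^*(h)=E[p_n^*(Z;\theta)]$ with $Z\sim N(h,I_\theta^{-1})$, for $h\in\mathbb{R}^p$. If $\inf\{\varphi_n(\theta)\colon n\ge1\}>0$, then for every convergent sequence $h_n\to h$ in $\mathbb{R}^p$, $$\log\frac{f_{\theta+h_n/\sqrt n}(Y^n\mid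 u_n)}{f_\theta(Y^n\mid u_n)}=h^\top I_\theta Z_n-\frac12h^\top I_\theta h+\log\frac{\varphi_n^*(0)}{\varphi_n^*(h)}+o_{F_\theta^{u_n}}(1)\quad\text{as } n\to\infty.$$ Furthermore, let $Z_n^*$ be a random vector following the selective $N(0,I_\theta^{-1})$ distribution with selection function $p_n^*(\cdot;\theta)$. If condition (1) is met, then $\Vert Z_n-Z_n^*\Vert_{\mathrm{TV}}\to0$ conditionally on $u_n$ (i.e. the total variation distance between the distribution of $Z_n$ under $F_\theta^{u_n}$ and the distribution of $Z_n^*$ tends to $0$). Otherwise (i.e. under condition (2)), $\Vert Z_n-Z_n^*\Vert_{\mathrm{BL}}\to0$, again with the distribution of $Z_n$ taken under $F_\theta^{u_n}$.
   Context: **Base model.** $\Theta\subseteq\mathbb{R}^p$ is open; for each $\theta\in\Theta$, $F_\theta$ is a probability distribution on a measurable space $(\mathcal{Y},\mathcal{A})$ with density $f_\theta$ with respect to a fixed measure $\mu$. Under the base model, $Y^n=[Y_1,\dots,Y_n]$ has independent components with distribution $F_\theta$, so $Y^n\sim F_\theta^n$. Write $l_\theta=\log f_\theta$; $\nabla l_\theta$ is the score (gradient in $\theta$; the score function appearing in the differentiability in quadratic mean), and $I_\theta=E_\theta[\nabla l_\theta(Y_1)\nabla l_\theta(Y_1)^\top]$. Differentiable in quadratic mean means: for every $\theta\in\Theta$, $\int\{\sqrt{f_{\theta+h}}-\sqrt{f_\theta}-\tfrac12h^\top\nabla l_\theta\sqrt{f_\theta}\}^2\,d\mu=o(\Vert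 h\Vert^2)$ as $h\to0$. **Selection model.** For each $n$, $U_n$ is a random quantity whose conditional distribution given $Y^n=y^n$ does not depend on $\theta$, with conditional density $f(u\mid y^n)$ with respect to a dominating measure, and $u_n$ is a fixed realized value. The selection function is the measurable function $p_n(y^n)=f(u_n\mid y^n)\ge0$, and $\varphi_n(\theta)=E_\theta[p_n(Y^n)]$ is the marginal density of $U_n$ at $u_n$, assumed positive for every $\theta\in\Theta$. The selection model is the family of distributions $F_\theta^{u_n}$ of $Y^n$ given $U_n=u_n$, with density $f_\theta(y^n\mid u_n)=\frac{p_n(y^n)}{\varphi_n(\theta)}\prod_{i=1}^nf_\theta(y_i)$. **Selective Gaussian distribution.** The selective $N(h,\Sigma)$ distribution with selection function $p\colon\mathbb{R}^p\to[0,\infty)$ is the distribution whose density is proportional to $p(z)$ times the $N(h,\Sigma)$ density. **Norms and distances.** $\Vert g\Vert_\infty=\sup_x|g(x)|$; for $g\colon\mathbb{R}^p\to\mathbb{R}$, $\Vert g\Vert_{\mathrm L}=\sup_{x\neq y}|g(x)-g(y)|/\Vert x-y\Vert$ and $\Vert g\Vert_{\mathrm{BL}}=\Vert g\Vert_\infty+\Vert g\Vert_{\mathrm L}$. For random vectors $X,Y$ in $\mathbb{R}^p$, $\Vert X-Y\Vert_{\mathrm{BL}}=\sup\{E[g(X)]-E[g(Y)]\colon\Vert g\Vert_{\mathrm{BL}}\le1\}$, and $\Vert X-Y\Vert_{\mathrm{TV}}=\sup_A|P(X\in A)-P(Y\in A)|$ over Borel sets $A$; both depend only on the distributions of $X$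 and $Y$. A probability distribution $\mu$ on $\mathbb{R}^p$ has an absolutely continuous component if, in its Lebesgue decomposition $\mu=\mu_C+\mu_S$ ($\mu_C$ absolutely continuous, $\mu_S$ singular with respect to Lebesgue measure), $\mu_S(\mathbb{R}^p)<1$. $o_{F_\theta^{u_n}}(1)$ denotes a sequence of random variables converging to $0$ in probability when $Y^n\sim F_\theta^{u_n}$. Local parameters $\theta+h_n/\sqrt n$ are considered for $n$ large enough that they belong to $\Theta$. *)

theory Defs
  imports "HOL-Probability.Probability" "HOL-Library.Landau_Symbols"
begin

subsection \<open>Norms and distances\<close>

text \<open>Norms take values in \<open>ennreal\<close>, so that unbounded and non-Lipschitz functions have norm
  \<open>\<infinity>\<close>.\<close>

definition sup_norm_on :: "'a set \<Rightarrow> ('a \<Rightarrow> real) \<Rightarrow> ennreal" where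
  "sup_norm_on S g = (SUP x\<in>S. ennreal \<bar>g x\<bar>)"

definition lip_norm :: "(real ^ 'p \<Rightarrow> real) \<Rightarrow> ennreal" where
  "lip_norm g = (SUP (x, y)\<in>{(x, y). x \<noteq> y}. ennreal (\<bar>g x - g y\<bar> / norm (x - y)))"

definition bl_norm :: "(real ^ 'p \<Rightarrow> real) \<Rightarrow> ennreal" where
  "bl_norm g = sup_norm_on UNIV g + lip_norm g"

text \<open>The two distances are meant for probability measures on the Borel sets; the suprema are then
  over sets of reals that are bounded by \<open>2\<close> and \<open>1\<close>, respectively.\<close>

definition bl_dist :: "(real ^ 'p) measure \<Rightarrow> (real ^ 'p) measure \<Rightarrow> real" where
  "bl_dist M N = (SUP g\<in>{g. bl_norm g \<le> 1}. (\<integral>x. g x \<partial>M) - (\<integral>x. g x \<partial>N))"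

definition tv_dist :: "(real ^ 'p) measure \<Rightarrow> (real ^ 'p) measure \<Rightarrow> real" where
  "tv_dist M N = (SUP A\<in>sets borel. \<bar>measure M A - measure N A\<bar>)"

definition mutually_singular :: "'a measure \<Rightarrow> 'a measure \<Rightarrow> bool" where
  "mutually_singular M N \<longleftrightarrow> (\<exists>A\<in>sets M. emeasure M A = 0 \<and> emeasure N (space M - A) = 0)"

definition has_ac_component :: "(real ^ 'p) measure \<Rightarrow> bool" where
  "has_ac_component M \<longleftrightarrow>
     (\<exists>M\<^sub>C M\<^sub>S. sets M\<^sub>C = sets borel \<and> sets M\<^sub>S = sets borel \<and>
        (\<forall>A\<in>sets borel. emeasure M A = emeasure M\<^sub>C A + emeasure M\<^sub>S A) \<and>
        absolutely_continuous lborel M\<^sub>C \<and> mutually_singular lborel M\<^sub>S \<and>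
        emeasure M\<^sub>S UNIV < 1)"

subsection \<open>Convergence in probability\<close>

text \<open>The \<open>n\<close>-th variable lives on the \<open>n\<close>-th probability space. Values are extended reals, because
  a log-likelihood ratio may be \<open>-\<infinity>\<close>; the library's \<open>ln\<close> would instead send \<open>0\<close> to \<open>0\<close>.\<close>

definition conv_in_prob_zero :: "(nat \<Rightarrow> 'a measure) \<Rightarrow> (nat \<Rightarrow> 'a \<Rightarrow> ereal) \<Rightarrow> bool" where
  "conv_in_prob_zero M R \<longleftrightarrow>
     (\<forall>\<epsilon>>0. (\<lambda>n. measure (M n) {\<omega>\<in>space (M n). \<bar>R n \<omega>\<bar> > ereal \<epsilon>}) \<longlonglongrightarrow> 0)"

definition ext_ln :: "real \<Rightarrow> ereal" where
  "ext_ln x = (if x > 0 then ereal (ln x) else - \<infinity>)"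

subsection \<open>Conditional densities and conditional expectations\<close>

text \<open>\<open>q u y\<close> is the density at \<open>u\<close>, with respect to \<open>N\<close>, of a random quantity given the value \<open>y\<close> of
  an observation in \<open>M\<close>.\<close>

definition conditional_density :: "'a measure \<Rightarrow> 'u measure \<Rightarrow> ('u \<Rightarrow> 'a \<Rightarrow> real) \<Rightarrow> bool" where
  "conditional_density M N q \<longleftrightarrow>
     (\<lambda>(u, y). q u y) \<in> borel_measurable (N \<Otimes>\<^sub>M M) \<and>
     (\<forall>u\<in>space N. \<forall>y\<in>space M. 0 \<le> q u y) \<and>
     (\<forall>y\<in>space M. (\<integral>\<^sup>+u. ennreal (q u y) \<partial>N) = 1)"

text \<open>\<open>g z = E[X | Z = z]\<close>. As usual for conditional expectations this determines \<open>g\<close> up to null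
  sets of the distribution of \<open>Z\<close>.\<close>

definition is_cond_exp_given ::
    "'a measure \<Rightarrow> ('a \<Rightarrow> real) \<Rightarrow> ('a \<Rightarrow> real ^ 'p) \<Rightarrow> (real ^ 'p \<Rightarrow> real) \<Rightarrow> bool" where
  "is_cond_exp_given M X Z g \<longleftrightarrow>
     (AE \<omega> in M. g (Z \<omega>) = real_cond_exp M (vimage_algebra (space M) Z borel) X \<omega>)"

subsection \<open>Gaussian and selective Gaussian distributions\<close>

definition pos_def :: "real ^ 'p ^ 'p \<Rightarrow> bool" where
  "pos_def A \<longleftrightarrow> transpose A = A \<and> (\<forall>v. v \<noteq> 0 \<longrightarrow> v \<bullet> (A *v v) > 0)"

definition gauss_density :: "real ^ 'p \<Rightarrow> real ^ 'p ^ 'p \<Rightarrow> real ^ 'p \<Rightarrow> real" where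
  "gauss_density m \<Sigma> z =
     exp (- ((z - m) \<bullet> (matrix_inv \<Sigma> *v (z - m))) / 2) / sqrt ((2 * pi) ^ CARD('p) * det \<Sigma>)"

definition gaussian :: "real ^ 'p \<Rightarrow> real ^ 'p ^ 'p \<Rightarrow> (real ^ 'p) measure" where
  "gaussian m \<Sigma> = density lborel (\<lambda>z. ennreal (gauss_density m \<Sigma> z))"

definition selective_gaussian ::
    "real ^ 'p \<Rightarrow> real ^ 'p ^ 'p \<Rightarrow> (real ^ 'p \<Rightarrow> real) \<Rightarrow> (real ^ 'p) measure" where
  "selective_gaussian m \<Sigma> p =
     density lborel (\<lambda>z. ennreal (p z * gauss_density m \<Sigma> z / (\<integral>x. p x * gauss_density m \<Sigma> x \<partial>lborel)))"

text \<open>\<open>\<phi>\<^sup>*(h) = E[p\<^sup>*(Z)]\<close> with \<open>Z \<sim> N(h, \<Sigma>)\<close>.\<close>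

definition limit_sel_prob :: "real ^ 'p ^ 'p \<Rightarrow> (real ^ 'p \<Rightarrow> real) \<Rightarrow> real ^ 'p \<Rightarrow> real" where
  "limit_sel_prob \<Sigma> p h = (\<integral>z. p z \<partial>gaussian h \<Sigma>)"

subsection \<open>The base model\<close>

text \<open>\<open>\<mu>\<close> is the dominating measure, \<open>f \<theta>\<close> the densities, \<open>s \<theta>\<close> the score function.
  Samples of size \<open>n\<close> are extensional functions on \<open>{..<n}\<close>.\<close>

definition base_dist :: "'y measure \<Rightarrow> ('t \<Rightarrow> 'y \<Rightarrow> real) \<Rightarrow> 't \<Rightarrow> 'y measure" where
  "base_dist \<mu> f \<theta> = density \<mu> (\<lambda>y. ennreal (f \<theta> y))"

definition density_family :: "'y measure \<Rightarrow> 't set \<Rightarrow> ('t \<Rightarrow> 'y \<Rightarrow> real) \<Rightarrow> bool" where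
  "density_family \<mu> \<Theta> f \<longleftrightarrow>
     (\<forall>\<theta>\<in>\<Theta>. f \<theta> \<in> borel_measurable \<mu> \<and> (\<forall>y\<in>space \<mu>. 0 \<le> f \<theta> y) \<and> prob_space (base_dist \<mu> f \<theta>))"

definition base_prod :: "'y measure \<Rightarrow> ('t \<Rightarrow> 'y \<Rightarrow> real) \<Rightarrow> 't \<Rightarrow> nat \<Rightarrow> (nat \<Rightarrow> 'y) measure" where
  "base_prod \<mu> f \<theta> n = Pi\<^sub>M {..<n} (\<lambda>_. base_dist \<mu> f \<theta>)"

definition dqm_remainder :: "(real ^ 'p \<Rightarrow> 'y \<Rightarrow> real) \<Rightarrow> (real ^ 'p \<Rightarrow> 'y \<Rightarrow> real ^ 'p) \<Rightarrow>
    real ^ 'p \<Rightarrow> real ^ 'p \<Rightarrow> 'y \<Rightarrow> real" where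
  "dqm_remainder f s \<theta> h y =
     sqrt (f (\<theta> + h) y) - sqrt (f \<theta> y) - 1 / 2 * (h \<bullet> s \<theta> y) * sqrt (f \<theta> y)"

text \<open>The integrability clause is needed because a divergent Bochner integral equals \<open>0\<close>.\<close>

definition diff_quadratic_mean :: "'y measure \<Rightarrow> (real ^ 'p) set \<Rightarrow> (real ^ 'p \<Rightarrow> 'y \<Rightarrow> real) \<Rightarrow>
    (real ^ 'p \<Rightarrow> 'y \<Rightarrow> real ^ 'p) \<Rightarrow> bool" where
  "diff_quadratic_mean \<mu> \<Theta> f s \<longleftrightarrow>
     (\<forall>\<theta>\<in>\<Theta>. s \<theta> \<in> borel_measurable \<mu> \<and>
        (\<forall>\<^sub>F h in at 0. integrable \<mu> (\<lambda>y. (dqm_remainder f s \<theta> h y)\<^sup>2)) \<and>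
        (\<lambda>h. \<integral>y. (dqm_remainder f s \<theta> h y)\<^sup>2 \<partial>\<mu>) \<in> o[at 0](\<lambda>h. (norm h)\<^sup>2))"

definition fisher_info :: "'y measure \<Rightarrow> (real ^ 'p \<Rightarrow> 'y \<Rightarrow> real) \<Rightarrow>
    (real ^ 'p \<Rightarrow> 'y \<Rightarrow> real ^ 'p) \<Rightarrow> real ^ 'p \<Rightarrow> real ^ 'p ^ 'p" where
  "fisher_info \<mu> f s \<theta> = (\<chi> i j. \<integral>y. s \<theta> y $ i * s \<theta> y $ j \<partial>base_dist \<mu> f \<theta>)"

definition norm_score :: "'y measure \<Rightarrow> (real ^ 'p \<Rightarrow> 'y \<Rightarrow> real) \<Rightarrow>
    (real ^ 'p \<Rightarrow> 'y \<Rightarrow> real ^ 'p) \<Rightarrow> real ^ 'p \<Rightarrow> nat \<Rightarrow> (nat \<Rightarrow> 'y) \<Rightarrow> real ^ 'p" where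
  "norm_score \<mu> f s \<theta> n y =
     (1 / sqrt (real n)) *\<^sub>R (matrix_inv (fisher_info \<mu> f s \<theta>) *v (\<Sum>i<n. s \<theta> (y i)))"

subsection \<open>The selection model\<close>

definition sel_prob :: "'y measure \<Rightarrow> ('t \<Rightarrow> 'y \<Rightarrow> real) \<Rightarrow> (nat \<Rightarrow> (nat \<Rightarrow> 'y) \<Rightarrow> real) \<Rightarrow>
    nat \<Rightarrow> 't \<Rightarrow> real" where
  "sel_prob \<mu> f p n \<theta> = (\<integral>y. p n y \<partial>base_prod \<mu> f \<theta> n)"

definition sel_density :: "'y measure \<Rightarrow> ('t \<Rightarrow> 'y \<Rightarrow> real) \<Rightarrow> (nat \<Rightarrow> (nat \<Rightarrow> 'y) \<Rightarrow> real) \<Rightarrow>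
    nat \<Rightarrow> 't \<Rightarrow> (nat \<Rightarrow> 'y) \<Rightarrow> real" where
  "sel_density \<mu> f p n \<theta> y = p n y / sel_prob \<mu> f p n \<theta> * (\<Prod>i<n. f \<theta> (y i))"

text \<open>The selection model is given by its density with respect to the base model, so that \<open>\<mu>\<close> need
  not be \<open>\<sigma>\<close>-finite. For \<open>\<sigma>\<close>-finite \<open>\<mu>\<close> its density with respect to the product of \<open>\<mu>\<close> is
  \<^const>\<open>sel_density\<close>, see \<open>sel_model_eq_density\<close> below.\<close>

definition sel_model :: "'y measure \<Rightarrow> ('t \<Rightarrow> 'y \<Rightarrow> real) \<Rightarrow> (nat \<Rightarrow> (nat \<Rightarrow> 'y) \<Rightarrow> real) \<Rightarrow>
    nat \<Rightarrow> 't \<Rightarrow> (nat \<Rightarrow> 'y) measure" where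
  "sel_model \<mu> f p n \<theta> =
     density (base_prod \<mu> f \<theta> n) (\<lambda>y. ennreal (p n y / sel_prob \<mu> f p n \<theta>))"

lemma base_prod_eq_density:
  assumes "sigma_finite_measure \<mu>" "density_family \<mu> \<Theta> f" "\<theta> \<in> \<Theta>"
  shows "base_prod \<mu> f \<theta> n = density (Pi\<^sub>M {..<n} (\<lambda>_. \<mu>)) (\<lambda>y. \<Prod>i<n. ennreal (f \<theta> (y i)))"
proof -
  interpret \<mu>: product_sigma_finite "\<lambda>_::nat. \<mu>"
    using assms(1) by (simp add: product_sigma_finite_def)
  have f[measurable]: "f \<theta> \<in> borel_measurable \<mu>" and P: "prob_space (base_dist \<mu> f \<theta>)"
    using assms by (auto simp: density_family_def)
  interpret F: product_sigma_finite "\<lambda>_::nat. base_dist \<mu> f \<theta>"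
    using P by (simp add: product_sigma_finite_def prob_space_imp_sigma_finite)
  have sets_eq: "sets (base_dist \<mu> f \<theta>) = sets \<mu>" by (simp add: base_dist_def)
  have "density (Pi\<^sub>M {..<n} (\<lambda>_. \<mu>)) (\<lambda>y. \<Prod>i<n. ennreal (f \<theta> (y i)))
      = Pi\<^sub>M {..<n} (\<lambda>_. base_dist \<mu> f \<theta>)"
  proof (rule F.PiM_eqI)
    show "sets (density (Pi\<^sub>M {..<n} (\<lambda>_. \<mu>)) (\<lambda>y. \<Prod>i<n. ennreal (f \<theta> (y i))))
        = sets (Pi\<^sub>M {..<n} (\<lambda>_. base_dist \<mu> f \<theta>))"
      by (auto intro!: sets_PiM_cong simp: sets_eq)
  next
    fix A assume A: "\<And>i. i \<in> {..<n} \<Longrightarrow> A i \<in> sets (base_dist \<mu> f \<theta>)"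
    then have A'[measurable]: "\<And>i. i < n \<Longrightarrow> A i \<in> sets \<mu>" by (simp add: sets_eq)
    have "emeasure (density (Pi\<^sub>M {..<n} (\<lambda>_. \<mu>)) (\<lambda>y. \<Prod>i<n. ennreal (f \<theta> (y i)))) (Pi\<^sub>E {..<n} A)
        = (\<integral>\<^sup>+y. (\<Prod>i<n. ennreal (f \<theta> (y i))) * indicator (Pi\<^sub>E {..<n} A) y \<partial>Pi\<^sub>M {..<n} (\<lambda>_. \<mu>))"
      by (intro emeasure_density sets_PiM_I_finite) (auto simp: A')
    also have "\<dots> = (\<integral>\<^sup>+y. (\<Prod>i<n. ennreal (f \<theta> (y i)) * indicator (A i) (y i)) \<partial>Pi\<^sub>M {..<n} (\<lambda>_. \<mu>))"
    proof (rule nn_integral_cong)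
      fix y assume y: "y \<in> space (Pi\<^sub>M {..<n} (\<lambda>_. \<mu>))"
      have "indicator (Pi\<^sub>E {..<n} A) y = (\<Prod>i<n. indicator (A i) (y i) :: ennreal)"
        using y by (auto simp: indicator_def space_PiM PiE_iff split: if_splits)
      then show "(\<Prod>i<n. ennreal (f \<theta> (y i))) * indicator (Pi\<^sub>E {..<n} A) y
          = (\<Prod>i<n. ennreal (f \<theta> (y i)) * indicator (A i) (y i))"
        by (simp add: prod.distrib)
    qed
    also have "\<dots> = (\<Prod>i<n. \<integral>\<^sup>+y. ennreal (f \<theta> y) * indicator (A i) y \<partial>\<mu>)"
      by (rule \<mu>.product_nn_integral_prod) (auto simp: A')
    also have "\<dots> = (\<Prod>i\<in>{..<n}. emeasure (base_dist \<mu> f \<theta>) (A i))"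
      by (intro prod.cong refl) (auto simp: base_dist_def emeasure_density A')
    finally show "emeasure (density (Pi\<^sub>M {..<n} (\<lambda>_. \<mu>)) (\<lambda>y. \<Prod>i<n. ennreal (f \<theta> (y i)))) (Pi\<^sub>E {..<n} A)
        = (\<Prod>i\<in>{..<n}. emeasure (base_dist \<mu> f \<theta>) (A i))" .
  qed simp
  then show ?thesis by (simp add: base_prod_def)
qed

lemma sel_model_eq_density:
  assumes "sigma_finite_measure \<mu>" "density_family \<mu> \<Theta> f" "\<theta> \<in> \<Theta>"
    and p[measurable]: "p n \<in> borel_measurable (Pi\<^sub>M {..<n} (\<lambda>_. \<mu>))"
    and "\<And>y. y \<in> space (Pi\<^sub>M {..<n} (\<lambda>_. \<mu>)) \<Longrightarrow> 0 \<le> p n y"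
    and "0 < sel_prob \<mu> f p n \<theta>"
  shows "sel_model \<mu> f p n \<theta> = density (Pi\<^sub>M {..<n} (\<lambda>_. \<mu>)) (\<lambda>y. ennreal (sel_density \<mu> f p n \<theta> y))"
proof -
  have f[measurable]: "f \<theta> \<in> borel_measurable \<mu>" and f0: "\<And>y. y \<in> space \<mu> \<Longrightarrow> 0 \<le> f \<theta> y"
    using assms by (auto simp: density_family_def)
  have "sel_model \<mu> f p n \<theta> = density (Pi\<^sub>M {..<n} (\<lambda>_. \<mu>))
      (\<lambda>y. (\<Prod>i<n. ennreal (f \<theta> (y i))) * ennreal (p n y / sel_prob \<mu> f p n \<theta>))"
    unfolding sel_model_def base_prod_eq_density[OF assms(1-3)] by (rule density_density_eq) auto
  also have "\<dots> = density (Pi\<^sub>M {..<n} (\<lambda>_. \<mu>)) (\<lambda>y. ennreal (sel_density \<mu> f p n \<theta> y))"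
  proof (rule density_cong)
    show "AE y in Pi\<^sub>M {..<n} (\<lambda>_. \<mu>).
        (\<Prod>i<n. ennreal (f \<theta> (y i))) * ennreal (p n y / sel_prob \<mu> f p n \<theta>)
        = ennreal (sel_density \<mu> f p n \<theta> y)"
    proof (rule AE_I2)
      fix y assume y: "y \<in> space (Pi\<^sub>M {..<n} (\<lambda>_. \<mu>))"
      then have "\<And>i. i < n \<Longrightarrow> 0 \<le> f \<theta> (y i)" by (auto simp: space_PiM PiE_iff f0)
      then have "(\<Prod>i<n. ennreal (f \<theta> (y i))) = ennreal (\<Prod>i<n. f \<theta> (y i))"
        by (intro prod_ennreal) auto
      moreover have "0 \<le> p n y / sel_prob \<mu> f p n \<theta>"
        using assms(5)[OF y] assms(6) by simp
      ultimately show "(\<Prod>i<n. ennreal (f \<theta> (y i))) * ennreal (p n y / sel_prob \<mu> f p n \<theta>)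
          = ennreal (sel_density \<mu> f p n \<theta> y)"
        unfolding sel_density_def by (subst ennreal_mult') (simp_all only: mult.commute)
    qed
  qed (auto simp: sel_density_def)
  finally show ?thesis .
qed

end

theory Submission
  imports Defs
begin

text \<open>Let \<open>J\<close> be the Fisher information at \<open>\<theta>\<close>, \<open>Z\<^sub>n\<close> the standardised score, \<open>Z\<close> a vector with distribution
  \<open>N(0, J\<^sup>-\<^sup>1)\<close>, and \<open>L\<^sub>h(z) = exp (h \<bullet> J z - h \<bullet> J h / 2)\<close>, the density of \<open>N(h, J\<^sup>-\<^sup>1)\<close> with respect to
  \<open>N(0, J\<^sup>-\<^sup>1)\<close>.

  Selection is harmless for two reasons. The density of the selection model with respect to the base
  model is bounded, because the \<open>p\<^sub>n\<close> are bounded and their means are bounded away from \<open>0\<close>; so an event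
  that becomes improbable in the base model becomes improbable after selection. And
  \<open>E[p\<^sub>n g(Z\<^sub>n)] = E[p\<^sup>*\<^sub>n(Z\<^sub>n) g(Z\<^sub>n)]\<close>, because \<open>p\<^sup>*\<^sub>n(Z\<^sub>n)\<close> is a conditional expectation. What remains
  are two statements about independent observations.

  The first is local asymptotic normality in \<open>L\<^sup>1\<close> (\<open>likelihood_ratio_L1\<close>): the likelihood ratio \<open>LR\<^sub>n\<close> of
  \<open>\<theta> + h\<^sub>n / \<surd>n\<close> against \<open>\<theta>\<close> satisfies \<open>E \<bar>LR\<^sub>n - L\<^sub>h(Z\<^sub>n)\<bar> \<longlonglongrightarrow> 0\<close>. Both are products over the
  observations, up to a constant, hence so is the affinity \<open>E \<surd>(LR\<^sub>n L\<^sub>h(Z\<^sub>n))\<close>; it is the \<open>n\<close>-th power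
  of an expectation over one observation, and differentiability in quadratic mean evaluates that
  expectation up to \<open>o(1 / n)\<close>. The affinity turns out to tend to \<open>1\<close>, so the Hellinger distance tends to
  \<open>0\<close>. Logarithms enter only at the end: since the means of \<open>1 / L\<^sub>h(Z\<^sub>n)\<close> stay bounded, the ratio
  \<open>LR\<^sub>n / L\<^sub>h(Z\<^sub>n)\<close> tends to \<open>1\<close> in probability.

  The second is a central limit theorem that is uniform over the test functions
  (\<open>clt_test_sequence\<close>): \<open>E[g\<^sub>n(Z\<^sub>n)] - E[g\<^sub>n(Z)] \<longlonglongrightarrow> 0\<close> whenever the \<open>g\<^sub>n\<close> are uniformly bounded and,
  unless the score has an absolutely continuous component, uniformly Lipschitz. If a small Gaussian
  noise is added to \<open>Z\<^sub>n\<close> and \<open>Z\<close>, the densities converge pointwise, because they are Fourier integrals of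
  the characteristic functions, and Scheffe's lemma gives convergence in total variation
  (\<open>smoothed_tv_limit\<close>). The noise is removed again if \<open>E[g\<^sub>n(Z\<^sub>n + v)]\<close> is close to \<open>E[g\<^sub>n(Z\<^sub>n)]\<close> for small
  \<open>v\<close>, uniformly in \<open>n\<close> (\<open>limit_of_shift_continuous\<close>). That is clear for Lipschitz functions. For bounded
  measurable functions it is the content of \<open>shift_bound\<close>: the sum of two scores has a component with a
  smooth density, so a sum of \<open>n\<close> scores contains of the order of \<open>n\<close> smooth summands, and these absorb
  a shift of size \<open>v \<surd>n\<close> in equal parts at a cost in Hellinger distance of the order of \<open>\<bar>v\<bar>\<close>.

  Together they give
  \<open>\<phi>\<^sub>n(\<theta> + h\<^sub>n / \<surd>n) = E[p\<^sub>n LR\<^sub>n] + o(1) = E[p\<^sup>*\<^sub>n(Z\<^sub>n) L\<^sub>h(Z\<^sub>n)] + o(1) = \<phi>\<^sup>*\<^sub>n(h) + o(1)\<close>, and the three claims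
  follow by division, as \<open>\<phi>\<^sup>*\<^sub>n(h)\<close> stays away from \<open>0\<close> (\<open>gsel_lower\<close>).\<close>

section \<open>Exponential moments of normalised sums\<close>

lemma norm_integral_le:
  fixes f :: "'a \<Rightarrow> 'b::{banach, second_countable_topology}"
  assumes "integrable M g" "\<And>x. x \<in> space M \<Longrightarrow> norm (f x) \<le> g x"
  shows "norm (\<integral>x. f x \<partial>M) \<le> (\<integral>x. g x \<partial>M)"
proof -
  have "norm (\<integral>x. f x \<partial>M) \<le> (\<integral>x. norm (f x) \<partial>M)" by (rule integral_norm_bound)
  also have "\<dots> \<le> (\<integral>x. g x \<partial>M)"
    using assms order_trans[OF norm_ge_zero assms(2)] by (intro integral_mono') auto
  finally show ?thesis .
qed

text \<open>Taken logarithms turn the claim into \<open>n Ln (c n) \<longlonglongrightarrow> a\<close>, and \<open>Ln (1 + z) = z + O(\<bar>z\<bar>\<^sup>2)\<close>.\<close>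

lemma tendsto_power_exp:
  fixes c :: "nat \<Rightarrow> complex"
  assumes "(\<lambda>n. of_nat n * (c n - 1)) \<longlonglongrightarrow> a"
  shows "(\<lambda>n. c n ^ n) \<longlonglongrightarrow> exp a"
proof -
  define b where "b n = of_nat n * (c n - 1)" for n
  have b: "b \<longlonglongrightarrow> a" using assms by (simp add: b_def[abs_def])
  have inv: "(\<lambda>n. 1 / of_nat n :: complex) \<longlonglongrightarrow> 0"
    using lim_1_over_n by blast
  have "(\<lambda>n. b n * (1 / of_nat n)) \<longlonglongrightarrow> a * 0"
    by (intro tendsto_mult b inv)
  moreover have "\<forall>\<^sub>F n in sequentially. b n * (1 / of_nat n) = c n - 1"
    using eventually_gt_at_top[of 0] by eventually_elim (simp add: b_def)
  ultimately have c0: "(\<lambda>n. c n - 1) \<longlonglongrightarrow> 0"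
    using Lim_transform_eventually by fastforce
  then have small: "\<forall>\<^sub>F n in sequentially. norm (c n - 1) < 1 / 2"
    using tendstoD[OF c0, of "1/2"] by simp
  have "\<forall>\<^sub>F n in sequentially. norm (of_nat n * Ln (c n) - b n) \<le> 2 * norm (b n) * norm (c n - 1)"
    using small
  proof eventually_elim
    case (elim n)
    have "norm (Ln (1 + (c n - 1)) - (c n - 1)) \<le> norm (c n - 1) ^ 2 / (1 - norm (c n - 1))"
      by (rule Ln_approx_linear) (use elim in simp)
    also have "\<dots> \<le> norm (c n - 1) ^ 2 / (1 / 2)"
      using elim by (intro divide_left_mono) auto
    finally have *: "norm (Ln (c n) - (c n - 1)) \<le> 2 * norm (c n - 1) ^ 2" by simp
    have "norm (of_nat n * Ln (c n) - b n) = norm (of_nat n * (Ln (c n) - (c n - 1)))"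
      by (simp add: b_def algebra_simps)
    also have "\<dots> = real n * norm (Ln (c n) - (c n - 1))" by (simp add: norm_mult)
    also have "\<dots> \<le> real n * (2 * norm (c n - 1) ^ 2)" by (intro mult_left_mono *) auto
    also have "\<dots> = 2 * norm (b n) * norm (c n - 1)"
      by (simp add: b_def norm_mult power2_eq_square)
    finally show ?case .
  qed
  moreover have "(\<lambda>n. 2 * norm (b n) * norm (c n - 1)) \<longlonglongrightarrow> 0"
    by (rule tendsto_eq_intros b c0 tendsto_norm refl | simp)+
  ultimately have "(\<lambda>n. of_nat n * Ln (c n) - b n) \<longlonglongrightarrow> 0"
    by (rule Lim_null_comparison)
  from tendsto_add[OF this b] have "(\<lambda>n. of_nat n * Ln (c n)) \<longlonglongrightarrow> a" by simp
  then have "(\<lambda>n. exp (of_nat n * Ln (c n))) \<longlonglongrightarrow> exp a" by (rule tendsto_exp)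
  moreover have "\<forall>\<^sub>F n in sequentially. exp (of_nat n * Ln (c n)) = c n ^ n"
    using small
  proof eventually_elim
    case (elim n)
    then have "c n \<noteq> 0" by auto
    then show ?case by (simp add: exp_of_nat_mult)
  qed
  ultimately show ?thesis by (rule Lim_transform_eventually)
qed

lemma tendsto_power_exp_real:
  fixes c :: "nat \<Rightarrow> real"
  assumes "(\<lambda>n. real n * (c n - 1)) \<longlonglongrightarrow> a"
  shows "(\<lambda>n. c n ^ n) \<longlonglongrightarrow> exp a"
proof -
  have "(\<lambda>n. of_nat n * (of_real (c n) - 1) :: complex) \<longlonglongrightarrow> of_real a"
    using tendsto_of_real[OF assms, where 'a=complex] by simp
  from tendsto_power_exp[OF this] have "(\<lambda>n. of_real (c n ^ n) :: complex) \<longlonglongrightarrow> of_real (exp a)"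
    by (simp flip: exp_of_real)
  then show ?thesis by (simp only: tendsto_of_real_iff)
qed

lemma power_le_exp:
  fixes x e :: real
  assumes "0 \<le> x" "0 < e"
  shows "x ^ k \<le> fact k / e ^ k * exp (e * x)"
proof -
  have "(e * x) ^ k / fact k \<le> (\<Sum>i. (e * x) ^ i / fact i)"
    using sum_le_suminf[OF summable_exp, of "{k}" "e * x"] assms
    by (simp add: field_simps)
  also have "\<dots> = exp (e * x)"
    by (simp add: exp_def field_simps)
  finally show ?thesis using assms by (simp add: field_simps power_mult_distrib)
qed

lemma integral_PiM_power:
  fixes f :: "'a \<Rightarrow> 'b::{real_normed_field, banach, second_countable_topology}"
  assumes "sigma_finite_measure L" "integrable L f"
  shows "integrable (Pi\<^sub>M {..<k} (\<lambda>_::nat. L)) (\<lambda>y. \<Prod>i<k. f (y i))"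
    and "(\<integral>y. (\<Prod>i<k. f (y i)) \<partial>Pi\<^sub>M {..<k} (\<lambda>_::nat. L)) = (\<integral>x. f x \<partial>L) ^ k"
proof -
  interpret P: product_sigma_finite "\<lambda>_::nat. L" using assms(1) by (simp add: product_sigma_finite_def)
  show "integrable (Pi\<^sub>M {..<k} (\<lambda>_::nat. L)) (\<lambda>y. \<Prod>i<k. f (y i))"
    by (rule P.product_integrable_prod) (use assms in auto)
  show "(\<integral>y. (\<Prod>i<k. f (y i)) \<partial>Pi\<^sub>M {..<k} (\<lambda>_::nat. L)) = (\<integral>x. f x \<partial>L) ^ k"
    by (subst P.product_integral_prod) (use assms in auto)
qed

context prob_space
begin

lemma integrable_exp_moment:
  fixes X :: "'a \<Rightarrow> real"
  assumes [measurable]: "X \<in> borel_measurable M"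
    and e: "0 < e" "integrable M (\<lambda>\<omega>. exp (e * \<bar>X \<omega>\<bar>))" and d: "d < e"
  shows "integrable M (\<lambda>\<omega>. \<bar>X \<omega>\<bar> ^ k * exp (d * \<bar>X \<omega>\<bar>))"
proof (rule Bochner_Integration.integrable_bound)
  show "integrable M (\<lambda>\<omega>. fact k / (e - d) ^ k * exp (e * \<bar>X \<omega>\<bar>))" using e(2) by simp
  show "AE \<omega> in M. norm (\<bar>X \<omega>\<bar> ^ k * exp (d * \<bar>X \<omega>\<bar>)) \<le> norm (fact k / (e - d) ^ k * exp (e * \<bar>X \<omega>\<bar>))"
  proof (rule AE_I2)
    fix \<omega>
    have "\<bar>X \<omega>\<bar> ^ k * exp (d * \<bar>X \<omega>\<bar>)
        \<le> (fact k / (e - d) ^ k * exp ((e - d) * \<bar>X \<omega>\<bar>)) * exp (d * \<bar>X \<omega>\<bar>)"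
      using d by (intro mult_right_mono power_le_exp) auto
    also have "\<dots> = fact k / (e - d) ^ k * exp (e * \<bar>X \<omega>\<bar>)"
      by (simp add: left_diff_distrib exp_diff)
    finally show "norm (\<bar>X \<omega>\<bar> ^ k * exp (d * \<bar>X \<omega>\<bar>)) \<le> norm (fact k / (e - d) ^ k * exp (e * \<bar>X \<omega>\<bar>))"
      using d by simp
  qed
qed simp

lemma integrable_power_exp_moment:
  fixes X :: "'a \<Rightarrow> real"
  assumes [measurable]: "X \<in> borel_measurable M"
    and e: "0 < e" "integrable M (\<lambda>\<omega>. exp (e * \<bar>X \<omega>\<bar>))"
  shows "integrable M (\<lambda>\<omega>. X \<omega> ^ k)"
  using integrable_exp_moment[OF assms(1) e, of 0 k] e(1)
  by (subst integrable_norm_iff[symmetric]) (auto simp: power_abs)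

text \<open>The Taylor expansion of the exponential to second order; the exponential moments of \<open>X\<close> bound the
  mean of the third-order remainder. A complex exponent \<open>z\<close> covers the moment generating function and the
  characteristic function at once.\<close>

lemma exp_moment_expansion:
  fixes X :: "'a \<Rightarrow> real" and z :: complex
  assumes X[measurable]: "X \<in> borel_measurable M"
    and e: "0 < e" "integrable M (\<lambda>\<omega>. exp (e * \<bar>X \<omega>\<bar>))"
    and mean: "expectation X = 0" and var: "expectation (\<lambda>\<omega>. (X \<omega>)\<^sup>2) = v"
  shows "\<forall>\<^sub>F n in sequentially. integrable M (\<lambda>\<omega>. exp (z * of_real (X \<omega> / sqrt (real n))))"
    and "(\<lambda>n. of_nat n * ((\<integral>\<omega>. exp (z * of_real (X \<omega> / sqrt (real n))) \<partial>M) - 1)) \<longlonglongrightarrow> z\<^sup>2 * v / 2"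
proof -
  have sqrt_lim: "filterlim (\<lambda>n. sqrt (real n)) at_top sequentially"
    by (rule filterlim_compose[OF sqrt_at_top filterlim_real_sequentially])
  have small: "\<forall>\<^sub>F n in sequentially. norm z / (e / 2) \<le> sqrt (real n) \<and> 0 < n"
    using filterlim_at_top[THEN iffD1, OF sqrt_lim, rule_format, of "norm z / (e / 2)"]
      eventually_gt_at_top[of "0::nat"] by eventually_elim auto
  have i1: "integrable M X" and i2: "integrable M (\<lambda>\<omega>. (X \<omega>)\<^sup>2)"
    using integrable_power_exp_moment[OF X e, of 1] integrable_power_exp_moment[OF X e, of 2] by auto
  have ie: "integrable M (\<lambda>\<omega>. \<bar>X \<omega>\<bar> ^ 3 * exp (e / 2 * \<bar>X \<omega>\<bar>))"
    by (rule integrable_exp_moment[OF X e]) (use e in auto)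
  have ie0: "integrable M (\<lambda>\<omega>. exp (e / 2 * \<bar>X \<omega>\<bar>))"
    using integrable_exp_moment[OF X e, of "e/2" 0] e by simp
  have nb: "norm (z * complex_of_real (x / sqrt (real n))) \<le> e / 2 * \<bar>x\<bar>"
    if "norm z / (e / 2) \<le> sqrt (real n) \<and> 0 < n" for x n
  proof -
    have "norm z / sqrt (real n) \<le> e / 2"
      using that e by (simp add: field_simps)
    then have "norm z / sqrt (real n) * \<bar>x\<bar> \<le> e / 2 * \<bar>x\<bar>" by (rule mult_right_mono) simp
    then show ?thesis using that by (simp add: norm_mult norm_divide)
  qed
  have int: "integrable M (\<lambda>\<omega>. exp (z * of_real (X \<omega> / sqrt (real n))))"
    if n: "norm z / (e / 2) \<le> sqrt (real n) \<and> 0 < n" for n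
  proof (rule Bochner_Integration.integrable_bound[OF ie0])
    show "AE \<omega> in M. norm (exp (z * complex_of_real (X \<omega> / sqrt (real n)))) \<le> norm (exp (e / 2 * \<bar>X \<omega>\<bar>))"
    proof (rule AE_I2)
      fix \<omega>
      have "Re (z * complex_of_real (X \<omega> / sqrt (real n))) \<le> e / 2 * \<bar>X \<omega>\<bar>"
        by (rule order_trans[OF complex_Re_le_cmod nb[OF n]])
      then show "norm (exp (z * complex_of_real (X \<omega> / sqrt (real n)))) \<le> norm (exp (e / 2 * \<bar>X \<omega>\<bar>))"
        by (simp del: times_complex.sel)
    qed
  qed simp
  show "\<forall>\<^sub>F n in sequentially. integrable M (\<lambda>\<omega>. exp (z * of_real (X \<omega> / sqrt (real n))))"
    using small by eventually_elim (rule int)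
  define C where "C = norm z ^ 3 * expectation (\<lambda>\<omega>. \<bar>X \<omega>\<bar> ^ 3 * exp (e / 2 * \<bar>X \<omega>\<bar>)) / 2"
  have "\<forall>\<^sub>F n in sequentially. norm (of_nat n * ((\<integral>\<omega>. exp (z * of_real (X \<omega> / sqrt (real n))) \<partial>M) - 1)
      - z\<^sup>2 * v / 2) \<le> C * (1 / sqrt (real n))"
    using small
  proof eventually_elim
    case (elim n)
    define w where "w \<omega> = z * complex_of_real (X \<omega> / sqrt (real n))" for \<omega>
    have w: "integrable M (\<lambda>\<omega>. exp (w \<omega>))" unfolding w_def by (rule int[OF elim])
    have w1: "integrable M w" unfolding w_def using i1 by simp
    have w2eq: "(w \<omega>)\<^sup>2 = z\<^sup>2 / of_nat n * complex_of_real ((X \<omega>)\<^sup>2)" for \<omega>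
      using elim by (simp add: w_def power_mult_distrib power_divide flip: of_real_power)
    have w2: "integrable M (\<lambda>\<omega>. (w \<omega>)\<^sup>2)" unfolding w2eq using i2 by (intro integrable_mult_right integrable_of_real)
    have "(\<integral>\<omega>. w \<omega> \<partial>M) = 0"
      using mean by (simp add: w_def)
    moreover have "(\<integral>\<omega>. (w \<omega>)\<^sup>2 \<partial>M) = z\<^sup>2 / of_nat n * v"
      unfolding w2eq by (subst integral_mult_right_zero, subst integral_complex_of_real) (simp add: var)
    ultimately have eq: "(\<integral>\<omega>. exp (w \<omega>) - 1 - w \<omega> - (w \<omega>)\<^sup>2 / 2 \<partial>M)
        = (\<integral>\<omega>. exp (w \<omega>) \<partial>M) - 1 - z\<^sup>2 / of_nat n * v / 2"
      using w w1 w2 by (simp add: prob_space)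
    have "norm (\<integral>\<omega>. exp (w \<omega>) - 1 - w \<omega> - (w \<omega>)\<^sup>2 / 2 \<partial>M)
        \<le> (\<integral>\<omega>. (norm z / sqrt n) ^ 3 / 2 * (\<bar>X \<omega>\<bar> ^ 3 * exp (e / 2 * \<bar>X \<omega>\<bar>)) \<partial>M)"
    proof (rule norm_integral_le)
      show "integrable M (\<lambda>\<omega>. (norm z / sqrt n) ^ 3 / 2 * (\<bar>X \<omega>\<bar> ^ 3 * exp (e / 2 * \<bar>X \<omega>\<bar>)))" using ie by simp
      fix \<omega>
      have taylor: "exp (w \<omega>) - 1 - w \<omega> - (w \<omega>)\<^sup>2 / 2 = exp (w \<omega>) - (\<Sum>k\<le>2. w \<omega> ^ k / fact k)"
        by (simp add: numeral_2_eq_2)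
      have "norm (exp (w \<omega>) - 1 - w \<omega> - (w \<omega>)\<^sup>2 / 2) \<le> exp \<bar>Re (w \<omega>)\<bar> * norm (w \<omega>) ^ 3 / 2"
        unfolding taylor using Taylor_exp[of "w \<omega>" 2] by simp
      also have "\<dots> \<le> exp (e / 2 * \<bar>X \<omega>\<bar>) * norm (w \<omega>) ^ 3 / 2"
        using order_trans[OF abs_Re_le_cmod nb[OF elim, of "X \<omega>"]]
        by (intro divide_right_mono mult_right_mono) (auto simp: w_def)
      also have "norm (w \<omega>) = norm z / sqrt n * \<bar>X \<omega>\<bar>" using elim by (simp add: w_def norm_mult norm_divide)
      also have "exp (e / 2 * \<bar>X \<omega>\<bar>) * (norm z / sqrt n * \<bar>X \<omega>\<bar>) ^ 3 / 2
          = (norm z / sqrt n) ^ 3 / 2 * (\<bar>X \<omega>\<bar> ^ 3 * exp (e / 2 * \<bar>X \<omega>\<bar>))"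
        by (simp only: power_mult_distrib) simp
      finally show "norm (exp (w \<omega>) - 1 - w \<omega> - (w \<omega>)\<^sup>2 / 2)
          \<le> (norm z / sqrt n) ^ 3 / 2 * (\<bar>X \<omega>\<bar> ^ 3 * exp (e / 2 * \<bar>X \<omega>\<bar>))" .
    qed
    also have "\<dots> = C / sqrt n ^ 3" by (simp add: C_def power_divide)
    finally have *: "norm ((\<integral>\<omega>. exp (w \<omega>) \<partial>M) - 1 - z\<^sup>2 / of_nat n * v / 2) \<le> C / sqrt n ^ 3"
      unfolding eq .
    have "of_nat n * ((\<integral>\<omega>. exp (w \<omega>) \<partial>M) - 1) - z\<^sup>2 * v / 2
        = of_nat n * ((\<integral>\<omega>. exp (w \<omega>) \<partial>M) - 1 - z\<^sup>2 / of_nat n * v / 2)"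
      using elim by (simp add: field_simps)
    then have "norm (of_nat n * ((\<integral>\<omega>. exp (w \<omega>) \<partial>M) - 1) - z\<^sup>2 * v / 2)
        = real n * norm ((\<integral>\<omega>. exp (w \<omega>) \<partial>M) - 1 - z\<^sup>2 / of_nat n * v / 2)"
      by (simp only: norm_mult norm_of_nat)
    also have "\<dots> \<le> real n * (C / sqrt n ^ 3)" by (intro mult_left_mono *) simp
    also have "\<dots> = C * (1 / sqrt n)"
    proof -
      have "real n = sqrt n * sqrt n" by simp
      then show ?thesis using elim by (simp add: power3_eq_cube divide_simps del: real_sqrt_mult_self)
    qed
    finally show ?case by (simp add: w_def)
  qed
  moreover have "(\<lambda>n. C * (1 / sqrt (real n))) \<longlonglongrightarrow> 0"
    using tendsto_mult_right_zero[OF tendsto_divide_0[OF tendsto_const filterlim_at_top_imp_at_infinity[OF sqrt_lim]]]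
    by blast
  ultimately have "(\<lambda>n. of_nat n * ((\<integral>\<omega>. exp (z * of_real (X \<omega> / sqrt (real n))) \<partial>M) - 1)
      - z\<^sup>2 * v / 2) \<longlonglongrightarrow> 0"
    by (rule Lim_null_comparison)
  then show "(\<lambda>n. of_nat n * ((\<integral>\<omega>. exp (z * of_real (X \<omega> / sqrt (real n))) \<partial>M) - 1)) \<longlonglongrightarrow> z\<^sup>2 * v / 2"
    by (rule LIM_zero_cancel)
qed

lemma exp_moment_expansion_real:
  fixes X :: "'a \<Rightarrow> real" and c :: real
  assumes X[measurable]: "X \<in> borel_measurable M"
    and e: "0 < e" "integrable M (\<lambda>\<omega>. exp (e * \<bar>X \<omega>\<bar>))"
    and mean: "expectation X = 0" and var: "expectation (\<lambda>\<omega>. (X \<omega>)\<^sup>2) = v"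
  shows "\<forall>\<^sub>F n in sequentially. integrable M (\<lambda>\<omega>. exp (c * (X \<omega> / sqrt (real n))))"
    and "(\<lambda>n. real n * ((\<integral>\<omega>. exp (c * (X \<omega> / sqrt (real n))) \<partial>M) - 1)) \<longlonglongrightarrow> c\<^sup>2 * v / 2"
proof -
  have eq: "exp (complex_of_real c * of_real x) = of_real (exp (c * x))" for x
    by (simp flip: exp_of_real)
  show "\<forall>\<^sub>F n in sequentially. integrable M (\<lambda>\<omega>. exp (c * (X \<omega> / sqrt (real n))))"
    using exp_moment_expansion(1)[OF X e mean var, of "of_real c"]
    by (simp only: eq complex_of_real_integrable_eq)
  have "(\<lambda>n. complex_of_real (real n * ((\<integral>\<omega>. exp (c * (X \<omega> / sqrt (real n))) \<partial>M) - 1)))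
      \<longlonglongrightarrow> complex_of_real (c\<^sup>2 * v / 2)"
    using exp_moment_expansion(2)[OF X e mean var, of "of_real c"]
    by (simp only: eq integral_complex_of_real) simp
  then show "(\<lambda>n. real n * ((\<integral>\<omega>. exp (c * (X \<omega> / sqrt (real n))) \<partial>M) - 1)) \<longlonglongrightarrow> c\<^sup>2 * v / 2"
    by (simp only: tendsto_of_real_iff)
qed

text \<open>The mean of \<open>exp (z S / \<surd>n)\<close> for a sum \<open>S\<close> of \<open>n\<close> independent copies of \<open>X\<close> is the \<open>n\<close>-th power of
  \<open>1 + z\<^sup>2 v / (2 n) + o(1 / n)\<close>.\<close>

lemma exp_sum_limit:
  fixes X :: "'a \<Rightarrow> real" and z :: complex
  assumes X: "X \<in> borel_measurable M"
    and e: "0 < e" "integrable M (\<lambda>\<omega>. exp (e * \<bar>X \<omega>\<bar>))"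
    and mean: "expectation X = 0" and var: "expectation (\<lambda>\<omega>. (X \<omega>)\<^sup>2) = v"
  shows "\<forall>\<^sub>F n in sequentially.
      integrable (Pi\<^sub>M {..<n} (\<lambda>_. M)) (\<lambda>y. exp (z * of_real ((\<Sum>i<n. X (y i)) / sqrt (real n))))"
    and "(\<lambda>n. \<integral>y. exp (z * of_real ((\<Sum>i<n. X (y i)) / sqrt (real n))) \<partial>Pi\<^sub>M {..<n} (\<lambda>_. M))
      \<longlonglongrightarrow> exp (z\<^sup>2 * v / 2)"
proof -
  have prod: "exp (z * of_real ((\<Sum>i<n. X (y i)) / sqrt (real n)))
      = (\<Prod>i<n. exp (z * of_real (X (y i) / sqrt (real n))))" for n y
    by (simp add: sum_divide_distrib sum_distrib_left exp_sum)
  note E = exp_moment_expansion[OF X e mean var, of z]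
  show "\<forall>\<^sub>F n in sequentially.
      integrable (Pi\<^sub>M {..<n} (\<lambda>_. M)) (\<lambda>y. exp (z * of_real ((\<Sum>i<n. X (y i)) / sqrt (real n))))"
    using E(1) unfolding prod
    by eventually_elim (rule integral_PiM_power(1)[OF sigma_finite_measure_axioms])
  have "\<forall>\<^sub>F n in sequentially. (\<integral>\<omega>. exp (z * of_real (X \<omega> / sqrt (real n))) \<partial>M) ^ n
      = (\<integral>y. exp (z * of_real ((\<Sum>i<n. X (y i)) / sqrt (real n))) \<partial>Pi\<^sub>M {..<n} (\<lambda>_. M))"
    using E(1) unfolding prod
    by eventually_elim (rule integral_PiM_power(2)[OF sigma_finite_measure_axioms, symmetric])
  from Lim_transform_eventually[OF tendsto_power_exp[OF E(2)] this]
  show "(\<lambda>n. \<integral>y. exp (z * of_real ((\<Sum>i<n. X (y i)) / sqrt (real n))) \<partial>Pi\<^sub>M {..<n} (\<lambda>_. M))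
      \<longlonglongrightarrow> exp (z\<^sup>2 * v / 2)" .
qed

lemma exp_sum_limit_real:
  fixes X :: "'a \<Rightarrow> real" and c :: real
  assumes X: "X \<in> borel_measurable M"
    and e: "0 < e" "integrable M (\<lambda>\<omega>. exp (e * \<bar>X \<omega>\<bar>))"
    and mean: "expectation X = 0" and var: "expectation (\<lambda>\<omega>. (X \<omega>)\<^sup>2) = v"
  shows "\<forall>\<^sub>F n in sequentially.
      integrable (Pi\<^sub>M {..<n} (\<lambda>_. M)) (\<lambda>y. exp (c * ((\<Sum>i<n. X (y i)) / sqrt (real n))))"
    and "(\<lambda>n. \<integral>y. exp (c * ((\<Sum>i<n. X (y i)) / sqrt (real n))) \<partial>Pi\<^sub>M {..<n} (\<lambda>_. M))
      \<longlonglongrightarrow> exp (c\<^sup>2 * v / 2)"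
proof -
  have eq: "exp (complex_of_real c * of_real x) = of_real (exp (c * x))" for x
    by (simp flip: exp_of_real)
  show "\<forall>\<^sub>F n in sequentially.
      integrable (Pi\<^sub>M {..<n} (\<lambda>_. M)) (\<lambda>y. exp (c * ((\<Sum>i<n. X (y i)) / sqrt (real n))))"
    using exp_sum_limit(1)[OF X e mean var, of "of_real c"]
    by (simp only: eq complex_of_real_integrable_eq)
  have "exp ((of_real c)\<^sup>2 * of_real v / 2) = complex_of_real (exp (c\<^sup>2 * v / 2))"
    by (simp flip: exp_of_real)
  with exp_sum_limit(2)[OF X e mean var, of "of_real c"]
  have "(\<lambda>n. complex_of_real (\<integral>y. exp (c * ((\<Sum>i<n. X (y i)) / sqrt (real n))) \<partial>Pi\<^sub>M {..<n} (\<lambda>_. M)))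
      \<longlonglongrightarrow> complex_of_real (exp (c\<^sup>2 * v / 2))"
    by (simp only: eq integral_complex_of_real)
  then show "(\<lambda>n. \<integral>y. exp (c * ((\<Sum>i<n. X (y i)) / sqrt (real n))) \<partial>Pi\<^sub>M {..<n} (\<lambda>_. M))
      \<longlonglongrightarrow> exp (c\<^sup>2 * v / 2)"
    by (simp only: tendsto_of_real_iff)
qed

end

section \<open>Gaussian distributions\<close>

definition std_gaussian :: "(real ^ 'p) measure" where
  "std_gaussian = density lborel (\<lambda>x. ennreal (\<Prod>b\<in>Basis. std_normal_density (x \<bullet> b)))"

lemma std_normal_exp:
  fixes t :: real
  assumes "z = 1 \<or> z = \<i>"
  shows "integrable lborel (\<lambda>x. std_normal_density x *\<^sub>R exp (z * complex_of_real (t * x)))"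
    and "(\<integral>x. std_normal_density x *\<^sub>R exp (z * complex_of_real (t * x)) \<partial>lborel) = exp (z\<^sup>2 * of_real (t\<^sup>2) / 2)"
proof -
  have *: "integrable lborel (\<lambda>x. std_normal_density x *\<^sub>R exp (z * complex_of_real (t * x))) \<and>
    (\<integral>x. std_normal_density x *\<^sub>R exp (z * complex_of_real (t * x)) \<partial>lborel) = exp (z\<^sup>2 * of_real (t\<^sup>2) / 2)"
    using assms
  proof
    assume z: "z = 1"
    have "std_normal_density x * exp (t * x) = exp (t\<^sup>2 / 2) * normal_density t 1 x" for x
      by (simp add: normal_density_def mult_exp_exp field_simps power2_eq_square)
    then have "std_normal_density x *\<^sub>R exp (z * complex_of_real (t * x)) =
        of_real (exp (t\<^sup>2 / 2) * normal_density t 1 x)" for x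
      unfolding z by (metis mult_1 exp_of_real of_real_mult scaleR_conv_of_real)
    then show ?thesis
      by (simp add: z integral_complex_of_real exp_of_real[symmetric] del: of_real_mult of_real_power)
  next
    assume z: "z = \<i>"
    have bound: "integrable lborel (\<lambda>x. std_normal_density x *\<^sub>R exp (z * complex_of_real (t * x)))"
      by (rule Bochner_Integration.integrable_bound[OF integrable_normal_density[of 1 0]])
        (auto simp: z)
    have "(\<integral>x. std_normal_density x *\<^sub>R exp (z * complex_of_real (t * x)) \<partial>lborel)
        = char std_normal_distribution t"
      unfolding char_def z by (subst integral_density) (auto simp: mult.commute)
    also have "\<dots> = exp (z\<^sup>2 * of_real (t\<^sup>2) / 2)"
      by (simp add: char_std_normal_distribution z exp_of_real[symmetric])
    finally show ?thesis using bound by simp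
  qed
  then show "integrable lborel (\<lambda>x. std_normal_density x *\<^sub>R exp (z * complex_of_real (t * x)))"
    and "(\<integral>x. std_normal_density x *\<^sub>R exp (z * complex_of_real (t * x)) \<partial>lborel) = exp (z\<^sup>2 * of_real (t\<^sup>2) / 2)"
    by auto
qed

lemma lborel_integral_prod:
  fixes f :: "'a::euclidean_space \<Rightarrow> real \<Rightarrow> 'b::{real_normed_field, banach, second_countable_topology}"
  assumes f: "\<And>b. b \<in> Basis \<Longrightarrow> integrable lborel (f b)"
  shows "integrable lborel (\<lambda>x::'a. \<Prod>b\<in>Basis. f b (x \<bullet> b))"
    and "(\<integral>x. (\<Prod>b\<in>(Basis :: 'a set). f b (x \<bullet> b)) \<partial>lborel) = (\<Prod>b\<in>Basis. \<integral>x. f b x \<partial>lborel)"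
proof -
  interpret P: product_sigma_finite "\<lambda>_::'a. lborel :: real measure"
    by (simp add: product_sigma_finite_def sigma_finite_lborel)
  have [measurable]: "\<And>b. b \<in> Basis \<Longrightarrow> f b \<in> borel_measurable borel"
    using borel_measurable_integrable[OF f] by simp
  have "(\<lambda>x::'a. \<Prod>b\<in>Basis. f b (x \<bullet> b)) \<in> borel_measurable borel"
    by measurable
  note m = this
  have e: "(\<Prod>b\<in>Basis. f b ((\<Sum>b\<in>Basis. y b *\<^sub>R b) \<bullet> b)) = (\<Prod>b\<in>Basis. f b (y b))" for y :: "'a \<Rightarrow> real"
    by (intro prod.cong refl) (simp add: inner_sum_left inner_Basis if_distrib sum.delta cong: if_cong)
  show "integrable lborel (\<lambda>x::'a. \<Prod>b\<in>Basis. f b (x \<bullet> b))"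
    using m by (subst lborel_eq, subst integrable_distr_eq) (auto simp: e intro!: P.product_integrable_prod f)
  show "(\<integral>x. (\<Prod>b\<in>(Basis :: 'a set). f b (x \<bullet> b)) \<partial>lborel) = (\<Prod>b\<in>Basis. \<integral>x. f b x \<partial>lborel)"
    using m by (subst lborel_eq, subst integral_distr) (auto simp: e intro!: P.product_integral_prod f)
qed

text \<open>The integrand factorises over the coordinates, which leaves the one-dimensional moment generating
  function (\<open>z = 1\<close>) and characteristic function (\<open>z = \<i>\<close>).\<close>

lemma std_gaussian_exp:
  fixes y :: "real ^ 'p"
  assumes z: "z = 1 \<or> z = \<i>"
  shows "integrable std_gaussian (\<lambda>x. exp (z * complex_of_real (y \<bullet> x)))"
    and "(\<integral>x. exp (z * complex_of_real (y \<bullet> x)) \<partial>std_gaussian) = exp (z\<^sup>2 * of_real (y \<bullet> y) / 2)"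
proof -
  have eq: "(\<Prod>b\<in>Basis. std_normal_density (x \<bullet> b)) *\<^sub>R exp (z * complex_of_real (y \<bullet> x))
      = (\<Prod>b\<in>Basis. std_normal_density (x \<bullet> b) *\<^sub>R exp (z * complex_of_real ((y \<bullet> b) * (x \<bullet> b))))"
    for x :: "real ^ 'p"
    by (simp add: euclidean_inner[of y x] scaleR_conv_of_real prod.distrib sum_distrib_left exp_sum)
  note P = lborel_integral_prod[where 'a="real ^ 'p" and
      f="\<lambda>b a. std_normal_density a *\<^sub>R exp (z * complex_of_real ((y \<bullet> b) * a))", OF std_normal_exp(1)[OF z]]
  have m: "(\<lambda>x::real ^ 'p. \<Prod>b\<in>Basis. std_normal_density (x \<bullet> b)) \<in> borel_measurable borel"
    by measurable
  have nn: "0 \<le> (\<Prod>b\<in>Basis. std_normal_density (x \<bullet> b))" for x :: "real ^ 'p"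
    by (intro prod_nonneg) simp
  show "integrable std_gaussian (\<lambda>x. exp (z * complex_of_real (y \<bullet> x)))"
    unfolding std_gaussian_def using m nn
    by (subst integrable_density)
      (simp_all add: eq P(1) del: of_real_mult)
  have "(\<integral>x. exp (z * complex_of_real (y \<bullet> x)) \<partial>std_gaussian)
      = (\<Prod>b\<in>Basis. exp (z\<^sup>2 * of_real ((y \<bullet> b)\<^sup>2) / 2))"
    unfolding std_gaussian_def using m nn
    by (subst integral_density)
      (simp_all add: eq P(2) std_normal_exp(2)[OF z] del: of_real_mult of_real_power)
  also have "\<dots> = exp (\<Sum>b\<in>Basis. z\<^sup>2 * of_real ((y \<bullet> b)\<^sup>2) / 2)"
    by (simp add: exp_sum)
  also have "(\<Sum>b\<in>Basis. z\<^sup>2 * of_real ((y \<bullet> b)\<^sup>2) / 2) = z\<^sup>2 * of_real (y \<bullet> y) / 2"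
    by (simp add: euclidean_inner[of y y] sum_distrib_left sum_divide_distrib power2_eq_square)
  finally show "(\<integral>x. exp (z * complex_of_real (y \<bullet> x)) \<partial>std_gaussian) = exp (z\<^sup>2 * of_real (y \<bullet> y) / 2)" .
qed

lemma prob_space_std_gaussian: "prob_space (std_gaussian :: (real ^ 'p) measure)"
proof
  have "emeasure (std_gaussian :: (real ^ 'p) measure) (space std_gaussian)
      = (\<integral>\<^sup>+x. (\<Prod>b\<in>(Basis :: (real ^ 'p) set). ennreal (std_normal_density (x \<bullet> b))) \<partial>lborel)"
    by (simp add: std_gaussian_def emeasure_density prod_ennreal)
  also have "\<dots> = (\<Prod>b\<in>(Basis::(real ^ 'p) set). \<integral>\<^sup>+x. ennreal (std_normal_density x) \<partial>lborel)"
    by (rule nn_integral_lborel_prod) auto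
  also have "\<dots> = 1"
    by (simp add: nn_integral_eq_integral)
  finally show "emeasure (std_gaussian :: (real ^ 'p) measure) (space std_gaussian) = 1" .
qed

lemma std_gaussian_density_eq:
  fixes x :: "real ^ 'p"
  shows "(\<Prod>b\<in>Basis. std_normal_density (x \<bullet> b)) = (1 / sqrt (2 * pi)) ^ CARD('p) * exp (- (x \<bullet> x) / 2)"
proof -
  have "(\<Prod>b\<in>Basis. std_normal_density (x \<bullet> b)) = (\<Prod>b\<in>(Basis::(real ^ 'p) set). 1 / sqrt (2 * pi)) * (\<Prod>b\<in>Basis. exp (- (x \<bullet> b)\<^sup>2 / 2))"
    by (simp only: std_normal_density_def prod.distrib)
  also have "(\<Prod>b\<in>Basis. exp (- (x \<bullet> b)\<^sup>2 / 2)) = exp (- (x \<bullet> x) / 2)"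
    by (simp add: exp_sum[symmetric] sum_negf sum_divide_distrib[symmetric] euclidean_inner[of x x] power2_eq_square)
  finally show ?thesis by simp
qed

text \<open>Uniqueness of Haar measure: by Fubini's theorem and the invariance of both measures, the integral of
  \<open>1\<^sub>A(x) 1\<^sub>B(y)\<close> is not changed by the substitutions \<open>x \<rightarrow> x + y\<close> and \<open>y \<rightarrow> y - x\<close>, which exchange the two
  measures if \<open>B\<close> is symmetric.\<close>

lemma translation_invariant_unique:
  fixes N :: "'a::euclidean_space measure"
  assumes sets[measurable_cong]: "sets N = sets borel" and sf: "sigma_finite_measure N"
    and inv: "\<And>v. distr N borel (\<lambda>x. x + v) = N"
    and fin: "emeasure N (ball 0 1) < \<infinity>"
  shows "\<exists>c<\<infinity>. N = density lborel (\<lambda>_. c)"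
proof -
  interpret N: sigma_finite_measure N by fact
  interpret LN: pair_sigma_finite lborel N
    by (simp add: pair_sigma_finite_def sf sigma_finite_lborel)
  let ?L = "lborel :: 'a measure"
  define B where "B = ball (0::'a) 1"
  have B[measurable]: "B \<in> sets borel" by (simp add: B_def)
  have invL: "distr ?L borel (\<lambda>x. x + v) = ?L" for v
    using lborel_distr_plus[of v] 
      by (metis (no_types, lifting) add.commute ext)
  have sym: "indicator B (- x) = (indicator B x :: ennreal)" for x by (simp add: B_def indicator_def)
  have key: "emeasure lborel A * emeasure N B = emeasure N A * emeasure ?L B" if A[measurable]: "A \<in> sets borel" for A
  proof -
    have "emeasure lborel A * emeasure N B = (\<integral>\<^sup>+x. \<integral>\<^sup>+y. indicator A x * indicator B y \<partial>N \<partial>?L)"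
      by (simp add: nn_integral_cmult nn_integral_multc sets)
    also have "\<dots> = (\<integral>\<^sup>+y. \<integral>\<^sup>+x. indicator A x * indicator B y \<partial>?L \<partial>N)"
      by (rule LN.Fubini'[symmetric]) measurable
    also have "\<dots> = (\<integral>\<^sup>+y. \<integral>\<^sup>+x. indicator A (x + y) * indicator B y \<partial>?L \<partial>N)"
    proof (rule nn_integral_cong)
      fix y
      have "(\<integral>\<^sup>+x. indicator A x * indicator B y \<partial>?L) = (\<integral>\<^sup>+x. indicator A x * indicator B y \<partial>distr ?L borel (\<lambda>x. x + y))"
        by (simp only: invL)
      also have "\<dots> = (\<integral>\<^sup>+x. indicator A (x + y) * indicator B y \<partial>?L)"
        by (subst nn_integral_distr) auto
      finally show "(\<integral>\<^sup>+x. indicator A x * indicator B y \<partial>?L) = (\<integral>\<^sup>+x. indicator A (x + y) * indicator B y \<partial>?L)" .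
    qed
    also have "\<dots> = (\<integral>\<^sup>+x. \<integral>\<^sup>+y. indicator A (x + y) * indicator B y \<partial>N \<partial>?L)"
      by (rule LN.Fubini') measurable
    also have "\<dots> = (\<integral>\<^sup>+x. \<integral>\<^sup>+y. indicator A y * indicator B (x - y) \<partial>N \<partial>?L)"
    proof (rule nn_integral_cong)
      fix x
      have "(\<integral>\<^sup>+y. indicator A y * indicator B (x - y) \<partial>N) = (\<integral>\<^sup>+y. indicator A y * indicator B (x - y) \<partial>distr N borel (\<lambda>y. y + x))"
        by (simp only: inv)
      also have "\<dots> = (\<integral>\<^sup>+y. indicator A (x + y) * indicator B y \<partial>N)"
        by (subst nn_integral_distr) (auto simp: sym add.commute)
      finally show "(\<integral>\<^sup>+y. indicator A (x + y) * indicator B y \<partial>N) = (\<integral>\<^sup>+y. indicator A y * indicator B (x - y) \<partial>N)" ..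
    qed
    also have "\<dots> = (\<integral>\<^sup>+y. \<integral>\<^sup>+x. indicator A y * indicator B (x - y) \<partial>?L \<partial>N)"
      by (rule LN.Fubini'[symmetric]) measurable
    also have "\<dots> = (\<integral>\<^sup>+y. indicator A y * emeasure ?L B \<partial>N)"
    proof (rule nn_integral_cong)
      fix y
      have "(\<integral>\<^sup>+x. indicator B (x - y) \<partial>?L) = (\<integral>\<^sup>+x. indicator B (x - y) \<partial>distr ?L borel (\<lambda>x. x + y))"
        by (simp only: invL)
      also have "\<dots> = emeasure ?L B"
        by (subst nn_integral_distr) auto
      finally show "(\<integral>\<^sup>+x. indicator A y * indicator B (x - y) \<partial>?L) = indicator A y * emeasure ?L B"
        by (simp add: nn_integral_cmult)
    qed
    also have "\<dots> = emeasure N A * emeasure ?L B"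
      by (simp add: nn_integral_multc sets)
    finally show ?thesis .
  qed
  have Bpos: "emeasure ?L B > 0"
    using emeasure_ball[of 1 "0::'a"] by (simp add: B_def)
  have Bfin: "emeasure ?L B < \<infinity>"
    unfolding B_def by (rule emeasure_lborel_ball_finite)
  define c where "c = emeasure N B / emeasure ?L B"
  have "c < \<infinity>" using Bpos fin by (auto simp: c_def B_def ennreal_divide_eq_top_iff less_top[symmetric])
  moreover have "N = density ?L (\<lambda>_. c)"
  proof (rule measure_eqI)
    fix A assume A: "A \<in> sets N"
    have "emeasure N A = emeasure N A * emeasure ?L B / emeasure ?L B"
      using Bpos Bfin by (subst ennreal_mult_divide_eq) (auto simp: less_top)
    also have "\<dots> = c * emeasure ?L A"
      using key[of A] A
      by (metis c_def ennreal_times_divide mult.commute sets)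
    finally show "emeasure N A = emeasure (density ?L (\<lambda>_. c)) A"
      using A by (simp add: emeasure_density sets nn_integral_cmult)
  qed (simp add: sets)
  ultimately show ?thesis by blast
qed


text \<open>Orthonormalising the coordinate vectors with respect to the inner product of \<open>J\<close> gives the columns of
  \<open>A\<close>. The induction runs over a set \<open>S\<close> of coordinates; a vector outside the span of the previous ones is
  recognised by its coordinate outside \<open>S\<close>.\<close>

lemma gram_schmidt:
  fixes J :: "real ^ 'p ^ 'p"
  assumes "pos_def J"
  shows "\<exists>A :: real ^ 'p ^ 'p. transpose A ** J ** A = mat 1"
proof -
  define ip where "ip v w = v \<bullet> (J *v w)" for v w :: "real ^ 'p"
  have pos: "ip v v > 0" if "v \<noteq> 0" for v using assms that by (simp add: pos_def_def ip_def)
  have sym: "ip v w = ip w v" for v w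
    using assms by (metis dot_lmul_matrix ip_def inner_commute pos_def_def transpose_matrix_vector)
  have lin: "ip (v - w) x = ip v x - ip w x" "ip (c *\<^sub>R v) x = c * ip v x" "ip (sum g S) x = (\<Sum>i\<in>S. ip (g i) x)"
    for v w x :: "real ^ 'p" and c and g :: "'p \<Rightarrow> real ^ 'p" and S
    by (simp_all add: ip_def inner_diff_left inner_sum_left)
  have "\<exists>b :: 'p \<Rightarrow> real ^ 'p. (\<forall>i\<in>S. \<forall>j\<in>S. ip (b i) (b j) = (if i = j then 1 else 0)) \<and>
      (\<forall>i\<in>S. \<forall>k. k \<notin> S \<longrightarrow> b i $ k = 0)" for S :: "'p set"
  proof (induction S rule: finite_induct[OF finite])
    case 1
    show ?case by simp
  next
    case (2 k S)
    then obtain b :: "'p \<Rightarrow> real ^ 'p"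
      where b: "\<And>i j. i \<in> S \<Longrightarrow> j \<in> S \<Longrightarrow> ip (b i) (b j) = (if i = j then 1 else 0)"
        and supp: "\<And>i k. i \<in> S \<Longrightarrow> k \<notin> S \<Longrightarrow> b i $ k = 0" by blast
    define v where "v = axis k 1 - (\<Sum>j\<in>S. ip (axis k 1) (b j) *\<^sub>R b j)"
    have "v $ k = 1" using supp 2 by (simp add: v_def sum_component)
    then have "v \<noteq> 0" by auto
    have vb: "ip v (b j) = 0" if "j \<in> S" for j
    proof -
      have "ip v (b j) = ip (axis k 1) (b j) - (\<Sum>i\<in>S. ip (axis k 1) (b i) * (if i = j then 1 else 0))"
        using that by (simp add: v_def lin b cong: sum.cong)
      then show ?thesis using that 2 by (simp add: if_distrib cong: if_cong)
    qed
    define c where "c = sqrt (ip v v)"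
    have c: "c > 0" "c * c = ip v v" using pos[OF \<open>v \<noteq> 0\<close>] by (simp_all add: c_def)
    define b' where "b' = b(k := (1 / c) *\<^sub>R v)"
    have "ip (b' k) (b' k) = 1"
    proof -
      have "ip (b' k) (b' k) = ip v v / (c * c)" by (simp add: b'_def lin sym[of v "_ *\<^sub>R _"])
      then show ?thesis using c pos[OF \<open>v \<noteq> 0\<close>] by simp
    qed
    moreover have "ip (b' k) (b' j) = 0" "ip (b' j) (b' k) = 0" if "j \<in> S" for j
      using that 2 vb[OF that] by (auto simp: b'_def lin sym[of "b j"])
    moreover have "ip (b' i) (b' j) = (if i = j then 1 else 0)" if "i \<in> S" "j \<in> S" for i j
      using that 2 b[OF that] by (auto simp: b'_def)
    moreover have "b' i $ l = 0" if "i \<in> insert k S" "l \<notin> insert k S" for i l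
      using that 2 supp by (auto simp: b'_def v_def sum_component axis_def)
    ultimately show ?case
      using 2 by (intro exI[of _ b']) (auto; metis)
  qed
  then obtain b :: "'p \<Rightarrow> real ^ 'p"
    where b: "\<And>i j. ip (b i) (b j) = (if i = j then 1 else 0)" by (metis UNIV_I)
  define A :: "real ^ 'p ^ 'p" where "A = (\<chi> i j. b j $ i)"
  have "(transpose A ** J ** A) $ i $ j = ip (b i) (b j)" for i j
  proof -
    have "(transpose A ** J ** A) $ i $ j = row i (transpose A) \<bullet> column j (J ** A)"
      unfolding matrix_mul_assoc[symmetric]
      by (simp add: matrix_matrix_mult_def inner_vec_def row_def column_def)
    also have "row i (transpose A) = b i" by (simp add: row_def transpose_def A_def)
    also have "column j (J ** A) = J *v b j"
      by (simp add: column_def matrix_matrix_mult_def matrix_vector_mult_def A_def)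
    finally show ?thesis by (simp add: ip_def)
  qed
  then have "transpose A ** J ** A = mat 1"
    by (simp add: vec_eq_iff b mat_def)
  then show ?thesis by blast
qed

lemma matrix_inv_eqI:
  fixes A B :: "real ^ 'p ^ 'p"
  assumes "B ** A = mat 1"
  shows "matrix_inv A = B"
proof -
  have "A ** B = mat 1" using assms matrix_left_right_inverse by blast
  then have "\<exists>A'. A ** A' = mat 1 \<and> A' ** A = mat 1" using assms by blast
  then have "A ** matrix_inv A = mat 1" unfolding matrix_inv_def by (rule someI2_ex) auto
  then have "B ** A ** matrix_inv A = B" by (simp flip: matrix_mul_assoc)
  then show ?thesis by (simp add: assms)
qed

text \<open>The image of Lebesgue measure under an invertible matrix is translation invariant. The constant
  cancels when the Gaussian density is normalised.\<close>

lemma distr_lborel_matrix: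
  fixes A :: "real ^ 'p ^ 'p"
  assumes A: "B ** A = mat 1" "A ** B = mat 1"
  shows "\<exists>c<\<infinity>. distr lborel borel ((*v) A) = density lborel (\<lambda>_. c)"
proof (rule translation_invariant_unique)
  have [measurable]: "(*v) A \<in> borel_measurable borel"
    by (simp add: borel_measurable_continuous_onI linear_continuous_on)
  have A'[measurable]: "(*v) B \<in> borel_measurable borel"
    by (simp add: borel_measurable_continuous_onI linear_continuous_on)
  have BA: "B *v (A *v x) = x" "A *v (B *v x) = x" for x
    by (simp_all add: matrix_vector_mul_assoc A)
  show "sets (distr lborel borel ((*v) A)) = sets borel" by simp
  show "distr (distr lborel borel ((*v) A)) borel (\<lambda>x. x + v) = distr lborel borel ((*v) A)" for v
  proof -
    have "distr (distr lborel borel ((*v) A)) borel (\<lambda>x. x + v) = distr lborel borel (\<lambda>x. A *v (B *v v + x))"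
      by (subst distr_distr) (auto simp: comp_def matrix_vector_right_distrib BA add.commute)
    also have "\<dots> = distr (distr lborel borel ((+) (B *v v))) borel ((*v) A)"
      by (subst distr_distr) (auto simp: comp_def)
    finally show ?thesis by (simp add: lborel_distr_plus)
  qed
  have fin: "emeasure (distr lborel borel ((*v) A)) (ball 0 r) < \<infinity>" for r
  proof -
    have "bounded ((*v) B ` ball 0 r)"
      by (intro bounded_linear_image) auto
    then obtain R where "(*v) B ` ball 0 r \<subseteq> ball 0 R"
      using bounded_subset_ballD by blast
    then have "(*v) A -` ball 0 r \<subseteq> ball 0 R"
      using BA by force
    then have "emeasure lborel ((*v) A -` ball 0 r) \<le> emeasure lborel (ball (0::real ^ 'p) R)"
      by (intro emeasure_mono) auto
    also have "\<dots> < \<infinity>" by (rule emeasure_lborel_ball_finite)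
    finally show ?thesis by (simp add: emeasure_distr)
  qed
  show "emeasure (distr lborel borel ((*v) A)) (ball 0 1) < \<infinity>" by (rule fin)
  show "sigma_finite_measure (distr lborel borel ((*v) A))"
  proof
    show "\<exists>S. countable S \<and> S \<subseteq> sets (distr lborel borel ((*v) A)) \<and> \<Union> S = space (distr lborel borel ((*v) A)) \<and>
        (\<forall>a\<in>S. emeasure (distr lborel borel ((*v) A)) a \<noteq> \<infinity>)"
      using fin by (intro exI[of _ "range (\<lambda>n::nat. ball 0 (real n))"])
        (auto simp: less_top intro: reals_Archimedean2)
  qed
qed


definition gauss_kernel :: "real ^ 'p ^ 'p \<Rightarrow> real ^ 'p \<Rightarrow> real" where
  "gauss_kernel J x = exp (- (x \<bullet> (J *v x)) / 2)"

text \<open>\<open>J\<close> is the precision matrix, so this is \<open>N(0, J\<^sup>-\<^sup>1)\<close>; the density is normalised by its integral instead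
  of the closed form with the determinant.\<close>

definition gauss_law :: "real ^ 'p ^ 'p \<Rightarrow> (real ^ 'p) measure" where
  "gauss_law J = density lborel (\<lambda>x. ennreal (gauss_kernel J x / (\<integral>x. gauss_kernel J x \<partial>lborel)))"

lemma matrix_vector_mult_measurable[measurable]:
  "(\<lambda>x. (A :: real ^ 'p ^ 'q) *v x) \<in> borel_measurable borel"
  by (simp add: borel_measurable_continuous_onI linear_continuous_on)

lemma gauss_kernel_measurable[measurable]: "gauss_kernel J \<in> borel_measurable borel"
  unfolding gauss_kernel_def by measurable

lemma gauss_kernel_pos: "gauss_kernel J x > 0" by (simp add: gauss_kernel_def)

lemma sets_gauss_law[simp, measurable_cong]: "sets (gauss_law J) = sets borel"
  by (simp add: gauss_law_def)

lemma space_gauss_law[simp]: "space (gauss_law J) = UNIV"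
  by (simp add: gauss_law_def)

text \<open>With \<open>A\<^sup>T J A = 1\<close>, the linear map \<open>A\<close> sends \<open>\<bar>x\<bar>\<^sup>2\<close> to the quadratic form of \<open>J\<close>, so \<open>gauss_law J\<close> is the
  image of the standard Gaussian distribution under \<open>A\<close>.\<close>

lemma gauss_law_normalised:
  fixes J A :: "real ^ 'p ^ 'p"
  assumes J: "pos_def J" and A: "transpose A ** J ** A = mat 1"
  shows "integrable lborel (gauss_kernel J)" and "0 < (\<integral>x. gauss_kernel J x \<partial>lborel)"
    and "gauss_law J = distr std_gaussian borel ((*v) A)"
proof -
  define B where "B = transpose A ** J"
  have BA: "B ** A = mat 1" and AB: "A ** B = mat 1"
    using A matrix_left_right_inverse unfolding B_def by blast+
  obtain c where c: "c < \<infinity>" "distr lborel borel ((*v) A) = density lborel (\<lambda>_. c)"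
    using distr_lborel_matrix[OF BA AB] by blast
  define c' where "c' = enn2real c"
  have c': "c = ennreal c'" "0 \<le> c'" using c(1) by (simp_all add: c'_def less_top)
  define C where "C = (1 / sqrt (2 * pi)) ^ CARD('p)"
  have C: "C > 0" by (simp add: C_def)
  have sqB: "(B *v x) \<bullet> (B *v x) = x \<bullet> (J *v x)" for x
  proof -
    have "(B *v x) \<bullet> (B *v x) = (transpose A *v (J *v x)) \<bullet> (B *v x)"
      by (simp add: B_def matrix_vector_mul_assoc)
    also have "\<dots> = (J *v x) \<bullet> (A *v (B *v x))"
      by (metis dot_lmul_matrix inner_commute vector_transpose_matrix)
    also have "A *v (B *v x) = x" by (simp add: matrix_vector_mul_assoc AB)
    finally show ?thesis by (simp add: inner_commute)
  qed
  have dens: "(\<Prod>b\<in>Basis. std_normal_density ((B *v x) \<bullet> b)) = C * gauss_kernel J x" for x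
    by (simp only: std_gaussian_density_eq sqB C_def gauss_kernel_def)
  have BAx: "B *v (A *v x) = x" for x by (simp add: matrix_vector_mul_assoc BA)
  have [measurable]: "(\<lambda>x. \<Prod>b\<in>Basis. std_normal_density ((B *v x) \<bullet> b)) \<in> borel_measurable borel"
    unfolding dens by measurable
  have "distr std_gaussian borel ((*v) A)
      = density (distr lborel borel ((*v) A)) (\<lambda>x. ennreal (\<Prod>b\<in>Basis. std_normal_density ((B *v x) \<bullet> b)))"
    by (subst density_distr) (simp_all add: std_gaussian_def BAx)
  also have "\<dots> = density lborel (\<lambda>x. ennreal (c' * C * gauss_kernel J x))"
    unfolding c dens using c' C
    by (subst density_density_eq) (auto simp: ennreal_mult'[symmetric] mult.assoc)
  finally have eq: "distr std_gaussian borel ((*v) A) = density lborel (\<lambda>x. ennreal (c' * C * gauss_kernel J x))" .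
  interpret S: prob_space "std_gaussian :: (real ^ 'p) measure" by (rule prob_space_std_gaussian)
  have "prob_space (distr std_gaussian borel ((*v) A))"
    by (rule S.prob_space_distr) (simp add: std_gaussian_def)
  then have "emeasure (density lborel (\<lambda>x. ennreal (c' * C * gauss_kernel J x))) UNIV = 1"
    unfolding eq using prob_space.emeasure_space_1 by fastforce
  then have tot: "(\<integral>\<^sup>+x. ennreal (c' * C * gauss_kernel J x) \<partial>lborel) = 1"
    by (simp add: emeasure_density)
  then have c'pos: "c' > 0" using c'(2) by (cases "c' = 0") auto
  have I1: "integrable lborel (\<lambda>x. c' * C * gauss_kernel J x)"
    using tot c' C by (intro integrableI_nonneg) (auto intro!: mult_nonneg_nonneg less_imp_le[OF gauss_kernel_pos])
  then show int: "integrable lborel (gauss_kernel J)"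
    using c'pos C by simp
  have "(\<integral>x. c' * C * gauss_kernel J x \<partial>lborel) = 1"
    using tot c' C by (subst integral_eq_nn_integral) (auto intro!: mult_nonneg_nonneg less_imp_le[OF gauss_kernel_pos])
  then have N: "c' * C * (\<integral>x. gauss_kernel J x \<partial>lborel) = 1" by simp
  show N0: "0 < (\<integral>x. gauss_kernel J x \<partial>lborel)"
    using N c'pos C by (metis mult_pos_pos zero_less_mult_pos zero_less_one)
  have "c' * C = 1 / (\<integral>x. gauss_kernel J x \<partial>lborel)"
    using N N0 by (simp add: field_simps)
  then show "gauss_law J = distr std_gaussian borel ((*v) A)"
    unfolding eq gauss_law_def by simp
qed

lemma prob_space_gauss_law:
  fixes J :: "real ^ 'p ^ 'p"
  assumes "pos_def J"
  shows "prob_space (gauss_law J)"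
proof -
  obtain A :: "real ^ 'p ^ 'p" where A: "transpose A ** J ** A = mat 1" using gram_schmidt[OF assms] by blast
  show ?thesis unfolding gauss_law_normalised(3)[OF assms A]
    by (rule prob_space.prob_space_distr[OF prob_space_std_gaussian]) (simp add: std_gaussian_def)
qed

lemma pos_def_inverse_factor:
  fixes J A :: "real ^ 'p ^ 'p"
  assumes A: "transpose A ** J ** A = mat 1"
  shows "matrix_inv J = A ** transpose A" and "J ** matrix_inv J = mat 1" and "matrix_inv J ** J = mat 1"
    and "matrix_inv (matrix_inv J) = J" and "det (matrix_inv J) > 0"
proof -
  have "A ** (transpose A ** J) = mat 1" using A matrix_left_right_inverse by blast
  then have 1: "(A ** transpose A) ** J = mat 1" by (simp add: matrix_mul_assoc)
  then have 2: "J ** (A ** transpose A) = mat 1" using matrix_left_right_inverse by blast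
  show inv: "matrix_inv J = A ** transpose A" by (rule matrix_inv_eqI[OF 1])
  show "J ** matrix_inv J = mat 1" "matrix_inv J ** J = mat 1" using 1 2 by (simp_all add: inv)
  show "matrix_inv (matrix_inv J) = J" unfolding inv by (rule matrix_inv_eqI[OF 2])
  have "det (A ** transpose A) * det J = 1" using arg_cong[OF 1, of det] by (simp add: det_mul)
  then have "det A \<noteq> 0" by (auto simp: det_mul)
  then show "det (matrix_inv J) > 0" by (auto simp: inv det_mul zero_less_mult_iff)
qed

lemma gauss_law_exp:
  fixes J :: "real ^ 'p ^ 'p" and v :: "real ^ 'p"
  assumes J: "pos_def J" and z: "z = 1 \<or> z = \<i>"
  shows "integrable (gauss_law J) (\<lambda>x. exp (z * complex_of_real (v \<bullet> x)))"
    and "(\<integral>x. exp (z * complex_of_real (v \<bullet> x)) \<partial>gauss_law J) = exp (z\<^sup>2 * of_real (v \<bullet> (matrix_inv J *v v)) / 2)"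
proof -
  obtain A :: "real ^ 'p ^ 'p" where A: "transpose A ** J ** A = mat 1" using gram_schmidt[OF J] by blast
  have vA: "v \<bullet> (A *v x) = (v v* A) \<bullet> x" for x
    by (simp add: dot_lmul_matrix)
  have vv: "(v v* A) \<bullet> (v v* A) = v \<bullet> (matrix_inv J *v v)"
    unfolding pos_def_inverse_factor(1)[OF A] by (simp add: dot_lmul_matrix flip: matrix_vector_mul_assoc)
  have m: "(*v) A \<in> std_gaussian \<rightarrow>\<^sub>M borel" by (simp add: std_gaussian_def)
  show "integrable (gauss_law J) (\<lambda>x. exp (z * complex_of_real (v \<bullet> x)))"
    unfolding gauss_law_normalised(3)[OF J A] using m
    by (subst integrable_distr_eq) (simp_all add: vA std_gaussian_exp[OF z])
  show "(\<integral>x. exp (z * complex_of_real (v \<bullet> x)) \<partial>gauss_law J) = exp (z\<^sup>2 * of_real (v \<bullet> (matrix_inv J *v v)) / 2)"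
    unfolding gauss_law_normalised(3)[OF J A] using m
    by (subst integral_distr) (simp_all add: vA vv std_gaussian_exp[OF z])
qed

lemma gauss_law_exp_real:
  fixes J :: "real ^ 'p ^ 'p" and v :: "real ^ 'p"
  assumes J: "pos_def J"
  shows "integrable (gauss_law J) (\<lambda>x. exp (v \<bullet> x))"
    and "(\<integral>x. exp (v \<bullet> x) \<partial>gauss_law J) = exp (v \<bullet> (matrix_inv J *v v) / 2)"
proof -
  have eq: "exp (1 * complex_of_real x) = of_real (exp x)" for x by (simp add: exp_of_real)
  have one: "(1 :: complex) = 1 \<or> (1 :: complex) = \<i>" by simp
  note E = gauss_law_exp[OF J one, of v, unfolded eq]
  show "integrable (gauss_law J) (\<lambda>x. exp (v \<bullet> x))"
    using E(1) by (simp only: complex_of_real_integrable_eq)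
  have "complex_of_real (\<integral>x. exp (v \<bullet> x) \<partial>gauss_law J) = of_real (exp (v \<bullet> (matrix_inv J *v v) / 2))"
    using E(2) by (simp only: integral_complex_of_real) (simp flip: exp_of_real)
  then show "(\<integral>x. exp (v \<bullet> x) \<partial>gauss_law J) = exp (v \<bullet> (matrix_inv J *v v) / 2)"
    by (simp only: of_real_eq_iff)
qed

text \<open>The density of \<open>N(h, J\<^sup>-\<^sup>1)\<close> with respect to \<open>N(0, J\<^sup>-\<^sup>1)\<close>.\<close>

definition gauss_ratio :: "real ^ 'p ^ 'p \<Rightarrow> real ^ 'p \<Rightarrow> real ^ 'p \<Rightarrow> real" where
  "gauss_ratio J h x = exp (h \<bullet> (J *v x) - 1 / 2 * (h \<bullet> (J *v h)))"

lemma gauss_ratio_measurable[measurable]: "gauss_ratio J h \<in> borel_measurable borel"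
  unfolding gauss_ratio_def by measurable

lemma gauss_ratio_pos: "gauss_ratio J h x > 0" by (simp add: gauss_ratio_def)

lemma pos_def_sym:
  fixes J :: "real ^ 'p ^ 'p"
  assumes "pos_def J" shows "v \<bullet> (J *v w) = (J *v v) \<bullet> w"
  using assms by (metis dot_lmul_matrix inner_commute pos_def_def transpose_matrix_vector)

lemma pos_def_inverse:
  fixes J :: "real ^ 'p ^ 'p"
  assumes "pos_def J"
  shows "J ** matrix_inv J = mat 1" and "matrix_inv J ** J = mat 1"
    and "J *v (matrix_inv J *v x) = x" and "matrix_inv J *v (J *v x) = x"
    and "v \<bullet> (matrix_inv J *v w) = (matrix_inv J *v v) \<bullet> w"
proof -
  obtain A :: "real ^ 'p ^ 'p" where A: "transpose A ** J ** A = mat 1" using gram_schmidt[OF assms] by blast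
  show 1: "J ** matrix_inv J = mat 1" and 2: "matrix_inv J ** J = mat 1" by (rule pos_def_inverse_factor[OF A])+
  show 3: "J *v (matrix_inv J *v x) = x" "matrix_inv J *v (J *v x) = x" for x
    by (simp_all add: matrix_vector_mul_assoc 1 2)
  show "v \<bullet> (matrix_inv J *v w) = (matrix_inv J *v v) \<bullet> w"
    using pos_def_sym[OF assms, of "matrix_inv J *v v" "matrix_inv J *v w"] by (simp add: 3)
qed

lemma gauss_kernel_shift:
  assumes "pos_def J"
  shows "gauss_kernel J (x - h) = gauss_kernel J x * gauss_ratio J h x"
proof -
  have "(x - h) \<bullet> (J *v (x - h)) = x \<bullet> (J *v x) - 2 * (h \<bullet> (J *v x)) + h \<bullet> (J *v h)"
    using pos_def_sym[OF assms, of x h]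
    by (simp add: matrix_vector_mult_diff_distrib inner_diff_left inner_diff_right inner_commute)
  then show ?thesis by (simp add: gauss_kernel_def gauss_ratio_def mult_exp_exp field_simps)
qed

lemma gauss_ratio_moments:
  fixes J :: "real ^ 'p ^ 'p"
  assumes J: "pos_def J"
  shows "integrable (gauss_law J) (gauss_ratio J h)"
    and "(\<integral>x. gauss_ratio J h x \<partial>gauss_law J) = 1"
    and "integrable (gauss_law J) (\<lambda>x. (gauss_ratio J h x)\<^sup>2)"
    and "(\<integral>x. (gauss_ratio J h x)\<^sup>2 \<partial>gauss_law J) = exp (h \<bullet> (J *v h))"
proof -
  obtain A :: "real ^ 'p ^ 'p" where A: "transpose A ** J ** A = mat 1" using gram_schmidt[OF J] by blast
  have inv: "matrix_inv J *v (J *v x) = x" for x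
    by (simp add: matrix_vector_mul_assoc pos_def_inverse_factor(3)[OF A])
  have eq: "gauss_ratio J h x = exp (- 1 / 2 * (h \<bullet> (J *v h))) * exp ((J *v h) \<bullet> x)" for x
    using pos_def_sym[OF J, of h x] by (simp add: gauss_ratio_def mult_exp_exp)
  have eq2: "(gauss_ratio J h x)\<^sup>2 = exp (- (h \<bullet> (J *v h))) * exp ((2 *\<^sub>R (J *v h)) \<bullet> x)" for x
    using pos_def_sym[OF J, of h x] by (simp add: gauss_ratio_def mult_exp_exp exp_double[symmetric] algebra_simps)
  show "integrable (gauss_law J) (gauss_ratio J h)"
    unfolding eq[abs_def] by (intro integrable_mult_right gauss_law_exp_real[OF J])
  show "(\<integral>x. gauss_ratio J h x \<partial>gauss_law J) = 1"
    unfolding eq integral_mult_right_zero gauss_law_exp_real(2)[OF J] inv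
    by (simp add: mult_exp_exp inner_commute)
  show "integrable (gauss_law J) (\<lambda>x. (gauss_ratio J h x)\<^sup>2)"
    unfolding eq2 by (intro integrable_mult_right gauss_law_exp_real[OF J])
  show "(\<integral>x. (gauss_ratio J h x)\<^sup>2 \<partial>gauss_law J) = exp (h \<bullet> (J *v h))"
    unfolding eq2 integral_mult_right_zero gauss_law_exp_real(2)[OF J] matrix_vector_mult_scaleR inv
    by (simp add: mult_exp_exp inner_commute)
qed

lemma gauss_law_integral:
  fixes g :: "real ^ 'p \<Rightarrow> real"
  assumes [measurable]: "g \<in> borel_measurable borel"
  assumes J: "pos_def J"
  shows "(\<integral>x. g x \<partial>gauss_law J) = (\<integral>x. gauss_kernel J x * g x \<partial>lborel) / (\<integral>x. gauss_kernel J x \<partial>lborel)"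
proof -
  obtain A :: "real ^ 'p ^ 'p" where A: "transpose A ** J ** A = mat 1" using gram_schmidt[OF J] by blast
  show ?thesis
    unfolding gauss_law_def using gauss_law_normalised(2)[OF J A] gauss_kernel_pos[of J]
    by (subst integral_density) (auto simp: less_imp_le)
qed

lemma gauss_law_translate:
  fixes g :: "real ^ 'p \<Rightarrow> real"
  assumes [measurable]: "g \<in> borel_measurable borel"
  assumes J: "pos_def J"
  shows "(\<integral>x. g (x + v) \<partial>gauss_law J) = (\<integral>x. g x * gauss_ratio J v x \<partial>gauss_law J)"
proof -
  have "(\<integral>x. gauss_kernel J x * g (x + v) \<partial>lborel) = (\<integral>x. gauss_kernel J (x - v) * g x \<partial>distr lborel borel ((+) v))"
    by (subst integral_distr) (auto simp: add.commute)
  also have "\<dots> = (\<integral>x. gauss_kernel J x * (g x * gauss_ratio J v x) \<partial>lborel)"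
    by (simp add: lborel_distr_plus gauss_kernel_shift[OF J] mult_ac)
  finally show ?thesis by (simp add: gauss_law_integral[OF _ J])
qed

lemma (in prob_space) abs_expectation_le_sqrt:
  fixes X :: "'a \<Rightarrow> real"
  assumes "integrable M X" "integrable M (\<lambda>x. (X x)\<^sup>2)"
  shows "expectation (\<lambda>x. \<bar>X x\<bar>) \<le> sqrt (expectation (\<lambda>x. (X x)\<^sup>2))"
proof -
  have "0 \<le> variance (\<lambda>x. \<bar>X x\<bar>)" by simp
  also have "\<dots> = expectation (\<lambda>x. (X x)\<^sup>2) - (expectation (\<lambda>x. \<bar>X x\<bar>))\<^sup>2"
    using assms by (subst variance_eq) auto
  finally show ?thesis by (intro real_le_rsqrt) simp
qed

text \<open>A shift of the argument is a change of measure with density \<open>gauss_ratio J v\<close>, whose distance to \<open>1\<close> in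
  \<open>L\<^sup>1\<close> is at most its distance in \<open>L\<^sup>2\<close>.\<close>

lemma gauss_law_shift_tv:
  fixes g :: "real ^ 'p \<Rightarrow> real"
  assumes [measurable]: "g \<in> borel_measurable borel" and K: "\<And>x. \<bar>g x\<bar> \<le> K"
  assumes J: "pos_def J"
  shows "\<bar>(\<integral>x. g (x + v) \<partial>gauss_law J) - (\<integral>x. g x \<partial>gauss_law J)\<bar> \<le> K * sqrt (exp (v \<bullet> (J *v v)) - 1)"
proof -
  interpret Q: prob_space "gauss_law J" by (rule prob_space_gauss_law[OF J])
  note R = gauss_ratio_moments[OF J, of v]
  have K0: "0 \<le> K" using K[of 0] by linarith
  have gi: "integrable (gauss_law J) g" by (rule Q.integrable_const_bound[of _ K]) (auto simp: K)
  have gr: "integrable (gauss_law J) (\<lambda>x. g x * gauss_ratio J v x)"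
    by (rule Bochner_Integration.integrable_bound[OF integrable_mult_right[OF R(1), of K]])
      (auto simp: abs_mult K0 less_imp_le[OF gauss_ratio_pos] intro!: mult_mono K)
  have i2: "integrable (gauss_law J) (\<lambda>x. (gauss_ratio J v x - 1)\<^sup>2)"
    using R by (simp add: power2_diff)
  have "\<bar>(\<integral>x. g (x + v) \<partial>gauss_law J) - (\<integral>x. g x \<partial>gauss_law J)\<bar>
      = norm (\<integral>x. g x * (gauss_ratio J v x - 1) \<partial>gauss_law J)"
    using gi gr by (simp add: gauss_law_translate[OF _ J] right_diff_distrib)
  also have "\<dots> \<le> (\<integral>x. K * \<bar>gauss_ratio J v x - 1\<bar> \<partial>gauss_law J)"
    by (rule order_trans[OF integral_norm_bound], rule integral_mono')
      (use R(1) K0 in \<open>auto simp: abs_mult intro!: mult_mono K\<close>)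
  also have "\<dots> = K * (\<integral>x. \<bar>gauss_ratio J v x - 1\<bar> \<partial>gauss_law J)" by simp
  also have "\<dots> \<le> K * sqrt (\<integral>x. (gauss_ratio J v x - 1)\<^sup>2 \<partial>gauss_law J)"
    using K0 R(1) i2 by (intro mult_left_mono Q.abs_expectation_le_sqrt) auto
  also have "(\<integral>x. (gauss_ratio J v x - 1)\<^sup>2 \<partial>gauss_law J) = exp (v \<bullet> (J *v v)) - 1"
    using R Q.prob_space by (simp add: power2_diff)
  finally show ?thesis .
qed

text \<open>Links the closed-form Gaussian densities to \<open>gauss_law\<close>. The factor \<open>k\<close> stems from
  the normalisation of the closed form and cancels from every quotient in which it occurs. Positivity of the determinant is what
  makes the closed form a positive density.\<close>

lemma gaussian_gauss_law:
  fixes J :: "real ^ 'p ^ 'p"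
  assumes J: "pos_def J"
  obtains k where "k > 0"
    and "\<forall>h. \<forall>g\<in>borel_measurable borel.
      limit_sel_prob (matrix_inv J) g h = k * (\<integral>x. g x * gauss_ratio J h x \<partial>gauss_law J)"
    and "\<forall>p\<in>borel_measurable borel.
      selective_gaussian 0 (matrix_inv J) p = density (gauss_law J) (\<lambda>z. ennreal (p z / (\<integral>x. p x \<partial>gauss_law J)))"
proof -
  obtain A :: "real ^ 'p ^ 'p" where A: "transpose A ** J ** A = mat 1" using gram_schmidt[OF J] by blast
  define N where "N = (\<integral>x. gauss_kernel J x \<partial>lborel)"
  define K where "K = sqrt ((2 * pi) ^ CARD('p) * det (matrix_inv J))"
  have N: "N > 0" using gauss_law_normalised(2)[OF J A] by (simp add: N_def)
  have K: "K > 0" using pos_def_inverse_factor(5)[OF A] by (simp add: K_def)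
  have dens: "gauss_density h (matrix_inv J) z = gauss_kernel J z * gauss_ratio J h z / K" for h z
    unfolding gauss_density_def pos_def_inverse_factor(4)[OF A] K_def[symmetric]
      gauss_kernel_def[symmetric] gauss_kernel_shift[OF J] ..
  have R0: "gauss_ratio J 0 z = 1" for z by (simp add: gauss_ratio_def)
  have nn: "0 \<le> gauss_kernel J z" "0 \<le> gauss_ratio J h z" for z h
    using gauss_kernel_pos[of J z] gauss_ratio_pos[of J h z] by simp_all
  show ?thesis
  proof (rule that[of "N / K"], safe)
    show "N / K > 0" using N K by simp
  next
    fix h and g :: "real ^ 'p \<Rightarrow> real" assume [measurable]: "g \<in> borel_measurable borel"
    show "limit_sel_prob (matrix_inv J) g h = N / K * (\<integral>x. g x * gauss_ratio J h x \<partial>gauss_law J)"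
      unfolding limit_sel_prob_def gaussian_def dens using N K
      by (subst integral_density) (auto simp: nn gauss_law_integral[OF _ J] N_def[symmetric] mult_ac)
  next
    fix p :: "real ^ 'p \<Rightarrow> real" assume [measurable]: "p \<in> borel_measurable borel"
    have eq: "p z * gauss_density 0 (matrix_inv J) z / (\<integral>x. p x * gauss_density 0 (matrix_inv J) x \<partial>lborel)
        = gauss_kernel J z / N * (p z / (\<integral>x. p x \<partial>gauss_law J))" for z
      using N K by (simp add: dens R0 gauss_law_integral[OF _ J] N_def[symmetric] mult_ac)
    show "selective_gaussian 0 (matrix_inv J) p = density (gauss_law J) (\<lambda>z. ennreal (p z / (\<integral>x. p x \<partial>gauss_law J)))"
      unfolding selective_gaussian_def eq gauss_law_def N_def[symmetric] using N
      by (subst density_density_eq) (auto simp: ennreal_mult'[symmetric] nn)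
  qed
qed

section \<open>Central limit theorems by Gaussian smoothing\<close>

definition std_kernel :: "real ^ 'p \<Rightarrow> real" where
  "std_kernel x = (1 / sqrt (2 * pi)) ^ CARD('p) * exp (- (x \<bullet> x) / 2)"

lemma std_kernel_measurable[measurable]: "std_kernel \<in> borel_measurable borel"
  unfolding std_kernel_def by measurable

lemma std_kernel_nonneg: "0 \<le> std_kernel x" by (simp add: std_kernel_def)

lemma std_gaussian_kernel: "std_gaussian = density lborel (\<lambda>x. ennreal (std_kernel x))"
  unfolding std_gaussian_def std_kernel_def std_gaussian_density_eq ..

lemma sets_std_gaussian[simp, measurable_cong]: "sets std_gaussian = sets borel"
  by (simp add: std_gaussian_def)

lemma nn_integral_std_kernel:
  fixes a :: "real ^ 'p"
  shows "(\<integral>\<^sup>+x. ennreal (std_kernel (x - a)) \<partial>lborel) = 1"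
proof -
  have "(\<integral>\<^sup>+x. ennreal (std_kernel (x - a)) \<partial>lborel) = (\<integral>\<^sup>+x. ennreal (std_kernel (x - a)) \<partial>distr lborel borel ((+) a))"
    by (simp add: lborel_distr_plus)
  also have "\<dots> = (\<integral>\<^sup>+x. ennreal (std_kernel (x :: real ^ 'p)) \<partial>lborel)"
    by (subst nn_integral_distr) auto
  also have "\<dots> = emeasure std_gaussian (UNIV :: (real ^ 'p) set)"
    by (simp add: std_gaussian_kernel emeasure_density)
  also have "\<dots> = 1"
    using prob_space.emeasure_space_1[OF prob_space_std_gaussian] by (simp add: std_gaussian_def)
  finally show ?thesis .
qed

text \<open>The density of the convolution of \<open>M\<close> with the standard Gaussian distribution.\<close>

definition smooth_density :: "(real ^ 'p) measure \<Rightarrow> real ^ 'p \<Rightarrow> real" where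
  "smooth_density M y = (\<integral>x. std_kernel (y - x) \<partial>M)"

lemma std_kernel_le: "std_kernel (x :: real ^ 'p) \<le> (1 / sqrt (2 * pi)) ^ CARD('p)"
  unfolding std_kernel_def by (intro mult_left_le) auto

context
  fixes M :: "(real ^ 'p) measure"
  assumes prob: "prob_space M" and sets_M[measurable_cong, simp]: "sets M = sets borel"
begin

interpretation M: prob_space M by (rule prob)
interpretation PL: pair_sigma_finite M lborel
  by (simp add: pair_sigma_finite_def M.sigma_finite_measure_axioms sigma_finite_lborel)

lemma smooth_density_measurable: "smooth_density M \<in> borel_measurable borel"
  unfolding smooth_density_def by measurable

lemma smooth_density_nonneg: "0 \<le> smooth_density M y"
  unfolding smooth_density_def by (simp add: std_kernel_nonneg)

lemma nn_smooth_density: "ennreal (smooth_density M y) = (\<integral>\<^sup>+x. ennreal (std_kernel (y - x)) \<partial>M)"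
proof -
  have "integrable M (\<lambda>x. std_kernel (y - x))"
    by (rule M.integrable_const_bound[where B="(1 / sqrt (2 * pi)) ^ CARD('p)"])
      (auto simp: std_kernel_nonneg std_kernel_le)
  then show ?thesis
    unfolding smooth_density_def by (intro nn_integral_eq_integral[symmetric]) (auto simp: std_kernel_nonneg)
qed

lemma nn_integral_smooth_density: "(\<integral>\<^sup>+y. ennreal (smooth_density M y) \<partial>lborel) = 1"
proof -
  have "(\<integral>\<^sup>+y. ennreal (smooth_density M y) \<partial>lborel) = (\<integral>\<^sup>+x. \<integral>\<^sup>+y. ennreal (std_kernel (y - x)) \<partial>lborel \<partial>M)"
    unfolding nn_smooth_density by (rule PL.Fubini') measurable
  also have "\<dots> = 1" by (simp add: nn_integral_std_kernel M.emeasure_space_1)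
  finally show ?thesis .
qed

lemma integral_smooth_density:
  fixes g :: "real ^ 'p \<Rightarrow> real"
  assumes g[measurable]: "g \<in> borel_measurable borel" and K: "\<And>x. \<bar>g x\<bar> \<le> K"
  shows "(\<integral>x. (\<integral>z. g (x + z) \<partial>std_gaussian) \<partial>M) = (\<integral>y. g y * smooth_density M y \<partial>lborel)"
proof -
  have K0: "0 \<le> K" using K[of 0] by linarith
  have int: "integrable (M \<Otimes>\<^sub>M lborel) (\<lambda>(x, y). g y * std_kernel (y - x))"
  proof (rule integrableI_bounded)
    have "(\<integral>\<^sup>+p. ennreal (norm (case p of (x, y) \<Rightarrow> g y * std_kernel (y - x))) \<partial>(M \<Otimes>\<^sub>M lborel))
        \<le> (\<integral>\<^sup>+p. ennreal K * ennreal (std_kernel (snd p - fst p)) \<partial>(M \<Otimes>\<^sub>M lborel))"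
      using K K0 by (intro nn_integral_mono)
        (auto simp: abs_mult std_kernel_nonneg ennreal_mult'[symmetric] intro!: ennreal_leI mult_right_mono)
    also have "\<dots> = ennreal K * (\<integral>\<^sup>+x. \<integral>\<^sup>+y. ennreal (std_kernel (y - x)) \<partial>lborel \<partial>M)"
      by (simp add: nn_integral_cmult flip: lborel.nn_integral_fst)
    also have "\<dots> < \<infinity>" by (simp add: nn_integral_std_kernel M.emeasure_space_1)
    finally show "(\<integral>\<^sup>+p. ennreal (norm (case p of (x, y) \<Rightarrow> g y * std_kernel (y - x))) \<partial>(M \<Otimes>\<^sub>M lborel)) < \<infinity>" .
  qed measurable
  have "(\<integral>z. g (x + z) \<partial>std_gaussian) = (\<integral>y. g y * std_kernel (y - x) \<partial>lborel)" for x
  proof -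
    have "(\<integral>y. g y * std_kernel (y - x) \<partial>lborel) = (\<integral>y. g y * std_kernel (y - x) \<partial>distr lborel borel ((+) x))"
      by (simp add: lborel_distr_plus)
    also have "\<dots> = (\<integral>z. g (x + z) * std_kernel z \<partial>lborel)"
      by (subst integral_distr) auto
    also have "\<dots> = (\<integral>z. g (x + z) \<partial>std_gaussian)"
      unfolding std_gaussian_kernel by (subst integral_density) (auto simp: std_kernel_nonneg mult.commute)
    finally show ?thesis ..
  qed
  then have "(\<integral>x. (\<integral>z. g (x + z) \<partial>std_gaussian) \<partial>M) = (\<integral>x. (\<integral>y. g y * std_kernel (y - x) \<partial>lborel) \<partial>M)"
    by simp
  also have "\<dots> = (\<integral>y. (\<integral>x. g y * std_kernel (y - x) \<partial>M) \<partial>lborel)"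
    by (rule PL.Fubini_integral[OF int, symmetric])
  finally show ?thesis by (simp add: smooth_density_def)
qed

text \<open>The Gaussian density is its own Fourier transform up to a constant, so the smoothed density is an
  integral of the characteristic function against an integrable weight.\<close>

lemma smooth_density_char:
  "complex_of_real (smooth_density M y) = (1 / sqrt (2 * pi)) ^ CARD('p) *
    (\<integral>z. exp (\<i> * of_real (y \<bullet> z)) * (\<integral>x. exp (\<i> * of_real ((- z) \<bullet> x)) \<partial>M) \<partial>std_gaussian)"
proof -
  interpret G: prob_space "std_gaussian :: (real ^ 'p) measure" by (rule prob_space_std_gaussian)
  interpret MG: pair_prob_space M "std_gaussian :: (real ^ 'p) measure" ..
  let ?e = "\<lambda>x z :: real ^ 'p. exp (\<i> * complex_of_real (y \<bullet> z)) * exp (\<i> * complex_of_real ((- z) \<bullet> x))"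
  have int: "integrable (M \<Otimes>\<^sub>M std_gaussian) (\<lambda>(x, z). ?e x z)"
    by (rule MG.integrable_const_bound[where B=1]) (auto simp: norm_mult)
  have "complex_of_real (exp (- ((y - x) \<bullet> (y - x)) / 2)) = (\<integral>z. ?e x z \<partial>std_gaussian)" for x
  proof -
    have "?e x z = exp (\<i> * complex_of_real ((y - x) \<bullet> z))" for z
      by (simp add: mult_exp_exp inner_diff_left inner_commute algebra_simps)
    then show ?thesis
      using std_gaussian_exp(2)[of \<i> "y - x"] by (simp add: exp_of_real[symmetric])
  qed
  then have "(\<integral>x. complex_of_real (exp (- ((y - x) \<bullet> (y - x)) / 2)) \<partial>M) = (\<integral>x. (\<integral>z. ?e x z \<partial>std_gaussian) \<partial>M)"
    by simp
  also have "\<dots> = (\<integral>z. (\<integral>x. ?e x z \<partial>M) \<partial>std_gaussian)"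
    by (rule MG.Fubini_integral[OF int, symmetric])
  finally have "complex_of_real (\<integral>x. exp (- ((y - x) \<bullet> (y - x)) / 2) \<partial>M)
      = (\<integral>z. exp (\<i> * of_real (y \<bullet> z)) * (\<integral>x. exp (\<i> * of_real ((- z) \<bullet> x)) \<partial>M) \<partial>std_gaussian)"
    by (simp only: integral_complex_of_real integral_mult_right_zero)
  then show ?thesis
    unfolding smooth_density_def std_kernel_def integral_mult_right_zero by simp
qed

end

text \<open>Characteristic functions are bounded by \<open>1\<close>, so their pointwise convergence passes to the smoothed
  densities by dominated convergence, and Scheffe's lemma turns pointwise convergence of probability
  densities into convergence in \<open>L\<^sup>1\<close>. Convergence in \<open>L\<^sup>1\<close> is uniform over bounded test functions, which is
  why the test function may depend on \<open>n\<close>.\<close>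

lemma smoothed_tv_limit:
  fixes Q :: "nat \<Rightarrow> (real ^ 'p) measure" and R :: "(real ^ 'p) measure"
  assumes Q: "\<And>n. prob_space (Q n)" "\<And>n. sets (Q n) = sets borel"
    and R: "prob_space R" "sets R = sets borel"
    and char: "\<And>t. (\<lambda>n. \<integral>x. exp (\<i> * of_real (t \<bullet> x)) \<partial>Q n) \<longlonglongrightarrow> (\<integral>x. exp (\<i> * of_real (t \<bullet> x)) \<partial>R)"
    and g: "\<And>n. g n \<in> borel_measurable borel" "\<And>n x. \<bar>g n x :: real\<bar> \<le> K"
  shows "(\<lambda>n. (\<integral>x. (\<integral>z. g n (x + z) \<partial>std_gaussian) \<partial>Q n) - (\<integral>x. (\<integral>z. g n (x + z) \<partial>std_gaussian) \<partial>R)) \<longlonglongrightarrow> 0"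
proof -
  interpret G: prob_space "std_gaussian :: (real ^ 'p) measure" by (rule prob_space_std_gaussian)
  have K0: "0 \<le> K" using g(2)[of 0 0] by linarith
  note [measurable] = g(1) smooth_density_measurable[OF Q] smooth_density_measurable[OF R]
  note [measurable_cong] = Q(2) R(2)
  have cm: "norm (\<integral>x. exp (\<i> * of_real (t \<bullet> x)) \<partial>Q n) \<le> 1" for t n
  proof -
    interpret Qn: prob_space "Q n" by (rule Q)
    have "norm (\<integral>x. exp (\<i> * of_real (t \<bullet> x)) \<partial>Q n) \<le> (\<integral>x. 1 \<partial>Q n)"
      by (rule norm_integral_le) auto
    then show ?thesis by (simp add: Qn.prob_space)
  qed
  interpret R: prob_space R by (rule R)
  have sf: "sigma_finite_measure (Q n)" for n
    using prob_space_imp_sigma_finite[OF Q(1)] .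
  have meas: "(\<lambda>z. \<integral>x. exp (\<i> * complex_of_real ((- z) \<bullet> x)) \<partial>Q n) \<in> borel_measurable borel" for n
    by (rule sigma_finite_measure.borel_measurable_lebesgue_integral[OF sf]) measurable
  have "(\<lambda>n. smooth_density (Q n) y) \<longlonglongrightarrow> smooth_density R y" for y
  proof -
    have "(\<lambda>n. \<integral>z. exp (\<i> * of_real (y \<bullet> z)) * (\<integral>x. exp (\<i> * of_real ((- z) \<bullet> x)) \<partial>Q n) \<partial>std_gaussian)
        \<longlonglongrightarrow> (\<integral>z. exp (\<i> * of_real (y \<bullet> z)) * (\<integral>x. exp (\<i> * of_real ((- z) \<bullet> x)) \<partial>R) \<partial>std_gaussian)"
    proof (rule integral_dominated_convergence[where w="\<lambda>_. 1"])
      show "AE z in std_gaussian. (\<lambda>n. exp (\<i> * complex_of_real (y \<bullet> z)) * (\<integral>x. exp (\<i> * of_real ((- z) \<bullet> x)) \<partial>Q n))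
          \<longlonglongrightarrow> exp (\<i> * of_real (y \<bullet> z)) * (\<integral>x. exp (\<i> * of_real ((- z) \<bullet> x)) \<partial>R)"
        by (intro AE_I2 tendsto_mult tendsto_const char)
    next
      fix n
      show "AE z in std_gaussian. norm (exp (\<i> * complex_of_real (y \<bullet> z)) * (\<integral>x. exp (\<i> * of_real ((- z) \<bullet> x)) \<partial>Q n)) \<le> 1"
        by (intro AE_I2) (simp only: norm_mult norm_exp_i_times mult_1 cm)
      show "(\<lambda>z. exp (\<i> * complex_of_real (y \<bullet> z)) * (\<integral>x. exp (\<i> * of_real ((- z) \<bullet> x)) \<partial>Q n)) \<in> borel_measurable std_gaussian"
        using meas by measurable
    next
      show "(\<lambda>z. exp (\<i> * complex_of_real (y \<bullet> z)) * (\<integral>x. exp (\<i> * of_real ((- z) \<bullet> x)) \<partial>R)) \<in> borel_measurable std_gaussian"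
        by measurable
    qed simp
    then have "(\<lambda>n. complex_of_real (smooth_density (Q n) y)) \<longlonglongrightarrow> complex_of_real (smooth_density R y)"
      unfolding smooth_density_char[OF Q] smooth_density_char[OF R]
      by (rule tendsto_mult[OF tendsto_const])
    then show ?thesis by (simp only: tendsto_of_real_iff)
  qed
  note pw = this
  have iQ: "integrable lborel (smooth_density (Q n))" for n
    by (rule integrableI_nonneg) (auto simp: nn_integral_smooth_density[OF Q] smooth_density_nonneg[OF Q])
  have iR: "integrable lborel (smooth_density R)"
    by (rule integrableI_nonneg) (auto simp: nn_integral_smooth_density[OF R] smooth_density_nonneg[OF R])
  have L1: "(\<lambda>n. \<integral>\<^sup>+y. norm (smooth_density (Q n) y - smooth_density R y) \<partial>lborel) \<longlonglongrightarrow> 0"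
    using pw iR by (intro Scheffe_lemma2)
      (auto simp: nn_integral_smooth_density[OF Q] smooth_density_nonneg[OF Q]
        nn_integral_smooth_density[OF R] smooth_density_nonneg[OF R])
  have "(\<lambda>n. ennreal (\<integral>y. norm (smooth_density (Q n) y - smooth_density R y) \<partial>lborel)) \<longlonglongrightarrow> ennreal 0"
    using L1 iQ iR by (simp add: nn_integral_eq_integral)
  then have L1': "(\<lambda>n. \<integral>y. norm (smooth_density (Q n) y - smooth_density R y) \<partial>lborel) \<longlonglongrightarrow> 0"
    by (subst (asm) tendsto_ennreal_iff) auto
  show ?thesis
  proof (rule Lim_null_comparison)
    show "(\<lambda>n. K * (\<integral>y. norm (smooth_density (Q n) y - smooth_density R y) \<partial>lborel)) \<longlonglongrightarrow> 0"
      using tendsto_mult_right_zero[OF L1'] .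
    show "\<forall>\<^sub>F n in sequentially. norm ((\<integral>x. (\<integral>z. g n (x + z) \<partial>std_gaussian) \<partial>Q n) - (\<integral>x. (\<integral>z. g n (x + z) \<partial>std_gaussian) \<partial>R))
        \<le> K * (\<integral>y. norm (smooth_density (Q n) y - smooth_density R y) \<partial>lborel)"
    proof (intro always_eventually allI)
      fix n
      have ig: "integrable lborel (\<lambda>y. g n y * smooth_density M y)"
        if M: "integrable lborel (smooth_density M)" for M
        by (rule Bochner_Integration.integrable_bound[OF integrable_mult_right[OF M, of K]])
          (use borel_measurable_integrable[OF M] g(2) K0 in \<open>auto simp: abs_mult intro!: mult_right_mono\<close>)
      have "(\<integral>x. (\<integral>z. g n (x + z) \<partial>std_gaussian) \<partial>Q n) - (\<integral>x. (\<integral>z. g n (x + z) \<partial>std_gaussian) \<partial>R)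
          = (\<integral>y. g n y * (smooth_density (Q n) y - smooth_density R y) \<partial>lborel)"
        using ig[OF iQ[of n]] ig[OF iR]
        by (simp add: integral_smooth_density[OF Q g] integral_smooth_density[OF R g] right_diff_distrib)
      also have "norm \<dots> \<le> (\<integral>y. K * norm (smooth_density (Q n) y - smooth_density R y) \<partial>lborel)"
        by (rule norm_integral_le)
          (use iQ[of n] iR g(2) K0 in \<open>auto simp: abs_mult intro!: mult_right_mono\<close>)
      finally show "norm ((\<integral>x. (\<integral>z. g n (x + z) \<partial>std_gaussian) \<partial>Q n) - (\<integral>x. (\<integral>z. g n (x + z) \<partial>std_gaussian) \<partial>R))
        \<le> K * (\<integral>y. norm (smooth_density (Q n) y - smooth_density R y) \<partial>lborel)" by simp
    qed
  qed
qed

lemma (in prob_space) norm_tail: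
  fixes X :: "'a \<Rightarrow> 'b::real_normed_vector"
  assumes [measurable]: "(\<lambda>x. norm (X x)) \<in> borel_measurable M" and "0 < e"
  obtains r :: real where "0 < r" "prob {x \<in> space M. r \<le> norm (X x)} < e"
proof -
  have "(\<lambda>n. prob {x \<in> space M. real n \<le> norm (X x)}) \<longlonglongrightarrow> prob (\<Inter>n. {x \<in> space M. real n \<le> norm (X x)})"
    by (rule finite_Lim_measure_decseq) (auto simp: decseq_def)
  moreover have "(\<Inter>n. {x \<in> space M. real n \<le> norm (X x)}) = {}"
    using reals_Archimedean2 by (auto, meson not_le)
  ultimately have "(\<lambda>n. prob {x \<in> space M. real n \<le> norm (X x)}) \<longlonglongrightarrow> 0" by simp
  then have "\<forall>\<^sub>F n in sequentially. prob {x \<in> space M. real n \<le> norm (X x)} < e \<and> 0 < n"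
    using order_tendstoD(2)[OF _ \<open>0 < e\<close>] eventually_gt_at_top[of 0] eventually_conj by blast
  then obtain n where "prob {x \<in> space M. real n \<le> norm (X x)} < e" "0 < n"
    using eventually_happens'[OF sequentially_bot] by blast
  then show ?thesis using that[of "real n"] by simp
qed

text \<open>Noise of size less than \<open>\<delta>\<close> costs \<open>\<eta>\<close> by assumption, and larger noise is improbable.\<close>

lemma smoothing_error:
  fixes M :: "(real ^ 'p) measure" and g :: "real ^ 'p \<Rightarrow> real"
  assumes M: "prob_space M" "sets M = sets borel"
    and g: "g \<in> borel_measurable borel" "\<And>x. \<bar>g x\<bar> \<le> K"
    and shift: "\<And>v. norm v < \<delta> \<Longrightarrow> \<bar>(\<integral>x. g (x + v) \<partial>M) - (\<integral>x. g x \<partial>M)\<bar> \<le> \<eta>"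
    and "0 < \<delta>" "0 < \<sigma>" "0 \<le> \<eta>"
  shows "\<bar>(\<integral>x. (\<integral>z. g (x + \<sigma> *\<^sub>R z) \<partial>std_gaussian) \<partial>M) - (\<integral>x. g x \<partial>M)\<bar>
    \<le> \<eta> + 2 * K * measure std_gaussian {z :: real ^ 'p. \<delta> / \<sigma> \<le> norm z}"
proof -
  interpret M: prob_space M by fact
  interpret G: prob_space "std_gaussian :: (real ^ 'p) measure" by (rule prob_space_std_gaussian)
  interpret MG: pair_prob_space M "std_gaussian :: (real ^ 'p) measure" ..
  note [measurable] = g(1) and [measurable_cong] = M(2)
  have space_M: "space M = UNIV" "space (std_gaussian :: (real ^ 'p) measure) = UNIV"
    using sets_eq_imp_space_eq[OF M(2)] by (simp_all add: std_gaussian_def)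
  have ig: "integrable M (\<lambda>x. g (x + v))" for v
    by (rule M.integrable_const_bound[where B=K]) (auto simp: g(2))
  have K0: "0 \<le> K" using g(2)[of 0] by linarith
  have int: "integrable (M \<Otimes>\<^sub>M std_gaussian) (\<lambda>(x, z). g (x + \<sigma> *\<^sub>R z))"
    by (rule MG.integrable_const_bound[where B=K]) (auto simp: g(2))
  have m: "(\<lambda>z. \<integral>x. g (x + \<sigma> *\<^sub>R z) \<partial>M) \<in> borel_measurable (std_gaussian :: (real ^ 'p) measure)"
    by measurable
  have bd: "\<bar>\<integral>x. g (x + v) \<partial>M\<bar> \<le> K" for v
  proof -
    have "norm (\<integral>x. g (x + v) \<partial>M) \<le> (\<integral>x. K \<partial>M)" by (rule norm_integral_le) (auto simp: g(2))
    then show ?thesis by (simp add: M.prob_space)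
  qed
  have iz: "integrable std_gaussian (\<lambda>z. \<integral>x. g (x + \<sigma> *\<^sub>R z) \<partial>M)"
    by (rule G.integrable_const_bound[where B=K, OF _ m]) (auto simp: bd)
  have "(\<integral>x. (\<integral>z. g (x + \<sigma> *\<^sub>R z) \<partial>std_gaussian) \<partial>M) - (\<integral>x. g x \<partial>M)
      = (\<integral>z. (\<integral>x. g (x + \<sigma> *\<^sub>R z) \<partial>M) \<partial>std_gaussian) - (\<integral>z. (\<integral>x. g x \<partial>M) \<partial>(std_gaussian :: (real ^ 'p) measure))"
    by (simp add: MG.Fubini_integral[OF int] space_M G.prob_space[unfolded space_M])
  also have "\<dots> = (\<integral>z. (\<integral>x. g (x + \<sigma> *\<^sub>R z) \<partial>M) - (\<integral>x. g x \<partial>M) \<partial>std_gaussian)"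
    using iz by simp
  also have "norm \<dots> \<le> (\<integral>z. \<eta> + 2 * K * indicator {z :: real ^ 'p. \<delta> / \<sigma> \<le> norm z} z \<partial>std_gaussian)"
  proof (rule norm_integral_le)
    show "integrable std_gaussian (\<lambda>z. \<eta> + 2 * K * indicator {z :: real ^ 'p. \<delta> / \<sigma> \<le> norm z} z)"
      by (intro Bochner_Integration.integrable_add integrable_mult_right G.integrable_const
          G.integrable_const_bound[where B=1]) (auto simp: indicator_def)
    fix z :: "real ^ 'p"
    show "norm ((\<integral>x. g (x + \<sigma> *\<^sub>R z) \<partial>M) - (\<integral>x. g x \<partial>M)) \<le> \<eta> + 2 * K * indicator {z. \<delta> / \<sigma> \<le> norm z} z"
    proof (cases "\<delta> / \<sigma> \<le> norm z")
      case True
      then show ?thesis using bd[of "\<sigma> *\<^sub>R z"] bd[of 0] \<open>0 \<le> \<eta>\<close> by simp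
    next
      case False
      then have "norm (\<sigma> *\<^sub>R z) < \<delta>" using \<open>0 < \<sigma>\<close> by (simp add: field_simps)
      then show ?thesis using shift[of "\<sigma> *\<^sub>R z"] False by simp
    qed
  qed
  also have "\<dots> = \<eta> + 2 * K * measure std_gaussian {z :: real ^ 'p. \<delta> / \<sigma> \<le> norm z}"
    using G.prob_space by (subst Bochner_Integration.integral_add)
      (auto simp: space_M less_top[symmetric] G.emeasure_finite intro!: integrable_mult_right)
  finally show ?thesis by simp
qed

text \<open>Noise of standard deviation \<open>\<sigma>\<close> reduces to standard noise by rescaling both laws with \<open>1 / \<sigma>\<close>. It is
  chosen so small that it changes neither integral by more than a multiple of \<open>\<eta>\<close>.\<close>

lemma limit_of_shift_continuous:
  fixes Q :: "nat \<Rightarrow> (real ^ 'p) measure" and R :: "(real ^ 'p) measure"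
  assumes Q: "\<And>n. prob_space (Q n)" "\<And>n. sets (Q n) = sets borel"
    and R: "prob_space R" "sets R = sets borel"
    and char: "\<And>t. (\<lambda>n. \<integral>x. exp (\<i> * of_real (t \<bullet> x)) \<partial>Q n) \<longlonglongrightarrow> (\<integral>x. exp (\<i> * of_real (t \<bullet> x)) \<partial>R)"
    and g: "\<And>n. g n \<in> borel_measurable borel" "\<And>n x. \<bar>g n x :: real\<bar> \<le> K"
    and shift: "\<And>\<eta>. 0 < \<eta> \<Longrightarrow> \<exists>\<delta>>0. \<forall>\<^sub>F n in sequentially. \<forall>v. norm v < \<delta> \<longrightarrow>
      \<bar>(\<integral>x. g n (x + v) \<partial>Q n) - (\<integral>x. g n x \<partial>Q n)\<bar> \<le> \<eta> \<and>
      \<bar>(\<integral>x. g n (x + v) \<partial>R) - (\<integral>x. g n x \<partial>R)\<bar> \<le> \<eta>"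
  shows "(\<lambda>n. (\<integral>x. g n x \<partial>Q n) - (\<integral>x. g n x \<partial>R)) \<longlonglongrightarrow> 0"
proof (rule tendstoI)
  fix e :: real assume "0 < e"
  define \<eta> where "\<eta> = e / 6"
  have \<eta>: "0 < \<eta>" using \<open>0 < e\<close> by (simp add: \<eta>_def)
  have K0: "0 \<le> K" using g(2)[of 0 0] by linarith
  note [measurable] = g(1)
  note [measurable_cong] = Q(2) R(2)
  interpret G: prob_space "std_gaussian :: (real ^ 'p) measure" by (rule prob_space_std_gaussian)
  obtain \<delta> where \<delta>: "0 < \<delta>" and ev: "\<forall>\<^sub>F n in sequentially. \<forall>v. norm v < \<delta> \<longrightarrow>
      \<bar>(\<integral>x. g n (x + v) \<partial>Q n) - (\<integral>x. g n x \<partial>Q n)\<bar> \<le> \<eta> \<and>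
      \<bar>(\<integral>x. g n (x + v) \<partial>R) - (\<integral>x. g n x \<partial>R)\<bar> \<le> \<eta>"
    using shift[OF \<eta>] by blast
  obtain r where r: "0 < r" "measure std_gaussian {z :: real ^ 'p. r \<le> norm z} < \<eta> / (2 * K + 1)"
    using G.norm_tail[of "\<lambda>z. z" "\<eta> / (2 * K + 1)"] \<eta> K0
    by (auto simp: std_gaussian_def)
  define \<sigma> where "\<sigma> = \<delta> / r"
  have \<sigma>: "0 < \<sigma>" "\<delta> / \<sigma> = r" using \<delta> r by (simp_all add: \<sigma>_def)
  have "2 * K * measure std_gaussian {z :: real ^ 'p. r \<le> norm z} \<le> 2 * K * (\<eta> / (2 * K + 1))"
    using r K0 by (intro mult_left_mono) auto
  also have "\<dots> \<le> \<eta>" using K0 \<eta> by (simp add: field_simps)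
  finally have tail: "2 * K * measure std_gaussian {z :: real ^ 'p. \<delta> / \<sigma> \<le> norm z} \<le> \<eta>"
    by (simp add: \<sigma>)
  let ?s = "\<lambda>M. distr M borel (\<lambda>x :: real ^ 'p. (1 / \<sigma>) *\<^sub>R x)"
  have lim: "(\<lambda>n. (\<integral>x. (\<integral>z. g n (\<sigma> *\<^sub>R (x + z)) \<partial>std_gaussian) \<partial>?s (Q n)) -
      (\<integral>x. (\<integral>z. g n (\<sigma> *\<^sub>R (x + z)) \<partial>std_gaussian) \<partial>?s R)) \<longlonglongrightarrow> 0"
  proof (rule smoothed_tv_limit[where K=K])
    show "prob_space (?s (Q n))" for n by (rule prob_space.prob_space_distr[OF Q(1)]) measurable
    show "prob_space (?s R)" by (rule prob_space.prob_space_distr[OF R(1)]) measurable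
    show "(\<lambda>n. \<integral>x. exp (\<i> * complex_of_real (t \<bullet> x)) \<partial>?s (Q n)) \<longlonglongrightarrow> (\<integral>x. exp (\<i> * complex_of_real (t \<bullet> x)) \<partial>?s R)" for t
      using char[of "(1 / \<sigma>) *\<^sub>R t"] by (simp add: integral_distr)
  qed (use g(2) in \<open>simp_all add: g(1)\<close>)
  have unscale: "(\<integral>x. (\<integral>z. g n (\<sigma> *\<^sub>R (x + z)) \<partial>std_gaussian) \<partial>?s M) = (\<integral>x. (\<integral>z. g n (x + \<sigma> *\<^sub>R z) \<partial>std_gaussian) \<partial>M)"
    if [measurable_cong]: "sets M = sets borel" for M n
    using \<sigma> by (subst integral_distr) (simp_all add: scaleR_add_right)
  have "\<forall>\<^sub>F n in sequentially. \<bar>(\<integral>x. (\<integral>z. g n (x + \<sigma> *\<^sub>R z) \<partial>std_gaussian) \<partial>Q n) -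
      (\<integral>x. (\<integral>z. g n (x + \<sigma> *\<^sub>R z) \<partial>std_gaussian) \<partial>R)\<bar> < \<eta>"
    using tendstoD[OF lim \<eta>] by (simp add: unscale Q R)
  with ev show "\<forall>\<^sub>F n in sequentially. dist ((\<integral>x. g n x \<partial>Q n) - (\<integral>x. g n x \<partial>R)) 0 < e"
  proof eventually_elim
    case (elim n)
    have "\<bar>(\<integral>x. (\<integral>z. g n (x + \<sigma> *\<^sub>R z) \<partial>std_gaussian) \<partial>Q n) - (\<integral>x. g n x \<partial>Q n)\<bar> \<le> \<eta> + \<eta>"
      by (rule order_trans[OF smoothing_error[OF Q g, where \<delta>=\<delta> and \<eta>=\<eta> and \<sigma>=\<sigma>]]) (use elim tail \<delta> \<sigma> \<eta> in auto)
    moreover have "\<bar>(\<integral>x. (\<integral>z. g n (x + \<sigma> *\<^sub>R z) \<partial>std_gaussian) \<partial>R) - (\<integral>x. g n x \<partial>R)\<bar> \<le> \<eta> + \<eta>"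
      by (rule order_trans[OF smoothing_error[OF R g, where \<delta>=\<delta> and \<eta>=\<eta> and \<sigma>=\<sigma>]]) (use elim tail \<delta> \<sigma> \<eta> in auto)
    ultimately show ?case using elim unfolding \<eta>_def dist_real_def by linarith
  qed
qed

section \<open>Shifts of sums with an absolutely continuous component\<close>

text \<open>The absolutely continuous part has positive mass, so its density exceeds some \<open>1 / Suc n\<close> on a
  bounded set of positive measure.\<close>

lemma ac_component_minorant:
  fixes q :: "(real ^ 'p) measure"
  assumes q: "prob_space q" and sets_q: "sets q = sets borel" and ac: "has_ac_component q"
  obtains \<epsilon> :: real and A where "0 < \<epsilon>" "A \<in> sets borel" "bounded A" "0 < emeasure lborel A"
    "\<forall>B\<in>sets borel. ennreal \<epsilon> * emeasure lborel (A \<inter> B) \<le> emeasure q B"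
proof -
  interpret q: prob_space q by fact
  obtain C S where C: "sets C = sets borel" and S: "sets S = sets borel"
    and dec: "\<And>B. B \<in> sets borel \<Longrightarrow> emeasure q B = emeasure C B + emeasure S B"
    and acC: "absolutely_continuous lborel C" and Slt: "emeasure S UNIV < 1"
    using ac unfolding has_ac_component_def by blast
  obtain f where f[measurable]: "f \<in> borel_measurable lborel" and Cf: "density lborel f = C"
    using sigma_finite_measure.Radon_Nikodym[OF sigma_finite_lborel acC] C by auto
  define A where "A n = {x :: real ^ 'p. x \<in> ball 0 (real n) \<and> ennreal (1 / real (Suc n)) \<le> f x}" for n
  have A[measurable]: "A n \<in> sets borel" for n unfolding A_def by measurable
  have "\<exists>n. emeasure lborel (A n) > 0"
  proof (rule ccontr)
    assume "\<not> (\<exists>n. emeasure lborel (A n) > 0)"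
    then have "A n \<in> null_sets lborel" for n by (auto simp: null_sets_def)
    then have "(\<Union>n. A n) \<in> null_sets lborel" by (intro null_sets_UN) auto
    moreover have "{x. f x \<noteq> 0} \<subseteq> (\<Union>n. A n)"
    proof
      fix x assume "x \<in> {x. f x \<noteq> 0}"
      then have "0 < f x" by (simp add: zero_less_iff_neq_zero)
      then obtain r where r: "0 < r" "ennreal r \<le> f x" 
        by (metis dense ennreal_cases ennreal_less_zero_iff less_imp_le less_top_ennreal top_greatest not_le order.strict_trans2)
      obtain n1 where n1: "1 / real (Suc n1) < r" using r(1) nat_approx_posE by metis
      obtain n2 where n2: "norm x < real n2" using reals_Archimedean2 by blast
      have "1 / real (Suc (max n1 n2)) \<le> 1 / real (Suc n1)" by (intro divide_left_mono) auto
      then have "ennreal (1 / real (Suc (max n1 n2))) \<le> f x"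
        using n1 r(2) by (meson ennreal_leI less_imp_le order_trans)
      then have "x \<in> A (max n1 n2)" using n2 by (simp add: A_def)
      then show "x \<in> (\<Union>n. A n)" by blast
    qed
    ultimately have "AE x in lborel. f x = 0" by (auto intro!: AE_I')
    then have "emeasure C UNIV = 0"
      by (simp add: Cf[symmetric] emeasure_density nn_integral_0_iff_AE)
    then have "emeasure q UNIV < 1" using dec[of UNIV] Slt by simp
    then show False using q.emeasure_space_1 sets_eq_imp_space_eq[OF sets_q] by simp
  qed
  then obtain n where n: "emeasure lborel (A n) > 0" by blast
  show ?thesis
  proof (rule that[of "1 / real (Suc n)" "A n"], safe)
    show "bounded (A n)" by (rule bounded_subset[OF bounded_ball[of 0 "real n"]]) (auto simp: A_def)
    fix B :: "(real ^ 'p) set" assume B[measurable]: "B \<in> sets borel"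
    have "ennreal (1 / real (Suc n)) * emeasure lborel (A n \<inter> B)
        = (\<integral>\<^sup>+x. ennreal (1 / real (Suc n)) * indicator (A n \<inter> B) x \<partial>lborel)"
      by (rule nn_integral_cmult_indicator[symmetric]) simp
    also have "\<dots> \<le> (\<integral>\<^sup>+x. f x * indicator B x \<partial>lborel)"
      by (intro nn_integral_mono) (auto simp: A_def indicator_def)
    also have "\<dots> = emeasure C B" by (simp add: Cf[symmetric] emeasure_density)
    also have "\<dots> \<le> emeasure q B" using dec[OF B] by simp
    finally show "ennreal (1 / real (Suc n)) * emeasure lborel (A n \<inter> B) \<le> emeasure q B" .
  qed (use n in auto)
qed

lemma lborel_translate_emeasure:
  fixes A :: "'a::euclidean_space set"
  assumes [measurable]: "A \<in> sets borel"
  shows "emeasure lborel ((\<lambda>x. x - w) -` A) = emeasure lborel A"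
proof -
  have "emeasure lborel A = emeasure (distr lborel borel ((+) (- w))) A" by (simp only: lborel_distr_plus)
  also have "\<dots> = emeasure lborel ((+) (- w) -` A)" by (subst emeasure_distr) auto
  also have "(+) (- w) -` A = (\<lambda>x. x - w) -` A" by auto
  finally show ?thesis ..
qed

text \<open>A variant of Steinhaus' theorem: the convolution of \<open>1\<^sub>A\<close> with itself, \<open>x \<mapsto> \<bar>A \<inter> (x - A)\<bar>\<close>, is bounded
  below on a ball. Its integral is \<open>\<bar>A\<bar>\<^sup>2\<close>, so it is positive at some \<open>x0\<close>. Choose a compact subset \<open>T\<close> of
  \<open>A \<inter> (x0 - A)\<close> and an open superset \<open>U\<close> of \<open>T\<close> with little more volume. Then \<open>T + w\<close> stays inside \<open>U\<close> for
  small \<open>w\<close>, hence overlaps with \<open>T\<close> substantially, and \<open>T \<inter> (T + w) \<subseteq> A \<inter> (x0 + w - A)\<close>.\<close>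

lemma self_convolution_lower_bound:
  fixes A :: "'a::euclidean_space set"
  assumes A[measurable]: "A \<in> sets borel" and "bounded A" and pos: "0 < emeasure lborel A"
  obtains x0 r \<kappa> where "0 < r" "0 < (\<kappa> :: real)"
    "\<forall>x\<in>ball x0 r. ennreal \<kappa> \<le> emeasure lborel (A \<inter> {y. x - y \<in> A})"
proof -
  have "(\<integral>\<^sup>+x. emeasure lborel (A \<inter> {y. x - y \<in> A}) \<partial>lborel)
      = (\<integral>\<^sup>+x. \<integral>\<^sup>+y. indicator A y * indicator A (x - y) \<partial>lborel \<partial>lborel)"
  proof (rule nn_integral_cong)
    fix x
    have "emeasure lborel (A \<inter> {y. x - y \<in> A}) = (\<integral>\<^sup>+y. indicator (A \<inter> {y. x - y \<in> A}) y \<partial>lborel)"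
      by (rule nn_integral_indicator[symmetric]) measurable
    also have "\<dots> = (\<integral>\<^sup>+y. indicator A y * indicator A (x - y) \<partial>lborel)"
      by (intro nn_integral_cong) (auto simp: indicator_def)
    finally show "emeasure lborel (A \<inter> {y. x - y \<in> A}) = (\<integral>\<^sup>+y. indicator A y * indicator A (x - y) \<partial>lborel)" .
  qed
  also have "\<dots> = (\<integral>\<^sup>+y. \<integral>\<^sup>+x. indicator A y * indicator A (x - y) \<partial>lborel \<partial>lborel)"
    by (rule lborel_pair.Fubini'[symmetric]) measurable
  also have "\<dots> = (\<integral>\<^sup>+y. indicator A y * emeasure lborel A \<partial>lborel)"
  proof (rule nn_integral_cong)
    fix y
    have "(\<integral>\<^sup>+x. indicator A (x - y) \<partial>lborel) = (\<integral>\<^sup>+x. indicator ((\<lambda>x. x - y) -` A) x \<partial>lborel)"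
      by (intro nn_integral_cong) (auto simp: indicator_def)
    also have "\<dots> = emeasure lborel ((\<lambda>x. x - y) -` A)"
      by (rule nn_integral_indicator) (use measurable_sets[of "\<lambda>x. x - y" borel borel A] in simp)
    finally show "(\<integral>\<^sup>+x. indicator A y * indicator A (x - y) \<partial>lborel) = indicator A y * emeasure lborel A"
      by (simp add: nn_integral_cmult lborel_translate_emeasure)
  qed
  also have "\<dots> = emeasure lborel A * emeasure lborel A"
    by (simp add: nn_integral_multc)
  finally have "(\<integral>\<^sup>+x. emeasure lborel (A \<inter> {y. x - y \<in> A}) \<partial>lborel) > 0"
    using pos by (simp add: ennreal_zero_less_mult_iff)
  then obtain x0 where x0: "emeasure lborel (A \<inter> {y. x0 - y \<in> A}) > 0"
    by (metis (no_types, lifting) ext nn_integral_0_iff_AE nn_integral_cong nn_integral_const mult_zero_left not_gr_zero)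
  define S where "S = A \<inter> {y. x0 - y \<in> A}"
  have S[measurable]: "S \<in> sets borel" unfolding S_def by measurable
  have Spos: "emeasure lborel S > 0" using x0 by (simp add: S_def)
  obtain s where s: "0 < s" "ennreal s < emeasure lborel S"
    using Spos by (metis dense ennreal_cases ennreal_less_zero_iff less_top_ennreal order_less_imp_not_less top.extremum_strict top.not_eq_extremum)
  obtain T where T: "closed T" "T \<subseteq> S" "emeasure lebesgue (S - T) < ennreal s"
    using sets_lebesgue_inner_closed[of S s] s S by (metis lborelD sets_completionI_sets)
  have "bounded T" using \<open>bounded A\<close> T(2) bounded_subset unfolding S_def by blast
  then have cT: "compact T" using T(1) by (simp add: compact_eq_bounded_closed)
  then have Tm[measurable]: "T \<in> sets borel" by (simp add: borel_compact)
  have Tpos: "emeasure lborel T > 0"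
  proof (rule ccontr)
    assume "\<not> emeasure lborel T > 0"
    then have T0: "emeasure lborel T = 0" by simp
    have "S = T \<union> (S - T)" using T(2) by blast
    then have "emeasure lborel S \<le> emeasure lborel T + emeasure lborel (S - T)"
      using emeasure_subadditive[of T lborel "S - T"] by simp
    also have "\<dots> < ennreal s" using T(3) T0 by (simp add: emeasure_completion)
    finally show False using s(2) by simp
  qed
  have Tfin: "emeasure lborel T < \<infinity>" by (rule emeasure_compact_finite[OF cT])
  define k where "k = measure lborel T"
  have k: "emeasure lborel T = ennreal k" "0 < k"
  proof -
    show 1: "emeasure lborel T = ennreal k"
      unfolding k_def using Tfin by (intro emeasure_eq_ennreal_measure) auto
    show "0 < k" using Tpos unfolding 1 by simp
  qed
  obtain U where U: "open U" "T \<subseteq> U" "emeasure lborel (U - T) < ennreal (k / 2)"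
    using outer_regular_lborel[OF Tm, of "k / 2"] k(2) by auto
  have Um[measurable]: "U \<in> sets borel" using U(1) by simp
  obtain \<delta> where \<delta>: "\<delta> > 0" "(\<Union>x\<in>T. ball x \<delta>) \<subseteq> U"
    using compact_subset_open_imp_ball_epsilon_subset[OF cT U(1,2)] by blast
  show ?thesis
  proof (rule that[of \<delta> "k / 2" x0], safe)
    show "0 < \<delta>" "0 < k / 2" using \<delta> k by auto
    fix x assume x: "x \<in> ball x0 \<delta>"
    define w where "w = x - x0"
    define Tw where "Tw = (\<lambda>y. y - w) -` T"
    have Twm[measurable]: "Tw \<in> sets borel"
      unfolding Tw_def using measurable_sets[of "\<lambda>y. y - w" borel borel T] by simp
    have Tw: "emeasure lborel Tw = ennreal k" unfolding Tw_def using lborel_translate_emeasure[OF Tm] k by simp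
    have "Tw \<subseteq> U"
    proof
      fix y assume "y \<in> Tw"
      then have "y - w \<in> T" by (simp add: Tw_def)
      moreover have "y \<in> ball (y - w) \<delta>" using x by (simp add: w_def dist_norm norm_minus_commute)
      ultimately show "y \<in> U" using \<delta>(2) by blast
    qed
    have mU: "emeasure lborel U = ennreal k + emeasure lborel (U - T)"
      using U(2) k(1) plus_emeasure[of T lborel "U - T"] by (simp add: Un_absorb1)
    have "emeasure lborel (U - Tw) = emeasure lborel U - ennreal k"
      using emeasure_Diff[of lborel Tw U] \<open>Tw \<subseteq> U\<close> Tw by simp
    also have "\<dots> = emeasure lborel (U - T)" unfolding mU by (simp add: ennreal_add_diff_cancel_left)
    finally have "emeasure lborel (T - Tw) < ennreal (k / 2)"
      using emeasure_mono[of "T - Tw" "U - Tw" lborel] U by (auto intro: le_less_trans)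
    moreover have "T \<inter> Tw \<inter> (T - Tw) = {}" by blast
    then have "ennreal k = emeasure lborel (T \<inter> Tw) + emeasure lborel (T - Tw)"
      using plus_emeasure[of "T \<inter> Tw" lborel "T - Tw"] k(1) by (simp add: Int_Diff_Un)
    ultimately have "ennreal k \<le> emeasure lborel (T \<inter> Tw) + ennreal (k / 2)"
      by (metis add_left_mono less_imp_le)
    moreover have "ennreal k = ennreal (k / 2) + ennreal (k / 2)" using k by (simp flip: ennreal_plus)
    ultimately have "ennreal (k / 2) + ennreal (k / 2) \<le> ennreal (k / 2) + emeasure lborel (T \<inter> Tw)"
      by (simp add: add.commute)
    then have "ennreal (k / 2) \<le> emeasure lborel (T \<inter> Tw)"
      by (simp only: ennreal_add_left_cancel_le) auto
    also have "\<dots> \<le> emeasure lborel (A \<inter> {y. x - y \<in> A})"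
    proof (rule emeasure_mono)
      show "T \<inter> Tw \<subseteq> A \<inter> {y. x - y \<in> A}"
      proof
        fix y assume y: "y \<in> T \<inter> Tw"
        then have "y \<in> A" using T(2) by (auto simp: S_def)
        moreover have "y - w \<in> S" using y T(2) by (auto simp: Tw_def)
        then have "x0 - (y - w) \<in> A" by (simp add: S_def)
        then have "x - y \<in> A" by (simp add: w_def algebra_simps)
        ultimately show "y \<in> A \<inter> {y. x - y \<in> A}" by simp
      qed
      show "A \<inter> {y. x - y \<in> A} \<in> sets lborel" by measurable
    qed
    finally show "ennreal (k / 2) \<le> emeasure lborel (A \<inter> {y. x - y \<in> A})" .
  qed
qed

text \<open>Two summands are taken because the density of a single one may be positive only on a set without
  interior, while the self-convolution of its density is bounded below on a ball.\<close>

lemma convolution_square_minorant: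
  fixes q :: "(real ^ 'p) measure"
  assumes q: "prob_space q" and sets_q[measurable_cong]: "sets q = sets borel" and ac: "has_ac_component q"
  obtains x0 r \<kappa> where "0 < r" "0 < (\<kappa> :: real)"
    "\<forall>G\<in>borel_measurable borel.
      (\<integral>\<^sup>+x. ennreal \<kappa> * indicator (ball x0 r) x * G x \<partial>lborel) \<le> (\<integral>\<^sup>+y. \<integral>\<^sup>+z. G (y + z) \<partial>q \<partial>q)"
proof -
  from ac_component_minorant[OF assms]
  obtain \<epsilon> A where e: "0 < \<epsilon>" and A[measurable]: "A \<in> sets borel" and bA: "bounded A" and pA: "0 < emeasure lborel A"
    and qA: "\<forall>B\<in>sets borel. ennreal \<epsilon> * emeasure lborel (A \<inter> B) \<le> emeasure q B" .
  from self_convolution_lower_bound[OF A bA pA]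
  obtain x0 r \<kappa> where r: "0 < r" and \<kappa>: "0 < (\<kappa> :: real)"
    and low: "\<forall>x\<in>ball x0 r. ennreal \<kappa> \<le> emeasure lborel (A \<inter> {y. x - y \<in> A})" .
  interpret q: prob_space q by fact
  have nn: "(\<integral>\<^sup>+x. ennreal \<epsilon> * indicator A x * H x \<partial>lborel) \<le> (\<integral>\<^sup>+x. H x \<partial>q)"
    if [measurable]: "H \<in> borel_measurable borel" for H
  proof -
    have "(\<integral>\<^sup>+x. ennreal \<epsilon> * indicator A x * H x \<partial>lborel) = (\<integral>\<^sup>+x. H x \<partial>density lborel (\<lambda>x. ennreal \<epsilon> * indicator A x))"
      by (subst nn_integral_density) auto
    also have "\<dots> \<le> (\<integral>\<^sup>+x. H x \<partial>q)"
    proof (rule nn_integral_mono_measure)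
      show s: "sets (density lborel (\<lambda>x. ennreal \<epsilon> * indicator A x)) = sets q" by (simp add: sets_q)
      have "emeasure (density lborel (\<lambda>x. ennreal \<epsilon> * indicator A x)) B \<le> emeasure q B" if "B \<in> sets q" for B
      proof -
        have [measurable]: "B \<in> sets borel" using that sets_q by simp
        have "emeasure (density lborel (\<lambda>x. ennreal \<epsilon> * indicator A x)) B
            = (\<integral>\<^sup>+x. ennreal \<epsilon> * indicator (A \<inter> B) x \<partial>lborel)"
          by (subst emeasure_density) (auto intro!: nn_integral_cong simp: indicator_def)
        also have "\<dots> = ennreal \<epsilon> * emeasure lborel (A \<inter> B)"
          by (rule nn_integral_cmult_indicator) simp
        finally show ?thesis using qA by simp
      qed
      then show "density lborel (\<lambda>x. ennreal \<epsilon> * indicator A x) \<le> q"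
        using s by (subst le_measure) (auto simp: le_fun_def emeasure_notin_sets)
    qed
    finally show ?thesis .
  qed
  show ?thesis
  proof (rule that[of r "\<epsilon> * \<epsilon> * \<kappa>" x0], safe)
    show "0 < r" "0 < \<epsilon> * \<epsilon> * \<kappa>" using r e \<kappa> by auto
    fix G :: "real ^ 'p \<Rightarrow> ennreal" assume [measurable]: "G \<in> borel_measurable borel"
    have "(\<integral>\<^sup>+x. ennreal (\<epsilon> * \<epsilon> * \<kappa>) * indicator (ball x0 r) x * G x \<partial>lborel)
        \<le> (\<integral>\<^sup>+x. ennreal \<epsilon> * ennreal \<epsilon> * (emeasure lborel (A \<inter> {y. x - y \<in> A}) * G x) \<partial>lborel)"
      using low e \<kappa> by (intro nn_integral_mono)
        (auto simp: indicator_def ennreal_mult' mult.assoc intro!: mult_left_mono mult_right_mono)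
    also have "\<dots> = (\<integral>\<^sup>+x. \<integral>\<^sup>+y. ennreal \<epsilon> * indicator A y * (ennreal \<epsilon> * indicator A (x - y) * G x) \<partial>lborel \<partial>lborel)"
    proof (rule nn_integral_cong)
      fix x
      have "emeasure lborel (A \<inter> {y. x - y \<in> A}) = (\<integral>\<^sup>+y. indicator (A \<inter> {y. x - y \<in> A}) y \<partial>lborel)"
        by (rule nn_integral_indicator[symmetric]) measurable
      then have "ennreal \<epsilon> * ennreal \<epsilon> * (emeasure lborel (A \<inter> {y. x - y \<in> A}) * G x)
          = (\<integral>\<^sup>+y. (ennreal \<epsilon> * ennreal \<epsilon> * G x) * indicator (A \<inter> {y. x - y \<in> A}) y \<partial>lborel)"
        by (subst nn_integral_cmult) (simp_all add: mult_ac)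
      also have "\<dots> = (\<integral>\<^sup>+y. ennreal \<epsilon> * indicator A y * (ennreal \<epsilon> * indicator A (x - y) * G x) \<partial>lborel)"
        by (intro nn_integral_cong) (auto simp: indicator_def mult_ac)
      finally show "ennreal \<epsilon> * ennreal \<epsilon> * (emeasure lborel (A \<inter> {y. x - y \<in> A}) * G x)
        = (\<integral>\<^sup>+y. ennreal \<epsilon> * indicator A y * (ennreal \<epsilon> * indicator A (x - y) * G x) \<partial>lborel)" .
    qed
    also have "\<dots> = (\<integral>\<^sup>+y. \<integral>\<^sup>+x. ennreal \<epsilon> * indicator A y * (ennreal \<epsilon> * indicator A (x - y) * G x) \<partial>lborel \<partial>lborel)"
      by (rule lborel_pair.Fubini'[symmetric]) measurable
    also have "\<dots> = (\<integral>\<^sup>+y. ennreal \<epsilon> * indicator A y * (\<integral>\<^sup>+z. ennreal \<epsilon> * indicator A z * G (y + z) \<partial>lborel) \<partial>lborel)"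
    proof (rule nn_integral_cong)
      fix y
      have "(\<integral>\<^sup>+x. ennreal \<epsilon> * indicator A (x - y) * G x \<partial>lborel) = (\<integral>\<^sup>+x. ennreal \<epsilon> * indicator A (x - y) * G x \<partial>distr lborel borel ((+) y))"
        by (simp only: lborel_distr_plus)
      also have "\<dots> = (\<integral>\<^sup>+z. ennreal \<epsilon> * indicator A z * G (y + z) \<partial>lborel)"
        by (subst nn_integral_distr) auto
      finally show "(\<integral>\<^sup>+x. ennreal \<epsilon> * indicator A y * (ennreal \<epsilon> * indicator A (x - y) * G x) \<partial>lborel)
          = ennreal \<epsilon> * indicator A y * (\<integral>\<^sup>+z. ennreal \<epsilon> * indicator A z * G (y + z) \<partial>lborel)"
        by (simp add: nn_integral_cmult)
    qed
    also have "\<dots> \<le> (\<integral>\<^sup>+y. ennreal \<epsilon> * indicator A y * (\<integral>\<^sup>+z. G (y + z) \<partial>q) \<partial>lborel)"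
      by (intro nn_integral_mono mult_left_mono nn) auto
    also have "\<dots> \<le> (\<integral>\<^sup>+y. \<integral>\<^sup>+z. G (y + z) \<partial>q \<partial>q)"
      by (rule nn) measurable
    finally show "(\<integral>\<^sup>+x. ennreal (\<epsilon> * \<epsilon> * \<kappa>) * indicator (ball x0 r) x * G x \<partial>lborel) \<le> (\<integral>\<^sup>+y. \<integral>\<^sup>+z. G (y + z) \<partial>q \<partial>q)" .
  qed
qed

text \<open>Boundedness is stated pointwise because the estimates below keep track of the bound \<open>K\<close>.\<close>

definition bfun :: "real \<Rightarrow> (real ^ 'p \<Rightarrow> real) \<Rightarrow> bool" where
  "bfun K g \<longleftrightarrow> g \<in> borel_measurable borel \<and> (\<forall>x. \<bar>g x\<bar> \<le> K)"

text \<open>The operator \<open>g \<mapsto> E[g(\<cdot> + Y)]\<close> with \<open>Y\<close> distributed as \<open>M\<close>. Its powers describe sums of independent copies of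
  \<open>Y\<close> (\<open>integral_sum_PiM\<close>), and operators allow subtracting a component of \<open>M\<close> without naming the remaining
  measure.\<close>

definition conv_op :: "(real ^ 'p) measure \<Rightarrow> (real ^ 'p \<Rightarrow> real) \<Rightarrow> real ^ 'p \<Rightarrow> real" where
  "conv_op M g x = (\<integral>y. g (x + y) \<partial>M)"

definition borel_prob :: "(real ^ 'p) measure \<Rightarrow> bool" where
  "borel_prob M \<longleftrightarrow> prob_space M \<and> sets M = sets borel"

lemma bfun_nonneg: "bfun K g \<Longrightarrow> 0 \<le> K"
  unfolding bfun_def by (meson abs_ge_zero order_trans)

lemma borel_prob_integrable:
  assumes "borel_prob M" "bfun K g"
  shows "integrable M (\<lambda>y. g (x + y))"
proof -
  interpret M: prob_space M using assms by (simp add: borel_prob_def)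
  have [measurable_cong]: "sets M = sets borel" and [measurable]: "g \<in> borel_measurable borel"
    using assms by (simp_all add: borel_prob_def bfun_def)
  show ?thesis by (rule M.integrable_const_bound[where B=K]) (use assms in \<open>auto simp: bfun_def\<close>)
qed

lemma conv_op_bfun:
  assumes "borel_prob M" "bfun K g"
  shows "bfun K (conv_op M g)"
proof -
  interpret M: prob_space M using assms by (simp add: borel_prob_def)
  have [measurable_cong]: "sets M = sets borel" and [measurable]: "g \<in> borel_measurable borel"
    using assms by (simp_all add: borel_prob_def bfun_def)
  have "\<bar>conv_op M g x\<bar> \<le> K" for x
  proof -
    have "norm (\<integral>y. g (x + y) \<partial>M) \<le> (\<integral>y. K \<partial>M)"
      by (rule norm_integral_le) (use assms in \<open>auto simp: bfun_def\<close>)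
    then show ?thesis by (simp add: conv_op_def M.prob_space)
  qed
  moreover have "conv_op M g \<in> borel_measurable borel" unfolding conv_op_def[abs_def] by measurable
  ultimately show ?thesis unfolding bfun_def by blast
qed

lemma conv_op_linear:
  assumes "borel_prob M" "bfun K f" "bfun L h"
  shows "conv_op M (\<lambda>x. a * f x + b * h x) = (\<lambda>x. a * conv_op M f x + b * conv_op M h x)"
  using borel_prob_integrable[OF assms(1,2)] borel_prob_integrable[OF assms(1,3)]
  by (simp add: conv_op_def fun_eq_iff)

lemma conv_op_commute:
  assumes M: "borel_prob M" and N: "borel_prob N" and g: "bfun K g"
  shows "conv_op M (conv_op N g) = conv_op N (conv_op M g)"
proof
  fix x
  interpret M: prob_space M using M by (simp add: borel_prob_def)
  interpret N: prob_space N using N by (simp add: borel_prob_def)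
  interpret MN: pair_prob_space M N ..
  have [measurable_cong]: "sets M = sets borel" "sets N = sets borel" and [measurable]: "g \<in> borel_measurable borel"
    using assms by (simp_all add: borel_prob_def bfun_def)
  have int: "integrable (M \<Otimes>\<^sub>M N) (\<lambda>(y, z). g (x + y + z))"
    by (rule MN.integrable_const_bound[where B=K]) (use g in \<open>auto simp: bfun_def\<close>)
  show "conv_op M (conv_op N g) x = conv_op N (conv_op M g) x"
    using MN.Fubini_integral[OF int] by (simp add: conv_op_def add_ac)
qed

lemma bfun_linear:
  assumes "bfun K f" "bfun L h"
  shows "bfun (\<bar>a\<bar> * K + \<bar>b\<bar> * L) (\<lambda>x. a * f x + b * h x)"
proof -
  have [measurable]: "f \<in> borel_measurable borel" "h \<in> borel_measurable borel"
    using assms by (simp_all add: bfun_def)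
  have "\<bar>a * f x + b * h x\<bar> \<le> \<bar>a\<bar> * K + \<bar>b\<bar> * L" for x
    using assms by (intro order_trans[OF abs_triangle_ineq] add_mono)
      (auto simp: bfun_def abs_mult intro!: mult_left_mono)
  then show ?thesis by (simp add: bfun_def)
qed

lemma conv_op_pow_bfun: "borel_prob M \<Longrightarrow> bfun K g \<Longrightarrow> bfun K ((conv_op M ^^ n) g)"
  by (induction n) (auto intro: conv_op_bfun)

lemma conv_op_pow_linear:
  assumes "borel_prob M" "bfun K f" "bfun L h"
  shows "(conv_op M ^^ n) (\<lambda>x. a * f x + b * h x) = (\<lambda>x. a * (conv_op M ^^ n) f x + b * (conv_op M ^^ n) h x)"
  by (induction n)
    (auto simp: conv_op_linear[OF assms(1) conv_op_pow_bfun[OF assms(1,2)] conv_op_pow_bfun[OF assms(1,3)]])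

lemma conv_op_shift: "conv_op M (\<lambda>x. g (x + w)) = (\<lambda>x. conv_op M g (x + w))"
  by (simp add: conv_op_def fun_eq_iff add_ac)

lemma conv_op_pow_commute:
  assumes M: "borel_prob M" and N: "borel_prob N" and g: "bfun K g"
  shows "(conv_op M ^^ n) (conv_op N g) = conv_op N ((conv_op M ^^ n) g)"
  by (induction n) (auto simp: conv_op_commute[OF M N conv_op_pow_bfun[OF M g]])

lemma integral_sum_PiM:
  fixes X :: "'a \<Rightarrow> real ^ 'p"
  assumes P: "prob_space P" and X[measurable]: "X \<in> borel_measurable P" and g: "bfun K g"
  shows "(\<integral>y. g (x + (\<Sum>i<n. X (y i))) \<partial>Pi\<^sub>M {..<n} (\<lambda>_::nat. P)) = (conv_op (distr P borel X) ^^ n) g x"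
  using g
proof (induction n arbitrary: g)
  case 0
  then show ?case by (simp add: PiM_empty lebesgue_integral_count_space_finite)
next
  case (Suc n)
  interpret P: prob_space P by (rule P)
  interpret F': product_sigma_finite "\<lambda>_::nat. P" by standard
  interpret FS: prob_space "Pi\<^sub>M {..<Suc n} (\<lambda>_::nat. P)" by (rule prob_space_PiM) (rule P)
  have bp: "borel_prob (distr P borel X)" by (simp add: borel_prob_def P.prob_space_distr)
  have [measurable]: "g \<in> borel_measurable borel" using Suc.prems by (simp add: bfun_def)
  have int: "integrable (Pi\<^sub>M (insert n {..<n}) (\<lambda>_::nat. P)) (\<lambda>y. g (x + (\<Sum>i<Suc n. X (y i))))"
    unfolding lessThan_Suc[symmetric]
    by (rule FS.integrable_const_bound[where B=K]) (use Suc.prems in \<open>auto simp: bfun_def\<close>)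
  have "(\<integral>y. g (x + (\<Sum>i<Suc n. X (y i))) \<partial>Pi\<^sub>M {..<Suc n} (\<lambda>_. P))
      = (\<integral>y. (\<integral>t. g (x + (\<Sum>i<Suc n. X ((y(n := t)) i))) \<partial>P) \<partial>Pi\<^sub>M {..<n} (\<lambda>_. P))"
    unfolding lessThan_Suc by (rule F'.product_integral_insert) (use int in \<open>auto simp: lessThan_Suc\<close>)
  also have "\<dots> = (\<integral>y. conv_op (distr P borel X) g (x + (\<Sum>i<n. X (y i))) \<partial>Pi\<^sub>M {..<n} (\<lambda>_. P))"
    by (intro Bochner_Integration.integral_cong refl) (simp add: conv_op_def integral_distr add_ac)
  also have "\<dots> = (conv_op (distr P borel X) ^^ n) (conv_op (distr P borel X) g) x"
    by (rule Suc.IH[OF conv_op_bfun[OF bp Suc.prems]])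
  finally show ?case by (simp add: funpow_swap1)
qed

text \<open>The square root \<open>u\<close> of the density of the smooth component is a cone over the ball. It is Lipschitz with
  bounded support, so the squared \<open>L\<^sup>2\<close> distance between \<open>u\<close> and its translate by \<open>h\<close> is of the order \<open>\<bar>h\<bar>\<^sup>2\<close>.\<close>

lemma tent_function:
  fixes x0 :: "real ^ 'p"
  assumes r: "0 < r"
  obtains u :: "real ^ 'p \<Rightarrow> real" and c C where "u \<in> borel_measurable borel" "\<forall>x. 0 \<le> u x" "0 < c" "0 < C"
    "\<forall>x. u x \<le> c * indicator (ball x0 r) x" "integrable lborel (\<lambda>x. (u x)\<^sup>2)" "(\<integral>x. (u x)\<^sup>2 \<partial>lborel) = 1"
    "\<forall>h. (\<integral>x. (u x - u (x - h))\<^sup>2 \<partial>lborel) \<le> C * (norm h)\<^sup>2"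
proof -
  define t where "t x = max 0 (1 - dist x0 x / r)" for x :: "real ^ 'p"
  have [measurable]: "t \<in> borel_measurable borel" unfolding t_def by measurable
  have t0: "0 \<le> t x" for x by (simp add: t_def)
  have t1: "t x \<le> indicator (ball x0 r) x" for x using r by (auto simp: t_def indicator_def)
  have tl: "\<bar>t x - t y\<bar> \<le> norm (x - y) / r" for x y
  proof -
    have "\<bar>t x - t y\<bar> \<le> \<bar>(1 - dist x0 x / r) - (1 - dist x0 y / r)\<bar>" by (simp add: t_def max_def)
    also have "\<dots> = \<bar>dist x0 y - dist x0 x\<bar> / r" using r by (simp add: diff_divide_distrib[symmetric])
    also have "\<dots> \<le> norm (x - y) / r"
      using abs_dist_diff_le[of x0 y x] r dist_commute[of x0] 
      by (intro divide_right_mono) (auto simp: dist_norm norm_minus_commute, norm)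
    finally show ?thesis .
  qed
  have bfin: "emeasure lborel (ball a r) < \<infinity>" for a :: "real ^ 'p" by (rule emeasure_lborel_ball_finite)
  have ib: "integrable lborel (indicator (ball a r) :: real ^ 'p \<Rightarrow> real)" for a
    using bfin[of a] by (intro integrable_real_indicator) auto
  have t2: "(t x)\<^sup>2 \<le> indicator (ball x0 r) x" for x
    using power_mono[OF t1 t0, of x 2] by (auto simp: indicator_def split: if_splits)
  have it: "integrable lborel (\<lambda>x. (t x)\<^sup>2)"
    by (rule Bochner_Integration.integrable_bound[OF ib]) (use t2 in auto)
  define T where "T = (\<integral>x. (t x)\<^sup>2 \<partial>lborel)"
  have T: "T > 0"
  proof -
    have "0 < measure lborel (ball x0 (r / 2)) / 4"
      using emeasure_ball[of "r / 2" x0] r by (simp add: measure_def)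
    also have "\<dots> = (\<integral>x. indicator (ball x0 (r / 2)) x / 4 \<partial>lborel)" by simp
    also have "\<dots> \<le> T" unfolding T_def
    proof (rule integral_mono'[OF it])
      fix x
      show "indicator (ball x0 (r / 2)) x / 4 \<le> (t x)\<^sup>2"
      proof (cases "x \<in> ball x0 (r / 2)")
        case True
        then have "1 / 2 \<le> t x" using r by (simp add: t_def max_def field_simps)
        then have "(1 / 2)\<^sup>2 \<le> (t x)\<^sup>2" by (intro power_mono) auto
        then show ?thesis using True by (simp add: power2_eq_square)
      qed simp
    qed simp
    finally show ?thesis .
  qed
  define v where "v = measure lborel (ball x0 r)"
  have v: "v > 0" using emeasure_ball[of r x0] r by (simp add: v_def measure_def)
  show ?thesis
  proof (rule that[of "\<lambda>x. t x / sqrt T" "1 / sqrt T" "2 * v / (T * r\<^sup>2)"])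
    show "\<forall>x. t x / sqrt T \<le> 1 / sqrt T * indicator (ball x0 r) x"
      using t1 T by (auto simp: divide_right_mono)
    show "integrable lborel (\<lambda>x. (t x / sqrt T)\<^sup>2)" using it T by (simp add: power_divide)
    show "(\<integral>x. (t x / sqrt T)\<^sup>2 \<partial>lborel) = 1" using T by (simp add: power_divide T_def[symmetric])
    show "0 < 2 * v / (T * r\<^sup>2)" using v T r by simp
    show "\<forall>h. (\<integral>x. (t x / sqrt T - t (x - h) / sqrt T)\<^sup>2 \<partial>lborel) \<le> 2 * v / (T * r\<^sup>2) * (norm h)\<^sup>2"
    proof
      fix h
      have "(\<integral>x. (t x / sqrt T - t (x - h) / sqrt T)\<^sup>2 \<partial>lborel)
          \<le> (\<integral>x. (norm h)\<^sup>2 / (T * r\<^sup>2) * (indicator (ball x0 r) x + indicator (ball (x0 + h) r) x) \<partial>lborel)"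
      proof (rule integral_mono')
        show "integrable lborel (\<lambda>x. (norm h)\<^sup>2 / (T * r\<^sup>2) * (indicator (ball x0 r) x + indicator (ball (x0 + h) r) x))"
          using ib by (intro integrable_mult_right Bochner_Integration.integrable_add) auto
        fix x
        show "0 \<le> (norm h)\<^sup>2 / (T * r\<^sup>2) * (indicator (ball x0 r) x + indicator (ball (x0 + h) r) x)"
          using T by simp
        show "(t x / sqrt T - t (x - h) / sqrt T)\<^sup>2 \<le> (norm h)\<^sup>2 / (T * r\<^sup>2) * (indicator (ball x0 r) x + indicator (ball (x0 + h) r) x)"
        proof (cases "x \<in> ball x0 r \<or> x \<in> ball (x0 + h) r")
          case True
          have "(t x - t (x - h))\<^sup>2 \<le> (norm h / r)\<^sup>2"
            using tl[of x "x - h"] by (subst abs_le_square_iff[symmetric]) (use r in auto)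
          then have "(t x - t (x - h))\<^sup>2 / T \<le> (norm h / r)\<^sup>2 / T"
            using T by (intro divide_right_mono) auto
          moreover have "(t x / sqrt T - t (x - h) / sqrt T)\<^sup>2 = (t x - t (x - h))\<^sup>2 / T"
            using T by (simp add: diff_divide_distrib[symmetric] power_divide)
          ultimately have "(t x / sqrt T - t (x - h) / sqrt T)\<^sup>2 \<le> (norm h / r)\<^sup>2 / T" by simp
          also have "\<dots> = (norm h)\<^sup>2 / (T * r\<^sup>2) * 1" by (simp add: power_divide)
          also have "\<dots> \<le> (norm h)\<^sup>2 / (T * r\<^sup>2) * (indicator (ball x0 r) x + indicator (ball (x0 + h) r) x)"
            using True T by (intro mult_left_mono) (auto simp: indicator_def)
          finally show ?thesis .
        next
          case False
          have "x - h \<notin> ball x0 r" using False by (auto simp: dist_norm algebra_simps)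
          then have "t x = 0" "t (x - h) = 0"
            using False t1[of x] t0[of x] t1[of "x - h"] t0[of "x - h"] by auto
          then show ?thesis using T by simp
        qed
      qed
      also have "\<dots> = (norm h)\<^sup>2 / (T * r\<^sup>2) * (v + measure lborel (ball (x0 + h) r))"
        using ib by (simp add: v_def)
      also have "measure lborel (ball (x0 + h) r) = v"
        using emeasure_ball[of r x0] emeasure_ball[of r "x0 + h"] r by (simp add: v_def measure_def)
      finally show "(\<integral>x. (t x / sqrt T - t (x - h) / sqrt T)\<^sup>2 \<partial>lborel) \<le> 2 * v / (T * r\<^sup>2) * (norm h)\<^sup>2"
        by (simp add: field_simps)
    qed
  qed (use T t0 in \<open>auto intro!: divide_nonneg_nonneg\<close>)
qed

text \<open>The Hellinger affinity \<open>\<rho>\<close> of two densities \<open>u\<^sup>2\<close> and \<open>v\<^sup>2\<close> is multiplicative on products, and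
  \<open>1 - \<rho>\<^sup>k \<le> k (1 - \<rho>)\<close> by Bernoulli's inequality. The parameter \<open>t\<close> balances the two terms of
  \<open>2 \<bar>U - V\<bar> \<bar>U + V\<bar> \<le> (U - V)\<^sup>2 / t + t (U + V)\<^sup>2\<close>.\<close>

lemma product_density_distance:
  fixes u v :: "'a \<Rightarrow> real"
  assumes sf: "sigma_finite_measure L" and [measurable]: "u \<in> borel_measurable L" "v \<in> borel_measurable L"
    and nn: "\<And>x. 0 \<le> u x" "\<And>x. 0 \<le> v x"
    and iu: "integrable L (\<lambda>x. (u x)\<^sup>2)" "(\<integral>x. (u x)\<^sup>2 \<partial>L) = 1"
    and iv: "integrable L (\<lambda>x. (v x)\<^sup>2)" "(\<integral>x. (v x)\<^sup>2 \<partial>L) = 1"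
    and \<delta>: "(\<integral>x. (u x - v x)\<^sup>2 \<partial>L) \<le> \<delta>" and t: "0 < t"
  shows "integrable (Pi\<^sub>M {..<k} (\<lambda>_::nat. L)) (\<lambda>y. \<Prod>i<k. (u (y i))\<^sup>2)"
    and "integrable (Pi\<^sub>M {..<k} (\<lambda>_::nat. L)) (\<lambda>y. \<Prod>i<k. (v (y i))\<^sup>2)"
    and "(\<integral>y. \<bar>(\<Prod>i<k. (u (y i))\<^sup>2) - (\<Prod>i<k. (v (y i))\<^sup>2)\<bar> \<partial>Pi\<^sub>M {..<k} (\<lambda>_::nat. L)) \<le> real k * \<delta> / (2 * t) + 2 * t"
proof -
  let ?L = "Pi\<^sub>M {..<k} (\<lambda>_::nat. L)"
  define U where "U y = (\<Prod>i<k. u (y i))" for y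
  define V where "V y = (\<Prod>i<k. v (y i))" for y
  have iuv: "integrable L (\<lambda>x. u x * v x)"
  proof (rule Bochner_Integration.integrable_bound[OF Bochner_Integration.integrable_add[OF iu(1) iv(1)]])
    show "AE x in L. norm (u x * v x) \<le> norm ((u x)\<^sup>2 + (v x)\<^sup>2)"
    proof (rule AE_I2)
      fix x
      have "2 * (u x * v x) \<le> (u x)\<^sup>2 + (v x)\<^sup>2" using sum_squares_bound[of "u x" "v x"] by simp
      moreover have "0 \<le> u x * v x" using nn by simp
      ultimately show "norm (u x * v x) \<le> norm ((u x)\<^sup>2 + (v x)\<^sup>2)" by simp
    qed
  qed simp
  define \<rho> where "\<rho> = (\<integral>x. u x * v x \<partial>L)"
  have \<rho>: "0 \<le> \<rho>" unfolding \<rho>_def using nn by simp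
  have "(\<integral>x. (u x - v x)\<^sup>2 \<partial>L) = 2 - 2 * \<rho>"
    using iu iv iuv by (simp add: power2_diff \<rho>_def mult.assoc)
  moreover have "0 \<le> (\<integral>x. (u x - v x)\<^sup>2 \<partial>L)" by simp
  ultimately have \<rho>\<delta>: "2 * (1 - \<rho>) \<le> \<delta>" and \<rho>1: "\<rho> \<le> 1"
    using \<delta> by simp_all
  have U2: "(\<Prod>i<k. (u (y i))\<^sup>2) = (U y)\<^sup>2" and V2: "(\<Prod>i<k. (v (y i))\<^sup>2) = (V y)\<^sup>2" for y
    by (simp_all add: U_def V_def prod_power_distrib)
  have UV: "(\<Prod>i<k. u (y i) * v (y i)) = U y * V y" for y by (simp add: U_def V_def prod.distrib)
  have IU: "integrable ?L (\<lambda>y. (U y)\<^sup>2)" "(\<integral>y. (U y)\<^sup>2 \<partial>?L) = 1"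
    unfolding U2[symmetric] using integral_PiM_power[OF sf iu(1), of k] iu(2) by simp_all
  have IV: "integrable ?L (\<lambda>y. (V y)\<^sup>2)" "(\<integral>y. (V y)\<^sup>2 \<partial>?L) = 1"
    unfolding V2[symmetric] using integral_PiM_power[OF sf iv(1), of k] iv(2) by simp_all
  have IUV: "integrable ?L (\<lambda>y. U y * V y)" "(\<integral>y. U y * V y \<partial>?L) = \<rho> ^ k"
    unfolding UV[symmetric] using integral_PiM_power[OF sf iuv, of k] by (simp_all add: \<rho>_def)
  show "integrable ?L (\<lambda>y. \<Prod>i<k. (u (y i))\<^sup>2)" "integrable ?L (\<lambda>y. \<Prod>i<k. (v (y i))\<^sup>2)"
    unfolding U2 V2 by (rule IU IV)+
  have bern: "1 - \<rho> ^ k \<le> real k * (1 - \<rho>)"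
    using Bernoulli_inequality[of "\<rho> - 1" k] \<rho> by (simp add: algebra_simps)
  have "(\<integral>y. \<bar>(U y)\<^sup>2 - (V y)\<^sup>2\<bar> \<partial>?L) \<le> (\<integral>y. 1 / (2 * t) * ((U y)\<^sup>2 + (V y)\<^sup>2 - 2 * (U y * V y))
      + t / 2 * ((U y)\<^sup>2 + (V y)\<^sup>2 + 2 * (U y * V y)) \<partial>?L)"
  proof (rule integral_mono)
    show "integrable ?L (\<lambda>y. \<bar>(U y)\<^sup>2 - (V y)\<^sup>2\<bar>)" using IU IV by simp
    show "integrable ?L (\<lambda>y. 1 / (2 * t) * ((U y)\<^sup>2 + (V y)\<^sup>2 - 2 * (U y * V y))
      + t / 2 * ((U y)\<^sup>2 + (V y)\<^sup>2 + 2 * (U y * V y)))" 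
      using IU(1) IV(1) IUV(1) 
      by (intro Bochner_Integration.integrable_add integrable_mult_right Bochner_Integration.integrable_diff)
    fix y
    define a b where "a = \<bar>U y - V y\<bar>" and "b = \<bar>U y + V y\<bar>"
    have "2 * t * (a * b) \<le> a\<^sup>2 + (t * b)\<^sup>2" using sum_squares_bound[of a "t * b"] by (simp add: mult_ac)
    then have "a * b \<le> (a\<^sup>2 + (t * b)\<^sup>2) / (2 * t)" using t by (simp add: field_simps)
    also have "\<dots> = 1 / (2 * t) * a\<^sup>2 + t / 2 * b\<^sup>2" using t by (simp add: field_simps power2_eq_square)
    also have "a\<^sup>2 = (U y)\<^sup>2 + (V y)\<^sup>2 - 2 * (U y * V y)" by (simp add: a_def power2_diff)
    also have "b\<^sup>2 = (U y)\<^sup>2 + (V y)\<^sup>2 + 2 * (U y * V y)" by (simp add: b_def power2_sum)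
    also have "a * b = \<bar>(U y)\<^sup>2 - (V y)\<^sup>2\<bar>" by (simp add: a_def b_def abs_mult[symmetric] power2_eq_square algebra_simps)
    finally show "\<bar>(U y)\<^sup>2 - (V y)\<^sup>2\<bar> \<le> 1 / (2 * t) * ((U y)\<^sup>2 + (V y)\<^sup>2 - 2 * (U y * V y))
      + t / 2 * ((U y)\<^sup>2 + (V y)\<^sup>2 + 2 * (U y * V y))" .
  qed
  also have "\<dots> = 1 / (2 * t) * (2 - 2 * \<rho> ^ k) + t / 2 * (2 + 2 * \<rho> ^ k)"
    using IU IV IUV by simp
  also have "\<dots> \<le> 1 / (2 * t) * (real k * \<delta>) + t / 2 * 4"
  proof (intro add_mono mult_left_mono)
    have "real k * (2 * (1 - \<rho>)) \<le> real k * \<delta>" by (intro mult_left_mono \<rho>\<delta>) simp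
    then show "2 - 2 * \<rho> ^ k \<le> real k * \<delta>" using bern by (simp add: algebra_simps)
    show "2 + 2 * \<rho> ^ k \<le> 4" using \<rho> \<rho>1 power_le_one[of \<rho> k] by simp
  qed (use t in auto)
  finally show "(\<integral>y. \<bar>(\<Prod>i<k. (u (y i))\<^sup>2) - (\<Prod>i<k. (v (y i))\<^sup>2)\<bar> \<partial>?L) \<le> real k * \<delta> / (2 * t) + 2 * t"
    unfolding U2 V2 by simp
qed

lemma conv_op_density_power:
  fixes u :: "real ^ 'p \<Rightarrow> real"
  assumes u[measurable]: "u \<in> borel_measurable borel"
    and iu: "integrable lborel (\<lambda>x. (u x)\<^sup>2)" "(\<integral>x. (u x)\<^sup>2 \<partial>lborel) = 1"
    and g: "bfun K g"
  shows "borel_prob (density lborel (\<lambda>x. ennreal ((u x)\<^sup>2)))"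
    and "(conv_op (density lborel (\<lambda>x. ennreal ((u x)\<^sup>2))) ^^ k) g x
      = (\<integral>y. (\<Prod>i<k. (u (y i))\<^sup>2) * g (x + (\<Sum>i<k. y i)) \<partial>Pi\<^sub>M {..<k} (\<lambda>_. lborel))"
proof -
  let ?W = "density lborel (\<lambda>x. ennreal ((u x)\<^sup>2))"
  have [measurable]: "g \<in> borel_measurable borel" using g by (simp add: bfun_def)
  have W: "prob_space ?W"
  proof
    show "emeasure ?W (space ?W) = 1"
      using iu by (simp add: emeasure_density nn_integral_eq_integral)
  qed
  then show "borel_prob ?W" by (simp add: borel_prob_def)
  have fam: "density_family lborel UNIV (\<lambda>_ :: unit. \<lambda>x. (u x)\<^sup>2)"
    using W by (simp add: density_family_def base_dist_def)
  have PW: "Pi\<^sub>M {..<k} (\<lambda>_. ?W) = density (Pi\<^sub>M {..<k} (\<lambda>_. lborel)) (\<lambda>y. ennreal (\<Prod>i<k. (u (y i))\<^sup>2))"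
    using base_prod_eq_density[OF sigma_finite_lborel fam UNIV_I, where n=k]
    by (simp add: base_prod_def base_dist_def prod_ennreal)
  have "(conv_op ?W ^^ k) g x = (conv_op (distr ?W borel (\<lambda>x. x)) ^^ k) g x"
    by (simp add: distr_id2)
  also have "\<dots> = (\<integral>y. g (x + (\<Sum>i<k. y i)) \<partial>Pi\<^sub>M {..<k} (\<lambda>_. ?W))"
    by (rule integral_sum_PiM[OF W _ g, symmetric]) simp
  also have "\<dots> = (\<integral>y. (\<Prod>i<k. (u (y i))\<^sup>2) * g (x + (\<Sum>i<k. y i)) \<partial>Pi\<^sub>M {..<k} (\<lambda>_. lborel))"
    unfolding PW by (subst integral_density) (auto simp: prod_nonneg)
  finally show "(conv_op ?W ^^ k) g x
      = (\<integral>y. (\<Prod>i<k. (u (y i))\<^sup>2) * g (x + (\<Sum>i<k. y i)) \<partial>Pi\<^sub>M {..<k} (\<lambda>_. lborel))" .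
qed

text \<open>A shift of a sum of \<open>k\<close> summands by \<open>w\<close> is a shift of each summand by \<open>w / k\<close>. The squared Hellinger distance
  per summand is then of the order \<open>(\<bar>w\<bar> / k)\<^sup>2\<close>, and \<open>k\<close> summands contribute \<open>\<bar>w\<bar>\<^sup>2 / k\<close>.\<close>

lemma smooth_component_shift:
  fixes u :: "real ^ 'p \<Rightarrow> real"
  assumes u[measurable]: "u \<in> borel_measurable borel" and nn: "\<And>x. 0 \<le> u x"
    and iu: "integrable lborel (\<lambda>x. (u x)\<^sup>2)" "(\<integral>x. (u x)\<^sup>2 \<partial>lborel) = 1"
    and C: "0 < C" "\<And>h. (\<integral>x. (u x - u (x - h))\<^sup>2 \<partial>lborel) \<le> C * (norm h)\<^sup>2"
    and g: "bfun K g" and k: "0 < k"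
  defines "V \<equiv> density lborel (\<lambda>x. ennreal ((u x)\<^sup>2))"
  shows "\<bar>(conv_op V ^^ k) g (x + w) - (conv_op V ^^ k) g x\<bar> \<le> K * (5 / 2 * sqrt C * norm w / sqrt k)"
proof (cases "w = 0")
  case True
  then show ?thesis using bfun_nonneg[OF g] by simp
next
  case False
  have gm[measurable]: "g \<in> borel_measurable borel" using g by (simp add: bfun_def)
  define h where "h = (1 / real k) *\<^sub>R w"
  define v where "v x = u (x - h)" for x
  have [measurable]: "v \<in> borel_measurable borel" unfolding v_def by measurable
  have shift_int: "(\<integral>x. H x \<partial>lborel) = (\<integral>x. H (x - h) \<partial>lborel)" and
    shift_integrable: "integrable lborel H \<Longrightarrow> integrable lborel (\<lambda>x. H (x - h))"
    if [measurable]: "H \<in> borel_measurable borel" for H :: "real ^ 'p \<Rightarrow> real"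
  proof -
    have eq: "H x = H ((h + x) - h)" for x by simp
    show "(\<integral>x. H x \<partial>lborel) = (\<integral>x. H (x - h) \<partial>lborel)"
      by (subst lborel_distr_plus[of h, symmetric], subst integral_distr) auto
    show "integrable lborel H \<Longrightarrow> integrable lborel (\<lambda>x. H (x - h))"
      by (subst lborel_distr_plus[of h, symmetric], subst integrable_distr_eq) auto
  qed
  have iv: "integrable lborel (\<lambda>x. (v x)\<^sup>2)" "(\<integral>x. (v x)\<^sup>2 \<partial>lborel) = 1"
    unfolding v_def using shift_integrable[OF _ iu(1)] shift_int[of "\<lambda>x. (u x)\<^sup>2"] iu(2) by simp_all
  \<comment> \<open>the distribution \<open>V'\<close> of a summand shifted by \<open>h = w / k\<close>\<close>
  define V' where "V' = density lborel (\<lambda>x. ennreal ((v x)\<^sup>2))"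
  have V'V: "conv_op V' f x = conv_op V f (x + h)" if "bfun K f" for f x
  proof -
    have [measurable]: "f \<in> borel_measurable borel" using that by (simp add: bfun_def)
    have "conv_op V' f x = (\<integral>y. (v y)\<^sup>2 * f (x + y) \<partial>lborel)"
      unfolding conv_op_def V'_def by (subst integral_density) auto
    also have "\<dots> = (\<integral>y. (u (y - h))\<^sup>2 * f (x + h + (y - h)) \<partial>lborel)" by (simp add: v_def)
    also have "\<dots> = (\<integral>y. (u y)\<^sup>2 * f (x + h + y) \<partial>lborel)"
      using shift_int[of "\<lambda>y. (u y)\<^sup>2 * f (x + h + y)"] by simp
    also have "\<dots> = conv_op V f (x + h)"
      unfolding conv_op_def V_def by (subst integral_density) auto
    finally show ?thesis .
  qed
  have bV: "borel_prob V" unfolding V_def by (rule conv_op_density_power(1)[OF u iu g])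
  have bV': "borel_prob V'" unfolding V'_def by (rule conv_op_density_power(1)[OF _ iv g]) simp
  have pow: "(conv_op V' ^^ j) g x = (conv_op V ^^ j) g (x + real j *\<^sub>R h)" for j x
  proof (induction j arbitrary: x)
    case (Suc j)
    have "(conv_op V' ^^ Suc j) g x = conv_op V ((conv_op V' ^^ j) g) (x + h)"
      by (simp add: V'V[OF conv_op_pow_bfun[OF bV' g]])
    also have "(conv_op V' ^^ j) g = (\<lambda>x. (conv_op V ^^ j) g (x + real j *\<^sub>R h))"
      using Suc by auto
    also have "conv_op V (\<lambda>x. (conv_op V ^^ j) g (x + real j *\<^sub>R h)) (x + h) = (conv_op V ^^ Suc j) g (x + real (Suc j) *\<^sub>R h)"
      by (simp add: conv_op_shift algebra_simps)
    finally show ?case .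
  qed simp
  have wh: "real k *\<^sub>R h = w" using k by (simp add: h_def)
  let ?L = "Pi\<^sub>M {..<k} (\<lambda>_::nat. lborel :: (real ^ 'p) measure)"
  have nn': "\<And>x. 0 \<le> v x" by (simp add: v_def nn)
  define t where "t = sqrt C * norm w / sqrt k"
  have t: "0 < t" using C False k by (simp add: t_def)
  have d: "(\<integral>x. (u x - v x)\<^sup>2 \<partial>lborel) \<le> C * (norm h)\<^sup>2" unfolding v_def by (rule C)
  note D = product_density_distance[OF sigma_finite_lborel _ _ nn nn' iu iv d t, of k]
  have gk: "\<bar>g y\<bar> \<le> K" for y using g by (simp add: bfun_def)
  have ig: "integrable ?L (\<lambda>y. F y * g (x + (\<Sum>i<k. y i)))" if F: "integrable ?L F" for F
    using borel_measurable_integrable[OF F]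
    by (intro Bochner_Integration.integrable_bound[OF integrable_mult_right[OF F, of K]])
      (auto simp: abs_mult mult.commute[of K] intro!: mult_left_mono gk order_trans[OF gk])
  have "(conv_op V ^^ k) g (x + w) - (conv_op V ^^ k) g x = (conv_op V' ^^ k) g x - (conv_op V ^^ k) g x"
    by (simp add: pow wh)
  also have "\<dots> = (\<integral>y. (\<Prod>i<k. (v (y i))\<^sup>2) * g (x + (\<Sum>i<k. y i)) \<partial>?L) - (\<integral>y. (\<Prod>i<k. (u (y i))\<^sup>2) * g (x + (\<Sum>i<k. y i)) \<partial>?L)"
    unfolding V_def V'_def using iu iv g by (simp add: conv_op_density_power(2))
  also have "\<dots> = (\<integral>y. (\<Prod>i<k. (v (y i))\<^sup>2) * g (x + (\<Sum>i<k. y i)) - (\<Prod>i<k. (u (y i))\<^sup>2) * g (x + (\<Sum>i<k. y i)) \<partial>?L)"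
    by (rule Bochner_Integration.integral_diff[symmetric]) (use ig D(1,2) in auto)
  also have "norm \<dots> \<le> (\<integral>y. K * \<bar>(\<Prod>i<k. (u (y i))\<^sup>2) - (\<Prod>i<k. (v (y i))\<^sup>2)\<bar> \<partial>?L)"
  proof (rule norm_integral_le)
    show "integrable ?L (\<lambda>y. K * \<bar>(\<Prod>i<k. (u (y i))\<^sup>2) - (\<Prod>i<k. (v (y i))\<^sup>2)\<bar>)"
      using D(1,2) by simp
    fix y
    show "norm ((\<Prod>i<k. (v (y i))\<^sup>2) * g (x + (\<Sum>i<k. y i)) - (\<Prod>i<k. (u (y i))\<^sup>2) * g (x + (\<Sum>i<k. y i)))
        \<le> K * \<bar>(\<Prod>i<k. (u (y i))\<^sup>2) - (\<Prod>i<k. (v (y i))\<^sup>2)\<bar>"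
      using gk by (simp add: left_diff_distrib[symmetric] abs_mult abs_minus_commute mult.commute[of K] mult_left_mono)
  qed
  also have "\<dots> \<le> K * (real k * (C * (norm h)\<^sup>2) / (2 * t) + 2 * t)"
    using D(3) bfun_nonneg[OF g] by (simp add: mult_left_mono)
  also have "real k * (C * (norm h)\<^sup>2) = t\<^sup>2"
    using C k by (simp add: t_def h_def power_mult_distrib power_divide power2_eq_square)
  also have "t\<^sup>2 / (2 * t) + 2 * t = 5 / 2 * t" using t by (simp add: power2_eq_square)
  finally show ?thesis by (simp add: t_def mult_ac)
qed

text \<open>If a counter increases by \<open>1\<close> with probability \<open>\<alpha>\<close> in every step, then \<open>1 / (k + 1 + \<alpha> m / 2)\<close> bounds the
  mean of its reciprocal, shifted by \<open>1\<close>, after \<open>m\<close> steps from \<open>k\<close>. This inequality is the induction step; the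
  slope \<open>\<alpha> / 2\<close> instead of \<open>\<alpha>\<close> leaves the room that the convexity of the reciprocal requires.\<close>

lemma reciprocal_supersolution:
  fixes \<alpha> \<beta> x :: real
  assumes "0 < \<alpha>" "\<alpha> \<le> 1" "\<beta> = \<alpha> / 2" "1 \<le> x - \<beta>"
  shows "\<alpha> / (x + 1 - \<beta>) + (1 - \<alpha>) / (x - \<beta>) \<le> 1 / x"
proof -
  have b: "0 < \<beta>" "\<beta> < 1" using assms by auto
  have x: "1 \<le> x" using assms b by linarith
  have "\<alpha> * (x - \<beta>) * x + (1 - \<alpha>) * (x + 1 - \<beta>) * x \<le> (x + 1 - \<beta>) * (x - \<beta>)"
  proof -
    have "\<beta> * (1 - \<beta>) \<le> \<beta> * x" using b x by (intro mult_left_mono) auto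
    moreover have "\<alpha> = 2 * \<beta>" using assms(3) by simp
    ultimately show ?thesis by (simp add: algebra_simps)
  qed
  then have "(\<alpha> * (x - \<beta>) + (1 - \<alpha>) * (x + 1 - \<beta>)) * x \<le> 1 * ((x + 1 - \<beta>) * (x - \<beta>))"
    by (simp add: algebra_simps)
  moreover have pos: "0 < (x + 1 - \<beta>) * (x - \<beta>)" using assms by (intro mult_pos_pos) auto
  ultimately have "(\<alpha> * (x - \<beta>) + (1 - \<alpha>) * (x + 1 - \<beta>)) / ((x + 1 - \<beta>) * (x - \<beta>)) \<le> 1 / x"
    using x by (subst frac_le_eq) (auto simp: divide_simps)
  moreover have "(\<alpha> * (x - \<beta>) + (1 - \<alpha>) * (x + 1 - \<beta>)) / ((x + 1 - \<beta>) * (x - \<beta>))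
      = \<alpha> / (x + 1 - \<beta>) + (1 - \<alpha>) / (x - \<beta>)"
    using assms by (simp add: add_divide_distrib)
  ultimately show ?thesis by simp
qed


text \<open>Two \<open>q\<close>-summands are distributed as a mixture of \<open>V\<close>, with weight \<open>\<alpha>\<close>, and a rest. Replacing one pair at a time
  either adds a \<open>V\<close>-summand or transforms \<open>g\<close> by the operator of the rest, which commutes with everything
  else; so \<open>k\<close> counts the \<open>V\<close>-summands collected so far. The second term under the root is the case that none
  was collected. The squared bound, not the bound, is propagated, because the reciprocals then satisfy
  \<open>reciprocal_supersolution\<close>.\<close>

lemma mixture_shift:
  fixes q V :: "(real ^ 'p) measure"
  assumes q: "borel_prob q" and V: "borel_prob V" and \<alpha>: "0 < \<alpha>" "\<alpha> \<le> 1"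
    and dom: "\<And>K g x. bfun K g \<Longrightarrow> (\<And>x. 0 \<le> g x) \<Longrightarrow> \<alpha> * conv_op V g x \<le> conv_op q (conv_op q g) x"
    and smooth: "\<And>K g k x. bfun K g \<Longrightarrow> 0 < k \<Longrightarrow>
      \<bar>(conv_op V ^^ k) g (x + w) - (conv_op V ^^ k) g x\<bar> \<le> K * (c * norm w / sqrt (real k))"
    and c: "0 \<le> c"
    and g: "bfun K g"
  shows "\<bar>(conv_op q ^^ (2 * m)) ((conv_op V ^^ k) g) (x + w) - (conv_op q ^^ (2 * m)) ((conv_op V ^^ k) g) x\<bar>
    \<le> K * sqrt (2 * (c * norm w)\<^sup>2 * (1 / (real k + 1 + \<alpha> / 2 * real m)) + (if k = 0 then 4 * (1 - \<alpha>) ^ m else 0))"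
  using g
proof (induction m arbitrary: k K g)
  case 0
  note K0 = bfun_nonneg[OF "0.prems"]
  show ?case
  proof (cases "k = 0")
    case True
    have "\<bar>g (x + w) - g x\<bar> \<le> \<bar>g (x + w)\<bar> + \<bar>g x\<bar>" by simp
    also have "\<dots> \<le> K + K" using 0 by (intro add_mono) (auto simp: bfun_def)
    also have "\<dots> = K * sqrt 4" by simp
    also have "\<dots> \<le> K * sqrt (2 * (c * norm w)\<^sup>2 * (1 / (real k + 1 + \<alpha> / 2 * real 0)) + 4)"
      using K0 by (intro mult_left_mono real_sqrt_le_mono) auto
    finally show ?thesis using True by simp
  next
    case False
    have "c * norm w / sqrt k \<le> sqrt (2 * (c * norm w)\<^sup>2 * (1 / (real k + 1)))"
    proof (rule real_le_rsqrt)
      have "(c * norm w / sqrt k)\<^sup>2 = (c * norm w)\<^sup>2 * (1 / k)" using False by (simp add: power_divide)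
      also have "\<dots> \<le> (c * norm w)\<^sup>2 * (2 * (1 / (real k + 1)))"
        using False by (intro mult_left_mono) (auto simp: field_simps)
      finally show "(c * norm w / sqrt k)\<^sup>2 \<le> 2 * (c * norm w)\<^sup>2 * (1 / (real k + 1))" by (simp add: mult_ac)
    qed
    then have "K * (c * norm w / sqrt k) \<le> K * sqrt (2 * (c * norm w)\<^sup>2 * (1 / (real k + 1)))"
      using K0 by (intro mult_left_mono)
    then show ?thesis using smooth[OF "0.prems", of k x] False by simp
  qed
next
  case (Suc m)
  note g = Suc.prems
  note K0 = bfun_nonneg[OF g]
  let ?D = "\<lambda>x. 1 * conv_op q (conv_op q g) x + (- \<alpha>) * conv_op V g x"
  let ?b = "\<lambda>k m. 2 * (c * norm w)\<^sup>2 * (1 / (real k + 1 + \<alpha> / 2 * real m)) + (if k = 0 then 4 * (1 - \<alpha>) ^ m else 0)"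
  have b0: "0 \<le> ?b k m" for k m using \<alpha> by auto
  have qg: "bfun K (conv_op q (conv_op q g))" and Vg: "bfun K (conv_op V g)"
    using g q V by (auto intro: conv_op_bfun)
  \<comment> \<open>the positive operator \<open>D\<close> has total mass \<open>1 - \<alpha>\<close>\<close>
  have mass: "conv_op M (\<lambda>x. a * g x + b) = (\<lambda>x. a * conv_op M g x + b)" if "borel_prob M" "bfun K g" for M g a b K
  proof -
    have one: "bfun 1 (\<lambda>_. 1)" by (simp add: bfun_def)
    have "conv_op M (\<lambda>_. 1) = (\<lambda>_. 1)" using that(1) by (auto simp: conv_op_def borel_prob_def prob_space.prob_space)
    then show ?thesis using conv_op_linear[OF that one, of a b] by simp
  qed
  have D: "bfun ((1 - \<alpha>) * K) ?D"
  proof -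
    have "\<bar>?D y\<bar> \<le> (1 - \<alpha>) * K" for y
    proof -
      have "\<alpha> * conv_op V (\<lambda>x. a * g x + K) y \<le> conv_op q (conv_op q (\<lambda>x. a * g x + K)) y" if a: "a = 1 \<or> a = -1" for a
      proof (rule dom)
        have "bfun 1 (\<lambda>_ :: real ^ 'p. 1 :: real)" by (simp add: bfun_def)
        from bfun_linear[OF g this, of a K] show "bfun (\<bar>a\<bar> * K + \<bar>K\<bar> * 1) (\<lambda>x. a * g x + K)" by simp
        have "- K \<le> g z" "g z \<le> K" for z using g by (auto simp: bfun_def abs_le_iff minus_le_iff)
        then show "\<And>z. 0 \<le> a * g z + K" using a by auto (smt (verit))
      qed
      then have le: "\<alpha> * (a * conv_op V g y + K) \<le> a * conv_op q (conv_op q g) y + K" if a: "a = 1 \<or> a = -1" for a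
        using a by (simp only: mass[OF V g] mass[OF q g] mass[OF q conv_op_bfun[OF q g]])
      show ?thesis using le[of 1] le[of "-1"] by (auto simp: abs_le_iff algebra_simps)
    qed
    then show ?thesis using bfun_linear[OF qg Vg, of 1 "-\<alpha>"] by (simp add: bfun_def)
  qed
  have step: "conv_op q (conv_op q ((conv_op V ^^ k) g)) = (\<lambda>x. \<alpha> * (conv_op V ^^ Suc k) g x + 1 * (conv_op V ^^ k) ?D x)"
  proof -
    have "conv_op q (conv_op q ((conv_op V ^^ k) g)) = (conv_op V ^^ k) (conv_op q (conv_op q g))"
      by (simp add: conv_op_pow_commute[OF V q g, symmetric] conv_op_pow_commute[OF V q conv_op_bfun[OF q g], symmetric])
    moreover have "(conv_op V ^^ Suc k) g = (conv_op V ^^ k) (conv_op V g)" by (simp add: funpow_swap1)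
    ultimately show ?thesis unfolding conv_op_pow_linear[OF V qg Vg] by simp
  qed
  have "(conv_op q ^^ (2 * Suc m)) ((conv_op V ^^ k) g) = (conv_op q ^^ (2 * m)) (conv_op q (conv_op q ((conv_op V ^^ k) g)))"
    by (simp add: funpow_swap1)
  also have "\<dots> = (\<lambda>x. \<alpha> * (conv_op q ^^ (2 * m)) ((conv_op V ^^ Suc k) g) x + 1 * (conv_op q ^^ (2 * m)) ((conv_op V ^^ k) ?D) x)"
    unfolding step by (rule conv_op_pow_linear[OF q conv_op_pow_bfun[OF V g] conv_op_pow_bfun[OF V D]])
  finally have eq: "(conv_op q ^^ (2 * Suc m)) ((conv_op V ^^ k) g)
      = (\<lambda>x. \<alpha> * (conv_op q ^^ (2 * m)) ((conv_op V ^^ Suc k) g) x + (conv_op q ^^ (2 * m)) ((conv_op V ^^ k) ?D) x)" by simp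
  have "\<bar>(conv_op q ^^ (2 * Suc m)) ((conv_op V ^^ k) g) (x + w) - (conv_op q ^^ (2 * Suc m)) ((conv_op V ^^ k) g) x\<bar>
    \<le> \<alpha> * \<bar>(conv_op q ^^ (2 * m)) ((conv_op V ^^ Suc k) g) (x + w) - (conv_op q ^^ (2 * m)) ((conv_op V ^^ Suc k) g) x\<bar>
      + \<bar>(conv_op q ^^ (2 * m)) ((conv_op V ^^ k) ?D) (x + w) - (conv_op q ^^ (2 * m)) ((conv_op V ^^ k) ?D) x\<bar>"
  proof -
    have tri: "\<bar>(\<alpha> * a + b) - (\<alpha> * a' + b')\<bar> \<le> \<alpha> * \<bar>a - a'\<bar> + \<bar>b - b'\<bar>" for a a' b b' :: real
    proof -
      have "\<bar>(\<alpha> * a + b) - (\<alpha> * a' + b')\<bar> = \<bar>\<alpha> * (a - a') + (b - b')\<bar>" by (simp add: algebra_simps)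
      also have "\<dots> \<le> \<bar>\<alpha> * (a - a')\<bar> + \<bar>b - b'\<bar>" by (rule abs_triangle_ineq)
      finally show ?thesis using \<alpha> by (simp add: abs_mult)
    qed
    show ?thesis unfolding eq by (rule tri)
  qed
  also have "\<dots> \<le> \<alpha> * (K * sqrt (?b (Suc k) m)) + (1 - \<alpha>) * K * sqrt (?b k m)"
    using Suc.IH[OF g, of "Suc k"] Suc.IH[OF D, of k] \<alpha> by (intro add_mono mult_left_mono) auto
  also have "\<dots> = K * (\<alpha> * sqrt (?b (Suc k) m) + (1 - \<alpha>) * sqrt (?b k m))" by (simp add: algebra_simps)
  also have "\<dots> \<le> K * sqrt (?b k (Suc m))"
  proof (intro mult_left_mono K0)
    have conv: "\<alpha> * sqrt a + (1 - \<alpha>) * sqrt b \<le> sqrt (\<alpha> * a + (1 - \<alpha>) * b)" if "0 \<le> a" "0 \<le> b" for a b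
    proof (rule real_le_rsqrt)
      have "0 \<le> \<alpha> * (1 - \<alpha>) * (sqrt a - sqrt b)\<^sup>2" using \<alpha> by simp
      also have "\<dots> = \<alpha> * a + (1 - \<alpha>) * b - (\<alpha> * sqrt a + (1 - \<alpha>) * sqrt b)\<^sup>2"
      proof -
        have sq: "(sqrt a)\<^sup>2 = a" "(sqrt b)\<^sup>2 = b" using that by auto
        have "\<alpha> * (1 - \<alpha>) * (s - t)\<^sup>2 = \<alpha> * s\<^sup>2 + (1 - \<alpha>) * t\<^sup>2 - (\<alpha> * s + (1 - \<alpha>) * t)\<^sup>2" for s t :: real
          by (simp add: power2_eq_square algebra_simps)
        from this[of "sqrt a" "sqrt b"] show ?thesis unfolding sq .
      qed
      finally show "(\<alpha> * sqrt a + (1 - \<alpha>) * sqrt b)\<^sup>2 \<le> \<alpha> * a + (1 - \<alpha>) * b" by simp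
    qed
    have "\<alpha> * ?b (Suc k) m + (1 - \<alpha>) * ?b k m = 2 * (c * norm w)\<^sup>2 *
        (\<alpha> / (real (Suc k) + 1 + \<alpha> / 2 * real m) + (1 - \<alpha>) / (real k + 1 + \<alpha> / 2 * real m)) + (if k = 0 then 4 * (1 - \<alpha>) ^ Suc m else 0)"
      by (simp add: algebra_simps)
    also have "\<dots> \<le> ?b k (Suc m)"
    proof -
      define X where "X = real k + 1 + \<alpha> / 2 * real (Suc m)"
      have X: "real (Suc k) + 1 + \<alpha> / 2 * real m = X + 1 - \<alpha> / 2" "real k + 1 + \<alpha> / 2 * real m = X - \<alpha> / 2"
        by (simp_all add: X_def algebra_simps)
      have "\<alpha> / (X + 1 - \<alpha> / 2) + (1 - \<alpha>) / (X - \<alpha> / 2) \<le> 1 / X"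
      proof (rule reciprocal_supersolution[OF \<alpha> refl])
        show "1 \<le> X - \<alpha> / 2" unfolding X(2)[symmetric] using \<alpha> by simp
      qed
      then show ?thesis unfolding X X_def[symmetric]
        by (intro add_mono mult_left_mono) auto
    qed
    finally have "sqrt (\<alpha> * ?b (Suc k) m + (1 - \<alpha>) * ?b k m) \<le> sqrt (?b k (Suc m))" by (rule real_sqrt_le_mono)
    then show "\<alpha> * sqrt (?b (Suc k) m) + (1 - \<alpha>) * sqrt (?b k m) \<le> sqrt (?b k (Suc m))"
      using conv[OF b0[of "Suc k" m] b0[of k m]] by (rule order_trans[rotated])
  qed
  finally show ?case .
qed

text \<open>A shift on the scale \<open>\<surd>n\<close> of a sum of \<open>n\<close> independent vectors changes its distribution in total variation
  by an amount proportional to the shift, up to the exponentially small chance that no summand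
  comes from the smooth component.\<close>

lemma shift_bound:
  fixes q :: "(real ^ 'p) measure"
  assumes q: "borel_prob q" and ac: "has_ac_component q"
  obtains C :: real and \<epsilon> :: "nat \<Rightarrow> real" where "0 \<le> C" "\<epsilon> \<longlonglongrightarrow> 0"
    "\<forall>n>0. \<forall>K g x w. bfun K g \<longrightarrow>
      \<bar>(conv_op q ^^ n) g (x + w) - (conv_op q ^^ n) g x\<bar> \<le> K * sqrt (C * (norm w / sqrt (real n))\<^sup>2 + \<epsilon> n)"
proof -
  have qp: "prob_space q" and sets_q[measurable_cong]: "sets q = sets borel" using q by (simp_all add: borel_prob_def)
  interpret q: prob_space q by fact
  from convolution_square_minorant[OF qp sets_q ac]
  obtain x0 r \<kappa> where r: "0 < r" and \<kappa>: "0 < (\<kappa> :: real)" and low: "\<forall>G\<in>borel_measurable borel.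
      (\<integral>\<^sup>+x. ennreal \<kappa> * indicator (ball x0 r) x * G x \<partial>lborel) \<le> (\<integral>\<^sup>+y. \<integral>\<^sup>+z. G (y + z) \<partial>q \<partial>q)" .
  from tent_function[OF r, of x0]
  obtain u :: "real ^ 'p \<Rightarrow> real" and c C where um[measurable]: "u \<in> borel_measurable borel" and u0: "\<forall>x. 0 \<le> u x"
    and c: "0 < c" and C: "0 < C" and uc: "\<forall>x. u x \<le> c * indicator (ball x0 r) x"
    and iu: "integrable lborel (\<lambda>x. (u x)\<^sup>2)" "(\<integral>x. (u x)\<^sup>2 \<partial>lborel) = 1"
    and uC: "\<forall>h. (\<integral>x. (u x - u (x - h))\<^sup>2 \<partial>lborel) \<le> C * (norm h)\<^sup>2" .
  define V where "V = density lborel (\<lambda>x. ennreal ((u x)\<^sup>2))"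
  \<comment> \<open>\<open>u\<^sup>2 \<le> c\<^sup>2\<close> on the ball, so \<open>\<alpha>\<close> times the density of \<open>V\<close> is below the minorant \<open>\<kappa>\<close>\<close>
  define \<alpha> where "\<alpha> = min (1 / 2) (\<kappa> / c\<^sup>2)"
  have \<alpha>: "0 < \<alpha>" "\<alpha> \<le> 1 / 2" "\<alpha> * c\<^sup>2 \<le> \<kappa>"
    using \<kappa> c by (auto simp: \<alpha>_def min_def field_simps)
  have one: "bfun 1 (\<lambda>_ :: real ^ 'p. 1)" by (simp add: bfun_def)
  have V: "borel_prob V" unfolding V_def by (rule conv_op_density_power(1)[OF um iu one])
  have dom: "\<alpha> * conv_op V g x \<le> conv_op q (conv_op q g) x" if g: "bfun K g" and g0: "\<And>x. 0 \<le> g x" for K g x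
  proof -
    have [measurable]: "g \<in> borel_measurable borel" using g by (simp add: bfun_def)
    have nn: "ennreal (conv_op M f y) = (\<integral>\<^sup>+z. ennreal (f (y + z)) \<partial>M)"
      if "borel_prob M" "bfun K f" "\<And>x. 0 \<le> f x" for M f y
      unfolding conv_op_def using that by (intro nn_integral_eq_integral[symmetric] borel_prob_integrable) auto
    have "ennreal (\<alpha> * conv_op V g x) = ennreal \<alpha> * (\<integral>\<^sup>+z. ennreal ((u z)\<^sup>2) * ennreal (g (x + z)) \<partial>lborel)"
      using \<alpha> by (simp add: ennreal_mult' nn[OF V g g0]) (simp add: V_def nn_integral_density)
    also have "\<dots> = (\<integral>\<^sup>+z. ennreal (\<alpha> * (u z)\<^sup>2) * ennreal (g (x + z)) \<partial>lborel)"
      using \<alpha> by (simp add: nn_integral_cmult ennreal_mult' mult.assoc)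
    also have "\<dots> \<le> (\<integral>\<^sup>+z. ennreal \<kappa> * indicator (ball x0 r) z * ennreal (g (x + z)) \<partial>lborel)"
    proof (intro nn_integral_mono mult_right_mono)
      fix z
      have "u z = 0 \<or> z \<in> ball x0 r" using uc u0 by (metis antisym indicator_simps(2) mult_zero_right)
      moreover have "\<alpha> * (u z)\<^sup>2 \<le> \<kappa>" if "z \<in> ball x0 r"
      proof -
        have "u z \<le> c" using uc[rule_format, of z] that by simp
        then have "(u z)\<^sup>2 \<le> c\<^sup>2" using u0 by (intro power_mono) auto
        then have "\<alpha> * (u z)\<^sup>2 \<le> \<alpha> * c\<^sup>2" using \<alpha> by (intro mult_left_mono) auto
        then show ?thesis using \<alpha> by linarith
      qed
      ultimately show "ennreal (\<alpha> * (u z)\<^sup>2) \<le> ennreal \<kappa> * indicator (ball x0 r) z"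
        by (auto simp: indicator_def intro!: ennreal_leI)
    qed simp
    also have "\<dots> \<le> (\<integral>\<^sup>+y. \<integral>\<^sup>+z. ennreal (g (x + (y + z))) \<partial>q \<partial>q)"
      using low[rule_format, of "\<lambda>z. ennreal (g (x + z))"] by simp
    also have "\<dots> = (\<integral>\<^sup>+y. ennreal (conv_op q g (x + y)) \<partial>q)"
      by (simp add: nn[OF q g g0] add.assoc)
    also have "\<dots> = ennreal (conv_op q (conv_op q g) x)"
      by (rule nn[OF q conv_op_bfun[OF q g], symmetric]) (simp add: conv_op_def g0)
    finally show ?thesis
      by (subst (asm) ennreal_le_iff) (simp add: conv_op_def g0)
  qed
  define d where "d = 5 / 2 * sqrt C"
  have d0: "0 \<le> d" using C by (simp add: d_def)
  have smooth: "\<bar>(conv_op V ^^ k) g (x + w) - (conv_op V ^^ k) g x\<bar> \<le> K * (d * norm w / sqrt (real k))"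
    if "bfun K g" "0 < k" for K g k x w
    unfolding V_def d_def by (rule smooth_component_shift) (use that u0 iu C uC in auto)
  define \<epsilon> where "\<epsilon> n = 4 * (1 - \<alpha>) ^ (n div 2)" for n :: nat
  show ?thesis
  proof (rule that[of "8 * d\<^sup>2 / \<alpha>" \<epsilon>], safe)
    show "0 \<le> 8 * d\<^sup>2 / \<alpha>" using \<alpha> by simp
    have "filterlim (\<lambda>n::nat. n div 2) sequentially sequentially"
      unfolding filterlim_at_top
    proof
      fix Z :: nat
      show "\<forall>\<^sub>F n in sequentially. Z \<le> n div 2" using eventually_ge_at_top[of "2 * Z"] by eventually_elim auto
    qed
    moreover have "(\<lambda>n. (1 - \<alpha>) ^ n) \<longlonglongrightarrow> 0" using \<alpha> by (intro LIMSEQ_power_zero) auto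
    ultimately have "(\<lambda>n. (1 - \<alpha>) ^ (n div 2)) \<longlonglongrightarrow> 0" using filterlim_compose by blast
    then show "\<epsilon> \<longlonglongrightarrow> 0" unfolding \<epsilon>_def by (rule tendsto_mult_right_zero)
    fix n :: nat and K and g :: "real ^ 'p \<Rightarrow> real" and x w :: "real ^ 'p" assume n: "0 < n" and g: "bfun K g"
    define m where "m = n div 2"
    define g' where "g' = (conv_op q ^^ (n mod 2)) g"
    have g': "bfun K g'" unfolding g'_def by (rule conv_op_pow_bfun[OF q g])
    have nm: "n = 2 * m + n mod 2" by (simp add: m_def)
    have split: "(conv_op q ^^ n) g = (conv_op q ^^ (2 * m)) g'"
      unfolding g'_def by (subst nm) (simp add: funpow_add)
    have "\<bar>(conv_op q ^^ (2 * m)) ((conv_op V ^^ 0) g') (x + w) - (conv_op q ^^ (2 * m)) ((conv_op V ^^ 0) g') x\<bar>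
      \<le> K * sqrt (2 * (d * norm w)\<^sup>2 * (1 / (real 0 + 1 + \<alpha> / 2 * real m)) + (if (0::nat) = 0 then 4 * (1 - \<alpha>) ^ m else 0))"
      by (rule mixture_shift[OF q V _ _ dom smooth d0 g']) (use \<alpha> in auto)
    then have "\<bar>(conv_op q ^^ n) g (x + w) - (conv_op q ^^ n) g x\<bar>
        \<le> K * sqrt (2 * (d * norm w)\<^sup>2 * (1 / (1 + \<alpha> / 2 * real m)) + \<epsilon> n)"
      by (simp add: split \<epsilon>_def m_def)
    also have "\<dots> \<le> K * sqrt (8 * d\<^sup>2 / \<alpha> * (norm w / sqrt n)\<^sup>2 + \<epsilon> n)"
    proof (intro mult_left_mono real_sqrt_le_mono add_right_mono bfun_nonneg[OF g])
      have "real n \<le> 2 * real m + 1" using nm by linarith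
      then have "\<alpha> * real n \<le> \<alpha> * (2 * real m + 1)" using \<alpha> by (intro mult_left_mono) auto
      also have "\<dots> \<le> 4 * (1 + \<alpha> / 2 * real m)" using \<alpha> by (simp add: algebra_simps)
      finally have "1 / (1 + \<alpha> / 2 * real m) \<le> 4 / (\<alpha> * real n)"
        using \<alpha> n by (simp add: field_simps add_pos_nonneg)
      then have "2 * (d * norm w)\<^sup>2 * (1 / (1 + \<alpha> / 2 * real m)) \<le> 2 * (d * norm w)\<^sup>2 * (4 / (\<alpha> * real n))"
        by (intro mult_left_mono) auto
      also have "\<dots> = 8 * d\<^sup>2 / \<alpha> * (norm w / sqrt n)\<^sup>2"
        by (simp add: power_mult_distrib power_divide)
      finally show "2 * (d * norm w)\<^sup>2 * (1 / (1 + \<alpha> / 2 * real m)) \<le> 8 * d\<^sup>2 / \<alpha> * (norm w / sqrt n)\<^sup>2" .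
    qed
    finally show "\<bar>(conv_op q ^^ n) g (x + w) - (conv_op q ^^ n) g x\<bar> \<le> K * sqrt (8 * d\<^sup>2 / \<alpha> * (norm w / sqrt n)\<^sup>2 + \<epsilon> n)" .
  qed
qed

section \<open>Likelihood ratios at contiguous parameters\<close>

lemma integral_cauchy_schwarz:
  fixes f g :: "'a \<Rightarrow> real"
  assumes [measurable]: "f \<in> borel_measurable M" "g \<in> borel_measurable M"
    and f: "integrable M (\<lambda>x. (f x)\<^sup>2)" and g: "integrable M (\<lambda>x. (g x)\<^sup>2)"
  shows "integrable M (\<lambda>x. f x * g x)"
    and "\<bar>\<integral>x. f x * g x \<partial>M\<bar> \<le> sqrt (\<integral>x. (f x)\<^sup>2 \<partial>M) * sqrt (\<integral>x. (g x)\<^sup>2 \<partial>M)"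
proof -
  show int: "integrable M (\<lambda>x. f x * g x)"
  proof (rule Bochner_Integration.integrable_bound[OF Bochner_Integration.integrable_add[OF f g]])
    show "AE x in M. norm (f x * g x) \<le> norm ((f x)\<^sup>2 + (g x)\<^sup>2)"
    proof (rule AE_I2)
      fix x
      have "2 * (\<bar>f x\<bar> * \<bar>g x\<bar>) \<le> (f x)\<^sup>2 + (g x)\<^sup>2" using sum_squares_bound[of "\<bar>f x\<bar>" "\<bar>g x\<bar>"] by simp
      moreover have "0 \<le> \<bar>f x\<bar> * \<bar>g x\<bar>" by simp
      ultimately have "\<bar>f x\<bar> * \<bar>g x\<bar> \<le> (f x)\<^sup>2 + (g x)\<^sup>2" by linarith
      then show "norm (f x * g x) \<le> norm ((f x)\<^sup>2 + (g x)\<^sup>2)" by (simp add: abs_mult)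
    qed
  qed simp
  have "(\<integral>\<^sup>+x. ennreal \<bar>f x\<bar> * ennreal \<bar>g x\<bar> \<partial>M)\<^sup>2 \<le> (\<integral>\<^sup>+x. (ennreal \<bar>f x\<bar>)\<^sup>2 \<partial>M) * (\<integral>\<^sup>+x. (ennreal \<bar>g x\<bar>)\<^sup>2 \<partial>M)"
    by (rule Cauchy_Schwarz_nn_integral) auto
  moreover have "(\<integral>\<^sup>+x. ennreal \<bar>f x\<bar> * ennreal \<bar>g x\<bar> \<partial>M) = ennreal (\<integral>x. \<bar>f x * g x\<bar> \<partial>M)"
    using nn_integral_eq_integral[OF integrable_abs[OF int]] by (simp add: abs_mult ennreal_mult')
  moreover have "(\<integral>\<^sup>+x. (ennreal \<bar>f x\<bar>)\<^sup>2 \<partial>M) = ennreal (\<integral>x. (f x)\<^sup>2 \<partial>M)"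
    using f by (simp add: nn_integral_eq_integral ennreal_power)
  moreover have "(\<integral>\<^sup>+x. (ennreal \<bar>g x\<bar>)\<^sup>2 \<partial>M) = ennreal (\<integral>x. (g x)\<^sup>2 \<partial>M)"
    using g by (simp add: nn_integral_eq_integral ennreal_power)
  ultimately have "(\<integral>x. \<bar>f x * g x\<bar> \<partial>M)\<^sup>2 \<le> (\<integral>x. (f x)\<^sup>2 \<partial>M) * (\<integral>x. (g x)\<^sup>2 \<partial>M)"
    by (simp add: ennreal_power ennreal_mult'[symmetric])
  then have "(\<integral>x. \<bar>f x * g x\<bar> \<partial>M) \<le> sqrt ((\<integral>x. (f x)\<^sup>2 \<partial>M) * (\<integral>x. (g x)\<^sup>2 \<partial>M))"
    by (rule real_le_rsqrt)
  then show "\<bar>\<integral>x. f x * g x \<partial>M\<bar> \<le> sqrt (\<integral>x. (f x)\<^sup>2 \<partial>M) * sqrt (\<integral>x. (g x)\<^sup>2 \<partial>M)"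
    unfolding real_sqrt_mult by (rule order_trans[OF integral_abs_bound])
qed

lemma exp_linear_bound: "\<bar>exp a - 1 - a\<bar> \<le> exp \<bar>a\<bar> * \<bar>a\<bar>\<^sup>2" for a :: real
proof -
  have eq: "exp a - 1 - a = exp a - (\<Sum>i\<le>1. a ^ i / fact i)" by simp
  show ?thesis unfolding eq using Taylor_exp_field[of a 1] by (simp add: numeral_2_eq_2)
qed

context prob_space
begin

lemma exp_linear_error:
  fixes X :: "'a \<Rightarrow> real"
  assumes X[measurable]: "X \<in> borel_measurable M"
    and e: "0 < e" "integrable M (\<lambda>\<omega>. exp (e * \<bar>X \<omega>\<bar>))"
  shows "\<forall>\<^sub>F n in sequentially. integrable M (\<lambda>\<omega>. (exp (1 / 2 * (X \<omega> / sqrt (real n))) - 1 - 1 / 2 * (X \<omega> / sqrt (real n)))\<^sup>2)"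
    and "(\<lambda>n. real n * expectation (\<lambda>\<omega>. (exp (1 / 2 * (X \<omega> / sqrt (real n))) - 1 - 1 / 2 * (X \<omega> / sqrt (real n)))\<^sup>2)) \<longlonglongrightarrow> 0"
proof -
  let ?a = "\<lambda>n \<omega>. 1 / 2 * (X \<omega> / sqrt (real n))"
  define C where "C = expectation (\<lambda>\<omega>. \<bar>X \<omega>\<bar> ^ 4 * exp (e / 2 * \<bar>X \<omega>\<bar>))"
  have ie: "integrable M (\<lambda>\<omega>. \<bar>X \<omega>\<bar> ^ 4 * exp (e / 2 * \<bar>X \<omega>\<bar>))"
    by (rule integrable_exp_moment[OF X e]) (use e in auto)
  have sqrt_lim: "filterlim (\<lambda>n. sqrt (real n)) at_top sequentially"
    by (rule filterlim_compose[OF sqrt_at_top filterlim_real_sequentially])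
  have small: "\<forall>\<^sub>F n in sequentially. 2 / e \<le> sqrt (real n) \<and> 0 < n"
    using filterlim_at_top[THEN iffD1, OF sqrt_lim, rule_format, of "2 / e"]
      eventually_gt_at_top[of "0::nat"] by eventually_elim auto
  have bound: "(exp (?a n \<omega>) - 1 - ?a n \<omega>)\<^sup>2 \<le> 1 / (16 * (real n)\<^sup>2) * (\<bar>X \<omega>\<bar> ^ 4 * exp (e / 2 * \<bar>X \<omega>\<bar>))"
    if n: "2 / e \<le> sqrt (real n) \<and> 0 < n" for n \<omega>
  proof -
    have "\<bar>exp (?a n \<omega>) - 1 - ?a n \<omega>\<bar> \<le> exp \<bar>?a n \<omega>\<bar> * \<bar>?a n \<omega>\<bar>\<^sup>2"
      by (rule exp_linear_bound)
    then have "\<bar>exp (?a n \<omega>) - 1 - ?a n \<omega>\<bar>\<^sup>2 \<le> (exp \<bar>?a n \<omega>\<bar> * \<bar>?a n \<omega>\<bar>\<^sup>2)\<^sup>2"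
      by (rule power_mono) simp
    also have "\<dots> = exp (2 * \<bar>?a n \<omega>\<bar>) * \<bar>?a n \<omega>\<bar> ^ 4"
      by (simp only: power_mult_distrib exp_double power_mult[symmetric]) simp
    also have "\<dots> \<le> exp (e / 2 * \<bar>X \<omega>\<bar>) * \<bar>?a n \<omega>\<bar> ^ 4"
    proof (intro mult_right_mono)
      have "1 / sqrt n \<le> e / 2" using n e by (simp add: field_simps)
      then have "1 / sqrt n * \<bar>X \<omega>\<bar> \<le> e / 2 * \<bar>X \<omega>\<bar>" by (intro mult_right_mono) auto
      then show "exp (2 * \<bar>?a n \<omega>\<bar>) \<le> exp (e / 2 * \<bar>X \<omega>\<bar>)" by (simp add: abs_mult)
    qed simp
    also have "\<bar>?a n \<omega>\<bar> ^ 4 = \<bar>X \<omega>\<bar> ^ 4 / (16 * (real n)\<^sup>2)"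
    proof -
      have "sqrt (real n) ^ 4 = (real n)\<^sup>2" using power_mult[of "sqrt (real n)" 2 2] by simp
      then show ?thesis by (simp add: abs_mult power_mult_distrib power_divide)
    qed
    finally show ?thesis by (simp add: mult_ac)
  qed
  show "\<forall>\<^sub>F n in sequentially. integrable M (\<lambda>\<omega>. (exp (?a n \<omega>) - 1 - ?a n \<omega>)\<^sup>2)"
    using small
  proof eventually_elim
    case (elim n)
    show ?case
      by (rule Bochner_Integration.integrable_bound[OF integrable_mult_right[OF ie, of "1 / (16 * (real n)\<^sup>2)"]])
        (use bound[OF elim] in \<open>auto intro!: order_trans[OF _ abs_ge_self]\<close>)
  qed
  have "\<forall>\<^sub>F n in sequentially. norm (real n * expectation (\<lambda>\<omega>. (exp (?a n \<omega>) - 1 - ?a n \<omega>)\<^sup>2)) \<le> C / 16 * (1 / real n)"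
    using small
  proof eventually_elim
    case (elim n)
    have "expectation (\<lambda>\<omega>. (exp (?a n \<omega>) - 1 - ?a n \<omega>)\<^sup>2) \<le> expectation (\<lambda>\<omega>. 1 / (16 * (real n)\<^sup>2) * (\<bar>X \<omega>\<bar> ^ 4 * exp (e / 2 * \<bar>X \<omega>\<bar>)))"
      by (rule integral_mono'[OF integrable_mult_right[OF ie]]) (use bound[OF elim] in auto)
    also have "\<dots> = C / (16 * (real n)\<^sup>2)" by (simp add: C_def)
    finally have "real n * expectation (\<lambda>\<omega>. (exp (?a n \<omega>) - 1 - ?a n \<omega>)\<^sup>2) \<le> real n * (C / (16 * (real n)\<^sup>2))"
      by (rule mult_left_mono) simp
    also have "\<dots> = C / 16 * (1 / real n)" using elim by (simp add: power2_eq_square)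
    finally show ?case by simp
  qed
  moreover have "(\<lambda>n. C / 16 * (1 / real n)) \<longlonglongrightarrow> 0"
    by (rule tendsto_mult_right_zero) (rule lim_1_over_n)
  ultimately show "(\<lambda>n. real n * expectation (\<lambda>\<omega>. (exp (?a n \<omega>) - 1 - ?a n \<omega>)\<^sup>2)) \<longlonglongrightarrow> 0"
    by (rule Lim_null_comparison)
qed

text \<open>\<open>r n\<close> is the square root of the likelihood ratio of one observation, and \<open>exp (X / (2 \<surd>n))\<close> that of its Gaussian
  counterpart up to a constant. Both agree with \<open>1 + X / (2 \<surd>n)\<close> up to \<open>o(1 / n)\<close> in mean square, so
  their difference \<open>\<sigma>\<close> is negligible in
  \<open>r exp a = r + (exp (2 a) - exp a) + \<sigma> (exp a - 1)\<close> with \<open>a = X / (2 \<surd>n)\<close>, and the three means on the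
  right are known up to \<open>o(1 / n)\<close>: \<open>- v / 8 + (v / 2 - v / 8) = v / 4\<close>.\<close>

lemma affinity_expansion:
  fixes X :: "'a \<Rightarrow> real" and r :: "nat \<Rightarrow> 'a \<Rightarrow> real"
  assumes X[measurable]: "X \<in> borel_measurable M"
    and e: "0 < e" "integrable M (\<lambda>\<omega>. exp (e * \<bar>X \<omega>\<bar>))"
    and mean: "expectation X = 0" and var: "expectation (\<lambda>\<omega>. (X \<omega>)\<^sup>2) = v"
    and r: "\<forall>\<^sub>F n in sequentially. r n \<in> borel_measurable M \<and> integrable M (\<lambda>\<omega>. (r n \<omega>)\<^sup>2)"
    and aff: "(\<lambda>n. real n * (1 - expectation (r n))) \<longlonglongrightarrow> v / 8"
    and dqm: "(\<lambda>n. real n * expectation (\<lambda>\<omega>. (r n \<omega> - 1 - 1 / 2 * (X \<omega> / sqrt (real n)))\<^sup>2)) \<longlonglongrightarrow> 0"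
  shows "\<forall>\<^sub>F n in sequentially. integrable M (\<lambda>\<omega>. r n \<omega> * exp (1 / 2 * (X \<omega> / sqrt (real n))))"
    and "(\<lambda>n. real n * (expectation (\<lambda>\<omega>. r n \<omega> * exp (1 / 2 * (X \<omega> / sqrt (real n)))) - 1)) \<longlonglongrightarrow> v / 4"
proof -
  let ?a = "\<lambda>n \<omega>. 1 / 2 * (X \<omega> / sqrt (real n))"
  note E1 = exp_moment_expansion_real[OF X e mean var, of 1]
  note E2 = exp_moment_expansion_real[OF X e mean var, of "1 / 2"]
  note L = exp_linear_error[OF X e]
  have sq: "(exp (?a n \<omega>))\<^sup>2 = exp (1 * (X \<omega> / sqrt (real n)))" for n \<omega>
    by (simp flip: exp_double)
  have X2: "integrable M (\<lambda>\<omega>. (X \<omega>)\<^sup>2)" by (rule integrable_power_exp_moment[OF X e])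
  have X1: "integrable M X" using integrable_power_exp_moment[OF X e, of 1] by simp
  define \<sigma> where "\<sigma> n \<omega> = r n \<omega> - exp (?a n \<omega>)" for n \<omega>
  have ev: "\<forall>\<^sub>F n in sequentially. r n \<in> borel_measurable M \<and> integrable M (\<lambda>\<omega>. (r n \<omega>)\<^sup>2) \<and>
      integrable M (\<lambda>\<omega>. exp (1 * (X \<omega> / sqrt (real n)))) \<and> integrable M (\<lambda>\<omega>. exp (?a n \<omega>)) \<and>
      integrable M (\<lambda>\<omega>. (exp (?a n \<omega>) - 1 - ?a n \<omega>)\<^sup>2)"
    using r E1(1) E2(1) L(1) by eventually_elim auto
  have int: "integrable M (r n)" "integrable M (\<lambda>\<omega>. r n \<omega> * exp (?a n \<omega>))" "integrable M (\<lambda>\<omega>. (\<sigma> n \<omega>)\<^sup>2)"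
    "integrable M (\<lambda>\<omega>. (exp (?a n \<omega>) - 1)\<^sup>2)" "integrable M (\<lambda>\<omega>. (r n \<omega> - 1 - ?a n \<omega>)\<^sup>2)"
    if "r n \<in> borel_measurable M \<and> integrable M (\<lambda>\<omega>. (r n \<omega>)\<^sup>2) \<and>
      integrable M (\<lambda>\<omega>. exp (1 * (X \<omega> / sqrt (real n)))) \<and> integrable M (\<lambda>\<omega>. exp (?a n \<omega>)) \<and>
      integrable M (\<lambda>\<omega>. (exp (?a n \<omega>) - 1 - ?a n \<omega>)\<^sup>2)" for n
  proof -
    have [measurable]: "r n \<in> borel_measurable M" and r2: "integrable M (\<lambda>\<omega>. (r n \<omega>)\<^sup>2)"
      and x1: "integrable M (\<lambda>\<omega>. exp (?a n \<omega>))" using that by auto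
    have x2: "integrable M (\<lambda>\<omega>. (exp (?a n \<omega>))\<^sup>2)" unfolding sq using that by blast
    show r1: "integrable M (r n)"
      using integral_cauchy_schwarz(1)[OF _ _ r2, of "\<lambda>_. 1"] by simp
    show rx: "integrable M (\<lambda>\<omega>. r n \<omega> * exp (?a n \<omega>))"
      by (rule integral_cauchy_schwarz(1)[OF _ _ r2 x2]) auto
    show "integrable M (\<lambda>\<omega>. (\<sigma> n \<omega>)\<^sup>2)"
      unfolding \<sigma>_def power2_diff using r2 x2 rx by (simp add: mult.assoc)
    show "integrable M (\<lambda>\<omega>. (exp (?a n \<omega>) - 1)\<^sup>2)"
      unfolding power2_diff using x2 x1 by simp
    have rX: "integrable M (\<lambda>\<omega>. r n \<omega> * X \<omega>)"
      by (rule integral_cauchy_schwarz(1)[OF _ _ r2 X2]) auto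
    have "(r n \<omega> - 1 - ?a n \<omega>)\<^sup>2 = (r n \<omega>)\<^sup>2 + 1 + (1 / 2 / sqrt n)\<^sup>2 * (X \<omega>)\<^sup>2 - 2 * r n \<omega> - (1 / sqrt n) * (r n \<omega> * X \<omega>) + (1 / sqrt n) * X \<omega>" for \<omega>
      by (simp add: power2_eq_square algebra_simps)
    then show "integrable M (\<lambda>\<omega>. (r n \<omega> - 1 - ?a n \<omega>)\<^sup>2)"
      using r2 r1 X2 X1 rX by simp
  qed
  show "\<forall>\<^sub>F n in sequentially. integrable M (\<lambda>\<omega>. r n \<omega> * exp (?a n \<omega>))"
    using ev by eventually_elim (rule int(2))
  have "(\<lambda>n. real n * expectation (\<lambda>\<omega>. (\<sigma> n \<omega>)\<^sup>2)) \<longlonglongrightarrow> 0"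
  proof (rule Lim_null_comparison)
    show "\<forall>\<^sub>F n in sequentially. norm (real n * expectation (\<lambda>\<omega>. (\<sigma> n \<omega>)\<^sup>2))
        \<le> 2 * (real n * expectation (\<lambda>\<omega>. (r n \<omega> - 1 - ?a n \<omega>)\<^sup>2)) + 2 * (real n * expectation (\<lambda>\<omega>. (exp (?a n \<omega>) - 1 - ?a n \<omega>)\<^sup>2))"
      using ev
    proof eventually_elim
      case (elim n)
      have "expectation (\<lambda>\<omega>. (\<sigma> n \<omega>)\<^sup>2) \<le> expectation (\<lambda>\<omega>. 2 * (r n \<omega> - 1 - ?a n \<omega>)\<^sup>2 + 2 * (exp (?a n \<omega>) - 1 - ?a n \<omega>)\<^sup>2)"
      proof (rule integral_mono[OF int(3)[OF elim]])
        show "integrable M (\<lambda>\<omega>. 2 * (r n \<omega> - 1 - ?a n \<omega>)\<^sup>2 + 2 * (exp (?a n \<omega>) - 1 - ?a n \<omega>)\<^sup>2)"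
          using int(5)[OF elim] elim by (intro Bochner_Integration.integrable_add integrable_mult_right) auto
        have sqd: "(p - q)\<^sup>2 \<le> 2 * p\<^sup>2 + 2 * q\<^sup>2" for p q :: real
          using zero_le_power2[of "p + q"] by (simp add: power2_sum power2_diff)
        fix \<omega>
        have "\<sigma> n \<omega> = (r n \<omega> - 1 - ?a n \<omega>) - (exp (?a n \<omega>) - 1 - ?a n \<omega>)" by (simp add: \<sigma>_def)
        then show "(\<sigma> n \<omega>)\<^sup>2 \<le> 2 * (r n \<omega> - 1 - ?a n \<omega>)\<^sup>2 + 2 * (exp (?a n \<omega>) - 1 - ?a n \<omega>)\<^sup>2"
          using sqd by metis
      qed
      also have "\<dots> = 2 * expectation (\<lambda>\<omega>. (r n \<omega> - 1 - ?a n \<omega>)\<^sup>2) + 2 * expectation (\<lambda>\<omega>. (exp (?a n \<omega>) - 1 - ?a n \<omega>)\<^sup>2)"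
        using int(5)[OF elim] elim by (subst Bochner_Integration.integral_add) auto
      finally have "real n * expectation (\<lambda>\<omega>. (\<sigma> n \<omega>)\<^sup>2) \<le> real n * \<dots>" by (rule mult_left_mono) simp
      then show ?case by (simp add: algebra_simps)
    qed
    show "(\<lambda>n. 2 * (real n * expectation (\<lambda>\<omega>. (r n \<omega> - 1 - ?a n \<omega>)\<^sup>2)) + 2 * (real n * expectation (\<lambda>\<omega>. (exp (?a n \<omega>) - 1 - ?a n \<omega>)\<^sup>2))) \<longlonglongrightarrow> 0"
      using tendsto_add[OF tendsto_mult[OF tendsto_const[of 2] dqm] tendsto_mult[OF tendsto_const[of 2] L(2)]] by simp
  qed
  note S = this
  have F: "(\<lambda>n. real n * expectation (\<lambda>\<omega>. (exp (?a n \<omega>) - 1)\<^sup>2)) \<longlonglongrightarrow> v / 4"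
  proof -
    have lim: "(\<lambda>n. real n * (expectation (\<lambda>\<omega>. exp (1 * (X \<omega> / sqrt (real n)))) - 1) - 2 * (real n * (expectation (\<lambda>\<omega>. exp (?a n \<omega>)) - 1)))
        \<longlonglongrightarrow> 1\<^sup>2 * v / 2 - 2 * ((1 / 2)\<^sup>2 * v / 2)"
      by (intro tendsto_diff tendsto_mult tendsto_const E1(2) E2(2))
    have val: "1\<^sup>2 * v / 2 - 2 * ((1 / 2)\<^sup>2 * v / 2) = v / 4" by (simp add: power2_eq_square)
    have trans: "\<forall>\<^sub>F n in sequentially. real n * (expectation (\<lambda>\<omega>. exp (1 * (X \<omega> / sqrt (real n)))) - 1) - 2 * (real n * (expectation (\<lambda>\<omega>. exp (?a n \<omega>)) - 1))
        = real n * expectation (\<lambda>\<omega>. (exp (?a n \<omega>) - 1)\<^sup>2)"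
      using ev
    proof eventually_elim
      case (elim n)
      have eq: "expectation (\<lambda>\<omega>. (exp (?a n \<omega>) - 1)\<^sup>2) = expectation (\<lambda>\<omega>. exp (1 * (X \<omega> / sqrt (real n)))) + 1 - 2 * expectation (\<lambda>\<omega>. exp (?a n \<omega>))"
        unfolding power2_diff sq using elim by (simp add: prob_space)
      show ?case unfolding eq by (simp add: algebra_simps)
    qed
    show ?thesis using Lim_transform_eventually[OF lim trans] unfolding val .
  qed
  have cross: "(\<lambda>n. real n * expectation (\<lambda>\<omega>. \<sigma> n \<omega> * (exp (?a n \<omega>) - 1))) \<longlonglongrightarrow> 0"
  proof (rule Lim_null_comparison)
    show "\<forall>\<^sub>F n in sequentially. norm (real n * expectation (\<lambda>\<omega>. \<sigma> n \<omega> * (exp (?a n \<omega>) - 1)))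
        \<le> sqrt (real n * expectation (\<lambda>\<omega>. (\<sigma> n \<omega>)\<^sup>2)) * sqrt (real n * expectation (\<lambda>\<omega>. (exp (?a n \<omega>) - 1)\<^sup>2))"
      using ev
    proof eventually_elim
      case (elim n)
      have [measurable]: "r n \<in> borel_measurable M" using elim by simp
      have "\<bar>expectation (\<lambda>\<omega>. \<sigma> n \<omega> * (exp (?a n \<omega>) - 1))\<bar>
          \<le> sqrt (expectation (\<lambda>\<omega>. (\<sigma> n \<omega>)\<^sup>2)) * sqrt (expectation (\<lambda>\<omega>. (exp (?a n \<omega>) - 1)\<^sup>2))"
        by (rule integral_cauchy_schwarz(2)[OF _ _ int(3)[OF elim] int(4)[OF elim]]) (simp_all add: \<sigma>_def)
      then have "real n * \<bar>expectation (\<lambda>\<omega>. \<sigma> n \<omega> * (exp (?a n \<omega>) - 1))\<bar>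
          \<le> (sqrt n * sqrt n) * (sqrt (expectation (\<lambda>\<omega>. (\<sigma> n \<omega>)\<^sup>2)) * sqrt (expectation (\<lambda>\<omega>. (exp (?a n \<omega>) - 1)\<^sup>2)))"
        by (simp add: mult_left_mono)
      then show ?case by (simp only: real_sqrt_mult real_norm_def abs_mult abs_of_nat mult_ac)
    qed
    show "(\<lambda>n. sqrt (real n * expectation (\<lambda>\<omega>. (\<sigma> n \<omega>)\<^sup>2)) * sqrt (real n * expectation (\<lambda>\<omega>. (exp (?a n \<omega>) - 1)\<^sup>2))) \<longlonglongrightarrow> 0"
      using tendsto_mult[OF tendsto_real_sqrt[OF S] tendsto_real_sqrt[OF F]] by simp
  qed
  have lim: "(\<lambda>n. - (real n * (1 - expectation (r n))) + real n * (expectation (\<lambda>\<omega>. exp (1 * (X \<omega> / sqrt (real n)))) - 1)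
      - real n * (expectation (\<lambda>\<omega>. exp (?a n \<omega>)) - 1) + real n * expectation (\<lambda>\<omega>. \<sigma> n \<omega> * (exp (?a n \<omega>) - 1)))
      \<longlonglongrightarrow> - (v / 8) + 1\<^sup>2 * v / 2 - (1 / 2)\<^sup>2 * v / 2 + 0"
    by (intro tendsto_add tendsto_diff tendsto_minus aff E1(2) E2(2) cross)
  have val: "- (v / 8) + 1\<^sup>2 * v / 2 - (1 / 2)\<^sup>2 * v / 2 + 0 = v / 4" by (simp add: power2_eq_square)
  have trans: "\<forall>\<^sub>F n in sequentially. - (real n * (1 - expectation (r n))) + real n * (expectation (\<lambda>\<omega>. exp (1 * (X \<omega> / sqrt (real n)))) - 1)
      - real n * (expectation (\<lambda>\<omega>. exp (?a n \<omega>)) - 1) + real n * expectation (\<lambda>\<omega>. \<sigma> n \<omega> * (exp (?a n \<omega>) - 1))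
      = real n * (expectation (\<lambda>\<omega>. r n \<omega> * exp (?a n \<omega>)) - 1)"
    using ev
  proof eventually_elim
    case (elim n)
    have [measurable]: "r n \<in> borel_measurable M" using elim by simp
    have "integrable M (\<lambda>\<omega>. \<sigma> n \<omega> * (exp (?a n \<omega>) - 1))"
      by (rule integral_cauchy_schwarz(1)[OF _ _ int(3)[OF elim] int(4)[OF elim]]) (simp_all add: \<sigma>_def)
    moreover have "r n \<omega> * exp (?a n \<omega>) = r n \<omega> + (exp (1 * (X \<omega> / sqrt (real n))) - exp (?a n \<omega>)) + \<sigma> n \<omega> * (exp (?a n \<omega>) - 1)" for \<omega>
      unfolding sq[symmetric] \<sigma>_def by (simp add: power2_eq_square algebra_simps)
    ultimately have eq: "expectation (\<lambda>\<omega>. r n \<omega> * exp (?a n \<omega>)) = expectation (r n) + (expectation (\<lambda>\<omega>. exp (1 * (X \<omega> / sqrt (real n))))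
        - expectation (\<lambda>\<omega>. exp (?a n \<omega>))) + expectation (\<lambda>\<omega>. \<sigma> n \<omega> * (exp (?a n \<omega>) - 1))"
      using elim int(1)[OF elim] by simp
    show ?case unfolding eq by (simp add: algebra_simps)
  qed
  show "(\<lambda>n. real n * (expectation (\<lambda>\<omega>. r n \<omega> * exp (?a n \<omega>)) - 1)) \<longlonglongrightarrow> v / 4"
    using Lim_transform_eventually[OF lim trans] unfolding val .
qed

text \<open>Write \<open>A\<^sup>2\<close> and \<open>B\<^sup>2\<close> for the likelihood ratio and its Gaussian form. The affinity \<open>E[A B]\<close> is \<open>exp (- v / 4)\<close>
  times the \<open>n\<close>-th power of \<open>1 + v / (4 n) + o(1 / n)\<close> and tends to \<open>1\<close>, while \<open>E[A\<^sup>2] \<le> 1\<close> and \<open>E[B\<^sup>2] \<longlonglongrightarrow> 1\<close>.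
  Hence \<open>E[(A - B)\<^sup>2] \<longlonglongrightarrow> 0\<close>, and the Cauchy-Schwarz inequality applied to
  \<open>A\<^sup>2 - B\<^sup>2 = (A - B) (A + B)\<close> gives convergence in \<open>L\<^sup>1\<close>.\<close>

lemma likelihood_ratio_L1:
  fixes X :: "'a \<Rightarrow> real" and r :: "nat \<Rightarrow> 'a \<Rightarrow> real"
  assumes X[measurable]: "X \<in> borel_measurable M"
    and e: "0 < e" "integrable M (\<lambda>\<omega>. exp (e * \<bar>X \<omega>\<bar>))"
    and mean: "expectation X = 0" and var: "expectation (\<lambda>\<omega>. (X \<omega>)\<^sup>2) = v"
    and r: "\<forall>\<^sub>F n in sequentially. r n \<in> borel_measurable M \<and> integrable M (\<lambda>\<omega>. (r n \<omega>)\<^sup>2)"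
    and r1: "\<forall>\<^sub>F n in sequentially. expectation (\<lambda>\<omega>. (r n \<omega>)\<^sup>2) \<le> 1"
    and aff: "(\<lambda>n. real n * (1 - expectation (r n))) \<longlonglongrightarrow> v / 8"
    and dqm: "(\<lambda>n. real n * expectation (\<lambda>\<omega>. (r n \<omega> - 1 - 1 / 2 * (X \<omega> / sqrt (real n)))\<^sup>2)) \<longlonglongrightarrow> 0"
  defines "P \<equiv> \<lambda>n. Pi\<^sub>M {..<n} (\<lambda>_::nat. M)"
    and "LR \<equiv> \<lambda>n y. \<Prod>i<n. (r n (y i))\<^sup>2"
    and "LL \<equiv> \<lambda>n y. exp ((\<Sum>i<n. X (y i)) / sqrt (real n) - v / 2)"
  shows "\<forall>\<^sub>F n in sequentially. integrable (P n) (LR n) \<and> integrable (P n) (LL n)"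
    and "(\<lambda>n. \<integral>y. LL n y \<partial>P n) \<longlonglongrightarrow> 1"
    and "(\<lambda>n. \<integral>y. \<bar>LR n y - LL n y\<bar> \<partial>P n) \<longlonglongrightarrow> 0"
    and "(\<lambda>n. \<integral>y. LR n y \<partial>P n) \<longlonglongrightarrow> 1"
proof -
  have sf: "sigma_finite_measure M" by (rule sigma_finite_measure_axioms)
  define A where "A n y = (\<Prod>i<n. r n (y i))" for n y
  define B where "B n y = exp (1 / 2 * ((\<Sum>i<n. X (y i)) / sqrt (real n)) - v / 4)" for n y
  note S = exp_sum_limit_real[OF X e mean var, of 1]
  note F = affinity_expansion[OF X e mean var r aff dqm]
  have A2: "(A n y)\<^sup>2 = LR n y" for n y by (simp add: A_def LR_def prod_power_distrib)
  have B2: "(B n y)\<^sup>2 = LL n y" for n y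
    by (simp add: B_def LL_def flip: exp_double) 
  have LLe: "LL n y = exp (- v / 2) * exp (1 * ((\<Sum>i<n. X (y i)) / sqrt (real n)))" for n y
    by (simp add: LL_def mult_exp_exp)
  have AB: "A n y * B n y = exp (- v / 4) * (\<Prod>i<n. r n (y i) * exp (1 / 2 * (X (y i) / sqrt (real n))))" for n y
  proof -
    have "(\<Prod>i<n. exp (1 / 2 * (X (y i) / sqrt (real n)))) = exp (1 / 2 * ((\<Sum>i<n. X (y i)) / sqrt (real n)))"
      by (subst exp_sum[symmetric]) (simp_all add: sum_divide_distrib sum_distrib_left)
    moreover have "B n y = exp (- v / 4) * exp (1 / 2 * ((\<Sum>i<n. X (y i)) / sqrt (real n)))"
      unfolding B_def exp_add[symmetric] by (rule arg_cong[of _ _ exp]) simp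
    ultimately show ?thesis by (simp only: A_def prod.distrib mult_ac)
  qed
  have ev: "\<forall>\<^sub>F n in sequentially. r n \<in> borel_measurable M \<and> integrable M (\<lambda>\<omega>. (r n \<omega>)\<^sup>2) \<and>
      expectation (\<lambda>\<omega>. (r n \<omega>)\<^sup>2) \<le> 1 \<and> integrable (P n) (LL n) \<and>
      integrable M (\<lambda>\<omega>. r n \<omega> * exp (1 / 2 * (X \<omega> / sqrt (real n))))"
    using r r1 S(1) F(1)
  proof eventually_elim
    case (elim n)
    then show ?case unfolding P_def LLe[abs_def] by (auto intro!: integrable_mult_right)
  qed
  have props: "integrable (P n) (LR n)" "(\<integral>y. LR n y \<partial>P n) \<le> 1" "integrable (P n) (\<lambda>y. A n y * B n y)"
    "(\<integral>y. A n y * B n y \<partial>P n) = exp (- v / 4) * expectation (\<lambda>\<omega>. r n \<omega> * exp (1 / 2 * (X \<omega> / sqrt (real n)))) ^ n"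
    "A n \<in> borel_measurable (P n)" "B n \<in> borel_measurable (P n)"
    if n: "r n \<in> borel_measurable M \<and> integrable M (\<lambda>\<omega>. (r n \<omega>)\<^sup>2) \<and>
      expectation (\<lambda>\<omega>. (r n \<omega>)\<^sup>2) \<le> 1 \<and> integrable (P n) (LL n) \<and>
      integrable M (\<lambda>\<omega>. r n \<omega> * exp (1 / 2 * (X \<omega> / sqrt (real n))))" for n
  proof -
    have [measurable]: "r n \<in> borel_measurable M" using n by blast
    show "integrable (P n) (LR n)" unfolding P_def LR_def by (rule integral_PiM_power[OF sf]) (use n in blast)
    have "(\<integral>y. LR n y \<partial>P n) = expectation (\<lambda>\<omega>. (r n \<omega>)\<^sup>2) ^ n"
      unfolding P_def LR_def by (rule integral_PiM_power[OF sf]) (use n in blast)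
    then show "(\<integral>y. LR n y \<partial>P n) \<le> 1" using n by (simp add: power_le_one)
    show "integrable (P n) (\<lambda>y. A n y * B n y)"
      unfolding P_def AB by (intro integrable_mult_right integral_PiM_power[OF sf]) (use n in blast)
    show "(\<integral>y. A n y * B n y \<partial>P n) = exp (- v / 4) * expectation (\<lambda>\<omega>. r n \<omega> * exp (1 / 2 * (X \<omega> / sqrt (real n)))) ^ n"
      unfolding P_def AB integral_mult_right_zero by (subst integral_PiM_power[OF sf]) (use n in auto)
    show "A n \<in> borel_measurable (P n)" unfolding A_def P_def by measurable
    show "B n \<in> borel_measurable (P n)" unfolding B_def P_def by measurable
  qed
  show "\<forall>\<^sub>F n in sequentially. integrable (P n) (LR n) \<and> integrable (P n) (LL n)"
    using ev by eventually_elim (use props(1) in auto)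
  have "(\<lambda>n. exp (- v / 2) * (\<integral>y. exp (1 * ((\<Sum>i<n. X (y i)) / sqrt (real n))) \<partial>P n)) \<longlonglongrightarrow> exp (- v / 2) * exp (1\<^sup>2 * v / 2)"
    unfolding P_def by (intro tendsto_mult tendsto_const S(2))
  then show LL1: "(\<lambda>n. \<integral>y. LL n y \<partial>P n) \<longlonglongrightarrow> 1"
    unfolding LLe integral_mult_right_zero by (simp add: mult_exp_exp)
  have "(\<lambda>n. exp (- v / 4) * expectation (\<lambda>\<omega>. r n \<omega> * exp (1 / 2 * (X \<omega> / sqrt (real n)))) ^ n) \<longlonglongrightarrow> exp (- v / 4) * exp (v / 4)"
    by (intro tendsto_mult tendsto_const tendsto_power_exp_real F(2))
  then have AB1: "(\<lambda>n. exp (- v / 4) * expectation (\<lambda>\<omega>. r n \<omega> * exp (1 / 2 * (X \<omega> / sqrt (real n)))) ^ n) \<longlonglongrightarrow> 1"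
    by (simp add: mult_exp_exp)
  show L1: "(\<lambda>n. \<integral>y. \<bar>LR n y - LL n y\<bar> \<partial>P n) \<longlonglongrightarrow> 0"
  proof (rule Lim_null_comparison)
    let ?c = "\<lambda>n. exp (- v / 4) * expectation (\<lambda>\<omega>. r n \<omega> * exp (1 / 2 * (X \<omega> / sqrt (real n)))) ^ n"
    let ?l = "\<lambda>n. \<integral>y. LL n y \<partial>P n"
    show "\<forall>\<^sub>F n in sequentially. norm (\<integral>y. \<bar>LR n y - LL n y\<bar> \<partial>P n) \<le> sqrt (1 + ?l n - 2 * ?c n) * sqrt (2 * (1 + ?l n))"
      using ev
    proof eventually_elim
      case (elim n)
      note p = props[OF elim]
      have iLL: "integrable (P n) (LL n)" using elim by blast
      have [measurable]: "A n \<in> borel_measurable (P n)" "B n \<in> borel_measurable (P n)" by (rule p)+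
      have i1: "integrable (P n) (\<lambda>y. \<bar>A n y - B n y\<bar>\<^sup>2)" and e1: "(\<integral>y. \<bar>A n y - B n y\<bar>\<^sup>2 \<partial>P n) \<le> 1 + ?l n - 2 * ?c n"
        using p(1,2,3,4) iLL by (simp_all add: power2_diff A2 B2 mult.assoc)
      have i2: "integrable (P n) (\<lambda>y. \<bar>A n y + B n y\<bar>\<^sup>2)"
        using p(1,3) iLL by (simp add: power2_sum A2 B2 mult.assoc)
      have "(\<integral>y. \<bar>A n y + B n y\<bar>\<^sup>2 \<partial>P n) \<le> (\<integral>y. 2 * (LR n y + LL n y) \<partial>P n)"
      proof (rule integral_mono[OF i2])
        show "integrable (P n) (\<lambda>y. 2 * (LR n y + LL n y))" using p(1) iLL by simp
        fix y
        have "0 \<le> (A n y - B n y)\<^sup>2" by simp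
        then show "\<bar>A n y + B n y\<bar>\<^sup>2 \<le> 2 * (LR n y + LL n y)" by (simp add: power2_sum power2_diff A2 B2)
      qed
      also have "\<dots> \<le> 2 * (1 + ?l n)" using p(1,2) iLL by simp
      finally have e2: "(\<integral>y. \<bar>A n y + B n y\<bar>\<^sup>2 \<partial>P n) \<le> 2 * (1 + ?l n)" .
      have "\<bar>LR n y - LL n y\<bar> = \<bar>A n y - B n y\<bar> * \<bar>A n y + B n y\<bar>" for y
        by (simp add: abs_mult[symmetric] A2[symmetric] B2[symmetric] power2_eq_square algebra_simps)
      then have "\<bar>\<integral>y. \<bar>LR n y - LL n y\<bar> \<partial>P n\<bar> = \<bar>\<integral>y. \<bar>A n y - B n y\<bar> * \<bar>A n y + B n y\<bar> \<partial>P n\<bar>" by simp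
      also have "\<dots> \<le> sqrt (\<integral>y. \<bar>A n y - B n y\<bar>\<^sup>2 \<partial>P n) * sqrt (\<integral>y. \<bar>A n y + B n y\<bar>\<^sup>2 \<partial>P n)"
        by (rule integral_cauchy_schwarz(2)[OF _ _ i1 i2]) auto
      also have "\<dots> \<le> sqrt (1 + ?l n - 2 * ?c n) * sqrt (2 * (1 + ?l n))"
        by (intro mult_mono real_sqrt_le_mono e1 e2 real_sqrt_ge_zero order_trans[OF _ e1]) auto
      finally show ?case by simp
    qed
    have "(\<lambda>n. sqrt (1 + ?l n - 2 * ?c n) * sqrt (2 * (1 + ?l n))) \<longlonglongrightarrow> sqrt (1 + 1 - 2 * 1) * sqrt (2 * (1 + 1))"
      by (intro tendsto_mult tendsto_real_sqrt tendsto_add tendsto_diff tendsto_const LL1 AB1)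
    then show "(\<lambda>n. sqrt (1 + ?l n - 2 * ?c n) * sqrt (2 * (1 + ?l n))) \<longlonglongrightarrow> 0" by simp
  qed
  have "(\<lambda>n. (\<integral>y. LR n y \<partial>P n) - (\<integral>y. LL n y \<partial>P n)) \<longlonglongrightarrow> 0"
  proof (rule Lim_null_comparison[OF _ L1])
    show "\<forall>\<^sub>F n in sequentially. norm ((\<integral>y. LR n y \<partial>P n) - (\<integral>y. LL n y \<partial>P n)) \<le> (\<integral>y. \<bar>LR n y - LL n y\<bar> \<partial>P n)"
      using ev
    proof eventually_elim
      case (elim n)
      have "(\<integral>y. LR n y \<partial>P n) - (\<integral>y. LL n y \<partial>P n) = (\<integral>y. LR n y - LL n y \<partial>P n)"
        using props(1)[OF elim] elim by simp
      then show ?case by simp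
    qed
  qed
  from tendsto_add[OF this LL1] show "(\<lambda>n. \<integral>y. LR n y \<partial>P n) \<longlonglongrightarrow> 1" by simp
qed

end

lemma PiM_density:
  fixes g :: "'a \<Rightarrow> ennreal"
  assumes P: "sigma_finite_measure P" and sf: "sigma_finite_measure (density P g)"
    and g[measurable]: "g \<in> borel_measurable P"
  shows "Pi\<^sub>M {..<n::nat} (\<lambda>_. density P g) = density (Pi\<^sub>M {..<n} (\<lambda>_. P)) (\<lambda>y. \<Prod>i<n. g (y i))"
proof -
  interpret P: product_sigma_finite "\<lambda>_::nat. P" using P by (simp add: product_sigma_finite_def)
  interpret D: product_sigma_finite "\<lambda>_::nat. density P g" using sf by (simp add: product_sigma_finite_def)
  let ?L = "density (Pi\<^sub>M {..<n} (\<lambda>_. P)) (\<lambda>y. \<Prod>i<n. g (y i))"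
  have "?L = Pi\<^sub>M {..<n} (\<lambda>_. density P g)"
  proof (rule D.PiM_eqI)
    show "sets ?L = sets (Pi\<^sub>M {..<n} (\<lambda>_. density P g))" by (auto intro!: sets_PiM_cong)
  next
    fix A assume A: "\<And>i. i \<in> {..<n} \<Longrightarrow> A i \<in> sets (density P g)"
    then have A'[measurable]: "\<And>i. i < n \<Longrightarrow> A i \<in> sets P" by simp
    have "emeasure ?L (Pi\<^sub>E {..<n} A) = (\<integral>\<^sup>+y. (\<Prod>i<n. g (y i)) * indicator (Pi\<^sub>E {..<n} A) y \<partial>Pi\<^sub>M {..<n} (\<lambda>_. P))"
      by (intro emeasure_density sets_PiM_I_finite) (auto simp: A')
    also have "\<dots> = (\<integral>\<^sup>+y. (\<Prod>i<n. g (y i) * indicator (A i) (y i)) \<partial>Pi\<^sub>M {..<n} (\<lambda>_. P))"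
    proof (rule nn_integral_cong)
      fix y assume y: "y \<in> space (Pi\<^sub>M {..<n} (\<lambda>_. P))"
      have "indicator (Pi\<^sub>E {..<n} A) y = (\<Prod>i<n. indicator (A i) (y i) :: ennreal)"
        using y by (auto simp: indicator_def space_PiM PiE_iff split: if_splits)
      then show "(\<Prod>i<n. g (y i)) * indicator (Pi\<^sub>E {..<n} A) y = (\<Prod>i<n. g (y i) * indicator (A i) (y i))"
        by (simp add: prod.distrib)
    qed
    also have "\<dots> = (\<Prod>i<n. \<integral>\<^sup>+y. g y * indicator (A i) y \<partial>P)"
      by (rule P.product_nn_integral_prod) (auto simp: A')
    also have "\<dots> = (\<Prod>i\<in>{..<n}. emeasure (density P g) (A i))"
      by (intro prod.cong refl) (auto simp: emeasure_density A')
    finally show "emeasure ?L (Pi\<^sub>E {..<n} A) = (\<Prod>i\<in>{..<n}. emeasure (density P g) (A i))" .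
  qed simp
  then show ?thesis ..
qed

text \<open>\<open>LR\<close> is the density of the part of the law under \<open>\<theta>'\<close> that lives on the set where all \<open>f \<theta> (y i)\<close> are positive;
  the other part has the mass that \<open>LR\<close> lacks to integrate to \<open>1\<close>. Both laws are compared as densities
  with respect to probability measures, as \<open>\<mu>\<close> may fail to be \<open>\<sigma>\<close>-finite.\<close>

lemma change_of_measure:
  fixes p :: "(nat \<Rightarrow> 'y) \<Rightarrow> real"
  assumes fam: "density_family \<mu> \<Theta> f" and t: "\<theta> \<in> \<Theta>" and t': "\<theta>' \<in> \<Theta>"
    and p[measurable]: "p \<in> borel_measurable (Pi\<^sub>M {..<n} (\<lambda>_. \<mu>))"
    and pb: "\<And>y. y \<in> space (Pi\<^sub>M {..<n} (\<lambda>_. \<mu>)) \<Longrightarrow> 0 \<le> p y \<and> p y \<le> B" and B: "0 \<le> B"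
  defines "LR \<equiv> \<lambda>y. \<Prod>i<n. f \<theta>' (y i) / f \<theta> (y i)"
  shows "\<bar>(\<integral>y. p y \<partial>base_prod \<mu> f \<theta>' n) - (\<integral>y. p y * LR y \<partial>base_prod \<mu> f \<theta> n)\<bar>
    \<le> B * (1 - (\<integral>y. LR y \<partial>base_prod \<mu> f \<theta> n))"
proof -
  have f[measurable]: "f \<theta> \<in> borel_measurable \<mu>" "f \<theta>' \<in> borel_measurable \<mu>"
    and f0: "\<And>y. y \<in> space \<mu> \<Longrightarrow> 0 \<le> f \<theta> y" "\<And>y. y \<in> space \<mu> \<Longrightarrow> 0 \<le> f \<theta>' y"
    and P: "prob_space (base_dist \<mu> f \<theta>)" and P': "prob_space (base_dist \<mu> f \<theta>')"
    using fam t t' by (auto simp: density_family_def)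
  interpret P: prob_space "base_dist \<mu> f \<theta>" by fact
  interpret P': prob_space "base_dist \<mu> f \<theta>'" by fact
  have sets_b[simp, measurable_cong]: "sets (base_dist \<mu> f t) = sets \<mu>" for t by (simp add: base_dist_def)
  have space_b[simp]: "space (base_dist \<mu> f t) = space \<mu>" for t by (simp add: base_dist_def)
  interpret PP': prob_space "base_prod \<mu> f \<theta>' n"
    unfolding base_prod_def by (rule prob_space_PiM) (rule P')
  define S where "S = {y \<in> space \<mu>. 0 < f \<theta> y}"
  have [measurable]: "S \<in> sets \<mu>" unfolding S_def by measurable
  let ?r = "\<lambda>y. ennreal (f \<theta>' y / f \<theta> y)"
  let ?i = "\<lambda>y. indicator S y :: ennreal"
  have D: "density (base_dist \<mu> f \<theta>) ?r = density (base_dist \<mu> f \<theta>') ?i"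
    unfolding base_dist_def
    by (subst (1 2) density_density_eq, (simp; fail)+, rule density_cong)
      (auto simp: S_def indicator_def ennreal_mult'[symmetric] f0 intro!: AE_I2 dest: f0)
  have finD: "finite_measure (density (base_dist \<mu> f \<theta>') ?i)"
  proof
    have "emeasure (density (base_dist \<mu> f \<theta>') ?i) (space (density (base_dist \<mu> f \<theta>') ?i)) \<le> emeasure (base_dist \<mu> f \<theta>') (space \<mu>)"
      by (subst emeasure_density) (auto intro!: nn_integral_mono simp: indicator_def simp flip: nn_integral_indicator)
    then show "emeasure (density (base_dist \<mu> f \<theta>') ?i) (space (density (base_dist \<mu> f \<theta>') ?i)) \<noteq> \<infinity>"
      using P'.emeasure_space_1 by (auto simp: top_unique)
  qed
  then have sfD: "sigma_finite_measure (density (base_dist \<mu> f \<theta>') ?i)" by (rule finite_measure.axioms)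
  define J where "J y = (\<Prod>i<n. indicator S (y i) :: real)" for y
  have LR[measurable]: "LR \<in> borel_measurable (Pi\<^sub>M {..<n} (\<lambda>_. \<mu>))" unfolding LR_def by measurable
  have J[measurable]: "J \<in> borel_measurable (Pi\<^sub>M {..<n} (\<lambda>_. \<mu>))" unfolding J_def by measurable
  have sets_pb[measurable_cong]: "sets (base_prod \<mu> f t n) = sets (Pi\<^sub>M {..<n} (\<lambda>_. \<mu>))" for t
    unfolding base_prod_def by (intro sets_PiM_cong) auto
  have space_pb: "space (base_prod \<mu> f t n) = space (Pi\<^sub>M {..<n} (\<lambda>_. \<mu>))" for t
    by (rule sets_eq_imp_space_eq[OF sets_pb])
  have LR0: "0 \<le> LR y" if "y \<in> space (Pi\<^sub>M {..<n} (\<lambda>_. \<mu>))" for y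
    using that f0 by (auto simp: LR_def space_PiM PiE_iff intro!: prod_nonneg divide_nonneg_nonneg)
  have J01: "0 \<le> J y" "J y \<le> 1" for y by (auto simp: J_def intro!: prod_nonneg prod_le_1)
  have eq: "density (base_prod \<mu> f \<theta> n) (\<lambda>y. ennreal (LR y)) = density (base_prod \<mu> f \<theta>' n) (\<lambda>y. ennreal (J y))"
  proof -
    have "density (base_prod \<mu> f \<theta> n) (\<lambda>y. ennreal (LR y)) = density (base_prod \<mu> f \<theta> n) (\<lambda>y. \<Prod>i<n. ?r (y i))"
      by (rule density_cong)
        (auto simp: LR_def space_pb space_PiM PiE_iff f0 base_prod_def[symmetric] intro!: AE_I2 prod_ennreal[symmetric] divide_nonneg_nonneg)
    also have "\<dots> = Pi\<^sub>M {..<n} (\<lambda>_. density (base_dist \<mu> f \<theta>) ?r)"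
      unfolding base_prod_def by (rule PiM_density[symmetric]) (auto simp: D sfD P.sigma_finite_measure_axioms)
    also have "\<dots> = density (base_prod \<mu> f \<theta>' n) (\<lambda>y. \<Prod>i<n. ?i (y i))"
      unfolding D base_prod_def by (rule PiM_density) (auto simp: sfD P'.sigma_finite_measure_axioms)
    also have "(\<lambda>y. \<Prod>i<n. ?i (y i)) = (\<lambda>y. ennreal (J y))"
      by (auto simp: J_def prod_ennreal[symmetric] ennreal_indicator)
    finally show ?thesis .
  qed
  have transfer: "(\<integral>y. g y * LR y \<partial>base_prod \<mu> f \<theta> n) = (\<integral>y. g y * J y \<partial>base_prod \<mu> f \<theta>' n)"
    if [measurable]: "g \<in> borel_measurable (Pi\<^sub>M {..<n} (\<lambda>_. \<mu>))" for g :: "_ \<Rightarrow> real"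
  proof -
    have "(\<integral>y. g y * LR y \<partial>base_prod \<mu> f \<theta> n) = (\<integral>y. g y \<partial>density (base_prod \<mu> f \<theta> n) (\<lambda>y. ennreal (LR y)))"
      by (subst integral_density) (auto simp: space_pb LR0 mult.commute intro!: AE_I2)
    also have "\<dots> = (\<integral>y. g y * J y \<partial>base_prod \<mu> f \<theta>' n)"
      unfolding eq by (subst integral_density) (auto simp: J01 mult.commute)
    finally show ?thesis .
  qed
  have ip: "integrable (base_prod \<mu> f \<theta>' n) p"
    by (rule PP'.integrable_const_bound[where B=B]) (auto simp: space_pb pb intro!: AE_I2)
  have ipJ: "integrable (base_prod \<mu> f \<theta>' n) (\<lambda>y. p y * J y)"
    by (rule PP'.integrable_const_bound[where B="B * 1"])
      (auto simp: space_pb pb abs_mult J01 B simp del: mult_1_right intro!: AE_I2 mult_mono)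
  have iJ: "integrable (base_prod \<mu> f \<theta>' n) J"
    by (rule PP'.integrable_const_bound[where B=1]) (auto simp: J01)
  have "(\<integral>y. p y \<partial>base_prod \<mu> f \<theta>' n) - (\<integral>y. p y * LR y \<partial>base_prod \<mu> f \<theta> n) = (\<integral>y. p y - p y * J y \<partial>base_prod \<mu> f \<theta>' n)"
    using ip ipJ by (simp add: transfer)
  also have "norm \<dots> \<le> (\<integral>y. B * (1 - J y) \<partial>base_prod \<mu> f \<theta>' n)"
  proof (rule norm_integral_le)
    show "integrable (base_prod \<mu> f \<theta>' n) (\<lambda>y. B * (1 - J y))" using iJ by simp
    fix y assume "y \<in> space (base_prod \<mu> f \<theta>' n)"
    then have "0 \<le> p y" "p y \<le> B" using pb by (auto simp: space_pb)
    moreover have "p y - p y * J y = p y * (1 - J y)" by (simp add: algebra_simps)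
    ultimately show "norm (p y - p y * J y) \<le> B * (1 - J y)" using J01[of y] by (simp add: abs_mult mult_right_mono)
  qed
  also have "\<dots> = B * (1 - (\<integral>y. J y \<partial>base_prod \<mu> f \<theta>' n))" using iJ by (simp add: PP'.prob_space)
  also have "(\<integral>y. J y \<partial>base_prod \<mu> f \<theta>' n) = (\<integral>y. LR y \<partial>base_prod \<mu> f \<theta> n)"
    using transfer[of "\<lambda>_. 1"] by simp
  finally show ?thesis by simp
qed

lemma exp_moment_direction:
  fixes s :: "'a \<Rightarrow> real ^ 'p"
  assumes "\<forall>\<^sub>F x in nhds 0. integrable P (\<lambda>y. exp (x \<bullet> s y))" and [measurable]: "s \<in> borel_measurable P"
  obtains e where "0 < e" "integrable P (\<lambda>y. exp (e * \<bar>v \<bullet> s y\<bar>))"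
proof -
  obtain d where d: "0 < d" "\<And>x. dist x 0 < d \<Longrightarrow> integrable P (\<lambda>y. exp (x \<bullet> s y))"
    using assms(1) by (auto simp: eventually_nhds_metric)
  define e where "e = d / 2 / (norm v + 1)"
  have nz: "0 < norm v + 1" by (simp add: add_nonneg_pos)
  have e: "0 < e" unfolding e_def using d nz by (intro divide_pos_pos) auto
  have "e * norm v < d"
  proof -
    have "e * norm v \<le> e * (norm v + 1)" using e by (intro mult_left_mono) auto
    also have "\<dots> = d / 2" unfolding e_def using nz by (metis less_irrefl nonzero_eq_divide_eq)
    finally show ?thesis using d by simp
  qed
  then have i: "integrable P (\<lambda>y. exp ((e *\<^sub>R v) \<bullet> s y))" "integrable P (\<lambda>y. exp (((- e) *\<^sub>R v) \<bullet> s y))"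
    using e by (intro d(2); simp)+
  have "integrable P (\<lambda>y. exp (e * \<bar>v \<bullet> s y\<bar>))"
  proof (rule Bochner_Integration.integrable_bound[OF Bochner_Integration.integrable_add[OF i]])
    show "AE y in P. norm (exp (e * \<bar>v \<bullet> s y\<bar>)) \<le> norm (exp ((e *\<^sub>R v) \<bullet> s y) + exp (((- e) *\<^sub>R v) \<bullet> s y))"
    proof (rule AE_I2)
      fix y
      have "exp (e * \<bar>a\<bar>) \<le> exp (e * a) + exp (- e * a)" for a :: real
        by (cases "0 \<le> a") (auto simp: less_imp_le)
      then show "norm (exp (e * \<bar>v \<bullet> s y\<bar>)) \<le> norm (exp ((e *\<^sub>R v) \<bullet> s y) + exp (((- e) *\<^sub>R v) \<bullet> s y))"
        by (simp add: abs_of_nonneg add_nonneg_nonneg)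
    qed
  qed measurable
  with e show ?thesis by (rule that)
qed

lemma fisher_quadratic_form:
  fixes s :: "real ^ 'p \<Rightarrow> 'y \<Rightarrow> real ^ 'p"
  assumes [measurable]: "s \<theta> \<in> borel_measurable (base_dist \<mu> f \<theta>)"
    and int: "\<And>v. integrable (base_dist \<mu> f \<theta>) (\<lambda>y. (v \<bullet> s \<theta> y)\<^sup>2)"
  shows "(\<integral>y. (v \<bullet> s \<theta> y)\<^sup>2 \<partial>base_dist \<mu> f \<theta>) = v \<bullet> (fisher_info \<mu> f s \<theta> *v v)"
proof -
  let ?P = "base_dist \<mu> f \<theta>"
  have c: "axis i 1 \<bullet> s \<theta> y = s \<theta> y $ i" for i y by (simp add: inner_axis' )
  have "(\<lambda>y. axis i 1 \<bullet> s \<theta> y) \<in> borel_measurable ?P" for i by measurable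
  then have m: "(\<lambda>y. s \<theta> y $ i) \<in> borel_measurable ?P" for i unfolding c .
  have ij: "integrable ?P (\<lambda>y. s \<theta> y $ i * s \<theta> y $ j)" for i j
    using integral_cauchy_schwarz(1)[OF _ _ int[of "axis i 1"] int[of "axis j 1"]] m unfolding c by blast
  have "(\<integral>y. (v \<bullet> s \<theta> y)\<^sup>2 \<partial>?P) = (\<integral>y. (\<Sum>i\<in>UNIV. \<Sum>j\<in>UNIV. v $ i * v $ j * (s \<theta> y $ i * s \<theta> y $ j)) \<partial>?P)"
    by (simp add: inner_vec_def power2_eq_square sum_product mult_ac)
  also have "\<dots> = (\<Sum>i\<in>UNIV. \<Sum>j\<in>UNIV. v $ i * v $ j * (\<integral>y. s \<theta> y $ i * s \<theta> y $ j \<partial>?P))"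
    using ij by (simp add: Bochner_Integration.integral_sum)
  also have "\<dots> = v \<bullet> (fisher_info \<mu> f s \<theta> *v v)"
    by (simp add: inner_vec_def matrix_vector_mult_def fisher_info_def sum_distrib_left mult_ac)
  finally show ?thesis .
qed


text \<open>\<open>1 - E[r]\<close> is half the squared \<open>L\<^sup>2(\<mu>)\<close> distance of the root densities, and that distance is read off from
  the expansion in quadratic mean. The distance has to be taken over the whole space: the set where
  \<open>f \<theta>\<close> vanishes carries part of the mass under the other parameter.\<close>

lemma dqm_local_expansion:
  fixes s :: "real ^ 'p \<Rightarrow> 'y \<Rightarrow> real ^ 'p" and hs :: "nat \<Rightarrow> real ^ 'p"
  assumes Th: "open \<Theta>" and fam: "density_family \<mu> \<Theta> f" and dqm: "diff_quadratic_mean \<mu> \<Theta> f s" and t: "\<theta> \<in> \<Theta>"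
    and int: "\<And>v. integrable (base_dist \<mu> f \<theta>) (\<lambda>y. (v \<bullet> s \<theta> y)\<^sup>2)" and hs: "hs \<longlonglongrightarrow> h"
  defines "P \<equiv> base_dist \<mu> f \<theta>" and "r \<equiv> \<lambda>n y. sqrt (f (\<theta> + (1 / sqrt (real n)) *\<^sub>R hs n) y / f \<theta> y)"
  shows "\<forall>\<^sub>F n in sequentially. \<theta> + (1 / sqrt (real n)) *\<^sub>R hs n \<in> \<Theta>"
    and "\<forall>\<^sub>F n in sequentially. r n \<in> borel_measurable P \<and> integrable P (\<lambda>y. (r n y)\<^sup>2)"
    and "\<forall>\<^sub>F n in sequentially. (\<integral>y. (r n y)\<^sup>2 \<partial>P) \<le> 1"
    and "(\<lambda>n. real n * (1 - (\<integral>y. r n y \<partial>P))) \<longlonglongrightarrow> (\<integral>y. (h \<bullet> s \<theta> y)\<^sup>2 \<partial>P) / 8"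
    and "(\<lambda>n. real n * (\<integral>y. (r n y - 1 - 1 / 2 * ((h \<bullet> s \<theta> y) / sqrt (real n)))\<^sup>2 \<partial>P)) \<longlonglongrightarrow> 0"
proof -
  define k where "k n = (1 / sqrt (real n)) *\<^sub>R hs n" for n
  have sm[measurable]: "s \<theta> \<in> borel_measurable \<mu>"
    and Rev: "\<forall>\<^sub>F h in at 0. integrable \<mu> (\<lambda>y. (dqm_remainder f s \<theta> h y)\<^sup>2)"
    and Ro: "(\<lambda>h. \<integral>y. (dqm_remainder f s \<theta> h y)\<^sup>2 \<partial>\<mu>) \<in> o[at 0](\<lambda>h. (norm h)\<^sup>2)"
    using dqm t by (auto simp: diff_quadratic_mean_def)
  have fm[measurable]: "f \<theta> \<in> borel_measurable \<mu>" and f0: "\<And>y. y \<in> space \<mu> \<Longrightarrow> 0 \<le> f \<theta> y"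
    using fam t by (auto simp: density_family_def)
  have sP[measurable]: "s \<theta> \<in> borel_measurable P" by (simp add: P_def base_dist_def)
  have spP: "space P = space \<mu>" by (simp add: P_def base_dist_def)
  have Pint: "(\<integral>y. g y \<partial>P) = (\<integral>y. f \<theta> y * g y \<partial>\<mu>)" "integrable P g \<longleftrightarrow> integrable \<mu> (\<lambda>y. f \<theta> y * g y)"
    if [measurable]: "g \<in> borel_measurable \<mu>" for g :: "'y \<Rightarrow> real"
    unfolding P_def base_dist_def using f0
    by (auto simp: integral_density integrable_density intro!: AE_I2)
  define Q where "Q v = (\<integral>y. (v \<bullet> s \<theta> y)\<^sup>2 \<partial>P)" for v
  have Qf: "Q v = v \<bullet> (fisher_info \<mu> f s \<theta> *v v)" for v
    unfolding Q_def P_def by (rule fisher_quadratic_form) (use sP int in \<open>simp_all add: P_def\<close>)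
  have Qlim: "(\<lambda>n. Q (v n)) \<longlonglongrightarrow> Q w" if "v \<longlonglongrightarrow> w" for v w
    unfolding Qf by (intro tendsto_inner that bounded_linear.tendsto[OF matrix_vector_mul_bounded_linear])
  have Q2: "Q (c *\<^sub>R v) = c\<^sup>2 * Q v" for c v by (simp add: Q_def power_mult_distrib)
  have sqrt_lim: "filterlim (\<lambda>n. sqrt (real n)) at_top sequentially"
    by (rule filterlim_compose[OF sqrt_at_top filterlim_real_sequentially])
  have k0: "k \<longlonglongrightarrow> 0"
    unfolding k_def using tendsto_scaleR[OF tendsto_divide_0[OF tendsto_const filterlim_at_top_imp_at_infinity[OF sqrt_lim]] hs]
    by simp
  have kTh: "\<forall>\<^sub>F n in sequentially. \<theta> + k n \<in> \<Theta>"
    using topological_tendstoD[OF tendsto_add[OF tendsto_const[of \<theta>] k0] Th] t by simp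
  then show "\<forall>\<^sub>F n in sequentially. \<theta> + (1 / sqrt (real n)) *\<^sub>R hs n \<in> \<Theta>" by (simp add: k_def)
  have R0: "dqm_remainder f s \<theta> 0 y = 0" for y by (simp add: dqm_remainder_def)
  have "\<forall>\<^sub>F h in nhds 0. integrable \<mu> (\<lambda>y. (dqm_remainder f s \<theta> h y)\<^sup>2)"
    using Rev unfolding eventually_at_filter by eventually_elim (use R0 in auto)
  then have Rk: "\<forall>\<^sub>F n in sequentially. integrable \<mu> (\<lambda>y. (dqm_remainder f s \<theta> (k n) y)\<^sup>2)"
    using k0 by (rule eventually_compose_filterlim)
  define R where "R n y = dqm_remainder f s \<theta> (k n) y" for n y
  define a where "a n = (\<integral>y. (R n y)\<^sup>2 \<partial>\<mu>)" for n
  have a0: "0 \<le> a n" for n by (simp add: a_def)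
  have alim: "(\<lambda>n. real n * a n) \<longlonglongrightarrow> 0"
  proof (rule tendstoI)
    fix e :: real assume e: "0 < e"
    have "Bseq hs" using hs convergent_def convergent_imp_Bseq by blast
    then obtain H where H: "0 < H" "\<And>n. norm (hs n) \<le> H" by (auto simp: Bseq_def)
    define c where "c = e / (2 * H\<^sup>2)"
    have c: "0 < c" using e H by (simp add: c_def)
    have "\<forall>\<^sub>F h in at 0. norm (\<integral>y. (dqm_remainder f s \<theta> h y)\<^sup>2 \<partial>\<mu>) \<le> c * norm ((norm h)\<^sup>2)"
      using landau_o.smallD[OF Ro c] .
    then have "\<forall>\<^sub>F h in nhds 0. norm (\<integral>y. (dqm_remainder f s \<theta> h y)\<^sup>2 \<partial>\<mu>) \<le> c * norm ((norm h)\<^sup>2)"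
      unfolding eventually_at_filter by eventually_elim (use R0 in auto)
    then have "\<forall>\<^sub>F n in sequentially. norm (\<integral>y. (dqm_remainder f s \<theta> (k n) y)\<^sup>2 \<partial>\<mu>) \<le> c * norm ((norm (k n))\<^sup>2)"
      using k0 by (rule eventually_compose_filterlim)
    then show "\<forall>\<^sub>F n in sequentially. dist (real n * a n) 0 < e"
      using eventually_gt_at_top[of 0]
    proof eventually_elim
      case (elim n)
      have "a n \<le> c * (norm (k n))\<^sup>2" using elim by (simp add: a_def R_def)
      then have "real n * a n \<le> real n * (c * (norm (k n))\<^sup>2)" by (rule mult_left_mono) simp
      also have "\<dots> = c * (norm (hs n))\<^sup>2" using elim by (simp add: k_def power_divide)
      also have "\<dots> \<le> c * H\<^sup>2" using H c by (intro mult_left_mono power_mono) auto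
      also have "\<dots> = e / 2" using H by (simp add: c_def)
      finally show ?case using e a0[of n] by simp
    qed
  qed
  have rn: "r n = (\<lambda>y. sqrt (f (\<theta> + k n) y / f \<theta> y))" for n by (simp add: r_def k_def)
  define S where "S n y = 1 / 2 * (k n \<bullet> s \<theta> y) * sqrt (f \<theta> y)" for n y
  have ev: "\<forall>\<^sub>F n in sequentially. \<theta> + k n \<in> \<Theta> \<and> integrable \<mu> (\<lambda>y. (R n y)\<^sup>2) \<and> 0 < n"
    using kTh Rk eventually_gt_at_top[of 0] by eventually_elim (auto simp: R_def)
  have iS: "integrable \<mu> (\<lambda>y. (S n y)\<^sup>2)" and eS: "0 < n \<Longrightarrow> real n * (\<integral>y. (S n y)\<^sup>2 \<partial>\<mu>) = Q (hs n) / 4" for n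
  proof -
    have eq: "(S n y)\<^sup>2 = 1 / 4 * (f \<theta> y * (k n \<bullet> s \<theta> y)\<^sup>2)" if "y \<in> space \<mu>" for y
      using f0[OF that] by (simp add: S_def power_mult_distrib power2_eq_square)
    have i: "integrable \<mu> (\<lambda>y. f \<theta> y * (k n \<bullet> s \<theta> y)\<^sup>2)"
      using int[of "k n"] by (subst Pint(2)[symmetric]) (auto simp: P_def)
    show "integrable \<mu> (\<lambda>y. (S n y)\<^sup>2)" by (subst Bochner_Integration.integrable_cong[OF refl eq]) (use i in auto)
    assume "0 < n"
    have "(\<integral>y. (S n y)\<^sup>2 \<partial>\<mu>) = (\<integral>y. 1 / 4 * (f \<theta> y * (k n \<bullet> s \<theta> y)\<^sup>2) \<partial>\<mu>)"
      by (rule Bochner_Integration.integral_cong[OF refl eq])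
    also have "\<dots> = Q (k n) / 4" by (simp add: Q_def Pint(1))
    also have "Q (k n) = Q (hs n) / real n" using \<open>0 < n\<close> by (simp add: k_def Q2 power_divide)
    finally show "real n * (\<integral>y. (S n y)\<^sup>2 \<partial>\<mu>) = Q (hs n) / 4" using \<open>0 < n\<close> by simp
  qed
  have Sm[measurable]: "S n \<in> borel_measurable \<mu>" for n unfolding S_def by measurable
  have facts: "r n \<in> borel_measurable P \<and> integrable P (\<lambda>y. (r n y)\<^sup>2)" "(\<integral>y. (r n y)\<^sup>2 \<partial>P) \<le> 1"
      "\<bar>real n * (1 - (\<integral>y. r n y \<partial>P)) - Q (hs n) / 8\<bar> \<le> 1 / 2 * (real n * a n) + sqrt (real n * a n) * sqrt (Q (hs n) / 4)"
      "(\<integral>y. (r n y - 1 - 1 / 2 * (k n \<bullet> s \<theta> y))\<^sup>2 \<partial>P) \<le> a n"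
      "integrable P (\<lambda>y. (r n y - 1 - 1 / 2 * (k n \<bullet> s \<theta> y))\<^sup>2)"
    if n: "\<theta> + k n \<in> \<Theta> \<and> integrable \<mu> (\<lambda>y. (R n y)\<^sup>2) \<and> 0 < n" for n
  proof -
    let ?g = "f (\<theta> + k n)"
    have g[measurable]: "?g \<in> borel_measurable \<mu>" and g0: "\<And>y. y \<in> space \<mu> \<Longrightarrow> 0 \<le> ?g y"
      and gp: "prob_space (density \<mu> (\<lambda>y. ennreal (?g y)))" and fp: "prob_space (density \<mu> (\<lambda>y. ennreal (f \<theta> y)))"
      using fam n t by (auto simp: density_family_def base_dist_def)
    have nn: "(\<integral>\<^sup>+y. ennreal (F y) \<partial>\<mu>) = 1" if "prob_space (density \<mu> (\<lambda>y. ennreal (F y)))" "F \<in> borel_measurable \<mu>" for F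
      using prob_space.emeasure_space_1[OF that(1)] that(2) by (simp add: emeasure_density cong: nn_integral_cong_simp)
    have tot: "integrable \<mu> F" "(\<integral>y. F y \<partial>\<mu>) = 1"
      if "prob_space (density \<mu> (\<lambda>y. ennreal (F y)))" "F \<in> borel_measurable \<mu>" "\<And>y. y \<in> space \<mu> \<Longrightarrow> 0 \<le> F y" for F
    proof -
      show "integrable \<mu> F" using nn[OF that(1,2)] that by (intro integrableI_nonneg) (auto intro!: AE_I2)
      show "(\<integral>y. F y \<partial>\<mu>) = 1" using nn[OF that(1,2)] that by (subst integral_eq_nn_integral) (auto intro!: AE_I2)
    qed
    note ig = tot[OF gp g g0] and iff = tot[OF fp fm f0]
    have rm[measurable]: "r n \<in> borel_measurable \<mu>" unfolding rn by measurable
    have Rm[measurable]: "R n \<in> borel_measurable \<mu>" unfolding R_def dqm_remainder_def by measurable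
    have r2: "f \<theta> y * (r n y)\<^sup>2 \<le> ?g y" "0 \<le> f \<theta> y * (r n y)\<^sup>2" if "y \<in> space \<mu>" for y
      using f0[OF that] g0[OF that] by (cases "f \<theta> y = 0"; simp add: rn)+
    have ir2: "integrable \<mu> (\<lambda>y. f \<theta> y * (r n y)\<^sup>2)"
      by (rule Bochner_Integration.integrable_bound[OF ig(1)]) (auto intro!: AE_I2 simp: r2 g0)
    show "r n \<in> borel_measurable P \<and> integrable P (\<lambda>y. (r n y)\<^sup>2)"
      using ir2 by (auto simp: Pint(2)) (simp add: P_def base_dist_def)
    show "(\<integral>y. (r n y)\<^sup>2 \<partial>P) \<le> 1"
    proof -
      have "(\<integral>y. (r n y)\<^sup>2 \<partial>P) = (\<integral>y. f \<theta> y * (r n y)\<^sup>2 \<partial>\<mu>)" by (rule Pint(1)) measurable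
      also have "\<dots> \<le> (\<integral>y. ?g y \<partial>\<mu>)" by (rule integral_mono[OF ir2 ig(1) r2(1)])
      finally show ?thesis using ig(2) by simp
    qed
    have sqf: "integrable \<mu> (\<lambda>y. (sqrt (f \<theta> y))\<^sup>2)" "integrable \<mu> (\<lambda>y. (sqrt (?g y))\<^sup>2)"
      using iff(1) ig(1) by (auto simp: f0 g0 cong: Bochner_Integration.integrable_cong)
    have ifg: "integrable \<mu> (\<lambda>y. sqrt (f \<theta> y) * sqrt (?g y))"
      by (rule integral_cauchy_schwarz(1)[OF _ _ sqf]) auto
    have fr: "f \<theta> y * r n y = sqrt (f \<theta> y) * sqrt (?g y)" if "y \<in> space \<mu>" for y
    proof -
      have gen: "b * b * (c / b) = b * c" for b c :: real by simp
      have "f \<theta> y = sqrt (f \<theta> y) * sqrt (f \<theta> y)" using f0[OF that] by simp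
      then have "f \<theta> y * r n y = sqrt (f \<theta> y) * sqrt (f \<theta> y) * (sqrt (?g y) / sqrt (f \<theta> y))"
        by (simp only: rn real_sqrt_divide)
      then show ?thesis by (simp only: gen)
    qed
    have Er: "(\<integral>y. r n y \<partial>P) = (\<integral>y. sqrt (f \<theta> y) * sqrt (?g y) \<partial>\<mu>)"
      by (simp add: Pint(1) fr cong: Bochner_Integration.integral_cong)
    have iRS: "integrable \<mu> (\<lambda>y. R n y * S n y)"
      and CS: "\<bar>\<integral>y. R n y * S n y \<partial>\<mu>\<bar> \<le> sqrt (a n) * sqrt (\<integral>y. (S n y)\<^sup>2 \<partial>\<mu>)"
      unfolding a_def by (rule integral_cauchy_schwarz[OF _ _ _ iS]; use n in auto)+
    have "(sqrt (?g y) - sqrt (f \<theta> y))\<^sup>2 = ?g y + f \<theta> y - 2 * (sqrt (f \<theta> y) * sqrt (?g y))" if "y \<in> space \<mu>" for y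
      using f0[OF that] g0[OF that] by (simp add: power2_diff)
    then have "(\<integral>y. (sqrt (?g y) - sqrt (f \<theta> y))\<^sup>2 \<partial>\<mu>) = (\<integral>y. ?g y + f \<theta> y - 2 * (sqrt (f \<theta> y) * sqrt (?g y)) \<partial>\<mu>)"
      by (intro Bochner_Integration.integral_cong refl) auto
    also have "\<dots> = 2 * (1 - (\<integral>y. r n y \<partial>P))" using ig iff ifg by (simp add: Er)
    finally have A1: "(\<integral>y. (sqrt (?g y) - sqrt (f \<theta> y))\<^sup>2 \<partial>\<mu>) = 2 * (1 - (\<integral>y. r n y \<partial>P))" .
    have "sqrt (?g y) - sqrt (f \<theta> y) = R n y + S n y" for y by (simp add: R_def S_def dqm_remainder_def)
    then have "(\<integral>y. (sqrt (?g y) - sqrt (f \<theta> y))\<^sup>2 \<partial>\<mu>) = (\<integral>y. (R n y)\<^sup>2 + (S n y)\<^sup>2 + 2 * (R n y * S n y) \<partial>\<mu>)"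
      by (simp add: power2_sum mult.assoc)
    also have "\<dots> = a n + (\<integral>y. (S n y)\<^sup>2 \<partial>\<mu>) + 2 * (\<integral>y. R n y * S n y \<partial>\<mu>)"
      using n iS[of n] iRS by (simp add: a_def)
    finally have eqx: "1 - (\<integral>y. r n y \<partial>P) = a n / 2 + (\<integral>y. (S n y)\<^sup>2 \<partial>\<mu>) / 2 + (\<integral>y. R n y * S n y \<partial>\<mu>)"
      using A1 by simp
    have "real n * (1 - (\<integral>y. r n y \<partial>P)) = 1 / 2 * (real n * a n) + (real n * (\<integral>y. (S n y)\<^sup>2 \<partial>\<mu>)) / 2 + real n * (\<integral>y. R n y * S n y \<partial>\<mu>)"
      unfolding eqx by (simp add: algebra_simps)
    then have "real n * (1 - (\<integral>y. r n y \<partial>P)) - Q (hs n) / 8 = 1 / 2 * (real n * a n) + real n * (\<integral>y. R n y * S n y \<partial>\<mu>)"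
      using eS[of n] n by simp
    moreover have "\<bar>real n * (\<integral>y. R n y * S n y \<partial>\<mu>)\<bar> \<le> sqrt (real n * a n) * sqrt (Q (hs n) / 4)"
    proof -
      have "real n * \<bar>\<integral>y. R n y * S n y \<partial>\<mu>\<bar> \<le> (sqrt n * sqrt n) * (sqrt (a n) * sqrt (\<integral>y. (S n y)\<^sup>2 \<partial>\<mu>))"
        using CS by (simp add: mult_left_mono)
      also have "\<dots> = sqrt (real n * a n) * sqrt (real n * (\<integral>y. (S n y)\<^sup>2 \<partial>\<mu>))"
        by (simp only: real_sqrt_mult mult_ac)
      finally show ?thesis using eS[of n] n by (simp add: abs_mult)
    qed
    moreover have "0 \<le> 1 / 2 * (real n * a n)" using a0 by simp
    ultimately show "\<bar>real n * (1 - (\<integral>y. r n y \<partial>P)) - Q (hs n) / 8\<bar> \<le> 1 / 2 * (real n * a n) + sqrt (real n * a n) * sqrt (Q (hs n) / 4)"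
      by linarith
    have le: "f \<theta> y * (r n y - 1 - 1 / 2 * (k n \<bullet> s \<theta> y))\<^sup>2 \<le> (R n y)\<^sup>2" if "y \<in> space \<mu>" for y
    proof (cases "f \<theta> y = 0")
      case False
      have p: "sqrt (f \<theta> y) * sqrt (f \<theta> y) = f \<theta> y" using f0[OF that] by simp
      have "sqrt (f \<theta> y) * (r n y - 1 - 1 / 2 * (k n \<bullet> s \<theta> y)) = R n y"
        using False by (simp add: rn real_sqrt_divide R_def dqm_remainder_def algebra_simps)
      then have "(R n y)\<^sup>2 = (sqrt (f \<theta> y) * sqrt (f \<theta> y)) * (r n y - 1 - 1 / 2 * (k n \<bullet> s \<theta> y))\<^sup>2"
        by (metis (no_types) power2_eq_square power_mult_distrib)
      then show ?thesis unfolding p by simp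
    qed simp
    have ile: "integrable \<mu> (\<lambda>y. f \<theta> y * (r n y - 1 - 1 / 2 * (k n \<bullet> s \<theta> y))\<^sup>2)"
    proof (rule Bochner_Integration.integrable_bound[OF n[THEN conjunct2, THEN conjunct1]])
      show "AE y in \<mu>. norm (f \<theta> y * (r n y - 1 - 1 / 2 * (k n \<bullet> s \<theta> y))\<^sup>2) \<le> norm ((R n y)\<^sup>2)"
        using le f0 by (intro AE_I2) (auto simp: abs_mult)
    qed measurable
    show "(\<integral>y. (r n y - 1 - 1 / 2 * (k n \<bullet> s \<theta> y))\<^sup>2 \<partial>P) \<le> a n"
      unfolding a_def using ile n le by (subst Pint(1)) (auto intro!: integral_mono)
    show "integrable P (\<lambda>y. (r n y - 1 - 1 / 2 * (k n \<bullet> s \<theta> y))\<^sup>2)"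
      using ile by (subst Pint(2)) auto
  qed
  show "\<forall>\<^sub>F n in sequentially. r n \<in> borel_measurable P \<and> integrable P (\<lambda>y. (r n y)\<^sup>2)"
    using ev by eventually_elim (rule facts(1))
  show "\<forall>\<^sub>F n in sequentially. (\<integral>y. (r n y)\<^sup>2 \<partial>P) \<le> 1"
    using ev by eventually_elim (rule facts(2))
  have "(\<lambda>n. real n * (1 - (\<integral>y. r n y \<partial>P)) - Q (hs n) / 8) \<longlonglongrightarrow> 0"
  proof (rule Lim_null_comparison)
    show "\<forall>\<^sub>F n in sequentially. norm (real n * (1 - (\<integral>y. r n y \<partial>P)) - Q (hs n) / 8) \<le> 1 / 2 * (real n * a n) + sqrt (real n * a n) * sqrt (Q (hs n) / 4)"
      using ev by eventually_elim (use facts(3) in auto)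
    have "(\<lambda>n. 1 / 2 * (real n * a n) + sqrt (real n * a n) * sqrt (Q (hs n) / 4)) \<longlonglongrightarrow> 1 / 2 * 0 + sqrt 0 * sqrt (Q h / 4)"
      by (intro tendsto_add tendsto_mult tendsto_const alim tendsto_real_sqrt tendsto_divide Qlim[OF hs]) simp
    then show "(\<lambda>n. 1 / 2 * (real n * a n) + sqrt (real n * a n) * sqrt (Q (hs n) / 4)) \<longlonglongrightarrow> 0" by simp
  qed
  moreover have "(\<lambda>n. Q (hs n) / 8) \<longlonglongrightarrow> Q h / 8" by (intro tendsto_divide Qlim[OF hs] tendsto_const) simp
  ultimately have "(\<lambda>n. (real n * (1 - (\<integral>y. r n y \<partial>P)) - Q (hs n) / 8) + Q (hs n) / 8) \<longlonglongrightarrow> 0 + Q h / 8"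
    by (rule tendsto_add)
  then show "(\<lambda>n. real n * (1 - (\<integral>y. r n y \<partial>P))) \<longlonglongrightarrow> (\<integral>y. (h \<bullet> s \<theta> y)\<^sup>2 \<partial>P) / 8" by (simp add: Q_def)
  show "(\<lambda>n. real n * (\<integral>y. (r n y - 1 - 1 / 2 * ((h \<bullet> s \<theta> y) / sqrt (real n)))\<^sup>2 \<partial>P)) \<longlonglongrightarrow> 0"
  proof (rule Lim_null_comparison)
    show "\<forall>\<^sub>F n in sequentially. norm (real n * (\<integral>y. (r n y - 1 - 1 / 2 * ((h \<bullet> s \<theta> y) / sqrt (real n)))\<^sup>2 \<partial>P))
        \<le> 2 * (real n * a n) + 1 / 2 * Q (hs n - h)"
      using ev
    proof eventually_elim
      case (elim n)
      let ?u = "\<lambda>y. r n y - 1 - 1 / 2 * (k n \<bullet> s \<theta> y)" and ?v = "\<lambda>y. ((1 / sqrt n) *\<^sub>R (hs n - h)) \<bullet> s \<theta> y"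
      have iv: "integrable P (\<lambda>y. (?v y)\<^sup>2)" unfolding P_def by (rule int)
      have "(\<integral>y. (r n y - 1 - 1 / 2 * ((h \<bullet> s \<theta> y) / sqrt n))\<^sup>2 \<partial>P) \<le> (\<integral>y. 2 * (?u y)\<^sup>2 + 1 / 2 * (?v y)\<^sup>2 \<partial>P)"
      proof (rule integral_mono')
        show "integrable P (\<lambda>y. 2 * (?u y)\<^sup>2 + 1 / 2 * (?v y)\<^sup>2)"
          using facts(5)[OF elim] iv by (intro Bochner_Integration.integrable_add integrable_mult_right)
        fix y
        have sqd: "(p + q / 2)\<^sup>2 \<le> 2 * p\<^sup>2 + 1 / 2 * q\<^sup>2" for p q :: real
          using zero_le_power2[of "p - q / 2"] by (simp add: power2_sum power2_diff power_divide)
        have "r n y - 1 - 1 / 2 * ((h \<bullet> s \<theta> y) / sqrt n) = ?u y + ?v y / 2"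
          by (simp add: k_def inner_diff_left diff_divide_distrib)
        then show "(r n y - 1 - 1 / 2 * ((h \<bullet> s \<theta> y) / sqrt n))\<^sup>2 \<le> 2 * (?u y)\<^sup>2 + 1 / 2 * (?v y)\<^sup>2"
          using sqd by metis
        show "0 \<le> 2 * (?u y)\<^sup>2 + 1 / 2 * (?v y)\<^sup>2" by simp
      qed
      also have "\<dots> = 2 * (\<integral>y. (?u y)\<^sup>2 \<partial>P) + 1 / 2 * Q ((1 / sqrt n) *\<^sub>R (hs n - h))"
        unfolding Q_def using facts(5)[OF elim] iv
        by (subst Bochner_Integration.integral_add) (auto intro!: integrable_mult_right simp del: inner_scaleR_left)
      also have "\<dots> \<le> 2 * a n + 1 / 2 * (Q (hs n - h) / real n)"
        using facts(4)[OF elim] elim by (auto simp: Q2 power_divide)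
      finally have "real n * (\<integral>y. (r n y - 1 - 1 / 2 * ((h \<bullet> s \<theta> y) / sqrt n))\<^sup>2 \<partial>P) \<le> real n * (2 * a n + 1 / 2 * (Q (hs n - h) / real n))"
        by (rule mult_left_mono) simp
      also have "\<dots> = 2 * (real n * a n) + 1 / 2 * Q (hs n - h)" using elim by (simp add: distrib_left)
      finally show ?case by simp
    qed
    have "(\<lambda>n. 2 * (real n * a n) + 1 / 2 * Q (hs n - h)) \<longlonglongrightarrow> 2 * 0 + 1 / 2 * Q 0"
      using hs by (intro tendsto_add tendsto_mult tendsto_const alim Qlim) (simp add: LIM_zero)
    then show "(\<lambda>n. 2 * (real n * a n) + 1 / 2 * Q (hs n - h)) \<longlonglongrightarrow> 0" by (simp add: Q_def)
  qed
qed

text \<open>\<open>\<surd>n E[r - 1]\<close> tends to \<open>0\<close>, because \<open>n (1 - E[r])\<close> converges, and to half the mean of the score, because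
  \<open>\<surd>n (r - 1)\<close> converges in mean square to half the score.\<close>

lemma score_mean_zero:
  fixes s :: "real ^ 'p \<Rightarrow> 'y \<Rightarrow> real ^ 'p"
  assumes Th: "open \<Theta>" and fam: "density_family \<mu> \<Theta> f" and dqm: "diff_quadratic_mean \<mu> \<Theta> f s" and t: "\<theta> \<in> \<Theta>"
    and int: "\<And>v. integrable (base_dist \<mu> f \<theta>) (\<lambda>y. (v \<bullet> s \<theta> y)\<^sup>2)"
  shows "(\<integral>y. v \<bullet> s \<theta> y \<partial>base_dist \<mu> f \<theta>) = 0"
proof -
  let ?P = "base_dist \<mu> f \<theta>"
  interpret P: prob_space ?P using fam t by (simp add: density_family_def)
  have [measurable]: "s \<theta> \<in> borel_measurable ?P" using dqm t by (simp add: diff_quadratic_mean_def base_dist_def)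
  note D = dqm_local_expansion[OF Th fam dqm t int tendsto_const[of v]]
  define r where "r n y = sqrt (f (\<theta> + (1 / sqrt (real n)) *\<^sub>R v) y / f \<theta> y)" for n y
  define Y where "Y n y = r n y - 1 - 1 / 2 * ((v \<bullet> s \<theta> y) / sqrt (real n))" for n y
  define m where "m = (\<integral>y. v \<bullet> s \<theta> y \<partial>?P)"
  have i1: "integrable ?P (\<lambda>y. v \<bullet> s \<theta> y)"
    using integral_cauchy_schwarz(1)[OF _ _ int[of v], of "\<lambda>_. 1"] by simp
  have l1: "(\<lambda>n. real n * (1 - (\<integral>y. r n y \<partial>?P))) \<longlonglongrightarrow> (\<integral>y. (v \<bullet> s \<theta> y)\<^sup>2 \<partial>?P) / 8"
    and l2: "(\<lambda>n. real n * (\<integral>y. (Y n y)\<^sup>2 \<partial>?P)) \<longlonglongrightarrow> 0"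
    using D(4,5) by (simp_all add: r_def Y_def)
  have sqrt_lim: "filterlim (\<lambda>n. sqrt (real n)) at_top sequentially"
    by (rule filterlim_compose[OF sqrt_at_top filterlim_real_sequentially])
  have inv: "(\<lambda>n. 1 / sqrt (real n)) \<longlonglongrightarrow> 0"
    by (rule tendsto_divide_0[OF tendsto_const filterlim_at_top_imp_at_infinity[OF sqrt_lim]])
  have "\<forall>\<^sub>F n in sequentially. norm (- m / 2) \<le> sqrt (real n * (\<integral>y. (Y n y)\<^sup>2 \<partial>?P)) + (1 / sqrt (real n)) * \<bar>real n * (1 - (\<integral>y. r n y \<partial>?P))\<bar>"
    using D(2) eventually_gt_at_top[of 0]
  proof eventually_elim
    case (elim n)
    have rm[measurable]: "r n \<in> borel_measurable ?P" and r2: "integrable ?P (\<lambda>y. (r n y)\<^sup>2)"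
      using elim(1) by (simp_all add: r_def[abs_def])
    have ir: "integrable ?P (r n)"
      using integral_cauchy_schwarz(1)[OF rm _ r2, of "\<lambda>_. 1"] by simp
    have irs: "integrable ?P (\<lambda>y. r n y * (v \<bullet> s \<theta> y))"
      by (rule integral_cauchy_schwarz(1)[OF rm _ r2 int]) measurable
    have iY: "integrable ?P (Y n)" unfolding Y_def using ir i1 by simp
    have "(Y n y)\<^sup>2 = (r n y)\<^sup>2 + 1 + (1 / 2 / sqrt n)\<^sup>2 * (v \<bullet> s \<theta> y)\<^sup>2 - 2 * r n y - (1 / sqrt n) * (r n y * (v \<bullet> s \<theta> y)) + (1 / sqrt n) * (v \<bullet> s \<theta> y)" for y
      by (simp add: Y_def power2_eq_square algebra_simps)
    then have iY2: "integrable ?P (\<lambda>y. (Y n y)\<^sup>2)" using r2 ir i1 int[of v] irs by simp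
    have eqY: "(\<integral>y. Y n y \<partial>?P) = (\<integral>y. r n y \<partial>?P) - 1 - 1 / 2 * (m / sqrt n)"
      unfolding Y_def m_def using ir i1 by (simp add: P.prob_space)
    have "- m / 2 = sqrt n * (\<integral>y. Y n y \<partial>?P) + sqrt n * (1 - (\<integral>y. r n y \<partial>?P))"
      unfolding eqY using elim(2) by (simp add: algebra_simps)
    then have 1: "\<bar>- m / 2\<bar> \<le> sqrt n * \<bar>\<integral>y. Y n y \<partial>?P\<bar> + sqrt n * \<bar>1 - (\<integral>y. r n y \<partial>?P)\<bar>"
      using abs_triangle_ineq[of "sqrt n * (\<integral>y. Y n y \<partial>?P)" "sqrt n * (1 - (\<integral>y. r n y \<partial>?P))"] by (simp add: abs_mult)
    have 2: "sqrt n * \<bar>\<integral>y. Y n y \<partial>?P\<bar> \<le> sqrt n * sqrt (\<integral>y. (Y n y)\<^sup>2 \<partial>?P)"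
      by (intro mult_left_mono order_trans[OF integral_abs_bound P.abs_expectation_le_sqrt[OF iY iY2]]) simp
    have 3: "sqrt n * \<bar>1 - (\<integral>y. r n y \<partial>?P)\<bar> = (1 / sqrt n) * \<bar>real n * (1 - (\<integral>y. r n y \<partial>?P))\<bar>"
    proof -
      have "(1 / sqrt n) * (real n * z) = (real n / sqrt n) * z" for z by simp
      then show ?thesis by (simp only: abs_mult abs_of_nat real_div_sqrt[OF of_nat_0_le_iff])
    qed
    show ?case using 1 2 unfolding 3 real_norm_def real_sqrt_mult by linarith
  qed
  moreover have "(\<lambda>n. sqrt (real n * (\<integral>y. (Y n y)\<^sup>2 \<partial>?P)) + (1 / sqrt (real n)) * \<bar>real n * (1 - (\<integral>y. r n y \<partial>?P))\<bar>)
      \<longlonglongrightarrow> sqrt 0 + 0 * \<bar>(\<integral>y. (v \<bullet> s \<theta> y)\<^sup>2 \<partial>?P) / 8\<bar>"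
    by (intro tendsto_add tendsto_real_sqrt tendsto_mult tendsto_rabs l1 l2 inv)
  then have "(\<lambda>n. sqrt (real n * (\<integral>y. (Y n y)\<^sup>2 \<partial>?P)) + (1 / sqrt (real n)) * \<bar>real n * (1 - (\<integral>y. r n y \<partial>?P))\<bar>) \<longlonglongrightarrow> 0" by simp
  ultimately have "(\<lambda>n :: nat. - m / 2) \<longlonglongrightarrow> 0" by (rule Lim_null_comparison)
  then show ?thesis by (simp add: m_def LIMSEQ_const_iff)
qed

section \<open>The normalised score\<close>

text \<open>Truncation makes the exponential Lipschitz; needed to keep truncated weights admissible as
  Lipschitz test functions.\<close>

lemma exp_min_lipschitz:
  fixes a b t :: real
  shows "\<bar>exp (min a t) - exp (min b t)\<bar> \<le> exp t * \<bar>a - b\<bar>"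
proof -
  have *: "exp x - exp y \<le> exp t * (x - y)" if "y \<le> x" "x \<le> t" for x y :: real
  proof -
    have "1 + (y - x) \<le> exp (y - x)" by (rule exp_ge_add_one_self)
    then have "exp x * (1 + (y - x)) \<le> exp x * exp (y - x)" by (rule mult_left_mono) simp
    then have "exp x - exp y \<le> exp x * (x - y)" by (simp add: mult_exp_exp algebra_simps)
    also have "\<dots> \<le> exp t * (x - y)" using that by (intro mult_right_mono) auto
    finally show ?thesis .
  qed
  have **: "\<bar>exp x - exp y\<bar> \<le> exp t * \<bar>x - y\<bar>" if "x \<le> t" "y \<le> t" for x y :: real
    using *[of x y] *[of y x] that by (cases "x \<le> y") (auto simp: abs_if)
  have "\<bar>exp (min a t) - exp (min b t)\<bar> \<le> exp t * \<bar>min a t - min b t\<bar>" by (rule **) auto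
  also have "\<dots> \<le> exp t * \<bar>a - b\<bar>" by (intro mult_left_mono) (auto simp: min_def)
  finally show ?thesis .
qed

text \<open>The score of one observation, as far as the central limit theorem is concerned; \<open>J\<close> is its covariance
  matrix.\<close>

locale score_model =
  fixes P :: "'y measure" and sc :: "'y \<Rightarrow> real ^ 'p" and J :: "real ^ 'p ^ 'p"
  assumes prob_P: "prob_space P" and sc[measurable]: "sc \<in> borel_measurable P"
    and exp_moments: "\<And>v. \<exists>e>0. integrable P (\<lambda>y. exp (e * \<bar>v \<bullet> sc y\<bar>))"
    and mean_zero: "\<And>v. (\<integral>y. v \<bullet> sc y \<partial>P) = 0"
    and variance: "\<And>v. (\<integral>y. (v \<bullet> sc y)\<^sup>2 \<partial>P) = v \<bullet> (J *v v)"
    and J: "pos_def J"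
begin

sublocale prob_space P by (rule prob_P)

abbreviation sample :: "nat \<Rightarrow> (nat \<Rightarrow> 'y) measure" where
  "sample n \<equiv> Pi\<^sub>M {..<n} (\<lambda>_. P)"

definition Z :: "nat \<Rightarrow> (nat \<Rightarrow> 'y) \<Rightarrow> real ^ 'p" where
  "Z n y = (1 / sqrt (real n)) *\<^sub>R (matrix_inv J *v (\<Sum>i<n. sc (y i)))"

lemma Z_measurable[measurable]: "Z n \<in> borel_measurable (sample n)"
  unfolding Z_def by measurable

lemma prob_sample: "prob_space (sample n)" by (rule prob_space_PiM) (rule prob_P)

lemma inner_Z: "v \<bullet> Z n y = (\<Sum>i<n. (matrix_inv J *v v) \<bullet> sc (y i)) / sqrt (real n)"
  by (simp add: Z_def pos_def_inverse(5)[OF J] inner_sum_right)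

lemma inner_J_Z: "h \<bullet> (J *v Z n y) = (\<Sum>i<n. h \<bullet> sc (y i)) / sqrt (real n)"
  by (simp add: pos_def_sym[OF J] inner_Z pos_def_inverse(3,4)[OF J])

lemma char_limit:
  "(\<lambda>n. \<integral>x. exp (\<i> * of_real (t \<bullet> x)) \<partial>distr (sample n) borel (Z n)) \<longlonglongrightarrow> (\<integral>x. exp (\<i> * of_real (t \<bullet> x)) \<partial>gauss_law J)"
proof -
  define X where "X y = (matrix_inv J *v t) \<bullet> sc y" for y
  obtain e where e: "0 < e" "integrable P (\<lambda>y. exp (e * \<bar>X y\<bar>))" unfolding X_def using exp_moments by blast
  have X: "X \<in> borel_measurable P" unfolding X_def by measurable
  have m: "expectation X = 0" unfolding X_def by (rule mean_zero)
  have v: "expectation (\<lambda>y. (X y)\<^sup>2) = t \<bullet> (matrix_inv J *v t)"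
    unfolding X_def variance by (simp add: pos_def_inverse(3,4)[OF J] inner_commute)
  have "(\<lambda>n. \<integral>y. exp (\<i> * of_real ((\<Sum>i<n. X (y i)) / sqrt (real n))) \<partial>sample n) \<longlonglongrightarrow> exp (\<i>\<^sup>2 * of_real (t \<bullet> (matrix_inv J *v t)) / 2)"
    by (rule exp_sum_limit(2)[OF X e m v])
  then show ?thesis
    using gauss_law_exp(2)[OF J, of \<i> t] by (simp add: integral_distr inner_Z X_def)
qed

text \<open>The sequences along which the law of \<open>Z n\<close> and its Gaussian limit cannot be told apart. The case
  distinction is that between convergence in total variation and in the bounded Lipschitz metric, so
  that both are treated at once. Sequences of functions, in place of classes, express uniformity.\<close>

definition test_sequence :: "(nat \<Rightarrow> real ^ 'p \<Rightarrow> real) \<Rightarrow> bool" where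
  "test_sequence g \<longleftrightarrow> (\<exists>K. \<forall>n. bfun K (g n)) \<and>
     (has_ac_component (distr P borel sc) \<or> (\<exists>L\<ge>0. \<forall>n x y. \<bar>g n x - g n y\<bar> \<le> L * norm (x - y)))"

lemma shift_continuity_lipschitz:
  assumes L: "0 \<le> L" "\<And>x y. \<bar>g x - g y\<bar> \<le> L * norm (x - y)" and g: "bfun K g" and M: "borel_prob M"
  shows "\<bar>(\<integral>x. g (x + v) \<partial>M) - (\<integral>x. g x \<partial>M)\<bar> \<le> L * norm v"
proof -
  interpret M: prob_space M using M by (simp add: borel_prob_def)
  have "integrable M (\<lambda>x. g (x + v))" "integrable M g"
    using borel_prob_integrable[OF M g, of v] borel_prob_integrable[OF M g, of 0] by (simp_all add: add.commute)
  then have "(\<integral>x. g (x + v) \<partial>M) - (\<integral>x. g x \<partial>M) = (\<integral>x. g (x + v) - g x \<partial>M)" by simp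
  also have "norm \<dots> \<le> (\<integral>x. L * norm v \<partial>M)"
  proof (rule norm_integral_le)
    show "norm (g (x + v) - g x) \<le> L * norm v" for x using L(2)[of "x + v" x] by simp
  qed simp
  finally show ?thesis by (simp add: M.prob_space)
qed

text \<open>A shift of \<open>Z n\<close> by \<open>v\<close> is a shift of the sum of the scores by \<open>\<surd>n J v\<close>, so \<open>shift_bound\<close> applies on the right
  scale.\<close>

lemma shift_continuity_ac:
  assumes ac: "has_ac_component (distr P borel sc)" and \<eta>: "0 < \<eta>" and K: "0 \<le> K"
  shows "\<exists>\<delta>>0. \<forall>\<^sub>F n in sequentially. \<forall>v (g :: real ^ 'p \<Rightarrow> real). norm v < \<delta> \<longrightarrow> bfun K g \<longrightarrow>
    \<bar>(\<integral>x. g (x + v) \<partial>distr (sample n) borel (Z n)) - (\<integral>x. g x \<partial>distr (sample n) borel (Z n))\<bar> \<le> \<eta> \<and>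
    \<bar>(\<integral>x. g (x + v) \<partial>gauss_law J) - (\<integral>x. g x \<partial>gauss_law J)\<bar> \<le> \<eta>"
proof -
  have q: "borel_prob (distr P borel sc)" by (simp add: borel_prob_def prob_space_distr)
  from shift_bound[OF q ac] obtain C :: real and \<epsilon> :: "nat \<Rightarrow> real" where C: "0 \<le> C" and \<epsilon>: "\<epsilon> \<longlonglongrightarrow> 0"
    and sb: "\<forall>n>0. \<forall>K g x w. bfun K g \<longrightarrow>
      \<bar>(conv_op (distr P borel sc) ^^ n) g (x + w) - (conv_op (distr P borel sc) ^^ n) g x\<bar> \<le> K * sqrt (C * (norm w / sqrt (real n))\<^sup>2 + \<epsilon> n)" .
  obtain B where B: "0 < B" "\<And>v. norm (J *v v) \<le> B * norm v"
    using bounded_linear.pos_bounded[OF matrix_vector_mul_bounded_linear[of J]] by (auto simp: mult.commute)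
  \<comment> \<open>both estimates are of the form \<open>K \<surd>s\<close>, and \<open>s \<le> \<tau>\<close> makes that at most \<open>\<eta>\<close>\<close>
  define \<tau> where "\<tau> = (\<eta> / (K + 1))\<^sup>2"
  have \<tau>: "0 < \<tau>" using \<eta> K by (simp add: \<tau>_def)
  define \<delta> where "\<delta> = min (sqrt (\<tau> / (2 * (C + 1) * B\<^sup>2))) (sqrt (ln (1 + \<tau>) / B))"
  have \<delta>0: "0 < \<delta>" using \<tau> C B by (simp add: \<delta>_def add_nonneg_pos)
  have root: "K * sqrt s \<le> \<eta>" if "s \<le> \<tau>" for s
  proof -
    have "sqrt s \<le> \<eta> / (K + 1)" using real_sqrt_le_mono[OF that] \<eta> K by (simp add: \<tau>_def)
    then have "K * sqrt s \<le> K * (\<eta> / (K + 1))" using K by (rule mult_left_mono)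
    also have "\<dots> \<le> \<eta>" using K \<eta> by (simp add: field_simps)
    finally show ?thesis .
  qed
  have "\<forall>\<^sub>F n in sequentially. \<epsilon> n < \<tau> / 2 \<and> 0 < n"
    using order_tendstoD(2)[OF \<epsilon>, of "\<tau> / 2"] \<tau> eventually_gt_at_top[of 0] eventually_conj by fastforce
  then have "\<forall>\<^sub>F n in sequentially. \<forall>v (g :: real ^ 'p \<Rightarrow> real). norm v < \<delta> \<longrightarrow> bfun K g \<longrightarrow>
    \<bar>(\<integral>x. g (x + v) \<partial>distr (sample n) borel (Z n)) - (\<integral>x. g x \<partial>distr (sample n) borel (Z n))\<bar> \<le> \<eta> \<and>
    \<bar>(\<integral>x. g (x + v) \<partial>gauss_law J) - (\<integral>x. g x \<partial>gauss_law J)\<bar> \<le> \<eta>"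
  proof eventually_elim
    case (elim n)
    show ?case
    proof (intro allI impI conjI)
      fix v :: "real ^ 'p" and g :: "real ^ 'p \<Rightarrow> real" assume v: "norm v < \<delta>" and g: "bfun K g"
      have gm[measurable]: "g \<in> borel_measurable borel" and gK: "\<And>x. \<bar>g x\<bar> \<le> K" using g by (simp_all add: bfun_def)
      have v2: "(norm v)\<^sup>2 \<le> \<delta>\<^sup>2" using v by (intro power_mono) auto
      define G where "G x = g ((1 / sqrt n) *\<^sub>R (matrix_inv J *v x))" for x
      have G: "bfun K G" using g by (auto simp: bfun_def G_def[abs_def])
      define w where "w = sqrt n *\<^sub>R (J *v v)"
      have rep: "(\<integral>y. G (x + (\<Sum>i<n. sc (y i))) \<partial>sample n) = (conv_op (distr P borel sc) ^^ n) G x" for x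
        by (rule integral_sum_PiM[OF prob_P sc G])
      have "(\<integral>x. g (x + v) \<partial>distr (sample n) borel (Z n)) = (\<integral>y. G (w + (\<Sum>i<n. sc (y i))) \<partial>sample n)"
        using elim by (simp add: integral_distr G_def Z_def w_def matrix_vector_right_distrib
            matrix_vector_mult_scaleR scaleR_add_right pos_def_inverse(3,4)[OF J] add.commute)
      moreover have "(\<integral>x. g x \<partial>distr (sample n) borel (Z n)) = (\<integral>y. G (0 + (\<Sum>i<n. sc (y i))) \<partial>sample n)"
        by (simp add: integral_distr G_def Z_def)
      ultimately have "\<bar>(\<integral>x. g (x + v) \<partial>distr (sample n) borel (Z n)) - (\<integral>x. g x \<partial>distr (sample n) borel (Z n))\<bar>
          \<le> K * sqrt (C * (norm w / sqrt (real n))\<^sup>2 + \<epsilon> n)"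
        unfolding rep using sb[rule_format, OF _ G, of n 0 w] elim by simp
      also have "\<dots> \<le> \<eta>"
      proof (rule root)
        have "norm w / sqrt n = norm (J *v v)" using elim by (simp add: w_def)
        also have "\<dots> \<le> B * norm v" by (rule B)
        finally have "(norm w / sqrt n)\<^sup>2 \<le> (B * norm v)\<^sup>2" by (intro power_mono) auto
        also have "\<dots> \<le> B\<^sup>2 * \<delta>\<^sup>2" using v2 by (simp add: power_mult_distrib mult_left_mono)
        also have "\<dots> \<le> B\<^sup>2 * (sqrt (\<tau> / (2 * (C + 1) * B\<^sup>2)))\<^sup>2"
          using \<delta>0 by (intro mult_left_mono power_mono) (auto simp: \<delta>_def)
        also have "\<dots> = \<tau> / (2 * (C + 1))" using \<tau> C B by (simp add: add_nonneg_pos)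
        finally have "C * (norm w / sqrt n)\<^sup>2 \<le> C * (\<tau> / (2 * (C + 1)))" using C by (rule mult_left_mono)
        also have "\<dots> \<le> \<tau> / 2" using C \<tau> by (simp add: field_simps)
        finally show "C * (norm w / sqrt n)\<^sup>2 + \<epsilon> n \<le> \<tau>" using elim by simp
      qed
      finally show "\<bar>(\<integral>x. g (x + v) \<partial>distr (sample n) borel (Z n)) - (\<integral>x. g x \<partial>distr (sample n) borel (Z n))\<bar> \<le> \<eta>" .
      have "\<bar>(\<integral>x. g (x + v) \<partial>gauss_law J) - (\<integral>x. g x \<partial>gauss_law J)\<bar> \<le> K * sqrt (exp (v \<bullet> (J *v v)) - 1)"
        by (rule gauss_law_shift_tv[OF gm gK J])
      also have "\<dots> \<le> \<eta>"
      proof (rule root)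
        have "v \<bullet> (J *v v) \<le> norm v * norm (J *v v)" by (rule norm_cauchy_schwarz)
        also have "\<dots> \<le> norm v * (B * norm v)" by (intro mult_left_mono B) simp
        also have "\<dots> = B * (norm v)\<^sup>2" by (simp add: power2_eq_square)
        also have "\<dots> \<le> B * \<delta>\<^sup>2" using v2 B by (intro mult_left_mono) auto
        also have "\<dots> \<le> B * (sqrt (ln (1 + \<tau>) / B))\<^sup>2"
          using \<delta>0 B by (intro mult_left_mono power_mono) (auto simp: \<delta>_def)
        also have "\<dots> = ln (1 + \<tau>)" using B \<tau> by simp
        finally have "exp (v \<bullet> (J *v v)) \<le> exp (ln (1 + \<tau>))" by simp
        then show "exp (v \<bullet> (J *v v)) - 1 \<le> \<tau>" using \<tau> by simp
      qed
      finally show "\<bar>(\<integral>x. g (x + v) \<partial>gauss_law J) - (\<integral>x. g x \<partial>gauss_law J)\<bar> \<le> \<eta>" .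
    qed
  qed
  with \<delta>0 show ?thesis by blast
qed

lemma clt_test_sequence:
  assumes "test_sequence g"
  shows "(\<lambda>n. (\<integral>y. g n (Z n y) \<partial>sample n) - (\<integral>x. g n x \<partial>gauss_law J)) \<longlonglongrightarrow> 0"
proof -
  obtain K where K: "\<And>n. bfun K (g n)" using assms unfolding test_sequence_def by blast
  have gm[measurable]: "\<And>n. g n \<in> borel_measurable borel" and gK: "\<And>n x. \<bar>g n x\<bar> \<le> K" using K by (simp_all add: bfun_def)
  have K0: "0 \<le> K" by (rule bfun_nonneg[OF K])
  have bQ: "borel_prob (distr (sample n) borel (Z n))" for n
    by (simp add: borel_prob_def prob_space.prob_space_distr[OF prob_sample])
  have bR: "borel_prob (gauss_law J)" by (simp add: borel_prob_def prob_space_gauss_law[OF J])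
  have "(\<lambda>n. (\<integral>x. g n x \<partial>distr (sample n) borel (Z n)) - (\<integral>x. g n x \<partial>gauss_law J)) \<longlonglongrightarrow> 0"
  proof (rule limit_of_shift_continuous[OF _ _ _ _ char_limit gm gK])
    fix \<eta> :: real assume \<eta>: "0 < \<eta>"
    consider (ac) "has_ac_component (distr P borel sc)"
      | (lip) L where "0 \<le> L" "\<And>n x y. \<bar>g n x - g n y\<bar> \<le> L * norm (x - y)"
      using assms unfolding test_sequence_def by blast
    then show "\<exists>\<delta>>0. \<forall>\<^sub>F n in sequentially. \<forall>v. norm v < \<delta> \<longrightarrow>
      \<bar>(\<integral>x. g n (x + v) \<partial>distr (sample n) borel (Z n)) - (\<integral>x. g n x \<partial>distr (sample n) borel (Z n))\<bar> \<le> \<eta> \<and>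
      \<bar>(\<integral>x. g n (x + v) \<partial>gauss_law J) - (\<integral>x. g n x \<partial>gauss_law J)\<bar> \<le> \<eta>"
    proof cases
      case ac
      from shift_continuity_ac[OF ac \<eta> K0] obtain \<delta> where \<delta>: "0 < \<delta>" and ev: "\<forall>\<^sub>F n in sequentially. \<forall>v (g :: real ^ 'p \<Rightarrow> real). norm v < \<delta> \<longrightarrow> bfun K g \<longrightarrow>
          \<bar>(\<integral>x. g (x + v) \<partial>distr (sample n) borel (Z n)) - (\<integral>x. g x \<partial>distr (sample n) borel (Z n))\<bar> \<le> \<eta> \<and>
          \<bar>(\<integral>x. g (x + v) \<partial>gauss_law J) - (\<integral>x. g x \<partial>gauss_law J)\<bar> \<le> \<eta>" by blast
      from ev have "\<forall>\<^sub>F n in sequentially. \<forall>v. norm v < \<delta> \<longrightarrow>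
          \<bar>(\<integral>x. g n (x + v) \<partial>distr (sample n) borel (Z n)) - (\<integral>x. g n x \<partial>distr (sample n) borel (Z n))\<bar> \<le> \<eta> \<and>
          \<bar>(\<integral>x. g n (x + v) \<partial>gauss_law J) - (\<integral>x. g n x \<partial>gauss_law J)\<bar> \<le> \<eta>"
        by eventually_elim (use K in blast)
      with \<delta> show ?thesis by blast
    next
      case lip
      define \<delta> where "\<delta> = \<eta> / (L + 1)"
      have \<delta>: "0 < \<delta>" using \<eta> lip by (simp add: \<delta>_def)
      have small: "L * norm v \<le> \<eta>" if "norm v < \<delta>" for v :: "real ^ 'p"
      proof -
        have "L * norm v \<le> L * \<delta>" using that lip by (intro mult_left_mono) auto
        also have "\<dots> \<le> \<eta>" using \<eta> lip by (simp add: \<delta>_def field_simps)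
        finally show ?thesis .
      qed
      show ?thesis
        by (intro exI[of _ \<delta>] conjI \<delta> always_eventually allI impI)
          (rule order_trans[OF shift_continuity_lipschitz[OF lip K] small], (rule bQ bR), assumption)+
    qed
  qed (use bQ bR in \<open>auto simp: borel_prob_def\<close>)
  then show ?thesis by (simp add: integral_distr)
qed

lemma gauss_ratio_Z: "gauss_ratio J h (Z n y) = exp ((\<Sum>i<n. h \<bullet> sc (y i)) / sqrt (real n) - h \<bullet> (J *v h) / 2)"
  by (simp add: gauss_ratio_def inner_J_Z)

text \<open>Powers of \<open>L\<^sub>h(Z n)\<close>, written as \<open>exp (c ln \<dots>)\<close>: the exponents \<open>1\<close>, \<open>2\<close> and \<open>-1\<close> are used for the mean, for the
  tails and for the distance of \<open>L\<^sub>h(Z n)\<close> from \<open>0\<close>.\<close>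

lemma gauss_ratio_power_limit:
  shows "\<forall>\<^sub>F n in sequentially. integrable (sample n) (\<lambda>y. exp (c * ln (gauss_ratio J h (Z n y))))"
    and "(\<lambda>n. \<integral>y. exp (c * ln (gauss_ratio J h (Z n y))) \<partial>sample n) \<longlonglongrightarrow> exp ((c\<^sup>2 - c) * (h \<bullet> (J *v h)) / 2)"
proof -
  define X where "X y = h \<bullet> sc y" for y
  obtain e where e: "0 < e" "integrable P (\<lambda>y. exp (e * \<bar>X y\<bar>))" unfolding X_def using exp_moments by blast
  have X: "X \<in> borel_measurable P" unfolding X_def by measurable
  have m: "expectation X = 0" unfolding X_def by (rule mean_zero)
  have v: "expectation (\<lambda>y. (X y)\<^sup>2) = h \<bullet> (J *v h)" unfolding X_def variance ..
  note S = exp_sum_limit_real[OF X e m v, of c]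
  have eq: "exp (c * ln (gauss_ratio J h (Z n y))) = exp (- c * (h \<bullet> (J *v h)) / 2) * exp (c * ((\<Sum>i<n. X (y i)) / sqrt (real n)))" for n y
    by (simp add: gauss_ratio_Z X_def mult_exp_exp right_diff_distrib)
  show "\<forall>\<^sub>F n in sequentially. integrable (sample n) (\<lambda>y. exp (c * ln (gauss_ratio J h (Z n y))))"
    unfolding eq using S(1) by eventually_elim (intro integrable_mult_right)
  have "(\<lambda>n. exp (- c * (h \<bullet> (J *v h)) / 2) * (\<integral>y. exp (c * ((\<Sum>i<n. X (y i)) / sqrt (real n))) \<partial>sample n))
      \<longlonglongrightarrow> exp (- c * (h \<bullet> (J *v h)) / 2) * exp (c\<^sup>2 * (h \<bullet> (J *v h)) / 2)"
    by (intro tendsto_mult tendsto_const S(2))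
  then show "(\<lambda>n. \<integral>y. exp (c * ln (gauss_ratio J h (Z n y))) \<partial>sample n) \<longlonglongrightarrow> exp ((c\<^sup>2 - c) * (h \<bullet> (J *v h)) / 2)"
    unfolding eq integral_mult_right_zero by (simp add: mult_exp_exp algebra_simps diff_divide_distrib)
qed

lemma test_sequence_mult:
  assumes g: "test_sequence g" and l: "test_sequence l"
  shows "test_sequence (\<lambda>n x. g n x * l n x)"
proof -
  obtain K where K: "\<And>n. bfun K (g n)" using g unfolding test_sequence_def by blast
  obtain T where T: "\<And>n. bfun T (l n)" using l unfolding test_sequence_def by blast
  have K0: "0 \<le> K" and T0: "0 \<le> T" by (rule bfun_nonneg[OF K] bfun_nonneg[OF T])+
  have "bfun (K * T) (\<lambda>x. g n x * l n x)" for n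
    using K[of n] T[of n] K0 T0 by (auto simp: bfun_def abs_mult intro!: mult_mono)
  moreover have "\<exists>L\<ge>0. \<forall>n x y. \<bar>g n x * l n x - g n y * l n y\<bar> \<le> L * norm (x - y)"
    if L: "0 \<le> L" "\<forall>n x y. \<bar>g n x - g n y\<bar> \<le> L * norm (x - y)"
      and L': "0 \<le> L'" "\<forall>n x y. \<bar>l n x - l n y\<bar> \<le> L' * norm (x - y)" for L L'
  proof (intro exI[of _ "L * T + K * L'"] conjI allI)
    show "0 \<le> L * T + K * L'" using L K0 T0 L' by simp
    fix n x y
    have "g n x * l n x - g n y * l n y = (g n x - g n y) * l n x + g n y * (l n x - l n y)" by (simp add: algebra_simps)
    then have "\<bar>g n x * l n x - g n y * l n y\<bar> \<le> \<bar>g n x - g n y\<bar> * \<bar>l n x\<bar> + \<bar>g n y\<bar> * \<bar>l n x - l n y\<bar>"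
      using abs_triangle_ineq[of "(g n x - g n y) * l n x" "g n y * (l n x - l n y)"] by (simp add: abs_mult)
    also have "\<dots> \<le> (L * norm (x - y)) * T + K * (L' * norm (x - y))"
      using L L' K[of n] T[of n] K0 by (intro add_mono mult_mono) (auto simp: bfun_def)
    finally show "\<bar>g n x * l n x - g n y * l n y\<bar> \<le> (L * T + K * L') * norm (x - y)" by (simp add: algebra_simps)
  qed
  ultimately show ?thesis using g l unfolding test_sequence_def by blast
qed

text \<open>The weight \<open>gauss_ratio\<close> is unbounded. Truncated at \<open>T\<close> it is a bounded Lipschitz factor, and the error
  is at most \<open>1 / T\<close> times its second moment, which is bounded in \<open>n\<close>.\<close>

lemma clt_weighted:
  assumes g: "test_sequence g"
  shows "(\<lambda>n. (\<integral>y. g n (Z n y) * gauss_ratio J h (Z n y) \<partial>sample n) - (\<integral>x. g n x * gauss_ratio J h x \<partial>gauss_law J)) \<longlonglongrightarrow> 0"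
proof (rule tendstoI)
  fix \<epsilon> :: real assume \<epsilon>: "0 < \<epsilon>"
  obtain K where K: "\<And>n. bfun K (g n)" using g unfolding test_sequence_def by blast
  have gm[measurable]: "\<And>n. g n \<in> borel_measurable borel" and gK: "\<And>n x. \<bar>g n x\<bar> \<le> K" using K by (simp_all add: bfun_def)
  have K0: "0 \<le> K" by (rule bfun_nonneg[OF K])
  interpret R: prob_space "gauss_law J" by (rule prob_space_gauss_law[OF J])
  let ?L = "gauss_ratio J h"
  define E where "E = exp (h \<bullet> (J *v h)) + 1"
  have E: "0 < E" by (simp add: E_def add_pos_pos)
  \<comment> \<open>the truncation level at which both tails are below \<open>\<epsilon> / 3\<close>\<close>
  define T where "T = 3 * (K + 1) * E / \<epsilon>"
  have T: "0 < T" using \<epsilon> E K0 by (simp add: T_def)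
  have tail_small: "K * (E / T) \<le> \<epsilon> / 3"
  proof -
    have "K * (E / T) = (K / (K + 1)) * (\<epsilon> / 3)" using E \<epsilon> K0 by (simp add: T_def)
    also have "\<dots> \<le> 1 * (\<epsilon> / 3)" using K0 \<epsilon> by (intro mult_right_mono) auto
    finally show ?thesis by simp
  qed
  define l where "l x = min (?L x) T" for x
  have l_exp: "l x = exp (min (h \<bullet> (J *v x) - 1 / 2 * (h \<bullet> (J *v h))) (ln T))" for x
    using T by (simp add: l_def gauss_ratio_def min_def) (metis exp_le_cancel_iff exp_ln)
  have [measurable]: "l \<in> borel_measurable borel" unfolding l_def by measurable
  have l0: "0 \<le> l x" for x using T gauss_ratio_pos[of J h x] by (simp add: l_def)
  have lT: "bfun T l" using l0 by (simp add: bfun_def abs_of_nonneg) (simp add: l_def)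
  have lip: "\<bar>l x - l y\<bar> \<le> T * norm (J *v h) * norm (x - y)" for x y
  proof -
    have "\<bar>l x - l y\<bar> \<le> exp (ln T) * \<bar>(h \<bullet> (J *v x) - 1 / 2 * (h \<bullet> (J *v h))) - (h \<bullet> (J *v y) - 1 / 2 * (h \<bullet> (J *v h)))\<bar>"
      unfolding l_exp by (rule exp_min_lipschitz)
    also have "\<dots> = T * \<bar>(J *v h) \<bullet> (x - y)\<bar>" using T by (simp add: pos_def_sym[OF J] inner_diff_right)
    also have "\<dots> \<le> T * (norm (J *v h) * norm (x - y))" using T by (intro mult_left_mono Cauchy_Schwarz_ineq2) auto
    finally show ?thesis by simp
  qed
  have ts: "test_sequence (\<lambda>n x. g n x * l x)"
  proof (rule test_sequence_mult[OF g])
    have "0 \<le> T * norm (J *v h)" using T by simp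
    with lT lip show "test_sequence (\<lambda>_. l)" unfolding test_sequence_def by blast
  qed
  have tail: "\<bar>?L x - l x\<bar> \<le> (?L x)\<^sup>2 / T" for x
  proof (cases "?L x \<le> T")
    case True then show ?thesis using T by (simp add: l_def)
  next
    case False
    have "?L x * 1 \<le> ?L x * (?L x / T)" using False T gauss_ratio_pos[of J h x] by (intro mult_left_mono) auto
    then show ?thesis using False T by (simp add: l_def power2_eq_square)
  qed
  have err: "integrable M (\<lambda>y. ?L (W y)) \<and> \<bar>(\<integral>y. g n (W y) * ?L (W y) \<partial>M) - (\<integral>y. g n (W y) * l (W y) \<partial>M)\<bar> \<le> \<epsilon> / 3"
    if M: "prob_space M" and W[measurable]: "W \<in> borel_measurable M"
      and i2: "integrable M (\<lambda>y. (?L (W y))\<^sup>2)" and e2: "(\<integral>y. (?L (W y))\<^sup>2 \<partial>M) \<le> E" for M :: "'b measure" and W n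
  proof -
    interpret M: prob_space M by fact
    have iL: "integrable M (\<lambda>y. ?L (W y))"
      using integral_cauchy_schwarz(1)[OF _ _ i2, of "\<lambda>_. 1"] by simp
    have igL: "integrable M (\<lambda>y. g n (W y) * ?L (W y))"
      by (rule Bochner_Integration.integrable_bound[OF integrable_mult_right[OF iL, of K]])
        (auto simp: abs_mult K0 less_imp_le[OF gauss_ratio_pos] intro!: mult_right_mono gK)
    have igl: "integrable M (\<lambda>y. g n (W y) * l (W y))"
      by (rule M.integrable_const_bound[where B="K * T"])
        (use gK lT K0 in \<open>auto simp: abs_mult bfun_def intro!: mult_mono\<close>)
    have "(\<integral>y. g n (W y) * ?L (W y) \<partial>M) - (\<integral>y. g n (W y) * l (W y) \<partial>M) = (\<integral>y. g n (W y) * (?L (W y) - l (W y)) \<partial>M)"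
      using igL igl by (simp add: right_diff_distrib)
    also have "norm \<dots> \<le> (\<integral>y. K * ((?L (W y))\<^sup>2 / T) \<partial>M)"
    proof (rule norm_integral_le)
      show "integrable M (\<lambda>y. K * ((?L (W y))\<^sup>2 / T))" using i2 by simp
      show "norm (g n (W y) * (?L (W y) - l (W y))) \<le> K * ((?L (W y))\<^sup>2 / T)" for y
        unfolding real_norm_def abs_mult by (intro mult_mono gK tail K0 abs_ge_zero)
    qed
    also have "\<dots> = K * ((\<integral>y. (?L (W y))\<^sup>2 \<partial>M) / T)" by simp
    also have "\<dots> \<le> K * (E / T)" using e2 T K0 by (intro mult_left_mono divide_right_mono) auto
    also have "\<dots> \<le> \<epsilon> / 3" by (rule tail_small)
    finally show ?thesis using iL by simp
  qed
  have sq: "(?L x)\<^sup>2 = exp (2 * ln (?L x))" for x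
    using gauss_ratio_pos[of J h x] by (simp add: exp_double)
  have lim2: "(\<lambda>n. \<integral>y. (?L (Z n y))\<^sup>2 \<partial>sample n) \<longlonglongrightarrow> exp (h \<bullet> (J *v h))"
    unfolding sq using gauss_ratio_power_limit(2)[of 2 h] by (simp add: power2_eq_square)
  have int2: "\<forall>\<^sub>F n in sequentially. integrable (sample n) (\<lambda>y. (?L (Z n y))\<^sup>2)"
    unfolding sq by (rule gauss_ratio_power_limit(1))
  have ev2: "\<forall>\<^sub>F n in sequentially. (\<integral>y. (?L (Z n y))\<^sup>2 \<partial>sample n) < E"
    by (rule order_tendstoD(2)[OF lim2]) (simp add: E_def)
  have ev3: "\<forall>\<^sub>F n in sequentially. \<bar>(\<integral>y. g n (Z n y) * l (Z n y) \<partial>sample n) - (\<integral>x. g n x * l x \<partial>gauss_law J)\<bar> < \<epsilon> / 3"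
    using tendstoD[OF clt_test_sequence[OF ts], of "\<epsilon> / 3"] \<epsilon> by simp
  have R3: "\<bar>(\<integral>x. g n x * ?L x \<partial>gauss_law J) - (\<integral>x. g n x * l x \<partial>gauss_law J)\<bar> \<le> \<epsilon> / 3" for n
    using err[OF R.prob_space_axioms, of "\<lambda>x. x" n] gauss_ratio_moments[OF J, of h] by (simp add: E_def)
  show "\<forall>\<^sub>F n in sequentially. dist ((\<integral>y. g n (Z n y) * ?L (Z n y) \<partial>sample n) - (\<integral>x. g n x * ?L x \<partial>gauss_law J)) 0 < \<epsilon>"
    using int2 ev2 ev3
  proof eventually_elim
    case (elim n)
    have "\<bar>(\<integral>y. g n (Z n y) * ?L (Z n y) \<partial>sample n) - (\<integral>y. g n (Z n y) * l (Z n y) \<partial>sample n)\<bar> \<le> \<epsilon> / 3"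
      using err[OF prob_sample Z_measurable elim(1)] elim(2) by simp
    then show ?case using elim(3) R3[of n] unfolding dist_real_def by linarith
  qed
qed

end

section \<open>Selection\<close>

lemma cond_exp_given_integral:
  fixes Z :: "'a \<Rightarrow> real ^ 'p"
  assumes M: "prob_space M" and Z[measurable]: "Z \<in> borel_measurable M" and X[measurable]: "X \<in> borel_measurable M"
    and B: "\<And>\<omega>. \<omega> \<in> space M \<Longrightarrow> \<bar>X \<omega>\<bar> \<le> B"
    and ce: "is_cond_exp_given M X Z g" and g[measurable]: "g \<in> borel_measurable borel" and \<phi>[measurable]: "\<phi> \<in> borel_measurable borel"
    and int: "integrable M (\<lambda>\<omega>. \<phi> (Z \<omega>))"
  shows "(\<integral>\<omega>. X \<omega> * \<phi> (Z \<omega>) \<partial>M) = (\<integral>\<omega>. g (Z \<omega>) * \<phi> (Z \<omega>) \<partial>M)"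
proof -
  interpret M: prob_space M by fact
  define F where "F = vimage_algebra (space M) Z borel"
  have sub: "subalgebra M F"
    unfolding subalgebra_def F_def by (auto intro: subsetD[OF sets_image_in_sets[OF refl Z]])
  interpret F: finite_measure_subalgebra M F
    using sub by unfold_locales
  have ZF: "Z \<in> borel_measurable F" unfolding F_def by (rule measurable_vimage_algebra1) auto
  have ZF': "(\<lambda>\<omega>. \<phi> (Z \<omega>)) \<in> borel_measurable F" using ZF by measurable
  have intX: "integrable M (\<lambda>\<omega>. \<phi> (Z \<omega>) * X \<omega>)"
  proof (rule Bochner_Integration.integrable_bound[OF integrable_mult_right[OF int, of B]])
    show "AE \<omega> in M. norm (\<phi> (Z \<omega>) * X \<omega>) \<le> norm (B * \<phi> (Z \<omega>))"
    proof (rule AE_I2)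
      fix \<omega> assume "\<omega> \<in> space M"
      then have "\<bar>\<phi> (Z \<omega>)\<bar> * \<bar>X \<omega>\<bar> \<le> \<bar>\<phi> (Z \<omega>)\<bar> * \<bar>B\<bar>" using B[of \<omega>] by (intro mult_left_mono) auto
      then show "norm (\<phi> (Z \<omega>) * X \<omega>) \<le> norm (B * \<phi> (Z \<omega>))" by (simp add: abs_mult mult.commute)
    qed
  qed measurable
  have "(\<integral>\<omega>. X \<omega> * \<phi> (Z \<omega>) \<partial>M) = (\<integral>\<omega>. \<phi> (Z \<omega>) * X \<omega> \<partial>M)" by (simp add: mult.commute)
  also have "\<dots> = (\<integral>\<omega>. \<phi> (Z \<omega>) * real_cond_exp M F X \<omega> \<partial>M)"
    by (rule F.real_cond_exp_intg(2)[OF intX ZF' X, symmetric])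
  also have "\<dots> = (\<integral>\<omega>. g (Z \<omega>) * \<phi> (Z \<omega>) \<partial>M)"
  proof (rule integral_cong_AE)
    show "AE \<omega> in M. \<phi> (Z \<omega>) * real_cond_exp M F X \<omega> = g (Z \<omega>) * \<phi> (Z \<omega>)"
      using ce unfolding is_cond_exp_given_def F_def by eventually_elim simp
  qed measurable
  finally show ?thesis .
qed

text \<open>Convergence along all sequences is uniform convergence: choose near-maximisers.\<close>

lemma SUP_tendsto_zero:
  fixes F :: "nat \<Rightarrow> 'a \<Rightarrow> real"
  assumes "x0 \<in> X" and bdd: "\<forall>\<^sub>F n in sequentially. bdd_above (F n ` X)"
    and lim: "\<And>x. (\<And>n. x n \<in> X) \<Longrightarrow> (\<lambda>n. F n (x n)) \<longlonglongrightarrow> 0"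
  shows "(\<lambda>n. SUP x\<in>X. F n x) \<longlonglongrightarrow> 0"
proof -
  have "\<exists>x\<in>X. (SUP x\<in>X. F n x) - 1 / real (Suc n) < F n x" for n
  proof -
    have "(SUP x\<in>X. F n x) - 1 / real (Suc n) < Sup (F n ` X)" by simp
    then show ?thesis using less_cSupE[of _ "F n ` X"] assms(1) by blast
  qed
  then obtain x where x: "\<And>n. x n \<in> X" "\<And>n. (SUP x\<in>X. F n x) - 1 / real (Suc n) < F n (x n)" by metis
  show ?thesis
  proof (rule tendsto_sandwich)
    show "(\<lambda>n. F n x0) \<longlonglongrightarrow> 0" by (rule lim) (rule assms(1))
    have "(\<lambda>n. 1 / real (Suc n)) \<longlonglongrightarrow> 0" using LIMSEQ_inverse_real_of_nat by (simp add: inverse_eq_divide)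
    from tendsto_add[OF lim[of x, OF x(1)] this] show "(\<lambda>n. F n (x n) + 1 / real (Suc n)) \<longlonglongrightarrow> 0" by simp
    show "\<forall>\<^sub>F n in sequentially. F n x0 \<le> (SUP x\<in>X. F n x)"
      using bdd by eventually_elim (rule cSUP_upper[OF assms(1)])
    show "\<forall>\<^sub>F n in sequentially. (SUP x\<in>X. F n x) \<le> F n (x n) + 1 / real (Suc n)"
      using x(2) by (intro always_eventually allI) (smt (verit))
  qed
qed

lemma ratio_tendsto_one:
  fixes x y :: "nat \<Rightarrow> real"
  assumes "(\<lambda>n. x n - y n) \<longlonglongrightarrow> 0" and c: "0 < c" and y: "\<forall>\<^sub>F n in sequentially. c \<le> y n"
  shows "(\<lambda>n. x n / y n) \<longlonglongrightarrow> 1"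
proof -
  have "(\<lambda>n. x n / y n - 1) \<longlonglongrightarrow> 0"
  proof (rule Lim_null_comparison)
    show "\<forall>\<^sub>F n in sequentially. norm (x n / y n - 1) \<le> \<bar>x n - y n\<bar> / c"
      using y
    proof eventually_elim
      case (elim n)
      have "x n / y n - 1 = (x n - y n) / y n" using elim c by (simp add: diff_divide_distrib)
      then have "norm (x n / y n - 1) = \<bar>x n - y n\<bar> / y n" using elim c by (simp add: abs_divide)
      also have "\<dots> \<le> \<bar>x n - y n\<bar> / c" using elim c by (intro divide_left_mono) auto
      finally show ?case .
    qed
    show "(\<lambda>n. \<bar>x n - y n\<bar> / c) \<longlonglongrightarrow> 0" using tendsto_divide[OF tendsto_rabs[OF assms(1)] tendsto_const[of c]] c by simp
  qed
  then show ?thesis using LIM_zero_cancel by fastforce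
qed

lemma ratio_diff_tendsto_zero:
  fixes x y a b :: "nat \<Rightarrow> real"
  assumes ab: "(\<lambda>n. a n - b n) \<longlonglongrightarrow> 0" and xy: "(\<lambda>n. x n - y n) \<longlonglongrightarrow> 0"
    and b: "\<And>n. \<bar>b n\<bar> \<le> K" and c: "0 < c" "\<forall>\<^sub>F n in sequentially. c \<le> x n" "\<forall>\<^sub>F n in sequentially. c \<le> y n"
  shows "(\<lambda>n. a n / x n - b n / y n) \<longlonglongrightarrow> 0"
proof (rule Lim_null_comparison)
  show "\<forall>\<^sub>F n in sequentially. norm (a n / x n - b n / y n) \<le> \<bar>a n - b n\<bar> / c + K * \<bar>x n - y n\<bar> / (c * c)"
    using c(2,3)
  proof eventually_elim
    case (elim n)
    have pos: "0 < x n" "0 < y n" using elim c by auto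
    have eq: "a n / x n - b n / y n = (a n - b n) / x n - b n * (x n - y n) / (x n * y n)"
      using pos by (simp add: field_simps)
    have "norm (a n / x n - b n / y n) \<le> \<bar>(a n - b n) / x n\<bar> + \<bar>b n * (x n - y n) / (x n * y n)\<bar>"
      unfolding eq real_norm_def by (rule abs_triangle_ineq4)
    moreover have "\<bar>(a n - b n) / x n\<bar> \<le> \<bar>a n - b n\<bar> / c"
      using elim c pos by (simp add: abs_divide) (intro divide_left_mono, auto)
    moreover have "\<bar>b n * (x n - y n) / (x n * y n)\<bar> = \<bar>b n\<bar> * \<bar>x n - y n\<bar> / (x n * y n)"
      using pos by (simp add: abs_mult abs_divide)
    moreover have "\<bar>b n\<bar> * \<bar>x n - y n\<bar> / (x n * y n) \<le> K * \<bar>x n - y n\<bar> / (c * c)"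
      using elim c pos b[of n] by (intro frac_le mult_mono) auto
    ultimately show ?case by linarith
  qed
  have "(\<lambda>n. \<bar>a n - b n\<bar> / c + K * \<bar>x n - y n\<bar> / (c * c)) \<longlonglongrightarrow> \<bar>0\<bar> / c + K * \<bar>0\<bar> / (c * c)"
    using c by (intro tendsto_intros ab xy) auto
  then show "(\<lambda>n. \<bar>a n - b n\<bar> / c + K * \<bar>x n - y n\<bar> / (c * c)) \<longlonglongrightarrow> 0" by simp
qed

text \<open>\<open>p n\<close> is the selection function and \<open>ps n\<close> its conditional expectation given \<open>Z n\<close>. Nothing is assumed about
  \<open>p 0\<close>, because samples have positive size.\<close>

locale selected_score_model = score_model +
  fixes p :: "nat \<Rightarrow> (nat \<Rightarrow> 'a) \<Rightarrow> real" and ps :: "nat \<Rightarrow> real ^ 'b \<Rightarrow> real" and B c0 :: real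
  assumes p_measurable: "\<And>n. 0 < n \<Longrightarrow> p n \<in> borel_measurable (sample n)"
    and p_bounds: "\<And>n y. 0 < n \<Longrightarrow> y \<in> space (sample n) \<Longrightarrow> 0 \<le> p n y \<and> p n y \<le> B"
    and ps_nonneg: "\<And>n z. 0 \<le> ps n z"
    and ps_test: "test_sequence ps"
    and ps_cond_exp: "\<And>n. 0 < n \<Longrightarrow> is_cond_exp_given (sample n) (p n) (Z n) (ps n)"
    and c0: "0 < c0" "\<And>n. 0 < n \<Longrightarrow> c0 \<le> (\<integral>y. p n y \<partial>sample n)"
begin

definition sel :: "nat \<Rightarrow> (nat \<Rightarrow> 'a) measure" where
  "sel n = density (sample n) (\<lambda>y. ennreal (p n y / (\<integral>y. p n y \<partial>sample n)))"

text \<open>The selection probability in the limit experiment, \<open>E[p\<^sup>*(Z)]\<close> with \<open>Z \<sim> N(h, J\<^sup>-\<^sup>1)\<close>, as an integral with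
  respect to \<open>N(0, J\<^sup>-\<^sup>1)\<close>.\<close>

definition gsel :: "nat \<Rightarrow> real ^ 'b \<Rightarrow> real" where
  "gsel n h = (\<integral>x. ps n x * gauss_ratio J h x \<partial>gauss_law J)"

lemma ps_measurable[measurable]: "ps n \<in> borel_measurable borel"
  using ps_test unfolding test_sequence_def bfun_def by blast

lemma gsel_0: "gsel n 0 = (\<integral>x. ps n x \<partial>gauss_law J)"
  by (simp add: gsel_def gauss_ratio_def)

lemma p_integral_eq:
  assumes n: "0 < n" and \<phi>: "\<phi> \<in> borel_measurable borel" and int: "integrable (sample n) (\<lambda>y. \<phi> (Z n y))"
  shows "(\<integral>y. p n y * \<phi> (Z n y) \<partial>sample n) = (\<integral>y. ps n (Z n y) * \<phi> (Z n y) \<partial>sample n)"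
proof (rule cond_exp_given_integral[OF prob_sample Z_measurable p_measurable[OF n] _ ps_cond_exp[OF n] ps_measurable \<phi> int])
  show "\<bar>p n y\<bar> \<le> B" if "y \<in> space (sample n)" for y using p_bounds[OF n that] by simp
qed

lemma sel_prob_limit: "(\<lambda>n. (\<integral>y. p n y \<partial>sample n) - gsel n 0) \<longlonglongrightarrow> 0"
proof -
  have "\<forall>\<^sub>F n in sequentially. (\<integral>y. ps n (Z n y) \<partial>sample n) - (\<integral>x. ps n x \<partial>gauss_law J) = (\<integral>y. p n y \<partial>sample n) - gsel n 0"
    using eventually_gt_at_top[of 0]
  proof eventually_elim
    case (elim n)
    interpret S: prob_space "sample n" by (rule prob_sample)
    have i: "integrable (sample n) (\<lambda>y. 1 :: real)" by simp
    have "(\<integral>y. p n y \<partial>sample n) = (\<integral>y. ps n (Z n y) \<partial>sample n)"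
      using p_integral_eq[OF elim borel_measurable_const[of "1 :: real"] i] by (simp only: mult_1_right)
    then show ?case by (simp only: gsel_0)
  qed
  then show ?thesis by (rule Lim_transform_eventually[OF clt_test_sequence[OF ps_test]])
qed

lemma integrable_gauss_ratio_Z: "\<forall>\<^sub>F n in sequentially. integrable (sample n) (\<lambda>y. gauss_ratio J h (Z n y))"
  using gauss_ratio_power_limit(1)[of 1 h] by (simp add: gauss_ratio_pos)

lemma tilted_sel_prob_limit: "(\<lambda>n. (\<integral>y. p n y * gauss_ratio J h (Z n y) \<partial>sample n) - gsel n h) \<longlonglongrightarrow> 0"
proof -
  have "\<forall>\<^sub>F n in sequentially. (\<integral>y. ps n (Z n y) * gauss_ratio J h (Z n y) \<partial>sample n) - (\<integral>x. ps n x * gauss_ratio J h x \<partial>gauss_law J)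
      = (\<integral>y. p n y * gauss_ratio J h (Z n y) \<partial>sample n) - gsel n h"
    using eventually_gt_at_top[of 0] integrable_gauss_ratio_Z[of h]
  proof eventually_elim
    case (elim n)
    show ?case unfolding gsel_def p_integral_eq[OF elim(1) gauss_ratio_measurable elim(2)] ..
  qed
  then show ?thesis by (rule Lim_transform_eventually[OF clt_weighted[OF ps_test]])
qed

lemma gsel_0_lower: "\<forall>\<^sub>F n in sequentially. c0 / 2 \<le> gsel n 0"
proof -
  have "\<forall>\<^sub>F n in sequentially. \<bar>(\<integral>y. p n y \<partial>sample n) - gsel n 0\<bar> < c0 / 2"
    using tendstoD[OF sel_prob_limit, of "c0 / 2"] c0 by simp
  with eventually_gt_at_top[of 0] show ?thesis
  proof eventually_elim
    case (elim n)
    then show ?case using c0(2)[OF elim(1)] by linarith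
  qed
qed

text \<open>A lower bound at \<open>0\<close> carries over to every \<open>h\<close>, because by the Cauchy-Schwarz inequality
  \<open>(E[p\<^sup>*])\<^sup>2 \<le> E[p\<^sup>* L\<^sub>h] E[p\<^sup>* / L\<^sub>h]\<close>, where \<open>p\<^sup>*\<close> is bounded and \<open>1 / L\<^sub>h\<close> is integrable.\<close>

lemma gsel_lower: "\<exists>c>0. \<forall>\<^sub>F n in sequentially. c \<le> gsel n h"
proof -
  obtain K where K: "\<And>n. bfun K (ps n)" using ps_test unfolding test_sequence_def by blast
  have psK: "ps n x \<le> K" for n x using K[of n] ps_nonneg[of n x] by (auto simp: bfun_def abs_le_iff)
  have K0: "0 \<le> K" by (rule bfun_nonneg[OF K])
  interpret R: prob_space "gauss_law J" by (rule prob_space_gauss_law[OF J])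
  let ?L = "gauss_ratio J h" and ?e = "exp (h \<bullet> (J *v h))"
  have inv: "1 / ?L x = ?e * gauss_ratio J (- h) x" for x
  proof -
    have neg: "J *v (- h) = - (J *v h)" using matrix_vector_mult_scaleR[of J "-1" h] by simp
    have "1 / ?L x = exp (- (h \<bullet> (J *v x) - 1 / 2 * (h \<bullet> (J *v h))))"
      by (simp only: gauss_ratio_def exp_minus inverse_eq_divide)
    also have "\<dots> = ?e * gauss_ratio J (- h) x" by (simp add: gauss_ratio_def neg mult_exp_exp)
    finally show ?thesis .
  qed
  have key: "(gsel n 0)\<^sup>2 \<le> gsel n h * (K * ?e)" for n
  proof -
    have i1: "integrable (gauss_law J) (\<lambda>x. (sqrt (ps n x * ?L x))\<^sup>2)"
      using psK ps_nonneg K0 gauss_ratio_pos[of J h]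
      by (intro Bochner_Integration.integrable_bound[OF integrable_mult_right[OF gauss_ratio_moments(1)[OF J, of h], of K]])
        (auto simp: abs_mult less_imp_le intro!: mult_right_mono)
    have i2: "integrable (gauss_law J) (\<lambda>x. (sqrt (ps n x * (1 / ?L x)))\<^sup>2)"
      using psK ps_nonneg K0 gauss_ratio_pos[of J "- h"] unfolding inv
      by (intro Bochner_Integration.integrable_bound[OF integrable_mult_right[OF gauss_ratio_moments(1)[OF J, of "- h"], of "K * ?e"]])
        (auto simp: abs_mult less_imp_le mult.assoc[symmetric] intro!: mult_right_mono)
    have e2: "(\<integral>x. (sqrt (ps n x * (1 / ?L x)))\<^sup>2 \<partial>gauss_law J) \<le> K * ?e"
    proof -
      have "(\<integral>x. (sqrt (ps n x * (1 / ?L x)))\<^sup>2 \<partial>gauss_law J) \<le> (\<integral>x. (K * ?e) * gauss_ratio J (- h) x \<partial>gauss_law J)"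
      proof (rule integral_mono[OF i2 integrable_mult_right[OF gauss_ratio_moments(1)[OF J]]])
        fix x
        have "(sqrt (ps n x * (1 / ?L x)))\<^sup>2 = ps n x * (1 / ?L x)"
          using ps_nonneg[of n x] gauss_ratio_pos[of J h x] by simp
        also have "\<dots> \<le> K * (1 / ?L x)" using psK gauss_ratio_pos[of J h x] by (intro mult_right_mono) (auto simp: less_imp_le)
        finally show "(sqrt (ps n x * (1 / ?L x)))\<^sup>2 \<le> (K * ?e) * gauss_ratio J (- h) x" unfolding inv by (simp add: mult.assoc)
      qed
      also have "\<dots> = K * ?e" by (simp only: integral_mult_right_zero gauss_ratio_moments(2)[OF J] mult_1_right)
      finally show ?thesis .
    qed
    have "gsel n 0 = (\<integral>x. sqrt (ps n x * ?L x) * sqrt (ps n x * (1 / ?L x)) \<partial>gauss_law J)"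
      unfolding gsel_0
    proof (intro Bochner_Integration.integral_cong refl)
      fix x
      have "ps n x * ?L x * (ps n x * (1 / ?L x)) = (ps n x)\<^sup>2"
        using gauss_ratio_pos[of J h x] by (simp add: power2_eq_square)
      then show "ps n x = sqrt (ps n x * ?L x) * sqrt (ps n x * (1 / ?L x))"
        using ps_nonneg[of n x] by (simp only: real_sqrt_mult[symmetric] real_sqrt_abs abs_of_nonneg)
    qed
    then have "\<bar>gsel n 0\<bar> \<le> sqrt (\<integral>x. (sqrt (ps n x * ?L x))\<^sup>2 \<partial>gauss_law J) * sqrt (\<integral>x. (sqrt (ps n x * (1 / ?L x)))\<^sup>2 \<partial>gauss_law J)"
      using integral_cauchy_schwarz(2)[OF _ _ i1 i2] by simp
    also have "(\<integral>x. (sqrt (ps n x * ?L x))\<^sup>2 \<partial>gauss_law J) = gsel n h"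
      unfolding gsel_def using ps_nonneg gauss_ratio_pos[of J h] by (simp add: less_imp_le)
    also have "sqrt (gsel n h) * sqrt (\<integral>x. (sqrt (ps n x * (1 / ?L x)))\<^sup>2 \<partial>gauss_law J) \<le> sqrt (gsel n h) * sqrt (K * ?e)"
      using ps_nonneg gauss_ratio_pos[of J h] by (intro mult_left_mono real_sqrt_le_mono e2) (auto simp: gsel_def less_imp_le)
    finally have "\<bar>gsel n 0\<bar> \<le> sqrt (gsel n h * (K * ?e))" by (simp add: real_sqrt_mult)
    then have "\<bar>gsel n 0\<bar>\<^sup>2 \<le> (sqrt (gsel n h * (K * ?e)))\<^sup>2" by (rule power_mono) simp
    moreover have "0 \<le> gsel n h" unfolding gsel_def using ps_nonneg gauss_ratio_pos[of J h] by (simp add: less_imp_le)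
    ultimately show ?thesis using K0 by simp
  qed
  \<comment> \<open>\<open>K + 1\<close> in place of \<open>K\<close> avoids division by \<open>0\<close>\<close>
  define c where "c = (c0 / 2)\<^sup>2 / ((K + 1) * ?e)"
  have "\<forall>\<^sub>F n in sequentially. c \<le> gsel n h"
    using gsel_0_lower
  proof eventually_elim
    case (elim n)
    have g0: "0 \<le> gsel n h" unfolding gsel_def using ps_nonneg gauss_ratio_pos[of J h] by (simp add: less_imp_le)
    have "(c0 / 2)\<^sup>2 \<le> (gsel n 0)\<^sup>2" using elim c0 by (intro power_mono) auto
    also have "\<dots> \<le> gsel n h * (K * ?e)" by (rule key)
    also have "\<dots> \<le> gsel n h * ((K + 1) * ?e)" using g0 by (intro mult_left_mono mult_right_mono) auto
    finally show ?case unfolding c_def using K0 by (simp add: divide_le_eq add_nonneg_pos)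
  qed
  moreover have "0 < c" using c0 K0 by (simp add: c_def add_nonneg_pos)
  ultimately show ?thesis by blast
qed

lemma prob_sel:
  assumes n: "0 < n"
  shows "prob_space (sel n)"
proof
  interpret S: prob_space "sample n" by (rule prob_sample)
  have [measurable]: "p n \<in> borel_measurable (sample n)" by (rule p_measurable[OF n])
  let ?\<phi> = "\<integral>y. p n y \<partial>sample n"
  have \<phi>: "0 < ?\<phi>" using c0(2)[OF n] c0(1) by linarith
  have ip: "integrable (sample n) (\<lambda>y. p n y / ?\<phi>)"
    by (intro integrable_divide S.integrable_const_bound[where B=B]) (use p_bounds[OF n] in \<open>auto intro!: AE_I2\<close>)
  have "emeasure (sel n) (space (sel n)) = (\<integral>\<^sup>+y. ennreal (p n y / ?\<phi>) \<partial>sample n)"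
    unfolding sel_def by (subst emeasure_density) (auto intro!: nn_integral_cong)
  also have "\<dots> = ennreal (\<integral>y. p n y / ?\<phi> \<partial>sample n)"
    using p_bounds[OF n] \<phi> by (intro nn_integral_eq_integral ip AE_I2) auto
  also have "\<dots> = 1" using \<phi> by simp
  finally show "emeasure (sel n) (space (sel n)) = 1" .
qed

lemma sel_integral:
  assumes n: "0 < n" and g: "bfun T g"
  shows "(\<integral>x. g x \<partial>distr (sel n) borel (Z n)) = (\<integral>y. ps n (Z n y) * g (Z n y) \<partial>sample n) / (\<integral>y. p n y \<partial>sample n)"
proof -
  interpret S: prob_space "sample n" by (rule prob_sample)
  have [measurable]: "p n \<in> borel_measurable (sample n)" by (rule p_measurable[OF n])
  have [measurable]: "g \<in> borel_measurable borel" using g by (simp add: bfun_def)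
  let ?\<phi> = "\<integral>y. p n y \<partial>sample n"
  have \<phi>: "0 < ?\<phi>" using c0(2)[OF n] c0(1) by linarith
  have ig: "integrable (sample n) (\<lambda>y. g (Z n y))"
    by (rule S.integrable_const_bound[where B=T]) (use g in \<open>auto simp: bfun_def\<close>)
  have "(\<integral>x. g x \<partial>distr (sel n) borel (Z n)) = (\<integral>y. g (Z n y) \<partial>sel n)"
    by (rule integral_distr) (auto simp: sel_def)
  also have "\<dots> = (\<integral>y. p n y / ?\<phi> * g (Z n y) \<partial>sample n)"
    unfolding sel_def using p_bounds[OF n] \<phi> by (subst integral_density) (auto intro!: AE_I2)
  also have "\<dots> = (\<integral>y. p n y * g (Z n y) \<partial>sample n) / ?\<phi>" by simp
  finally show ?thesis by (simp add: p_integral_eq[OF n _ ig])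
qed

lemma gsel_law_integral:
  assumes [measurable]: "g \<in> borel_measurable borel"
  shows "(\<integral>x. g x \<partial>density (gauss_law J) (\<lambda>z. ennreal (ps n z / (\<integral>x. ps n x \<partial>gauss_law J))))
    = (\<integral>x. ps n x * g x \<partial>gauss_law J) / gsel n 0"
proof -
  have "0 \<le> (\<integral>x. ps n x \<partial>gauss_law J)" using ps_nonneg by simp
  then show ?thesis
    using ps_nonneg by (subst integral_density) (auto simp: gsel_0)
qed

lemma sel_test_limit:
  assumes g: "test_sequence g"
  shows "(\<lambda>n. (\<integral>x. g n x \<partial>distr (sel n) borel (Z n))
    - (\<integral>x. g n x \<partial>density (gauss_law J) (\<lambda>z. ennreal (ps n z / (\<integral>x. ps n x \<partial>gauss_law J))))) \<longlonglongrightarrow> 0"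
proof -
  obtain T where T: "\<And>n. bfun T (g n)" using g unfolding test_sequence_def by blast
  have ts: "test_sequence (\<lambda>n x. ps n x * g n x)" by (rule test_sequence_mult[OF ps_test g])
  then obtain K where K: "\<And>n. bfun K (\<lambda>x. ps n x * g n x)" unfolding test_sequence_def by blast
  interpret R: prob_space "gauss_law J" by (rule prob_space_gauss_law[OF J])
  have bd: "\<bar>\<integral>x. ps n x * g n x \<partial>gauss_law J\<bar> \<le> K" for n
  proof -
    have "norm (\<integral>x. ps n x * g n x \<partial>gauss_law J) \<le> (\<integral>x. K \<partial>gauss_law J)"
      by (rule norm_integral_le) (use K[of n] in \<open>auto simp: bfun_def\<close>)
    then show ?thesis using R.prob_space by simp
  qed
  have lim: "(\<lambda>n. (\<integral>y. ps n (Z n y) * g n (Z n y) \<partial>sample n) / (\<integral>y. p n y \<partial>sample n)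
      - (\<integral>x. ps n x * g n x \<partial>gauss_law J) / gsel n 0) \<longlonglongrightarrow> 0"
  proof (rule ratio_diff_tendsto_zero[OF clt_test_sequence[OF ts] sel_prob_limit bd, of "c0 / 2"])
    show "\<forall>\<^sub>F n in sequentially. c0 / 2 \<le> (\<integral>y. p n y \<partial>sample n)"
      using eventually_gt_at_top[of 0]
    proof eventually_elim
      case (elim n)
      then show ?case using c0(1) c0(2)[OF elim] by linarith
    qed
  qed (use c0 gsel_0_lower in auto)
  have "\<forall>\<^sub>F n in sequentially. (\<integral>y. ps n (Z n y) * g n (Z n y) \<partial>sample n) / (\<integral>y. p n y \<partial>sample n)
      - (\<integral>x. ps n x * g n x \<partial>gauss_law J) / gsel n 0 = (\<integral>x. g n x \<partial>distr (sel n) borel (Z n))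
    - (\<integral>x. g n x \<partial>density (gauss_law J) (\<lambda>z. ennreal (ps n z / (\<integral>x. ps n x \<partial>gauss_law J))))"
    using eventually_gt_at_top[of 0]
  proof eventually_elim
    case (elim n)
    have "g n \<in> borel_measurable borel" using T[of n] by (simp add: bfun_def)
    then show ?case by (simp only: sel_integral[OF elim T] gsel_law_integral)
  qed
  then show ?thesis by (rule Lim_transform_eventually[OF lim])
qed

text \<open>The density of the selection model is at most \<open>B / c0\<close>. \<open>A\<close> is an arbitrary subset, so that the bound
  applies directly to the set of large deviations of the log-likelihood ratio.\<close>

lemma sel_measure_le:
  assumes n: "0 < n" and N: "N \<in> null_sets (sample n)" and D: "D \<in> sets (sample n)"
    and A: "A \<subseteq> {y \<in> space (sample n). p n y = 0} \<union> N \<union> D"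
  shows "measure (sel n) A \<le> B / c0 * measure (sample n) D"
proof -
  interpret S: prob_space "sample n" by (rule prob_sample)
  interpret L: prob_space "sel n" by (rule prob_sel[OF n])
  have [measurable]: "p n \<in> borel_measurable (sample n)" by (rule p_measurable[OF n])
  have [measurable]: "N \<in> sets (sample n)" "D \<in> sets (sample n)" using N D by auto
  let ?\<phi> = "\<integral>y. p n y \<partial>sample n"
  have \<phi>: "0 < ?\<phi>" using c0(2)[OF n] c0(1) by linarith
  let ?T = "{y \<in> space (sample n). p n y = 0} \<union> N \<union> D"
  obtain y0 where "y0 \<in> space (sample n)" using S.not_empty by blast
  then have B0: "0 \<le> B" using p_bounds[OF n] by (meson order_trans)
  have "emeasure (sel n) ?T = (\<integral>\<^sup>+y. ennreal (p n y / ?\<phi>) * indicator ?T y \<partial>sample n)"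
    unfolding sel_def by (rule emeasure_density) auto
  also have "\<dots> \<le> (\<integral>\<^sup>+y. ennreal (B / c0) * indicator D y \<partial>sample n)"
  proof (rule nn_integral_mono_AE)
    show "AE y in sample n. ennreal (p n y / ?\<phi>) * indicator ?T y \<le> ennreal (B / c0) * indicator D y"
      using AE_not_in[OF N] AE_space
    proof eventually_elim
      case (elim y)
      have "p n y / ?\<phi> \<le> B / c0" using p_bounds[OF n elim(2)] c0(2)[OF n] c0(1) B0 by (intro frac_le) auto
      then show ?case using elim by (auto simp: indicator_def intro!: ennreal_leI)
    qed
  qed
  also have "\<dots> = ennreal (B / c0 * measure (sample n) D)"
    using B0 c0 by (subst nn_integral_cmult_indicator) (simp_all add: S.emeasure_eq_measure flip: ennreal_mult')
  finally have "measure (sel n) ?T \<le> B / c0 * measure (sample n) D"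
    using B0 c0 by (simp add: L.emeasure_eq_measure)
  moreover have "measure (sel n) A \<le> measure (sel n) ?T"
    using A by (intro L.finite_measure_mono) (auto simp: sel_def)
  ultimately show ?thesis by linarith
qed

text \<open>Division by \<open>L\<^sub>h(Z n)\<close> is allowed because \<open>E[1 / L\<^sub>h(Z n)]\<close> is bounded: Markov's inequality for
  \<open>\<surd>(\<bar>LR - L\<^sub>h\<bar> / L\<^sub>h)\<close> and the Cauchy-Schwarz inequality.\<close>

lemma likelihood_ratio_in_probability:
  fixes LR :: "nat \<Rightarrow> (nat \<Rightarrow> 'a) \<Rightarrow> real"
  assumes int: "\<forall>\<^sub>F n in sequentially. integrable (sample n) (LR n)"
    and L1: "(\<lambda>n. \<integral>y. \<bar>LR n y - gauss_ratio J h (Z n y)\<bar> \<partial>sample n) \<longlonglongrightarrow> 0" and \<eta>: "0 < \<eta>"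
  shows "(\<lambda>n. measure (sample n) {y \<in> space (sample n). \<eta> * gauss_ratio J h (Z n y) \<le> \<bar>LR n y - gauss_ratio J h (Z n y)\<bar>}) \<longlonglongrightarrow> 0"
proof -
  let ?L = "\<lambda>n y. gauss_ratio J h (Z n y)"
  let ?D = "\<lambda>n y. \<bar>LR n y - ?L n y\<bar>"
  have inv: "1 / gauss_ratio J h x = exp (- 1 * ln (gauss_ratio J h x))" for x
    using gauss_ratio_pos[of J h x] by (simp add: exp_minus inverse_eq_divide)
  have lim: "(\<lambda>n. \<integral>y. 1 / ?L n y \<partial>sample n) \<longlonglongrightarrow> exp (h \<bullet> (J *v h))"
    unfolding inv using gauss_ratio_power_limit(2)[of "- 1" h] by simp
  have ev: "\<forall>\<^sub>F n in sequentially. integrable (sample n) (LR n) \<and> integrable (sample n) (?L n) \<and> integrable (sample n) (\<lambda>y. 1 / ?L n y)"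
    using int integrable_gauss_ratio_Z[of h] gauss_ratio_power_limit(1)[of "- 1" h]
    unfolding inv by eventually_elim blast
  show ?thesis
  proof (rule Lim_null_comparison)
    show "\<forall>\<^sub>F n in sequentially. norm (measure (sample n) {y \<in> space (sample n). \<eta> * ?L n y \<le> ?D n y})
        \<le> sqrt (\<integral>y. ?D n y \<partial>sample n) * sqrt (\<integral>y. 1 / ?L n y \<partial>sample n) / sqrt \<eta>"
      using ev
    proof eventually_elim
      case (elim n)
      interpret S: prob_space "sample n" by (rule prob_sample)
      have [measurable]: "LR n \<in> borel_measurable (sample n)" using elim by auto
      have i1: "integrable (sample n) (\<lambda>y. (sqrt (?D n y))\<^sup>2)" using elim by simp
      have i2: "integrable (sample n) (\<lambda>y. (sqrt (1 / ?L n y))\<^sup>2)" using elim gauss_ratio_pos[of J h] by (simp add: less_imp_le)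
      note CS = integral_cauchy_schwarz[OF _ _ i1 i2]
      have "measure (sample n) {y \<in> space (sample n). \<eta> * ?L n y \<le> ?D n y}
          \<le> measure (sample n) {y \<in> space (sample n). sqrt \<eta> \<le> sqrt (?D n y) * sqrt (1 / ?L n y)}"
      proof (rule S.finite_measure_mono)
        have "sqrt \<eta> \<le> sqrt d * sqrt (1 / l)" if "\<eta> * l \<le> d" "0 < l" for d l :: real
          using that by (simp only: real_sqrt_mult[symmetric]) (simp add: field_simps)
        then show "{y \<in> space (sample n). \<eta> * ?L n y \<le> ?D n y} \<subseteq> {y \<in> space (sample n). sqrt \<eta> \<le> sqrt (?D n y) * sqrt (1 / ?L n y)}"
          using gauss_ratio_pos[of J h] by blast
      qed measurable
      also have "\<dots> \<le> (\<integral>y. sqrt (?D n y) * sqrt (1 / ?L n y) \<partial>sample n) / sqrt \<eta>"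
        by (rule integral_Markov_inequality_measure[where A="{}"])
          (use CS(1) \<eta> gauss_ratio_pos[of J h] in \<open>auto simp: less_imp_le\<close>)
      also have "\<dots> \<le> sqrt (\<integral>y. (sqrt (?D n y))\<^sup>2 \<partial>sample n) * sqrt (\<integral>y. (sqrt (1 / ?L n y))\<^sup>2 \<partial>sample n) / sqrt \<eta>"
        using CS(2) \<eta> by (intro divide_right_mono) auto
      finally show ?case using gauss_ratio_pos[of J h] by (simp add: less_imp_le)
    qed
    have "(\<lambda>n. sqrt (\<integral>y. ?D n y \<partial>sample n) * sqrt (\<integral>y. 1 / ?L n y \<partial>sample n) / sqrt \<eta>) \<longlonglongrightarrow> sqrt 0 * sqrt (exp (h \<bullet> (J *v h))) / sqrt \<eta>"
      using \<eta> by (intro tendsto_intros L1 lim) auto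
    then show "(\<lambda>n. sqrt (\<integral>y. ?D n y \<partial>sample n) * sqrt (\<integral>y. 1 / ?L n y \<partial>sample n) / sqrt \<eta>) \<longlonglongrightarrow> 0" by simp
  qed
qed

end

lemma sup_norm_SUP_bound:
  assumes "(SUP n\<in>{1::nat..}. sup_norm_on (S n) (g n)) < \<infinity>"
  shows "\<exists>B\<ge>0. \<forall>n\<ge>1. \<forall>x\<in>S n. \<bar>g n x\<bar> \<le> B"
proof -
  obtain B where B: "(SUP n\<in>{1::nat..}. sup_norm_on (S n) (g n)) = ennreal B" "0 \<le> B"
    using assms by (metis ennreal_enn2real enn2real_nonneg infinity_ennreal_def)
  have "\<bar>g n x\<bar> \<le> B" if "1 \<le> n" "x \<in> S n" for n x
  proof -
    have "ennreal \<bar>g n x\<bar> \<le> sup_norm_on (S n) (g n)" unfolding sup_norm_on_def by (rule SUP_upper[OF that(2)])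
    also have "\<dots> \<le> ennreal B" unfolding B(1)[symmetric] by (rule SUP_upper) (use that in simp)
    finally show ?thesis using B(2) by simp
  qed
  with B(2) show ?thesis by blast
qed

lemma bl_norm_bounds:
  fixes g :: "real ^ 'p \<Rightarrow> real"
  assumes "bl_norm g \<le> ennreal L" "0 \<le> L"
  shows "\<bar>g x\<bar> \<le> L" and "\<bar>g x - g y\<bar> \<le> L * norm (x - y)"
proof -
  have "ennreal \<bar>g x\<bar> \<le> sup_norm_on UNIV g" unfolding sup_norm_on_def by (rule SUP_upper) simp
  also have "\<dots> \<le> bl_norm g" by (simp add: bl_norm_def)
  also note assms(1)
  finally show "\<bar>g x\<bar> \<le> L" using assms(2) by simp
  show "\<bar>g x - g y\<bar> \<le> L * norm (x - y)"
  proof (cases "x = y")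
    case False
    have "ennreal (\<bar>g x - g y\<bar> / norm (x - y)) \<le> lip_norm g"
      unfolding lip_norm_def using False by (intro SUP_upper2[of "(x, y)"]) auto
    also have "\<dots> \<le> bl_norm g" by (simp add: bl_norm_def)
    also note assms(1)
    finally have "\<bar>g x - g y\<bar> / norm (x - y) \<le> L" using assms(2) by simp
    then show ?thesis using False by (simp add: divide_le_eq)
  qed simp
qed

text \<open>\<open>\<eta>\<close> is such that the interval \<open>(1 - \<eta>, 1 + \<eta>)\<close> lies in \<open>(exp (- \<epsilon>), exp \<epsilon>)\<close>; the upper end is covered because
  \<open>exp \<epsilon> + exp (- \<epsilon>) \<ge> 2\<close>.\<close>

lemma log_ratio_bound:
  fixes l g q \<epsilon> :: real
  assumes \<epsilon>: "0 < \<epsilon>" and \<eta>: "\<eta> = 1 - exp (- \<epsilon>)" and g: "0 < g"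
    and l: "\<bar>l - g\<bar> < \<eta> / 4 * g" and q: "\<bar>q - 1\<bar> < \<eta> / 2"
  shows "0 < l * q / g" and "\<bar>ln (l * q / g)\<bar> \<le> \<epsilon>"
proof -
  have \<eta>01: "0 < \<eta>" "\<eta> < 1" using \<epsilon> \<eta> by auto
  have "l / g - 1 = (l - g) / g" using g by (simp add: diff_divide_distrib)
  then have lg: "\<bar>l / g - 1\<bar> < \<eta> / 4" using l g by (simp add: abs_divide divide_less_eq)
  have "l * q / g - 1 = (l / g - 1) * q + (q - 1)" using g by (simp add: field_simps)
  then have "\<bar>l * q / g - 1\<bar> \<le> \<bar>l / g - 1\<bar> * \<bar>q\<bar> + \<bar>q - 1\<bar>"
    using abs_triangle_ineq[of "(l / g - 1) * q" "q - 1"] by (simp add: abs_mult)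
  moreover have "\<bar>l / g - 1\<bar> * \<bar>q\<bar> \<le> \<eta> / 4 * 2"
  proof (rule mult_mono)
    show "\<bar>q\<bar> \<le> 2" using q \<eta>01 by linarith
  qed (use lg \<eta>01 in auto)
  ultimately have u: "\<bar>l * q / g - 1\<bar> < \<eta>" using q by linarith
  then show pos: "0 < l * q / g" using \<eta>01 by linarith
  have "exp (- \<epsilon>) < l * q / g" using u \<eta> by linarith
  then have 1: "- \<epsilon> < ln (l * q / g)" using ln_less_cancel_iff[of "exp (- \<epsilon>)" "l * q / g"] pos by simp
  have "2 \<le> exp \<epsilon> + exp (- \<epsilon>)"
  proof -
    have "0 \<le> (exp (\<epsilon> / 2) - exp (- \<epsilon> / 2))\<^sup>2" by simp
    also have "\<dots> = exp \<epsilon> + exp (- \<epsilon>) - 2"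
      by (simp add: power2_diff exp_double[symmetric] mult_exp_exp)
    finally show ?thesis by simp
  qed
  then have "l * q / g < exp \<epsilon>" using u \<eta> by linarith
  then have "ln (l * q / g) < \<epsilon>" using ln_less_cancel_iff[of "l * q / g" "exp \<epsilon>"] pos by simp
  with 1 show "\<bar>ln (l * q / g)\<bar> \<le> \<epsilon>" by linarith
qed

context selected_score_model
begin

abbreviation limit_law :: "nat \<Rightarrow> (real ^ 'b) measure" where
  "limit_law n \<equiv> density (gauss_law J) (\<lambda>z. ennreal (ps n z / (\<integral>x. ps n x \<partial>gauss_law J)))"

lemma difference_bound:
  assumes n: "0 < n" and g: "bfun 1 g"
  shows "\<bar>(\<integral>x. g x \<partial>distr (sel n) borel (Z n)) - (\<integral>x. g x \<partial>limit_law n)\<bar> \<le> 2"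
proof -
  have [measurable]: "g \<in> borel_measurable borel" and g1: "\<And>x. \<bar>g x\<bar> \<le> 1" using g by (simp_all add: bfun_def)
  have "prob_space (distr (sel n) borel (Z n))"
    by (rule prob_space.prob_space_distr[OF prob_sel[OF n]]) (simp add: sel_def)
  then interpret D: prob_space "distr (sel n) borel (Z n)" .
  interpret R: prob_space "gauss_law J" by (rule prob_space_gauss_law[OF J])
  have "norm (\<integral>x. g x \<partial>distr (sel n) borel (Z n)) \<le> (\<integral>x. 1 \<partial>distr (sel n) borel (Z n))"
    by (rule norm_integral_le) (use g1 in auto)
  then have 1: "\<bar>\<integral>x. g x \<partial>distr (sel n) borel (Z n)\<bar> \<le> 1" using D.prob_space by simp
  obtain K where K: "\<And>n. bfun K (ps n)" using ps_test unfolding test_sequence_def by blast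
  have ips: "integrable (gauss_law J) (ps n)"
    by (rule R.integrable_const_bound[where B=K]) (use K[of n] in \<open>auto simp: bfun_def\<close>)
  have "norm (\<integral>x. ps n x * g x \<partial>gauss_law J) \<le> (\<integral>x. ps n x \<partial>gauss_law J)"
    by (rule norm_integral_le[OF ips]) (use ps_nonneg g1 in \<open>auto simp: abs_mult intro!: mult_left_le\<close>)
  then have "\<bar>\<integral>x. ps n x * g x \<partial>gauss_law J\<bar> \<le> gsel n 0" by (simp add: gsel_0)
  then have "\<bar>(\<integral>x. ps n x * g x \<partial>gauss_law J) / gsel n 0\<bar> \<le> 1"
    by (cases "gsel n 0 = 0") (auto simp: abs_divide divide_le_eq)
  then have 2: "\<bar>\<integral>x. g x \<partial>limit_law n\<bar> \<le> 1" by (simp only: gsel_law_integral[OF \<open>g \<in> borel_measurable borel\<close>])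
  show ?thesis using 1 2 by linarith
qed

lemma tv_limit:
  assumes ac: "has_ac_component (distr P borel sc)"
  shows "(\<lambda>n. tv_dist (distr (sel n) borel (Z n)) (limit_law n)) \<longlonglongrightarrow> 0"
  unfolding tv_dist_def
proof (rule SUP_tendsto_zero)
  show "{} \<in> sets borel" by simp
  have ind: "measure M A = (\<integral>x. indicator A x \<partial>M)" if "sets M = sets borel" for M :: "(real ^ 'b) measure" and A
    using sets_eq_imp_space_eq[OF that] by simp
  have bf: "bfun 1 (indicator A :: real ^ 'b \<Rightarrow> real)" if "A \<in> sets borel" for A
    using that by (auto simp: bfun_def indicator_def)
  have eq: "\<bar>measure (distr (sel n) borel (Z n)) A - measure (limit_law n) A\<bar>
      = \<bar>(\<integral>x. indicator A x \<partial>distr (sel n) borel (Z n)) - (\<integral>x. indicator A x \<partial>limit_law n)\<bar>" for n A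
    by (subst (1 2) ind) auto
  show "\<forall>\<^sub>F n in sequentially. bdd_above ((\<lambda>A. \<bar>measure (distr (sel n) borel (Z n)) A - measure (limit_law n) A\<bar>) ` sets borel)"
    using eventually_gt_at_top[of 0]
  proof eventually_elim
    case (elim n)
    show ?case unfolding eq by (rule bdd_aboveI2[of _ _ 2]) (rule difference_bound[OF elim bf])
  qed
  fix A :: "nat \<Rightarrow> (real ^ 'b) set" assume A: "\<And>n. A n \<in> sets borel"
  have "test_sequence (\<lambda>n. indicator (A n))"
    using ac bf[OF A] unfolding test_sequence_def by blast
  then show "(\<lambda>n. \<bar>measure (distr (sel n) borel (Z n)) (A n) - measure (limit_law n) (A n)\<bar>) \<longlonglongrightarrow> 0"
    unfolding eq by (intro tendsto_rabs_zero sel_test_limit)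
qed

lemma bl_limit: "(\<lambda>n. bl_dist (distr (sel n) borel (Z n)) (limit_law n)) \<longlonglongrightarrow> 0"
  unfolding bl_dist_def
proof (rule SUP_tendsto_zero)
  have b: "\<bar>g x\<bar> \<le> 1" "\<bar>g x - g y\<bar> \<le> 1 * norm (x - y)" if "bl_norm g \<le> 1" for g :: "real ^ 'b \<Rightarrow> real" and x y
    using bl_norm_bounds[of g 1] that by simp_all
  have m: "g \<in> borel_measurable borel" if "bl_norm g \<le> 1" for g :: "real ^ 'b \<Rightarrow> real"
  proof -
    have "1-lipschitz_on UNIV g"
      by (rule lipschitz_onI) (use b(2)[OF that] in \<open>auto simp: dist_norm\<close>)
    then show ?thesis by (intro borel_measurable_continuous_onI lipschitz_on_continuous_on)
  qed
  have bf: "bfun 1 g" if "bl_norm g \<le> 1" for g :: "real ^ 'b \<Rightarrow> real"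
    using m[OF that] b(1)[OF that] by (simp add: bfun_def)
  show "(\<lambda>_. 0) \<in> {g :: real ^ 'b \<Rightarrow> real. bl_norm g \<le> 1}"
    by (auto simp: bl_norm_def sup_norm_on_def lip_norm_def case_prod_beta intro!: SUP_least)
  show "\<forall>\<^sub>F n in sequentially. bdd_above ((\<lambda>g. (\<integral>x. g x \<partial>distr (sel n) borel (Z n)) - (\<integral>x. g x \<partial>limit_law n)) ` {g. bl_norm g \<le> 1})"
    using eventually_gt_at_top[of 0]
  proof eventually_elim
    case (elim n)
    show ?case
      by (rule bdd_aboveI2[of _ _ 2]) (use difference_bound[OF elim bf] in \<open>auto simp: abs_le_iff\<close>)
  qed
  fix g :: "nat \<Rightarrow> real ^ 'b \<Rightarrow> real" assume g: "\<And>n. g n \<in> {g. bl_norm g \<le> 1}"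
  have "test_sequence g"
    unfolding test_sequence_def
    by (intro conjI disjI2 exI[of _ "1 :: real"] allI) (use g bf b(2) in auto)
  then show "(\<lambda>n. (\<integral>x. g n x \<partial>distr (sel n) borel (Z n)) - (\<integral>x. g n x \<partial>limit_law n)) \<longlonglongrightarrow> 0"
    by (rule sel_test_limit)
qed

end

theorem theorem1:
  fixes \<mu> :: "'y measure"
    and \<Theta> :: "(real ^ 'p) set"
    and f :: "real ^ 'p \<Rightarrow> 'y \<Rightarrow> real"
    and s :: "real ^ 'p \<Rightarrow> 'y \<Rightarrow> real ^ 'p"
    and \<nu> :: "nat \<Rightarrow> 'u measure"
    and q :: "nat \<Rightarrow> 'u \<Rightarrow> (nat \<Rightarrow> 'y) \<Rightarrow> real"
    and u :: "nat \<Rightarrow> 'u"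
    and p :: "nat \<Rightarrow> (nat \<Rightarrow> 'y) \<Rightarrow> real"
    and \<theta> :: "real ^ 'p"
    and pstar :: "nat \<Rightarrow> real ^ 'p \<Rightarrow> real"
  assumes "open \<Theta>"
    and "density_family \<mu> \<Theta> f"
    and "diff_quadratic_mean \<mu> \<Theta> f s"
    and "\<forall>\<theta>'\<in>\<Theta>. pos_def (fisher_info \<mu> f s \<theta>')"
    and "\<forall>n\<ge>1. conditional_density (Pi\<^sub>M {..<n} (\<lambda>_. \<mu>)) (\<nu> n) (q n)"
    and "\<forall>n\<ge>1. u n \<in> space (\<nu> n)"
    and "\<forall>n\<ge>1. p n = q n (u n)"
    and "\<forall>n\<ge>1. \<forall>\<theta>'\<in>\<Theta>. sel_prob \<mu> f p n \<theta>' > 0"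
    and "(SUP n\<in>{1..}. sup_norm_on (space (Pi\<^sub>M {..<n} (\<lambda>_. \<mu>))) (p n)) < \<infinity>"
    and "\<theta> \<in> \<Theta>"
    and "\<forall>\<^sub>F x in nhds 0. integrable (base_dist \<mu> f \<theta>) (\<lambda>y. exp (x \<bullet> s \<theta> y))"
    and "\<forall>n\<ge>1. pstar n \<in> borel_measurable borel \<and> (\<forall>z. 0 \<le> pstar n z)"
    and "(SUP n\<in>{1..}. sup_norm_on UNIV (pstar n)) < \<infinity>"
    and "\<forall>n\<ge>1. is_cond_exp_given (base_prod \<mu> f \<theta> n) (p n) (norm_score \<mu> f s \<theta> n) (pstar n)"
    and "has_ac_component (distr (base_dist \<mu> f \<theta>) borel (s \<theta>))
         \<or> (SUP n\<in>{1..}. bl_norm (pstar n)) < \<infinity>"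
    and "(INF n\<in>{1..}. sel_prob \<mu> f p n \<theta>) > 0"
  defines "I \<equiv> fisher_info \<mu> f s \<theta>"
    and "Z \<equiv> norm_score \<mu> f s \<theta>"
    and "\<phi>star \<equiv> (\<lambda>n. limit_sel_prob (matrix_inv (fisher_info \<mu> f s \<theta>)) (pstar n))"
  shows "(\<forall>(hs :: nat \<Rightarrow> real ^ 'p) h. hs \<longlonglongrightarrow> h \<longrightarrow>
            conv_in_prob_zero (\<lambda>n. sel_model \<mu> f p n \<theta>)
              (\<lambda>n y. ext_ln (sel_density \<mu> f p n (\<theta> + (1 / sqrt (real n)) *\<^sub>R hs n) y
                              / sel_density \<mu> f p n \<theta> y)
                     - ereal (h \<bullet> (I *v Z n y) - 1 / 2 * (h \<bullet> (I *v h))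
                              + ln (\<phi>star n 0 / \<phi>star n h))))
       \<and> (has_ac_component (distr (base_dist \<mu> f \<theta>) borel (s \<theta>)) \<longrightarrow>
            (\<lambda>n. tv_dist (distr (sel_model \<mu> f p n \<theta>) borel (Z n))
                         (selective_gaussian 0 (matrix_inv I) (pstar n))) \<longlonglongrightarrow> 0)
       \<and> ((SUP n\<in>{1..}. bl_norm (pstar n)) < \<infinity> \<longrightarrow>
            (\<lambda>n. bl_dist (distr (sel_model \<mu> f p n \<theta>) borel (Z n))
                         (selective_gaussian 0 (matrix_inv I) (pstar n))) \<longlonglongrightarrow> 0)"
proof -
  note Th = assms(1) and fam = assms(2) and dqm = assms(3) and th = assms(10)
  let ?P = "base_dist \<mu> f \<theta>"
  interpret P: prob_space ?P using fam th by (simp add: density_family_def)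
  have sc[measurable]: "s \<theta> \<in> borel_measurable ?P" using dqm th by (simp add: diff_quadratic_mean_def base_dist_def)
  have J: "pos_def I" unfolding I_def using assms(4) th by blast
  have moments: "\<exists>e>0. integrable ?P (\<lambda>y. exp (e * \<bar>v \<bullet> s \<theta> y\<bar>))" for v
    using exp_moment_direction[OF assms(11) sc] by metis
  have sq_int: "integrable ?P (\<lambda>y. (v \<bullet> s \<theta> y)\<^sup>2)" for v
  proof -
    obtain e where "0 < e" "integrable ?P (\<lambda>y. exp (e * \<bar>v \<bullet> s \<theta> y\<bar>))" using moments by blast
    then show ?thesis by (intro P.integrable_power_exp_moment) auto
  qed
  have mean: "(\<integral>y. v \<bullet> s \<theta> y \<partial>?P) = 0" for v by (rule score_mean_zero[OF Th fam dqm th sq_int])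
  have var: "(\<integral>y. (v \<bullet> s \<theta> y)\<^sup>2 \<partial>?P) = v \<bullet> (I *v v)" for v
    unfolding I_def by (rule fisher_quadratic_form) (use sc sq_int in auto)
  have sm: "score_model ?P (s \<theta>) I"
    by (rule score_model.intro) (rule P.prob_space_axioms sc moments mean var J)+
  interpret S: score_model ?P "s \<theta>" I by (rule sm)
  have Z: "Z = S.Z" by (intro ext, simp only: Z_def norm_score_def S.Z_def I_def[symmetric])
  have sets_P: "sets (Pi\<^sub>M {..<n} (\<lambda>_. ?P)) = sets (Pi\<^sub>M {..<n} (\<lambda>_. \<mu>))" for n
    by (intro sets_PiM_cong) (auto simp: base_dist_def)
  have space_P: "space (Pi\<^sub>M {..<n} (\<lambda>_. ?P)) = space (Pi\<^sub>M {..<n} (\<lambda>_. \<mu>))" for n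
    by (rule sets_eq_imp_space_eq[OF sets_P])
  obtain B where B: "0 \<le> B" "\<forall>n\<ge>1. \<forall>y\<in>space (Pi\<^sub>M {..<n} (\<lambda>_. \<mu>)). \<bar>p n y\<bar> \<le> B"
    using sup_norm_SUP_bound[OF assms(9)] by blast
  obtain K where K: "0 \<le> K" "\<forall>n\<ge>1. \<forall>z\<in>UNIV. \<bar>pstar n z\<bar> \<le> K"
    using sup_norm_SUP_bound[OF assms(13)] by blast
  have pm: "p n \<in> borel_measurable (Pi\<^sub>M {..<n} (\<lambda>_. \<mu>))" and p0: "y \<in> space (Pi\<^sub>M {..<n} (\<lambda>_. \<mu>)) \<Longrightarrow> 0 \<le> p n y"
    if n: "0 < n" for n y
  proof -
    have cd: "conditional_density (Pi\<^sub>M {..<n} (\<lambda>_. \<mu>)) (\<nu> n) (q n)" and u: "u n \<in> space (\<nu> n)" and pq: "p n = q n (u n)"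
      using assms(5-7) n by auto
    have "(\<lambda>(u, y). q n u y) \<in> borel_measurable (\<nu> n \<Otimes>\<^sub>M Pi\<^sub>M {..<n} (\<lambda>_. \<mu>))"
      using cd by (simp add: conditional_density_def)
    from measurable_compose[OF measurable_Pair1'[OF u] this]
    show "p n \<in> borel_measurable (Pi\<^sub>M {..<n} (\<lambda>_. \<mu>))" by (simp add: pq)
    show "y \<in> space (Pi\<^sub>M {..<n} (\<lambda>_. \<mu>)) \<Longrightarrow> 0 \<le> p n y"
      using cd u by (auto simp: conditional_density_def pq)
  qed
  \<comment> \<open>only samples of positive size are constrained, so the value at \<open>0\<close> is set to a harmless one\<close>
  define ps where "ps n = (if n = 0 then (\<lambda>_. 0) else pstar n)" for n
  have psn: "ps n = pstar n" if "0 < n" for n using that by (simp add: ps_def)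
  define c0 where "c0 = (INF n\<in>{1..}. sel_prob \<mu> f p n \<theta>)"
  have c0: "0 < c0" using assms(16) by (simp add: c0_def)
  have c0_le: "c0 \<le> sel_prob \<mu> f p n \<theta>" if "0 < n" for n
    unfolding c0_def
  proof (rule cINF_lower)
    show "bdd_below ((\<lambda>n. sel_prob \<mu> f p n \<theta>) ` {1..})"
      by (rule bdd_belowI2[of _ 0]) (use assms(8) th in \<open>auto intro: less_imp_le\<close>)
  qed (use that in auto)
  have sel_prob_eq: "sel_prob \<mu> f p n \<theta> = (\<integral>y. p n y \<partial>S.sample n)" for n
    by (simp add: sel_prob_def base_prod_def)
  have ps_bfun: "bfun K (ps n)" for n
    using K assms(12) by (auto simp: ps_def bfun_def)
  have ps_test: "S.test_sequence ps"
    unfolding S.test_sequence_def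
  proof (intro conjI exI allI)
    show "bfun K (ps n)" for n by (rule ps_bfun)
    show "has_ac_component (distr ?P borel (s \<theta>)) \<or> (\<exists>L\<ge>0. \<forall>n x y. \<bar>ps n x - ps n y\<bar> \<le> L * norm (x - y))"
      using assms(15)
    proof
      assume fin: "(SUP n\<in>{1..}. bl_norm (pstar n)) < \<infinity>"
      then obtain L where L: "(SUP n\<in>{1..}. bl_norm (pstar n)) = ennreal L" "0 \<le> L"
        by (metis ennreal_enn2real enn2real_nonneg infinity_ennreal_def)
      have "\<bar>ps n x - ps n y\<bar> \<le> L * norm (x - y)" for n x y
      proof (cases "n = 0")
        case False
        have "bl_norm (pstar n) \<le> ennreal L" unfolding L(1)[symmetric] by (rule SUP_upper) (use False in auto)
        then show ?thesis using bl_norm_bounds(2)[OF _ L(2)] False by (simp add: ps_def)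
      qed (use L in \<open>simp add: ps_def\<close>)
      with L(2) show ?thesis by blast
    qed simp
  qed
  interpret S: selected_score_model ?P "s \<theta>" I p ps B c0
  proof (rule selected_score_model.intro[OF sm], unfold_locales)
    show "p n \<in> borel_measurable (S.sample n)" if "0 < n" for n
      using pm[OF that] by (simp cong: measurable_cong_sets add: measurable_cong_sets[OF sets_P refl])
    show "0 \<le> p n y \<and> p n y \<le> B" if "0 < n" "y \<in> space (S.sample n)" for n y
    proof -
      have y: "y \<in> space (Pi\<^sub>M {..<n} (\<lambda>_. \<mu>))" using that(2) by (simp add: space_P)
      have "\<bar>p n y\<bar> \<le> B" using B(2) that(1) y by auto
      with p0[OF that(1) y] show ?thesis by linarith
    qed
    show "0 \<le> ps n z" for n z using assms(12) by (simp add: ps_def)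
    show "S.test_sequence ps" by (rule ps_test)
    show "is_cond_exp_given (S.sample n) (p n) (S.Z n) (ps n)" if "0 < n" for n
      using assms(14) that by (simp add: psn base_prod_def Z[symmetric] Z_def)
    show "0 < c0" by (rule c0)
    show "c0 \<le> (\<integral>y. p n y \<partial>S.sample n)" if "0 < n" for n
      using c0_le[OF that] by (simp add: sel_prob_eq)
  qed
  have sel_eq: "sel_model \<mu> f p n \<theta> = S.sel n" for n
    by (simp add: sel_model_def S.sel_def sel_prob_eq base_prod_def)
  from gaussian_gauss_law[OF J] obtain k where k: "0 < k"
    and phi: "\<forall>h. \<forall>g\<in>borel_measurable borel. limit_sel_prob (matrix_inv I) g h = k * (\<integral>x. g x * gauss_ratio I h x \<partial>gauss_law I)"
    and selg: "\<forall>p\<in>borel_measurable borel.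
      selective_gaussian 0 (matrix_inv I) p = density (gauss_law I) (\<lambda>z. ennreal (p z / (\<integral>x. p x \<partial>gauss_law I)))" .
  have phistar: "\<phi>star n h = k * S.gsel n h" if "0 < n" for n h
  proof -
    have "\<phi>star n h = limit_sel_prob (matrix_inv I) (pstar n) h" by (simp only: \<phi>star_def I_def)
    also have "\<dots> = k * S.gsel n h" using assms(12) that phi by (simp add: S.gsel_def psn)
    finally show ?thesis .
  qed
  have law: "selective_gaussian 0 (matrix_inv I) (pstar n) = S.limit_law n" if "0 < n" for n
    using assms(12) that by (simp add: selg psn)
  have tv: "(\<lambda>n. tv_dist (distr (sel_model \<mu> f p n \<theta>) borel (Z n)) (selective_gaussian 0 (matrix_inv I) (pstar n))) \<longlonglongrightarrow> 0"
    if "has_ac_component (distr ?P borel (s \<theta>))"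
  proof (rule Lim_transform_eventually[OF S.tv_limit[OF that]])
    show "\<forall>\<^sub>F n in sequentially. tv_dist (distr (S.sel n) borel (S.Z n)) (S.limit_law n)
        = tv_dist (distr (sel_model \<mu> f p n \<theta>) borel (Z n)) (selective_gaussian 0 (matrix_inv I) (pstar n))"
      using eventually_gt_at_top[of 0] by eventually_elim (simp only: law sel_eq Z)
  qed
  have bl: "(\<lambda>n. bl_dist (distr (sel_model \<mu> f p n \<theta>) borel (Z n)) (selective_gaussian 0 (matrix_inv I) (pstar n))) \<longlonglongrightarrow> 0"
  proof (rule Lim_transform_eventually[OF S.bl_limit])
    show "\<forall>\<^sub>F n in sequentially. bl_dist (distr (S.sel n) borel (S.Z n)) (S.limit_law n)
        = bl_dist (distr (sel_model \<mu> f p n \<theta>) borel (Z n)) (selective_gaussian 0 (matrix_inv I) (pstar n))"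
      using eventually_gt_at_top[of 0] by eventually_elim (simp only: law sel_eq Z)
  qed
  have lan: "conv_in_prob_zero (\<lambda>n. sel_model \<mu> f p n \<theta>)
      (\<lambda>n y. ext_ln (sel_density \<mu> f p n (\<theta> + (1 / sqrt (real n)) *\<^sub>R hs n) y / sel_density \<mu> f p n \<theta> y)
        - ereal (h \<bullet> (I *v Z n y) - 1 / 2 * (h \<bullet> (I *v h)) + ln (\<phi>star n 0 / \<phi>star n h)))"
    if hs: "hs \<longlonglongrightarrow> h" for hs h
    unfolding conv_in_prob_zero_def
  proof (intro allI impI)
    fix \<epsilon> :: real assume \<epsilon>: "0 < \<epsilon>"
    define t where "t n = \<theta> + (1 / sqrt (real n)) *\<^sub>R hs n" for n
    define \<phi>' where "\<phi>' n = sel_prob \<mu> f p n (t n)" for n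
    define LR where "LR n y = (\<Prod>i<n. f (t n) (y i) / f \<theta> (y i))" for n :: nat and y :: "nat \<Rightarrow> 'y"
    let ?L = "\<lambda>n y. gauss_ratio I h (S.Z n y)"
    note D = dqm_local_expansion[OF Th fam dqm th sq_int hs, folded t_def]
    have Xm: "(\<lambda>y. h \<bullet> s \<theta> y) \<in> borel_measurable ?P" by measurable
    obtain e where e: "0 < e" "integrable ?P (\<lambda>y. exp (e * \<bar>h \<bullet> s \<theta> y\<bar>))" using moments by blast
    note LL = P.likelihood_ratio_L1[OF Xm e mean var D(2,3) D(4)[unfolded var] D(5), folded S.gauss_ratio_Z]
    have f0: "0 \<le> f \<theta>' y" if "\<theta>' \<in> \<Theta>" "y \<in> space \<mu>" for \<theta>' y
      using fam that by (simp add: density_family_def)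
    have LR_eq: "(\<Prod>i<n. (sqrt (f (t n) (y i) / f \<theta> (y i)))\<^sup>2) = LR n y"
      if "t n \<in> \<Theta>" "y \<in> space (S.sample n)" for n y
      unfolding LR_def using that f0[OF that(1)] f0[OF th]
      by (intro prod.cong refl) (auto simp: base_dist_def space_PiM PiE_iff)
    have LRint: "\<forall>\<^sub>F n in sequentially. integrable (S.sample n) (LR n)"
      using LL(1) D(1)
    proof eventually_elim
      case (elim n)
      show ?case using elim(1) LR_eq[OF elim(2)] by (subst Bochner_Integration.integrable_cong[OF refl LR_eq[OF elim(2), symmetric]]) auto
    qed
    have L1: "(\<lambda>n. \<integral>y. \<bar>LR n y - ?L n y\<bar> \<partial>S.sample n) \<longlonglongrightarrow> 0"
    proof (rule Lim_transform_eventually[OF LL(3)])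
      show "\<forall>\<^sub>F n in sequentially. (\<integral>y. \<bar>(\<Prod>i<n. (sqrt (f (t n) (y i) / f \<theta> (y i)))\<^sup>2) - ?L n y\<bar> \<partial>S.sample n)
          = (\<integral>y. \<bar>LR n y - ?L n y\<bar> \<partial>S.sample n)"
        using D(1) by eventually_elim (intro Bochner_Integration.integral_cong refl, simp only: LR_eq)
    qed
    have LR1: "(\<lambda>n. \<integral>y. LR n y \<partial>S.sample n) \<longlonglongrightarrow> 1"
    proof (rule Lim_transform_eventually[OF LL(4)])
      show "\<forall>\<^sub>F n in sequentially. (\<integral>y. (\<Prod>i<n. (sqrt (f (t n) (y i) / f \<theta> (y i)))\<^sup>2) \<partial>S.sample n) = (\<integral>y. LR n y \<partial>S.sample n)"
        using D(1) by eventually_elim (intro Bochner_Integration.integral_cong refl, simp only: LR_eq)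
    qed
    have "(\<lambda>n. \<phi>' n - (\<integral>y. p n y * ?L n y \<partial>S.sample n)) \<longlonglongrightarrow> 0"
    proof (rule Lim_null_comparison)
      show "\<forall>\<^sub>F n in sequentially. norm (\<phi>' n - (\<integral>y. p n y * ?L n y \<partial>S.sample n))
          \<le> B * (1 - (\<integral>y. LR n y \<partial>S.sample n)) + B * (\<integral>y. \<bar>LR n y - ?L n y\<bar> \<partial>S.sample n)"
        using D(1) LRint LL(1) eventually_gt_at_top[of 0]
      proof eventually_elim
        case (elim n)
        have [measurable]: "p n \<in> borel_measurable (S.sample n)" by (rule S.p_measurable[OF elim(4)])
        have iL: "integrable (S.sample n) (?L n)" using elim by blast
        have ip: "integrable (S.sample n) (\<lambda>y. p n y * G y)" if G: "integrable (S.sample n) G" for G :: "_ \<Rightarrow> real"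
        proof (rule Bochner_Integration.integrable_bound[OF integrable_mult_right[OF G, of B]])
          show "AE y in S.sample n. norm (p n y * G y) \<le> norm (B * G y)"
            using S.p_bounds[OF elim(4)] B(1) by (intro AE_I2) (auto simp: abs_mult intro!: mult_right_mono)
        qed (use borel_measurable_integrable[OF G] in measurable)
        have 1: "\<bar>\<phi>' n - (\<integral>y. p n y * LR n y \<partial>S.sample n)\<bar> \<le> B * (1 - (\<integral>y. LR n y \<partial>S.sample n))"
          unfolding \<phi>'_def sel_prob_def LR_def base_prod_def[of \<mu> f \<theta>, symmetric]
          by (rule change_of_measure[OF fam th elim(1) pm[OF elim(4)] _ B(1)])
            (use S.p_bounds[OF elim(4)] in \<open>auto simp: space_P\<close>)
        have "(\<integral>y. p n y * LR n y \<partial>S.sample n) - (\<integral>y. p n y * ?L n y \<partial>S.sample n) = (\<integral>y. p n y * (LR n y - ?L n y) \<partial>S.sample n)"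
          using ip[OF elim(2)] ip[OF iL] by (simp add: right_diff_distrib)
        also have "norm \<dots> \<le> (\<integral>y. B * \<bar>LR n y - ?L n y\<bar> \<partial>S.sample n)"
          by (rule norm_integral_le)
            (use elim(2) iL S.p_bounds[OF elim(4)] in \<open>auto simp: abs_mult intro!: mult_right_mono\<close>)
        finally have 2: "\<bar>(\<integral>y. p n y * LR n y \<partial>S.sample n) - (\<integral>y. p n y * ?L n y \<partial>S.sample n)\<bar> \<le> B * (\<integral>y. \<bar>LR n y - ?L n y\<bar> \<partial>S.sample n)"
          by simp
        show ?case using 1 2 unfolding real_norm_def by linarith
      qed
      have "(\<lambda>n. B * (1 - (\<integral>y. LR n y \<partial>S.sample n)) + B * (\<integral>y. \<bar>LR n y - ?L n y\<bar> \<partial>S.sample n)) \<longlonglongrightarrow> B * (1 - 1) + B * 0"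
        by (intro tendsto_intros LR1 L1)
      then show "(\<lambda>n. B * (1 - (\<integral>y. LR n y \<partial>S.sample n)) + B * (\<integral>y. \<bar>LR n y - ?L n y\<bar> \<partial>S.sample n)) \<longlonglongrightarrow> 0" by simp
    qed
    from tendsto_add[OF this S.tilted_sel_prob_limit[of h]] have \<phi>'_lim: "(\<lambda>n. \<phi>' n - S.gsel n h) \<longlonglongrightarrow> 0" by simp
    obtain ch where ch: "0 < ch" "\<forall>\<^sub>F n in sequentially. ch \<le> S.gsel n h" using S.gsel_lower by blast
    \<comment> \<open>the factor by which selection changes the normalised likelihood ratio, relative to its limit\<close>
    define Q where "Q n = (sel_prob \<mu> f p n \<theta> / S.gsel n 0) / (\<phi>' n / S.gsel n h)" for n
    have "Q \<longlonglongrightarrow> 1 / 1"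
      unfolding Q_def sel_prob_eq
      by (intro tendsto_divide ratio_tendsto_one[OF S.sel_prob_limit _ S.gsel_0_lower] ratio_tendsto_one[OF \<phi>'_lim ch]) (use c0 in auto)
    then have Q1: "Q \<longlonglongrightarrow> 1" by simp
    define \<eta> where "\<eta> = 1 - exp (- \<epsilon>)"
    have \<eta>: "0 < \<eta>" using \<epsilon> by (simp add: \<eta>_def)
    have Q2: "\<forall>\<^sub>F n in sequentially. dist (Q n) 1 < \<eta> / 2" using tendstoD[OF Q1, of "\<eta> / 2"] \<eta> by simp
    define W where "W n = {y \<in> space (S.sample n). \<eta> / 4 * ?L n y \<le> \<bar>LR n y - ?L n y\<bar>}" for n
    have W0: "(\<lambda>n. measure (S.sample n) (W n)) \<longlonglongrightarrow> 0"
      unfolding W_def by (rule S.likelihood_ratio_in_probability[OF LRint L1]) (use \<eta> in simp)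
    let ?R = "\<lambda>n y. ext_ln (sel_density \<mu> f p n (t n) y / sel_density \<mu> f p n \<theta> y)
        - ereal (h \<bullet> (I *v Z n y) - 1 / 2 * (h \<bullet> (I *v h)) + ln (\<phi>star n 0 / \<phi>star n h))"
    have "\<forall>\<^sub>F n in sequentially. norm (measure (sel_model \<mu> f p n \<theta>) {y \<in> space (sel_model \<mu> f p n \<theta>). \<bar>?R n y\<bar> > ereal \<epsilon>})
        \<le> B / c0 * measure (S.sample n) (W n)"
      using D(1) LRint eventually_gt_at_top[of 0] Q2 S.gsel_0_lower ch(2)
    proof eventually_elim
      case (elim n)
      note n = \<open>0 < n\<close>
      have [measurable]: "LR n \<in> borel_measurable (S.sample n)" using elim(2) by simp
      \<comment> \<open>on \<open>N\<close> the likelihood ratio is a quotient by \<open>0\<close>\<close>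
      define N where "N = {y \<in> space (S.sample n). \<exists>i<n. f \<theta> (y i) = 0}"
      have N: "N \<in> null_sets (S.sample n)"
      proof -
        have [measurable]: "f \<theta> \<in> borel_measurable ?P" using fam th by (simp add: density_family_def base_dist_def)
        have "AE y in ?P. f \<theta> y \<noteq> 0"
          using fam th unfolding base_dist_def by (subst AE_density) (auto simp: density_family_def)
        then have "AE y in S.sample n. f \<theta> (y i) \<noteq> 0" if "i < n" for i
          using AE_PiM_component[of "{..<n}" "\<lambda>_. ?P" i "\<lambda>y. f \<theta> y \<noteq> 0"] that P.prob_space_axioms by simp
        then have "AE y in S.sample n. \<forall>i\<in>{..<n}. f \<theta> (y i) \<noteq> 0"
          by (intro AE_finite_allI) auto
        moreover have "N \<in> sets (S.sample n)" unfolding N_def by measurable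
        ultimately show ?thesis
          by (subst AE_iff_null_sets) (auto simp: N_def elim!: eventually_mono)
      qed
      have pos: "0 < sel_prob \<mu> f p n \<theta>" "0 < \<phi>' n" "0 < S.gsel n 0" "0 < S.gsel n h"
        using assms(8) n th elim c0 ch(1) by (auto simp: \<phi>'_def intro: less_le_trans[rotated])
      have "measure (S.sel n) {y \<in> space (S.sel n). \<bar>?R n y\<bar> > ereal \<epsilon>} \<le> B / c0 * measure (S.sample n) (W n)"
      proof (rule S.sel_measure_le[OF n N])
        show "W n \<in> sets (S.sample n)" unfolding W_def by measurable
        show "{y \<in> space (S.sel n). \<bar>?R n y\<bar> > ereal \<epsilon>} \<subseteq> {y \<in> space (S.sample n). p n y = 0} \<union> N \<union> W n"
        proof (rule subsetI, rule ccontr)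
          fix y assume y: "y \<in> {y \<in> space (S.sel n). \<bar>?R n y\<bar> > ereal \<epsilon>}" and "y \<notin> {y \<in> space (S.sample n). p n y = 0} \<union> N \<union> W n"
          then have ysp: "y \<in> space (S.sample n)" and py: "p n y \<noteq> 0" and fy: "\<And>i. i < n \<Longrightarrow> f \<theta> (y i) \<noteq> 0"
            and dev: "\<bar>LR n y - ?L n y\<bar> < \<eta> / 4 * ?L n y"
            by (auto simp: S.sel_def N_def W_def)
          have ppos: "0 < p n y" using S.p_bounds[OF n ysp] py by simp
          have qd: "\<bar>Q n - 1\<bar> < \<eta> / 2" using elim(4) \<eta> by (simp add: dist_real_def)
          note lb = log_ratio_bound[OF \<epsilon> \<eta>_def gauss_ratio_pos dev qd]
          define x where "x = LR n y * (sel_prob \<mu> f p n \<theta> / \<phi>' n)"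
          define d where "d = S.gsel n 0 / S.gsel n h"
          have d: "0 < d" using pos by (simp add: d_def)
          have ratio: "sel_density \<mu> f p n (t n) y / sel_density \<mu> f p n \<theta> y = x"
            unfolding sel_density_def x_def LR_def \<phi>'_def[symmetric] prod_dividef using ppos pos by simp
          have xd: "LR n y * Q n / ?L n y = x / d / ?L n y"
            using pos by (simp add: x_def d_def Q_def field_simps)
          have x0: "0 < x" using lb(1) d gauss_ratio_pos[of I h "S.Z n y"] mult_pos_pos[OF d gauss_ratio_pos[of I h "S.Z n y"]]
            unfolding xd by (auto simp: zero_less_divide_iff)
          have e1: "ln (x / d / ?L n y) = ln x - ln d - ln (?L n y)"
            using x0 d gauss_ratio_pos[of I h "S.Z n y"] by (simp add: ln_div ln_mult)
          have e2: "ln (?L n y) = h \<bullet> (I *v Z n y) - 1 / 2 * (h \<bullet> (I *v h))" by (simp add: gauss_ratio_def Z)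
          have e3: "\<phi>star n 0 / \<phi>star n h = d" using k n by (simp add: phistar d_def)
          have "\<bar>ln x - (h \<bullet> (I *v Z n y) - 1 / 2 * (h \<bullet> (I *v h)) + ln (\<phi>star n 0 / \<phi>star n h))\<bar> \<le> \<epsilon>"
            using lb(2) unfolding xd e1 e2 e3 by (simp add: algebra_simps)
          then have "\<bar>?R n y\<bar> \<le> ereal \<epsilon>"
            unfolding ratio using x0 by (simp add: ext_ln_def)
          moreover have "\<bar>?R n y\<bar> > ereal \<epsilon>" using y by blast
          ultimately show False by (meson not_le)
        qed
      qed
      then show ?case by (simp add: sel_eq)
    qed
    moreover have "(\<lambda>n. B / c0 * measure (S.sample n) (W n)) \<longlonglongrightarrow> 0"
      using tendsto_mult_right_zero[OF W0] .
    ultimately show "(\<lambda>n. measure (sel_model \<mu> f p n \<theta>) {\<omega> \<in> space (sel_model \<mu> f p n \<theta>).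
        \<bar>ext_ln (sel_density \<mu> f p n (\<theta> + (1 / sqrt (real n)) *\<^sub>R hs n) \<omega> / sel_density \<mu> f p n \<theta> \<omega>)
        - ereal (h \<bullet> (I *v Z n \<omega>) - 1 / 2 * (h \<bullet> (I *v h)) + ln (\<phi>star n 0 / \<phi>star n h))\<bar> > ereal \<epsilon>}) \<longlonglongrightarrow> 0"
      unfolding t_def by (rule Lim_null_comparison)
  qed
  show ?thesis using lan tv bl by blast
qed

end
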